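(* Let $\sigma=0$ and $\gamma>0$, let the initial data satisfy (I), let $Q$ satisfy (Q), and let the probability space $(\tilde\Omega,\tilde{\mathcal F},\tilde{\mathbb P})$ and the limits $E$, $v$ of the solutions of the equation (RCH) be as described in the context. Then there exists a $Q$-Wiener process $\tilde W$ on $L^2(\mathcal D)$, defined on $(\tilde\Omega,\tilde{\mathcal F},\tilde{\mathbb P})$, such that $$2\,d\chi_{E_t}=\Delta v\,dt+d\tilde W_t$$ in the sense that for any $t\in[0,T]$ and any $\psi\in C_c^1([0,t)\times\bar{\mathcal D})$, $$\int_0^t\int_{\mathcal D}\bigl(-2\chi_{E_\tau}\partial_t\psi+\nabla v\cdot\nabla\psi\bigr)\,dx\,d\tau=\int_{\mathcal D}2\chi_{E_0}\psi(0,\cdot)\,dx+\int_0^t\langle\psi(\tau,\cdot),d\tilde W_\tau\rangle .$$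
   Context: Setting. $d\in\{2,3\}$, $\mathcal D\subset\mathbb R^d$ is a smooth bounded open domain, $T>0$, $\mathcal D_T:=[0,T]\times\mathcal D$. $F(u)=\frac14(u^2-1)^2$, $f=F'$. (Q): $Q$ is a linear (covariance) operator on $L^2(\mathcal D)$ commuting with $\Delta$ such that $Q\mathbf 1=0$ ($\mathbf 1$ the constant function $1$) and $\mathrm{Tr}((-\Delta)Q)<\infty$. $(W_t)_{t\in\mathbb R}$ is a two-sided $Q$-Wiener process on $(\Omega,\mathcal F,\mathbb P)$. Smeared noise: $\rho\in C^\infty(\mathbb R)$, $0\le\rho\le1$, $\mathrm{supp}\,\rho\subset[-1,1]$, $\int\rho=1$, $\rho(t)=\rho(-t)$; $\rho_\varepsilon(t)=\varepsilon^{-\gamma}\rho(t/\varepsilon^\gamma)$; $W^\varepsilon_t=\int_{\mathbb R}\rho_\varepsilon(t-s)W_s\,ds$ and $\xi^\varepsilon_t=\frac{d}{dt}W^\varepsilon_t$. (RCH) with $\sigma=0$: $\partial_tu^\varepsilon=\Delta v^\varepsilon+\xi^\varepsilon_t$, $v^\varepsilon=-\varepsilon\Delta u^\varepsilon+\frac1\varepsilon f(u^\varepsilon)$ on $[0,T]\times\mathcal D$, $\partial_nu^\varepsilon=\partial_nv^\varepsilon=0$ on $[0,T]\times\partial\mathcal D$, $u^\varepsilon(0)=u_0^\varepsilon$. (I): $\sup_{0<\varepsilon\le1}\int_{\mathcal D}\bigl(\frac\varepsilon2|\nabla u_0^\varepsilon|^2+\frac1\varepsilon F(u_0^\varepsilon)\bigr)dx\le\mathcal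 E_0<\infty$ and $\frac1{|\mathcal D|}\int_{\mathcal D}u_0^\varepsilon dx=m_0\in(-1,1)$ for all $\varepsilon\in(0,1]$. Limits. On $(\tilde\Omega,\tilde{\mathcal F},\tilde{\mathbb P})$ there are random variables $(\tilde u^\varepsilon,\tilde v^\varepsilon)$ with the same law on $C([0,T];L^2)\times L^2(0,T;H^1)$ as $(u^\varepsilon,v^\varepsilon)$, and a sequence $\varepsilon_k\searrow0$ such that $\tilde{\mathbb P}$-a.s. $\tilde u^{\varepsilon_k}\to-1+2\chi_E$ a.e. in $\mathcal D_T$ and in $C^\beta([0,T];L^2)$ for all $\beta<\frac1{12}$, where $E\subset\tilde\Omega\times\mathcal D_T$ is measurable with time slices $E_t$, and $\tilde v^{\varepsilon_k}\to v$ weakly in $L^2(0,T;H^1)$; moreover $\chi_E\in C([0,T];L^1)\cap L^\infty(0,T;BV)$ $\tilde{\mathbb P}$-a.s. $\chi$ denotes the characteristic function of a set. *)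

theory Defs
  imports "HOL-Probability.Probability"
begin

section \<open>Smooth functions and smooth domains\<close>

text \<open>For open \<open>S\<close> this is membership in \<open>C^k(S)\<close>, via existence and continuity of all
  partial derivatives up to order \<open>k\<close>.\<close>

primrec Ck_on :: "nat \<Rightarrow> 'a::euclidean_space set \<Rightarrow> ('a \<Rightarrow> real) \<Rightarrow> bool" where
  "Ck_on 0 S f \<longleftrightarrow> continuous_on S f"
| "Ck_on (Suc k) S f \<longleftrightarrow> f differentiable_on S \<and>
     (\<forall>b\<in>Basis. Ck_on k S (\<lambda>x. frechet_derivative f (at x) b))"

definition smooth_fun_on :: "'a::euclidean_space set \<Rightarrow> ('a \<Rightarrow> real) \<Rightarrow> bool" where
  "smooth_fun_on S f \<longleftrightarrow> (\<forall>k. Ck_on k S f)"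

definition grad :: "('a::euclidean_space \<Rightarrow> real) \<Rightarrow> 'a \<Rightarrow> 'a" where
  "grad f x = (\<Sum>b\<in>Basis. frechet_derivative f (at x) b *\<^sub>R b)"

definition divergence :: "('a::euclidean_space \<Rightarrow> 'a) \<Rightarrow> 'a \<Rightarrow> real" where
  "divergence f x = (\<Sum>b\<in>Basis. frechet_derivative f (at x) b \<bullet> b)"

definition smooth_bounded_domain :: "'a::euclidean_space set \<Rightarrow> bool" where
  "smooth_bounded_domain D \<longleftrightarrow> open D \<and> bounded D \<and> connected D \<and> D \<noteq> {} \<and>
     (\<forall>x\<in>frontier D. \<exists>U \<Phi>. open U \<and> x \<in> U \<and> smooth_fun_on U \<Phi> \<and>
        (\<forall>y\<in>U. grad \<Phi> y \<noteq> 0) \<and> D \<inter> U = {y\<in>U. \<Phi> y < 0})"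


section \<open>Borel sets of a pseudometric, and the space \<open>L^2\<close>\<close>

text \<open>Elements of \<open>L^2(D)\<close>, \<open>C([0,T];L^2)\<close>, \<open>L^2(0,T;H^1)\<close> are represented by (Borel measurable)
  functions.  The distance of such a space is then a pseudometric \<open>d\<close> on the set \<open>S\<close> of
  representatives; its open sets, hence the sets of \<open>pm_borel S d\<close>, are saturated and correspond
  exactly to the open (Borel) sets of the quotient.\<close>

definition pm_borel :: "'x set \<Rightarrow> ('x \<Rightarrow> 'x \<Rightarrow> real) \<Rightarrow> 'x measure" where
  "pm_borel S d = sigma S {U. U \<subseteq> S \<and> (\<forall>x\<in>U. \<exists>r>0. \<forall>y\<in>S. d x y < r \<longrightarrow> y \<in> U)}"

definition L2 :: "'a::euclidean_space set \<Rightarrow> ('a \<Rightarrow> 'b::euclidean_space) set" where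
  "L2 A = {f. set_borel_measurable lborel A f \<and> set_integrable lborel A (\<lambda>x. (norm (f x))\<^sup>2)}"

definition L2_inner :: "'a::euclidean_space set \<Rightarrow> ('a \<Rightarrow> 'b::euclidean_space) \<Rightarrow> ('a \<Rightarrow> 'b) \<Rightarrow> real" where
  "L2_inner A f g = (LINT x:A|lborel. f x \<bullet> g x)"

definition L2_norm :: "'a::euclidean_space set \<Rightarrow> ('a \<Rightarrow> 'b::euclidean_space) \<Rightarrow> real" where
  "L2_norm A f = sqrt (L2_inner A f f)"

definition L2_eq :: "'a::euclidean_space set \<Rightarrow> ('a \<Rightarrow> 'b::euclidean_space) \<Rightarrow> ('a \<Rightarrow> 'b) \<Rightarrow> bool" where
  "L2_eq A f g \<longleftrightarrow> (AE x in lborel. x \<in> A \<longrightarrow> f x = g x)"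

definition L2_borel :: "'a::euclidean_space set \<Rightarrow> ('a \<Rightarrow> real) measure" where
  "L2_borel D = pm_borel (L2 D) (\<lambda>f g. L2_norm D (f - g))"

definition orthonormal_basis :: "'a::euclidean_space set \<Rightarrow> (nat \<Rightarrow> 'a \<Rightarrow> real) \<Rightarrow> bool" where
  "orthonormal_basis D e \<longleftrightarrow> (\<forall>k. e k \<in> L2 D) \<and>
     (\<forall>j k. L2_inner D (e j) (e k) = (if j = k then 1 else 0)) \<and>
     (\<forall>f\<in>L2 D. (\<forall>k. L2_inner D f (e k) = 0) \<longrightarrow> L2_eq D f (\<lambda>x. 0))"


section \<open>\<open>H^1\<close> and the Neumann Laplacian\<close>

definition test_fun :: "'a::euclidean_space set \<Rightarrow> ('a \<Rightarrow> real) \<Rightarrow> bool" where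
  "test_fun D \<phi> \<longleftrightarrow> smooth_fun_on UNIV \<phi> \<and> (\<exists>K. compact K \<and> K \<subseteq> D \<and> (\<forall>x. x \<notin> K \<longrightarrow> \<phi> x = 0))"

definition weak_grad :: "'a::euclidean_space set \<Rightarrow> ('a \<Rightarrow> real) \<Rightarrow> ('a \<Rightarrow> 'a) \<Rightarrow> bool" where
  "weak_grad D f g \<longleftrightarrow> f \<in> L2 D \<and> g \<in> L2 D \<and>
     (\<forall>\<phi>. test_fun D \<phi> \<longrightarrow> (\<forall>b\<in>Basis.
        (LINT x:D|lborel. f x * frechet_derivative \<phi> (at x) b) = - (LINT x:D|lborel. (g x \<bullet> b) * \<phi> x)))"

definition H1 :: "'a::euclidean_space set \<Rightarrow> ('a \<Rightarrow> real) set" where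
  "H1 D = {f. \<exists>g. weak_grad D f g}"

definition wgrad :: "'a::euclidean_space set \<Rightarrow> ('a \<Rightarrow> real) \<Rightarrow> 'a \<Rightarrow> 'a" where
  "wgrad D f = (SOME g. weak_grad D f g)"

text \<open>Graph of the Laplacian with homogeneous Neumann boundary condition, in weak form:
  \<open>\<Delta> f = h\<close> in \<open>D\<close> and \<open>\<partial>\<^sub>n f = 0\<close> on the boundary.\<close>

definition neumann_laplacian :: "'a::euclidean_space set \<Rightarrow> ('a \<Rightarrow> real) \<Rightarrow> ('a \<Rightarrow> real) \<Rightarrow> bool" where
  "neumann_laplacian D f h \<longleftrightarrow> f \<in> H1 D \<and> h \<in> L2 D \<and>
     (\<forall>\<phi>\<in>H1 D. L2_inner D (wgrad D f) (wgrad D \<phi>) = - L2_inner D h \<phi>)"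


section \<open>Covariance operators\<close>

text \<open>Finite trace of a nonnegative self-adjoint, possibly unbounded operator on \<open>L^2(D)\<close> given by
  its graph \<open>A\<close>.  For such operators the sum does not depend on the orthonormal basis chosen
  inside the domain.\<close>

definition finite_trace ::
  "'a::euclidean_space set \<Rightarrow> (('a \<Rightarrow> real) \<Rightarrow> ('a \<Rightarrow> real) \<Rightarrow> bool) \<Rightarrow> bool" where
  "finite_trace D A \<longleftrightarrow> (\<exists>e h. orthonormal_basis D e \<and> (\<forall>k. A (e k) (h k)) \<and>
     summable (\<lambda>k. L2_inner D (h k) (e k)))"

definition covariance_operator ::
  "'a::euclidean_space set \<Rightarrow> (('a \<Rightarrow> real) \<Rightarrow> ('a \<Rightarrow> real)) \<Rightarrow> bool" where
  "covariance_operator D Q \<longleftrightarrow>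
     (\<forall>f\<in>L2 D. Q f \<in> L2 D) \<and>
     (\<forall>f\<in>L2 D. \<forall>g\<in>L2 D. \<forall>a b. L2_eq D (Q (\<lambda>x. a * f x + b * g x)) (\<lambda>x. a * Q f x + b * Q g x)) \<and>
     (\<exists>C. \<forall>f\<in>L2 D. L2_norm D (Q f) \<le> C * L2_norm D f) \<and>
     (\<forall>f\<in>L2 D. \<forall>g\<in>L2 D. L2_inner D (Q f) g = L2_inner D f (Q g)) \<and>
     (\<forall>f\<in>L2 D. 0 \<le> L2_inner D (Q f) f) \<and>
     finite_trace D (\<lambda>f h. h = Q f)"

definition condition_Q ::
  "'a::euclidean_space set \<Rightarrow> (('a \<Rightarrow> real) \<Rightarrow> ('a \<Rightarrow> real)) \<Rightarrow> bool" where
  "condition_Q D Q \<longleftrightarrow> covariance_operator D Q \<and>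
     (\<forall>f h. neumann_laplacian D f h \<longrightarrow> neumann_laplacian D (Q f) (Q h)) \<and>
     L2_eq D (Q (\<lambda>x. 1)) (\<lambda>x. 0) \<and>
     finite_trace D (\<lambda>f h. neumann_laplacian D (Q f) (\<lambda>x. - h x))"


section \<open>Wiener processes and the Wiener integral\<close>

text \<open>Centred real Gaussian variable of variance \<open>v \<ge> 0\<close>, the degenerate case included.\<close>

definition centred_gaussian :: "'w measure \<Rightarrow> ('w \<Rightarrow> real) \<Rightarrow> real \<Rightarrow> bool" where
  "centred_gaussian M X v \<longleftrightarrow> X \<in> borel_measurable M \<and>
     (if v = 0 then (AE \<omega> in M. X \<omega> = 0) else distributed M lborel X (normal_density 0 (sqrt v)))"

text \<open>\<open>Q\<close>-Wiener process with time set \<open>I\<close>; \<open>I = UNIV\<close> gives the two-sided process.\<close>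

definition Q_Wiener_process ::
  "'a::euclidean_space set \<Rightarrow> (('a \<Rightarrow> real) \<Rightarrow> ('a \<Rightarrow> real)) \<Rightarrow> 'w measure \<Rightarrow> real set
     \<Rightarrow> (real \<Rightarrow> 'w \<Rightarrow> 'a \<Rightarrow> real) \<Rightarrow> bool" where
  "Q_Wiener_process D Q M I W \<longleftrightarrow>
     (\<forall>t\<in>I. W t \<in> M \<rightarrow>\<^sub>M L2_borel D) \<and>
     (AE \<omega> in M. L2_eq D (W 0 \<omega>) (\<lambda>x. 0)) \<and>
     (AE \<omega> in M. \<forall>t\<in>I. ((\<lambda>s. L2_norm D (W s \<omega> - W t \<omega>)) \<longlongrightarrow> 0) (at t within I)) \<and>
     (\<forall>s\<in>I. \<forall>t\<in>I. s < t \<longrightarrow> (\<forall>h\<in>L2 D.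
        centred_gaussian M (\<lambda>\<omega>. L2_inner D (W t \<omega> - W s \<omega>) h) ((t - s) * L2_inner D (Q h) h))) \<and>
     (\<forall>n. \<forall>t::nat \<Rightarrow> real. (\<forall>i\<le>n. t i \<in> I) \<and> (\<forall>i<n. t i < t (Suc i)) \<longrightarrow>
        prob_space.indep_vars M (\<lambda>_. L2_borel D) (\<lambda>i \<omega>. W (t (Suc i)) \<omega> - W (t i) \<omega>) {..<n})"

definition step_fun ::
  "nat \<Rightarrow> (nat \<Rightarrow> real) \<Rightarrow> (nat \<Rightarrow> 'a \<Rightarrow> real) \<Rightarrow> real \<Rightarrow> 'a \<Rightarrow> real" where
  "step_fun n s h \<tau> x = (\<Sum>i<n. indicator {s i<..s (Suc i)} \<tau> * h i x)"

definition step_integral ::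
  "'a::euclidean_space set \<Rightarrow> (real \<Rightarrow> 'w \<Rightarrow> 'a \<Rightarrow> real) \<Rightarrow> nat \<Rightarrow> (nat \<Rightarrow> real) \<Rightarrow> (nat \<Rightarrow> 'a \<Rightarrow> real)
     \<Rightarrow> 'w \<Rightarrow> real" where
  "step_integral D W n s h \<omega> = (\<Sum>i<n. L2_inner D (h i) (W (s (Suc i)) \<omega> - W (s i) \<omega>))"

text \<open>\<open>X = \<integral>\<^sub>0\<^sup>t \<langle>\<psi>(\<tau>), dW\<^sub>\<tau>\<rangle>\<close> for deterministic \<open>\<psi>\<close> in \<open>L^2(0,t;L^2(D))\<close>: \<open>X\<close> is the limit in
  \<open>L^2(M)\<close> of the integrals of \<open>L^2(D)\<close>-valued step functions approximating \<open>\<psi>\<close>.  By the isometry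
  property \<open>X\<close> is unique up to a null set and does not depend on the approximation.\<close>

definition has_Wiener_integral ::
  "'w measure \<Rightarrow> 'a::euclidean_space set \<Rightarrow> (real \<Rightarrow> 'w \<Rightarrow> 'a \<Rightarrow> real) \<Rightarrow> real
     \<Rightarrow> (real \<Rightarrow> 'a \<Rightarrow> real) \<Rightarrow> ('w \<Rightarrow> real) \<Rightarrow> bool" where
  "has_Wiener_integral M D W t \<psi> X \<longleftrightarrow>
     X \<in> borel_measurable M \<and> integrable M (\<lambda>\<omega>. (X \<omega>)\<^sup>2) \<and>
     (\<exists>n s h.
        (\<forall>k. s k 0 = 0 \<and> s k (n k) = t \<and> (\<forall>i<n k. s k i \<le> s k (Suc i)) \<and> (\<forall>i<n k. h k i \<in> L2 D)) \<and>
        (\<lambda>k. \<integral>\<^sup>+\<tau>\<in>{0..t}. ennreal ((L2_norm D (step_fun (n k) (s k) (h k) \<tau> - \<psi> \<tau>))\<^sup>2) \<partial>lborel)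
           \<longlonglongrightarrow> 0 \<and>
        (\<lambda>k. \<integral>\<^sup>+\<omega>. ennreal ((step_integral D W (n k) (s k) (h k) \<omega> - X \<omega>)\<^sup>2) \<partial>M) \<longlonglongrightarrow> 0)"


section \<open>Smeared noise\<close>

definition noise_kernel :: "(real \<Rightarrow> real) \<Rightarrow> bool" where
  "noise_kernel \<rho> \<longleftrightarrow> smooth_fun_on UNIV \<rho> \<and> (\<forall>t. 0 \<le> \<rho> t \<and> \<rho> t \<le> 1) \<and>
     (\<forall>t. t \<notin> {-1..1} \<longrightarrow> \<rho> t = 0) \<and> (LINT t|lborel. \<rho> t) = 1 \<and> (\<forall>t. \<rho> (- t) = \<rho> t)"

definition rescaled_kernel :: "(real \<Rightarrow> real) \<Rightarrow> real \<Rightarrow> real \<Rightarrow> real \<Rightarrow> real" where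
  "rescaled_kernel \<rho> \<gamma> \<epsilon> t = \<epsilon> powr (- \<gamma>) * \<rho> (t / \<epsilon> powr \<gamma>)"

text \<open>\<open>L^2(D)\<close>-valued integral over the real line, through duality; it agrees with the Bochner
  integral whenever the latter exists.\<close>

definition has_L2_integral ::
  "'a::euclidean_space set \<Rightarrow> (real \<Rightarrow> 'a \<Rightarrow> real) \<Rightarrow> ('a \<Rightarrow> real) \<Rightarrow> bool" where
  "has_L2_integral D w F \<longleftrightarrow> F \<in> L2 D \<and>
     (\<forall>h\<in>L2 D. has_bochner_integral lborel (\<lambda>s. L2_inner D (w s) h) (L2_inner D F h))"

definition has_L2_derivative ::
  "'a::euclidean_space set \<Rightarrow> (real \<Rightarrow> 'a \<Rightarrow> real) \<Rightarrow> ('a \<Rightarrow> real) \<Rightarrow> real \<Rightarrow> bool" where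
  "has_L2_derivative D w w' t \<longleftrightarrow> w' \<in> L2 D \<and>
     ((\<lambda>h. L2_norm D (\<lambda>x. (w (t + h) x - w t x) / h - w' x)) \<longlongrightarrow> 0) (at 0)"


section \<open>Path spaces\<close>

text \<open>\<open>C([0,T];L^2(D))\<close>.  Representatives are jointly measurable, so that almost everywhere
  statements on \<open>[0,T] \<times> D\<close> make sense.\<close>

definition C_L2 :: "real \<Rightarrow> 'a::euclidean_space set \<Rightarrow> (real \<Rightarrow> 'a \<Rightarrow> real) set" where
  "C_L2 T D = {u. set_borel_measurable lborel ({0..T} \<times> D) (case_prod u) \<and> (\<forall>t\<in>{0..T}. u t \<in> L2 D) \<and>
     (\<forall>t\<in>{0..T}. ((\<lambda>s. L2_norm D (u s - u t)) \<longlongrightarrow> 0) (at t within {0..T}))}"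

definition C_L2_borel :: "real \<Rightarrow> 'a::euclidean_space set \<Rightarrow> (real \<Rightarrow> 'a \<Rightarrow> real) measure" where
  "C_L2_borel T D = pm_borel (C_L2 T D) (\<lambda>u w. SUP t\<in>{0..T}. L2_norm D (u t - w t))"

text \<open>\<open>L^2(0,T;H^1(D))\<close>; \<open>grad_xt T D v\<close> is a jointly measurable version of the weak spatial
  gradient.\<close>

definition weak_grad_xt ::
  "real \<Rightarrow> 'a::euclidean_space set \<Rightarrow> (real \<Rightarrow> 'a \<Rightarrow> real) \<Rightarrow> (real \<Rightarrow> 'a \<Rightarrow> 'a) \<Rightarrow> bool" where
  "weak_grad_xt T D v g \<longleftrightarrow> case_prod g \<in> L2 ({0..T} \<times> D) \<and>
     (AE t in lborel. t \<in> {0..T} \<longrightarrow> weak_grad D (v t) (g t))"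

definition L2_H1 :: "real \<Rightarrow> 'a::euclidean_space set \<Rightarrow> (real \<Rightarrow> 'a \<Rightarrow> real) set" where
  "L2_H1 T D = {v. case_prod v \<in> L2 ({0..T} \<times> D) \<and> (\<exists>g. weak_grad_xt T D v g)}"

definition grad_xt ::
  "real \<Rightarrow> 'a::euclidean_space set \<Rightarrow> (real \<Rightarrow> 'a \<Rightarrow> real) \<Rightarrow> real \<Rightarrow> 'a \<Rightarrow> 'a" where
  "grad_xt T D v = (SOME g. weak_grad_xt T D v g)"

definition L2_H1_norm :: "real \<Rightarrow> 'a::euclidean_space set \<Rightarrow> (real \<Rightarrow> 'a \<Rightarrow> real) \<Rightarrow> real" where
  "L2_H1_norm T D v = sqrt ((L2_norm ({0..T} \<times> D) (case_prod v))\<^sup>2 +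
     (L2_norm ({0..T} \<times> D) (case_prod (grad_xt T D v)))\<^sup>2)"

definition L2_H1_borel :: "real \<Rightarrow> 'a::euclidean_space set \<Rightarrow> (real \<Rightarrow> 'a \<Rightarrow> real) measure" where
  "L2_H1_borel T D = pm_borel (L2_H1 T D) (\<lambda>v w. L2_H1_norm T D (v - w))"

definition L2_H1_functional ::
  "real \<Rightarrow> 'a::euclidean_space set \<Rightarrow> ((real \<Rightarrow> 'a \<Rightarrow> real) \<Rightarrow> real) \<Rightarrow> bool" where
  "L2_H1_functional T D l \<longleftrightarrow>
     (\<forall>v\<in>L2_H1 T D. \<forall>w\<in>L2_H1 T D. \<forall>a b. l (\<lambda>t x. a * v t x + b * w t x) = a * l v + b * l w) \<and>
     (\<exists>C. \<forall>v\<in>L2_H1 T D. \<bar>l v\<bar> \<le> C * L2_H1_norm T D v)"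

definition weakly_converges_L2_H1 ::
  "real \<Rightarrow> 'a::euclidean_space set \<Rightarrow> (nat \<Rightarrow> real \<Rightarrow> 'a \<Rightarrow> real) \<Rightarrow> (real \<Rightarrow> 'a \<Rightarrow> real) \<Rightarrow> bool" where
  "weakly_converges_L2_H1 T D v w \<longleftrightarrow> (\<forall>k. v k \<in> L2_H1 T D) \<and> w \<in> L2_H1 T D \<and>
     (\<forall>l. L2_H1_functional T D l \<longrightarrow> (\<lambda>k. l (v k)) \<longlonglongrightarrow> l w)"

definition Holder_norm ::
  "real \<Rightarrow> real \<Rightarrow> 'a::euclidean_space set \<Rightarrow> (real \<Rightarrow> 'a \<Rightarrow> real) \<Rightarrow> ennreal" where
  "Holder_norm \<beta> T D u = (SUP t\<in>{0..T}. ennreal (L2_norm D (u t))) +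
     (SUP p\<in>{(s, t). s \<in> {0..T} \<and> t \<in> {0..T} \<and> s < t}.
        ennreal (L2_norm D (u (snd p) - u (fst p)) / (snd p - fst p) powr \<beta>))"

definition converges_Holder ::
  "real \<Rightarrow> real \<Rightarrow> 'a::euclidean_space set \<Rightarrow> (nat \<Rightarrow> real \<Rightarrow> 'a \<Rightarrow> real) \<Rightarrow> (real \<Rightarrow> 'a \<Rightarrow> real) \<Rightarrow> bool" where
  "converges_Holder \<beta> T D u w \<longleftrightarrow> (\<forall>k. Holder_norm \<beta> T D (u k) < \<infinity>) \<and> Holder_norm \<beta> T D w < \<infinity> \<and>
     (\<lambda>k. Holder_norm \<beta> T D (u k - w)) \<longlonglongrightarrow> 0"

definition C_L1 :: "real \<Rightarrow> 'a::euclidean_space set \<Rightarrow> (real \<Rightarrow> 'a \<Rightarrow> real) set" where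
  "C_L1 T D = {u. (\<forall>t\<in>{0..T}. set_integrable lborel D (u t)) \<and>
     (\<forall>t\<in>{0..T}. ((\<lambda>s. LINT x:D|lborel. \<bar>u s x - u t x\<bar>) \<longlongrightarrow> 0) (at t within {0..T}))}"

definition total_variation :: "'a::euclidean_space set \<Rightarrow> ('a \<Rightarrow> real) \<Rightarrow> ereal" where
  "total_variation D f = (SUP \<phi>\<in>{\<phi>::'a \<Rightarrow> 'a. (\<forall>b\<in>Basis. Ck_on 1 UNIV (\<lambda>x. \<phi> x \<bullet> b)) \<and>
      (\<exists>K. compact K \<and> K \<subseteq> D \<and> (\<forall>x. x \<notin> K \<longrightarrow> \<phi> x = 0)) \<and> (\<forall>x. norm (\<phi> x) \<le> 1)}.
      ereal (LINT x:D|lborel. f x * divergence \<phi> x))"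

definition Linf_BV :: "real \<Rightarrow> 'a::euclidean_space set \<Rightarrow> (real \<Rightarrow> 'a \<Rightarrow> real) set" where
  "Linf_BV T D = {u. \<exists>C::real. AE t in lborel. t \<in> {0..T} \<longrightarrow> set_integrable lborel D (u t) \<and>
     ereal (LINT x:D|lborel. \<bar>u t x\<bar>) + total_variation D (u t) \<le> ereal C}"


section \<open>The random Cahn--Hilliard equation\<close>

definition F_pot :: "real \<Rightarrow> real" where
  "F_pot u = 1/4 * (u\<^sup>2 - 1)\<^sup>2"

definition f_pot :: "real \<Rightarrow> real" where
  "f_pot u = deriv F_pot u"

definition condition_I ::
  "'a::euclidean_space set \<Rightarrow> (real \<Rightarrow> 'a \<Rightarrow> real) \<Rightarrow> real \<Rightarrow> real \<Rightarrow> bool" where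
  "condition_I D u0 \<E>\<^sub>0 m\<^sub>0 \<longleftrightarrow> m\<^sub>0 \<in> {-1<..<1} \<and>
     (\<forall>\<epsilon>\<in>{0<..1}. u0 \<epsilon> \<in> H1 D \<and> set_integrable lborel D (\<lambda>x. F_pot (u0 \<epsilon> x)) \<and>
        (LINT x:D|lborel. \<epsilon> / 2 * (norm (wgrad D (u0 \<epsilon>) x))\<^sup>2 + 1 / \<epsilon> * F_pot (u0 \<epsilon> x)) \<le> \<E>\<^sub>0 \<and>
        1 / measure lborel D * (LINT x:D|lborel. u0 \<epsilon> x) = m\<^sub>0)"

text \<open>Weak solution \<open>(u,v)\<close>, for one path \<open>\<xi>\<close> of the noise, of
  \<open>\<partial>\<^sub>t u = \<Delta> v + \<xi>\<close>, \<open>v = - \<epsilon> \<Delta> u + f(u) / \<epsilon>\<close> with homogeneous Neumann boundary conditions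
  for \<open>u\<close> and \<open>v\<close> (both are encoded by testing with all of \<open>H^1(D)\<close>) and \<open>u(0) = u0\<close>.\<close>

definition RCH_solution ::
  "real \<Rightarrow> 'a::euclidean_space set \<Rightarrow> real \<Rightarrow> ('a \<Rightarrow> real) \<Rightarrow> (real \<Rightarrow> 'a \<Rightarrow> real)
     \<Rightarrow> (real \<Rightarrow> 'a \<Rightarrow> real) \<Rightarrow> (real \<Rightarrow> 'a \<Rightarrow> real) \<Rightarrow> bool" where
  "RCH_solution T D \<epsilon> u0 \<xi> u v \<longleftrightarrow>
     u \<in> C_L2 T D \<and> u \<in> L2_H1 T D \<and> v \<in> L2_H1 T D \<and> L2_eq D (u 0) u0 \<and>
     (\<forall>\<phi>\<in>H1 D. \<forall>t\<in>{0..T}.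
        L2_inner D (u t) \<phi> = L2_inner D u0 \<phi> +
          (LINT s:{0..t}|lborel. - L2_inner D (grad_xt T D v s) (wgrad D \<phi>) + L2_inner D (\<xi> s) \<phi>)) \<and>
     (AE t in lborel. t \<in> {0..T} \<longrightarrow> (\<forall>\<phi>\<in>H1 D.
        L2_inner D (v t) \<phi> = \<epsilon> * L2_inner D (grad_xt T D u t) (wgrad D \<phi>) +
          1 / \<epsilon> * L2_inner D (\<lambda>x. f_pot (u t x)) \<phi>))"


section \<open>Limit objects\<close>

definition slice :: "('w \<times> real \<times> 'a) set \<Rightarrow> 'w \<Rightarrow> real \<Rightarrow> 'a set" where
  "slice E \<omega> t = {x. (\<omega>, t, x) \<in> E}"

text \<open>\<open>C\<^sub>c\<^sup>1([0,t) \<times> closure D)\<close>: functions of class \<open>C^1\<close> in the interior whose derivatives extend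
  continuously to \<open>[0,t) \<times> closure D\<close>, with compact support there, extended by zero to all
  arguments (so for \<open>t = 0\<close> only \<open>\<psi> = 0\<close> is left).\<close>

definition C1c :: "real \<Rightarrow> 'a::euclidean_space set \<Rightarrow> (real \<Rightarrow> 'a \<Rightarrow> real) set" where
  "C1c t D = {\<psi>.
     (\<exists>K. compact K \<and> K \<subseteq> {0..<t} \<times> closure D \<and> (\<forall>\<tau> x. (\<tau>, x) \<notin> K \<longrightarrow> \<psi> \<tau> x = 0)) \<and>
     continuous_on ({0..<t} \<times> closure D) (case_prod \<psi>) \<and>
     (\<exists>G::real \<times> 'a \<Rightarrow> real \<times> 'a. continuous_on ({0..<t} \<times> closure D) G \<and>
        (\<forall>p\<in>{0<..<t} \<times> D. (case_prod \<psi> has_derivative (\<lambda>q. G p \<bullet> q)) (at p)))}"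

end

(*
  The functional <u_t - u_0, phi> + int_0^t <grad v, grad phi> of the path (u, v) is measurable, and
  by the weak equation it equals <W^eps_t - W^eps_0, phi> for the solution (u^eps, v^eps).  As
  eps -> 0 it converges almost surely on both probability spaces: on the original one to
  <W_t - W_0, phi>, by continuity of the paths of W, and on the new one to
  Z_t(phi) = <2 chi_{E_t} - 2 chi_{E_0}, phi> + int_0^t <grad v, grad phi>.  Since the laws agree for
  each eps, the two limits have the same joint law over countably many (t, phi).

  Expanding Z_t along an orthonormal basis contained in H^1 yields an L^2-valued process W', whose
  square summability, path continuity, Gaussianity and independence of increments are transferred
  from W through this equality of laws; no trace computation or Kolmogorov criterion is needed.

  Finally, for psi in C^1_c the dyadic Riemann sums of the Wiener integral of psi against W' are sums
  of increments of Z.  They converge geometrically fast in L^2(P'), and pathwise, by Abel summation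
  and dominated convergence, to the left-hand side of the limit equation minus its initial term.
*)

theory Submission
  imports Defs
begin

section \<open>Square-integrable functions\<close>

text \<open>Weak convergence of \<open>v\<close> controls bounded linear functionals only, so every
  spatial test function has to lie in H^1. A basis obtained from the trace condition need not do so;
  this is why a second basis is built inside H^1.

  The limit equation shows \<open>W'\<close> only through scalar functionals, and each comparison of
  laws gives identities off a null set that depends on the pair (t, \<phi>). Two devices deal with
  this. Properties of whole paths are first stated as countable conditions on coordinates at
  rational times, transferred, and then extended by continuity. The Wiener integral is taken along
  dyadic partitions, which involve countably many pairs; geometric convergence makes it an almost
  sure limit along the full sequence, the same sequence along which the pathwise limit is computed.

  Elements of L^2 are functions and gradients are chosen by \<open>SOME\<close>. Hence Borel sets
  are shown to be saturated under almost everywhere equality, and identities between gradients are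
  claimed up to null sets and used under integrals.\<close>

definition sq_integrable :: "'x measure \<Rightarrow> ('x \<Rightarrow> 'b::euclidean_space) \<Rightarrow> bool" where
  "sq_integrable M f \<longleftrightarrow> f \<in> borel_measurable M \<and> integrable M (\<lambda>x. (norm (f x))\<^sup>2)"

lemma sq_integrable_inner:
  assumes "sq_integrable M f" "sq_integrable M g"
  shows "integrable M (\<lambda>x. f x \<bullet> g x)"
proof (rule Bochner_Integration.integrable_bound)
  show "integrable M (\<lambda>x. (norm (f x))\<^sup>2 + (norm (g x))\<^sup>2)"
    using assms by (auto simp: sq_integrable_def)
  show "(\<lambda>x. f x \<bullet> g x) \<in> borel_measurable M"
    using assms by (auto simp: sq_integrable_def)
  have "\<bar>f x \<bullet> g x\<bar> \<le> \<bar>(norm (f x))\<^sup>2 + (norm (g x))\<^sup>2\<bar>" for x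
  proof -
    have "\<bar>f x \<bullet> g x\<bar> \<le> norm (f x) * norm (g x)" by (rule Cauchy_Schwarz_ineq2)
    moreover have "2 * (norm (f x) * norm (g x)) \<le> (norm (f x))\<^sup>2 + (norm (g x))\<^sup>2"
      using sum_squares_bound[of "norm (f x)" "norm (g x)"] by (simp add: ac_simps)
    moreover have "0 \<le> norm (f x) * norm (g x)" by simp
    ultimately show ?thesis by linarith
  qed
  then show "AE x in M. norm (f x \<bullet> g x) \<le> norm ((norm (f x))\<^sup>2 + (norm (g x))\<^sup>2)" by simp
qed

lemma sq_integrable_add:
  assumes "sq_integrable M f" "sq_integrable M g"
  shows "sq_integrable M (\<lambda>x. f x + g x)"
proof -
  have "(norm (f x + g x))\<^sup>2 = (norm (f x))\<^sup>2 + 2 * (f x \<bullet> g x) + (norm (g x))\<^sup>2" for x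
    by (simp add: power2_norm_eq_inner inner_add_left inner_add_right inner_commute)
  then show ?thesis
    using assms sq_integrable_inner[OF assms] by (auto simp: sq_integrable_def)
qed

lemma sq_integrable_scaleR:
  assumes "sq_integrable M f" shows "sq_integrable M (\<lambda>x. c *\<^sub>R f x)"
  using assms by (auto simp: sq_integrable_def power_mult_distrib)

lemma sq_integrable_diff:
  assumes "sq_integrable M f" "sq_integrable M g"
  shows "sq_integrable M (\<lambda>x. f x - g x)"
  using sq_integrable_add[OF assms(1) sq_integrable_scaleR[OF assms(2), of "-1"]] by simp

text \<open>The polynomial a t^2 + 2 b t + c, the squared norm of t f + g, is nonnegative for every
  real t, so b^2 is at most a c.\<close>

lemma sq_integrable_Cauchy_Schwarz:
  assumes f: "sq_integrable M f" and g: "sq_integrable M g"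
  shows "\<bar>\<integral>x. f x \<bullet> g x \<partial>M\<bar> \<le> sqrt (\<integral>x. (norm (f x))\<^sup>2 \<partial>M) * sqrt (\<integral>x. (norm (g x))\<^sup>2 \<partial>M)"
proof -
  define a where "a = (\<integral>x. (norm (f x))\<^sup>2 \<partial>M)"
  define b where "b = (\<integral>x. f x \<bullet> g x \<partial>M)"
  define c where "c = (\<integral>x. (norm (g x))\<^sup>2 \<partial>M)"
  have int: "integrable M (\<lambda>x. (norm (f x))\<^sup>2)" "integrable M (\<lambda>x. f x \<bullet> g x)"
    "integrable M (\<lambda>x. (norm (g x))\<^sup>2)"
    using f g sq_integrable_inner[OF f g] by (auto simp: sq_integrable_def)
  have "0 \<le> a * t\<^sup>2 + 2 * b * t + c" for t
  proof -
    have "0 \<le> (\<integral>x. (norm (t *\<^sub>R f x + g x))\<^sup>2 \<partial>M)" by simp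
    also have "(\<lambda>x. (norm (t *\<^sub>R f x + g x))\<^sup>2) =
       (\<lambda>x. t\<^sup>2 * (norm (f x))\<^sup>2 + 2 * t * (f x \<bullet> g x) + (norm (g x))\<^sup>2)"
      unfolding power2_norm_eq_inner
      by (simp add: inner_add_left inner_add_right inner_commute power2_eq_square fun_eq_iff algebra_simps)
    also have "integral\<^sup>L M \<dots> = a * t\<^sup>2 + 2 * b * t + c"
      using int by (simp add: a_def b_def c_def)
    finally show ?thesis .
  qed
  note q = this
  have a0: "0 \<le> a" "0 \<le> c" by (auto simp: a_def c_def)
  have "b\<^sup>2 \<le> a * c"
  proof (cases "a = 0")
    case True
    have "b = 0"
    proof (rule ccontr)
      assume "b \<noteq> 0"
      \<comment> \<open>With a = 0 the polynomial is affine, and this argument gives it the value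
        -1.\<close>
      then show False using q[of "- (c + 1) / (2 * b)"] True a0 by simp
    qed
    then show ?thesis using True by simp
  next
    case False
    then have "a > 0" using a0 by simp
    have "0 \<le> a * (a * (- b / a)\<^sup>2 + 2 * b * (- b / a) + c)"
      using q[of "- b / a"] \<open>a > 0\<close> by simp
    also have "\<dots> = a * c - b\<^sup>2" using \<open>a > 0\<close> by (simp add: field_simps power2_eq_square)
    finally show ?thesis by simp
  qed
  then have "\<bar>b\<bar> \<le> sqrt (a * c)" by (metis real_sqrt_abs real_sqrt_le_iff)
  then show ?thesis by (simp add: a_def b_def c_def real_sqrt_mult)
qed

lemma sq_integrable_triangle:
  assumes f: "sq_integrable M f" and g: "sq_integrable M g"
  shows "sqrt (\<integral>x. (norm (f x + g x))\<^sup>2 \<partial>M) \<le>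
     sqrt (\<integral>x. (norm (f x))\<^sup>2 \<partial>M) + sqrt (\<integral>x. (norm (g x))\<^sup>2 \<partial>M)"
proof (rule real_le_lsqrt)
  define a where "a = sqrt (\<integral>x. (norm (f x))\<^sup>2 \<partial>M)"
  define c where "c = sqrt (\<integral>x. (norm (g x))\<^sup>2 \<partial>M)"
  have "(\<integral>x. (norm (f x + g x))\<^sup>2 \<partial>M) =
     (\<integral>x. (norm (f x))\<^sup>2 + 2 * (f x \<bullet> g x) + (norm (g x))\<^sup>2 \<partial>M)"
    by (simp add: power2_norm_eq_inner inner_add_left inner_add_right inner_commute algebra_simps)
  also have "\<dots> = a\<^sup>2 + 2 * (\<integral>x. f x \<bullet> g x \<partial>M) + c\<^sup>2"
    using f g sq_integrable_inner[OF f g] by (simp add: sq_integrable_def a_def c_def)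
  also have "\<dots> \<le> a\<^sup>2 + 2 * (a * c) + c\<^sup>2"
    using sq_integrable_Cauchy_Schwarz[OF f g] by (simp add: a_def c_def)
  also have "\<dots> = (a + c)\<^sup>2" by (simp add: power2_eq_square algebra_simps)
  finally show "(\<integral>x. (norm (f x + g x))\<^sup>2 \<partial>M) \<le>
    (sqrt (\<integral>x. (norm (f x))\<^sup>2 \<partial>M) + sqrt (\<integral>x. (norm (g x))\<^sup>2 \<partial>M))\<^sup>2"
    by (simp add: a_def c_def)
qed auto

text \<open>A geometric rate for successive differences gives almost everywhere convergence of the
  whole sequence and not merely of a subsequence. The measure is arbitrary because the criterion
  serves twice: on \<open>lborel\<close> for Riesz-Fischer and on the probability space for the
  Wiener integral.\<close>

lemma sq_integrable_fast_Cauchy: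
  fixes F :: "nat \<Rightarrow> 'x \<Rightarrow> real"
  assumes F: "\<And>n. sq_integrable M (F n)"
    and r: "0 < r" "r < 1"
    and step: "\<And>n. sqrt (\<integral>x. (F (Suc n) x - F n x)\<^sup>2 \<partial>M) \<le> C * r ^ n"
  obtains G where "sq_integrable M G" "AE x in M. (\<lambda>n. F n x) \<longlonglongrightarrow> G x"
    "(\<lambda>n. \<integral>\<^sup>+x. ennreal ((F n x - G x)\<^sup>2) \<partial>M) \<longlonglongrightarrow> 0"
    "\<And>n. (\<integral>\<^sup>+x. ennreal ((F n x - G x)\<^sup>2) \<partial>M) < \<infinity>"
proof -
  have [measurable]: "F n \<in> borel_measurable M" for n using F by (auto simp: sq_integrable_def)
  define d where "d n x = F (Suc n) x - F n x" for n x
  have [measurable]: "d n \<in> borel_measurable M" for n unfolding d_def by measurable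
  have sd: "sq_integrable M (d n)" for n
    unfolding d_def by (intro sq_integrable_diff F)
  have intd: "integrable M (\<lambda>x. (d n x)\<^sup>2)" for n using sd[of n] by (simp add: sq_integrable_def)
  have C0: "0 \<le> C" using order_trans[OF real_sqrt_ge_zero step[of 0]] by simp
  have dint: "(\<integral>x. (d n x)\<^sup>2 \<partial>M) \<le> (C * r ^ n)\<^sup>2" for n
    using step[of n] unfolding d_def by (meson sqrt_le_D)
  \<comment> \<open>The integral of the squared difference is at most C^2 r^(2n). Half of this decay
    is spent on the weight 1/r^n: the weighted integrals remain summable, and finiteness of the
    weighted sum at a point forces the differences there below (sqrt r)^n eventually.\<close>
  have "(\<integral>\<^sup>+x. (\<Sum>n. ennreal ((d n x)\<^sup>2 / r ^ n)) \<partial>M) = (\<Sum>n. \<integral>\<^sup>+x. ennreal ((d n x)\<^sup>2 / r ^ n) \<partial>M)"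
    by (rule nn_integral_suminf) measurable
  also have "\<dots> \<le> (\<Sum>n. ennreal (C\<^sup>2 * r ^ n))"
  proof (rule suminf_le)
    fix n
    have "(\<integral>\<^sup>+x. ennreal ((d n x)\<^sup>2 / r ^ n) \<partial>M) = ennreal (\<integral>x. (d n x)\<^sup>2 / r ^ n \<partial>M)"
      using intd[of n] r by (intro nn_integral_eq_integral) auto
    also have "\<dots> \<le> ennreal (C\<^sup>2 * r ^ n)"
    proof (rule ennreal_leI)
      have "(\<integral>x. (d n x)\<^sup>2 \<partial>M) / r ^ n \<le> (C * r ^ n)\<^sup>2 / r ^ n"
        using dint[of n] r by (intro divide_right_mono) auto
      also have "\<dots> = C\<^sup>2 * r ^ n" using r by (simp add: power2_eq_square)
      finally show "(\<integral>x. (d n x)\<^sup>2 / r ^ n \<partial>M) \<le> C\<^sup>2 * r ^ n" by simp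
    qed
    finally show "(\<integral>\<^sup>+x. ennreal ((d n x)\<^sup>2 / r ^ n) \<partial>M) \<le> ennreal (C\<^sup>2 * r ^ n)" .
  qed auto
  also have "\<dots> = ennreal (\<Sum>n. C\<^sup>2 * r ^ n)"
    using r by (intro suminf_ennreal2) (auto intro!: summable_mult summable_geometric)
  also have "\<dots> < \<infinity>" by simp
  finally have "AE x in M. (\<Sum>n. ennreal ((d n x)\<^sup>2 / r ^ n)) \<noteq> \<infinity>"
    by (intro nn_integral_noteq_infinite) (auto simp: less_top[symmetric])
  then have conv: "AE x in M. convergent (\<lambda>n. F n x)"
  proof eventually_elim
    fix x assume fin: "(\<Sum>n. ennreal ((d n x)\<^sup>2 / r ^ n)) \<noteq> \<infinity>"
    have "summable (\<lambda>n. (d n x)\<^sup>2 / r ^ n)"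
      by (rule summable_suminf_not_top) (use fin r in auto)
    then have "(\<lambda>n. (d n x)\<^sup>2 / r ^ n) \<longlonglongrightarrow> 0" by (rule summable_LIMSEQ_zero)
    then have "eventually (\<lambda>n. (d n x)\<^sup>2 / r ^ n < 1) sequentially"
      by (rule order_tendstoD) simp
    then have ev: "eventually (\<lambda>n. norm (d n x) \<le> (sqrt r) ^ n) sequentially"
    proof eventually_elim
      fix n assume "(d n x)\<^sup>2 / r ^ n < 1"
      then have "(d n x)\<^sup>2 \<le> r ^ n" using r by (simp add: field_simps)
      then have "sqrt ((d n x)\<^sup>2) \<le> sqrt (r ^ n)" by (rule real_sqrt_le_mono)
      then show "norm (d n x) \<le> (sqrt r) ^ n" unfolding real_sqrt_abs by (simp add: real_sqrt_power)
    qed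
    have "summable (\<lambda>n. (sqrt r) ^ n)" using r by (intro summable_geometric) simp
    then have "summable (\<lambda>n. d n x)" by (rule summable_comparison_test_ev[OF ev])
    then have "convergent (\<lambda>n. \<Sum>i<n. d i x)"
      by (simp add: summable_iff_convergent)
    also have "(\<lambda>n. \<Sum>i<n. d i x) = (\<lambda>n. F n x - F 0 x)"
      unfolding d_def by (intro ext sum_lessThan_telescope)
    finally have "convergent (\<lambda>n. (F n x - F 0 x) + F 0 x)" by (intro convergent_add convergent_const)
    then show "convergent (\<lambda>n. F n x)" by simp
  qed
  define G where "G x = lim (\<lambda>n. F n x)" for x
  have [measurable]: "G \<in> borel_measurable M" unfolding G_def by measurable
  have lim: "AE x in M. (\<lambda>n. F n x) \<longlonglongrightarrow> G x"
    using conv by eventually_elim (simp add: G_def convergent_LIMSEQ_iff)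
  have tail: "sqrt (\<integral>x. (F (n + m) x - F n x)\<^sup>2 \<partial>M) \<le> (\<Sum>j<m. C * r ^ (n + j))" for n m
  proof (induction m)
    case (Suc m)
    have "sqrt (\<integral>x. (norm ((F (n + m) x - F n x) + d (n + m) x))\<^sup>2 \<partial>M) \<le>
      sqrt (\<integral>x. (norm (F (n + m) x - F n x))\<^sup>2 \<partial>M) + sqrt (\<integral>x. (norm (d (n + m) x))\<^sup>2 \<partial>M)"
      by (intro sq_integrable_triangle sq_integrable_diff F sd)
    also have "\<dots> \<le> (\<Sum>j<m. C * r ^ (n + j)) + C * r ^ (n + m)"
      using Suc step[of "n + m"] by (simp add: d_def)
    finally show ?case by (simp add: d_def)
  qed simp
  define K where "K = C / (1 - r)"
  have tail2: "(\<integral>x. (F (n + m) x - F n x)\<^sup>2 \<partial>M) \<le> (K * r ^ n)\<^sup>2" for n m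
  proof -
    have "(\<Sum>j<m. C * r ^ (n + j)) = C * r ^ n * (\<Sum>j<m. r ^ j)"
      by (simp add: power_add sum_distrib_left mult.assoc)
    also have "\<dots> \<le> C * r ^ n * (1 / (1 - r))"
    proof (rule mult_left_mono)
      have "(\<Sum>j<m. r ^ j) = (1 - r ^ m) / (1 - r)" using r by (simp add: sum_gp_strict)
      also have "\<dots> \<le> 1 / (1 - r)" using r by (intro divide_right_mono) auto
      finally show "(\<Sum>j<m. r ^ j) \<le> 1 / (1 - r)" .
    qed (use C0 r in auto)
    finally have "sqrt (\<integral>x. (F (n + m) x - F n x)\<^sup>2 \<partial>M) \<le> K * r ^ n"
      using tail[of n m] by (simp add: K_def)
    then show ?thesis by (meson sqrt_le_D)
  qed
  \<comment> \<open>Fatou's lemma carries the uniform tail estimate \<open>tail2\<close> over to the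
    pointwise limit \<open>G\<close>.\<close>
  have bd: "(\<integral>\<^sup>+x. ennreal ((F n x - G x)\<^sup>2) \<partial>M) \<le> ennreal ((K * r ^ n)\<^sup>2)" for n
  proof -
    have "(\<integral>\<^sup>+x. ennreal ((F n x - G x)\<^sup>2) \<partial>M) =
       (\<integral>\<^sup>+x. liminf (\<lambda>m. ennreal ((F (n + m) x - F n x)\<^sup>2)) \<partial>M)"
    proof (rule nn_integral_cong_AE, use lim in eventually_elim)
      fix x assume "(\<lambda>n. F n x) \<longlonglongrightarrow> G x"
      then have "(\<lambda>m. F (n + m) x) \<longlonglongrightarrow> G x"
        using LIMSEQ_ignore_initial_segment[of "\<lambda>n. F n x" "G x" n] by (simp add: add.commute)
      then have "(\<lambda>m. ennreal ((F (n + m) x - F n x)\<^sup>2)) \<longlonglongrightarrow> ennreal ((G x - F n x)\<^sup>2)"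
        by (intro tendsto_intros)
      from lim_imp_Liminf[OF trivial_limit_sequentially this]
      show "ennreal ((F n x - G x)\<^sup>2) = liminf (\<lambda>m. ennreal ((F (n + m) x - F n x)\<^sup>2))"
        by (simp only: power2_commute[of "F n x" "G x"])
    qed
    also have "\<dots> \<le> liminf (\<lambda>m. \<integral>\<^sup>+x. ennreal ((F (n + m) x - F n x)\<^sup>2) \<partial>M)"
      by (rule nn_integral_liminf) measurable
    also have "\<dots> \<le> liminf (\<lambda>m::nat. ennreal ((K * r ^ n)\<^sup>2))"
    proof (intro Liminf_mono always_eventually allI)
      fix m
      have "integrable M (\<lambda>x. (F (n + m) x - F n x)\<^sup>2)"
        using sq_integrable_diff[OF F F, of "n + m" n] by (simp add: sq_integrable_def)
      then have "(\<integral>\<^sup>+x. ennreal ((F (n + m) x - F n x)\<^sup>2) \<partial>M) =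
         ennreal (\<integral>x. (F (n + m) x - F n x)\<^sup>2 \<partial>M)"
        by (intro nn_integral_eq_integral) auto
      then show "(\<integral>\<^sup>+x. ennreal ((F (n + m) x - F n x)\<^sup>2) \<partial>M) \<le> ennreal ((K * r ^ n)\<^sup>2)"
        using tail2[of n m] by (simp add: ennreal_leI)
    qed
    also have "\<dots> = ennreal ((K * r ^ n)\<^sup>2)" by (simp add: Liminf_const)
    finally show ?thesis .
  qed
  have fin: "(\<integral>\<^sup>+x. ennreal ((F n x - G x)\<^sup>2) \<partial>M) < \<infinity>" for n
    using bd[of n] by (rule le_less_trans) simp
  have "integrable M (\<lambda>x. (F 0 x - G x)\<^sup>2)"
    by (rule integrableI_nonneg) (use fin[of 0] in auto)
  then have "sq_integrable M (\<lambda>x. F 0 x - G x)" by (simp add: sq_integrable_def)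
  from sq_integrable_diff[OF F[of 0] this] have sG: "sq_integrable M G" by simp
  have "(\<lambda>n. ennreal ((K * r ^ n)\<^sup>2)) \<longlonglongrightarrow> ennreal ((K * 0)\<^sup>2)"
    using r by (intro tendsto_ennrealI tendsto_power tendsto_mult tendsto_const LIMSEQ_realpow_zero) auto
  then have "(\<lambda>n. ennreal ((K * r ^ n)\<^sup>2)) \<longlonglongrightarrow> 0" by simp
  then have "(\<lambda>n. \<integral>\<^sup>+x. ennreal ((F n x - G x)\<^sup>2) \<partial>M) \<longlonglongrightarrow> 0"
    by (rule tendsto_sandwich[OF always_eventually[OF allI] always_eventually[OF allI] tendsto_const, rotated 2])
      (rule zero_le, rule bd)
  with that sG lim fin show ?thesis by blast
qed

subsection \<open>The space $L^2(A)$\<close>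

text \<open>Putting the indicator into the function keeps the single measure \<open>lborel\<close>
  for all sets \<open>A\<close>, so every fact about \<open>sq_integrable\<close> carries over
  directly.\<close>

lemma L2_iff: "f \<in> L2 A \<longleftrightarrow> sq_integrable lborel (\<lambda>x. indicator A x *\<^sub>R f x)"
proof -
  have "(\<lambda>x. indicat_real A x *\<^sub>R (norm (f x))\<^sup>2) = (\<lambda>x. (norm (indicator A x *\<^sub>R f x))\<^sup>2)"
    by (auto simp: fun_eq_iff indicator_def)
  then show ?thesis
    by (simp add: L2_def sq_integrable_def set_borel_measurable_def set_integrable_def)
qed

lemma L2_inner_integral:
  "L2_inner A f g = (\<integral>x. (indicator A x *\<^sub>R f x) \<bullet> (indicator A x *\<^sub>R g x) \<partial>lborel)"
  unfolding L2_inner_def set_lebesgue_integral_def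
  by (rule arg_cong[of _ _ "integral\<^sup>L lborel"]) (auto simp: fun_eq_iff indicator_def)

lemma L2_norm_integral: "L2_norm A f = sqrt (\<integral>x. (norm (indicator A x *\<^sub>R f x))\<^sup>2 \<partial>lborel)"
  unfolding L2_norm_def L2_inner_integral power2_norm_eq_inner ..

lemma L2_add: "f \<in> L2 A \<Longrightarrow> g \<in> L2 A \<Longrightarrow> (\<lambda>x. f x + g x) \<in> L2 A"
  unfolding L2_iff using sq_integrable_add[of lborel "\<lambda>x. indicator A x *\<^sub>R f x" "\<lambda>x. indicator A x *\<^sub>R g x"]
  by (simp add: scaleR_add_right)

lemma L2_scaleR: "f \<in> L2 A \<Longrightarrow> (\<lambda>x. c *\<^sub>R f x) \<in> L2 A"
  unfolding L2_iff using sq_integrable_scaleR[of lborel "\<lambda>x. indicator A x *\<^sub>R f x" c]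
  by (simp add: mult.commute)

lemma L2_cmult: "f \<in> L2 A \<Longrightarrow> (\<lambda>x. c * f x :: real) \<in> L2 A"
  using L2_scaleR[of f A c] by simp

lemma L2_diff: "f \<in> L2 A \<Longrightarrow> g \<in> L2 A \<Longrightarrow> (\<lambda>x. f x - g x) \<in> L2 A"
  using L2_add[OF _ L2_scaleR[of g A "-1"]] by simp

lemma L2_diff': "f \<in> L2 A \<Longrightarrow> g \<in> L2 A \<Longrightarrow> f - g \<in> L2 A"
  using L2_diff[of f A g] by (simp add: fun_diff_def)

lemma L2_zero: "(\<lambda>x. 0) \<in> L2 A"
  by (simp add: L2_iff sq_integrable_def)

lemma L2_sum: "(\<And>i. i \<in> I \<Longrightarrow> f i \<in> L2 A) \<Longrightarrow> (\<lambda>x. \<Sum>i\<in>I. f i x) \<in> L2 A"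
  by (induction I rule: infinite_finite_induct) (auto simp: L2_zero intro!: L2_add)

lemma L2_inner_commute: "L2_inner A f g = L2_inner A g f"
  by (simp add: L2_inner_def inner_commute)

lemma L2_inner_integrable:
  assumes "f \<in> L2 A" "g \<in> L2 A"
  shows "set_integrable lborel A (\<lambda>x. f x \<bullet> g x)"
proof -
  have "(\<lambda>x. indicator A x *\<^sub>R (f x \<bullet> g x)) =
     (\<lambda>x. (indicator A x *\<^sub>R f x) \<bullet> (indicator A x *\<^sub>R g x))"
    by (auto simp: fun_eq_iff indicator_def)
  then show ?thesis
    unfolding set_integrable_def
    using sq_integrable_inner[OF assms[unfolded L2_iff]] by metis
qed

lemma L2_inner_add_left:
  assumes "f \<in> L2 A" "g \<in> L2 A" "h \<in> L2 A"
  shows "L2_inner A (\<lambda>x. f x + g x) h = L2_inner A f h + L2_inner A g h"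
  unfolding L2_inner_def inner_add_left
  by (intro set_integral_add L2_inner_integrable assms)

lemma L2_inner_scaleR_left: "L2_inner A (\<lambda>x. c *\<^sub>R f x) h = c * L2_inner A f h"
  by (simp add: L2_inner_def)

lemma L2_inner_cmult_left: "L2_inner A (\<lambda>x. c * f x :: real) h = c * L2_inner A f h"
  using L2_inner_scaleR_left[of A c f h] by simp

lemma L2_inner_diff_left:
  assumes "f \<in> L2 A" "g \<in> L2 A" "h \<in> L2 A"
  shows "L2_inner A (\<lambda>x. f x - g x) h = L2_inner A f h - L2_inner A g h"
  unfolding L2_inner_def inner_diff_left
  by (intro set_integral_diff L2_inner_integrable assms)

lemma L2_inner_diff_left':
  assumes "f \<in> L2 A" "g \<in> L2 A" "h \<in> L2 A"
  shows "L2_inner A (f - g) h = L2_inner A f h - L2_inner A g h"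
  using L2_inner_diff_left[OF assms] by (simp add: fun_diff_def)

lemma L2_inner_zero_left: "L2_inner A (\<lambda>x. 0) h = 0"
  by (simp add: L2_inner_def)

lemma L2_inner_sum_left:
  assumes "finite I" "\<And>i. i \<in> I \<Longrightarrow> f i \<in> L2 A" "h \<in> L2 A"
  shows "L2_inner A (\<lambda>x. \<Sum>i\<in>I. f i x) h = (\<Sum>i\<in>I. L2_inner A (f i) h)"
  using assms(1,2)
proof (induction I rule: finite_induct)
  case (insert i I)
  then show ?case using assms(3) by (simp add: L2_inner_add_left L2_sum)
qed (simp add: L2_inner_zero_left)

lemma L2_inner_cong:
  assumes "L2_eq A f f'" "L2_eq A g g'" "f \<in> L2 A" "f' \<in> L2 A" "g \<in> L2 A" "g' \<in> L2 A"
  shows "L2_inner A f g = L2_inner A f' g'"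
  unfolding L2_inner_integral
proof (rule integral_cong_AE)
  have m: "(\<lambda>x. indicat_real A x *\<^sub>R h x) \<in> borel_measurable lborel" if "h \<in> L2 A" for h :: "'a \<Rightarrow> 'b"
    using that by (simp add: L2_iff sq_integrable_def)
  show "(\<lambda>x. indicat_real A x *\<^sub>R f x \<bullet> indicat_real A x *\<^sub>R g x) \<in> borel_measurable lborel"
    by (intro borel_measurable_inner m assms)
  show "(\<lambda>x. indicat_real A x *\<^sub>R f' x \<bullet> indicat_real A x *\<^sub>R g' x) \<in> borel_measurable lborel"
    by (intro borel_measurable_inner m assms)
  show "AE x in lborel. indicat_real A x *\<^sub>R f x \<bullet> indicat_real A x *\<^sub>R g x =
      indicat_real A x *\<^sub>R f' x \<bullet> indicat_real A x *\<^sub>R g' x"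
    using assms(1,2) unfolding L2_eq_def by eventually_elim (auto simp: indicator_def)
qed

lemma L2_inner_self_nonneg: "0 \<le> L2_inner A f f"
  by (simp add: L2_inner_integral)

lemma L2_norm_nonneg: "0 \<le> L2_norm A f"
  by (simp add: L2_norm_def L2_inner_self_nonneg)

lemma L2_norm_sq: "(L2_norm A f)\<^sup>2 = L2_inner A f f"
  by (simp add: L2_norm_def L2_inner_self_nonneg)

lemma L2_Cauchy_Schwarz:
  assumes "f \<in> L2 A" "g \<in> L2 A"
  shows "\<bar>L2_inner A f g\<bar> \<le> L2_norm A f * L2_norm A g"
  using sq_integrable_Cauchy_Schwarz[OF assms[unfolded L2_iff]]
  by (simp add: L2_inner_integral L2_norm_integral)

lemma L2_norm_triangle:
  assumes "f \<in> L2 A" "g \<in> L2 A"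
  shows "L2_norm A (\<lambda>x. f x + g x) \<le> L2_norm A f + L2_norm A g"
  using sq_integrable_triangle[OF assms[unfolded L2_iff]]
  by (simp add: L2_norm_integral scaleR_add_right)

lemma L2_norm_minus_commute: "L2_norm A (f - g) = L2_norm A (g - f)"
proof -
  have "L2_inner A (f - g) (f - g) = L2_inner A (g - f) (g - f)"
    unfolding L2_inner_def by (simp add: inner_diff_left inner_diff_right algebra_simps inner_commute)
  then show ?thesis by (simp add: L2_norm_def)
qed

lemma L2_dist_triangle:
  assumes "f \<in> L2 A" "g \<in> L2 A" "h \<in> L2 A"
  shows "L2_norm A (f - h) \<le> L2_norm A (f - g) + L2_norm A (g - h)"
  using L2_norm_triangle[OF L2_diff'[OF assms(1,2)] L2_diff'[OF assms(2,3)]]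
  by (simp add: fun_diff_def)

lemma L2_norm_zero_iff:
  assumes "f \<in> L2 A"
  shows "L2_norm A f = 0 \<longleftrightarrow> L2_eq A f (\<lambda>x. 0)"
proof -
  have "L2_norm A f = 0 \<longleftrightarrow> (\<integral>x. (norm (indicator A x *\<^sub>R f x))\<^sup>2 \<partial>lborel) = 0"
    by (simp add: L2_norm_integral)
  also have "\<dots> \<longleftrightarrow> (AE x in lborel. (norm (indicator A x *\<^sub>R f x))\<^sup>2 = 0)"
    using assms by (intro integral_nonneg_eq_0_iff_AE) (auto simp: L2_iff sq_integrable_def)
  also have "\<dots> \<longleftrightarrow> L2_eq A f (\<lambda>x. 0)"
    unfolding L2_eq_def by (intro AE_cong) (auto simp: indicator_def)
  finally show ?thesis .
qed

lemma L2_norm_diff_zero_iff: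
  assumes "f \<in> L2 A" "g \<in> L2 A"
  shows "L2_norm A (f - g) = 0 \<longleftrightarrow> L2_eq A f g"
  using L2_norm_zero_iff[OF L2_diff'[OF assms]] by (simp add: L2_eq_def)

lemma L2_norm_cong:
  assumes "L2_eq A f g" "f \<in> L2 A" "g \<in> L2 A"
  shows "L2_norm A f = L2_norm A g"
  using L2_inner_cong[OF assms(1,1,2,3,2,3)] by (simp add: L2_norm_def)

lemma L2_eq_refl: "L2_eq A f f"
  by (simp add: L2_eq_def)

lemma L2_eq_sym: "L2_eq A f g \<Longrightarrow> L2_eq A g f"
  unfolding L2_eq_def by (erule AE_mp) (auto intro!: AE_I2)

subsection \<open>Orthonormal expansions\<close>

text \<open>Completing the square in the coefficients \<open>c k\<close>. Orthonormality is asked of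
  the vectors below \<open>n\<close> only, because in the middle of Gram-Schmidt no further vectors
  exist.\<close>

lemma orthonormal_norm_diff_sq_lessThan:
  fixes e :: "nat \<Rightarrow> 'a::euclidean_space \<Rightarrow> real"
  assumes e: "\<And>k. k < n \<Longrightarrow> e k \<in> L2 A"
    and o: "\<And>j k. j < n \<Longrightarrow> k < n \<Longrightarrow> L2_inner A (e j) (e k) = (if j = k then 1 else 0)"
    and f: "f \<in> L2 A"
  shows "L2_inner A (\<lambda>x. f x - (\<Sum>k<n. c k * e k x)) (\<lambda>x. f x - (\<Sum>k<n. c k * e k x)) =
    L2_inner A f f - (\<Sum>k<n. (L2_inner A f (e k))\<^sup>2) + (\<Sum>k<n. (L2_inner A f (e k) - c k)\<^sup>2)"
proof -
  let ?s = "\<lambda>x. \<Sum>k<n. c k * e k x"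
  have s: "?s \<in> L2 A" by (intro L2_sum L2_cmult e) auto
  have es: "L2_inner A ?s (e j) = c j" if "j < n" for j
  proof -
    have "L2_inner A ?s (e j) = (\<Sum>k<n. L2_inner A (\<lambda>x. c k * e k x) (e j))"
      using that by (intro L2_inner_sum_left L2_cmult e) auto
    also have "\<dots> = (\<Sum>k<n. if k = j then c j else 0)"
      using that by (intro sum.cong) (auto simp: L2_inner_cmult_left o)
    also have "\<dots> = c j" using that by (simp add: sum.delta')
    finally show ?thesis .
  qed
  have si: "L2_inner A ?s h = (\<Sum>k<n. c k * L2_inner A (e k) h)" if "h \<in> L2 A" for h
    using that by (subst L2_inner_sum_left) (auto intro!: L2_cmult e simp: L2_inner_cmult_left)
  have "L2_inner A (\<lambda>x. f x - ?s x) (\<lambda>x. f x - ?s x) =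
     L2_inner A f f - 2 * L2_inner A ?s f + L2_inner A ?s ?s"
  proof -
    have "L2_inner A (\<lambda>x. f x - ?s x) (\<lambda>x. f x - ?s x) =
       L2_inner A f (\<lambda>x. f x - ?s x) - L2_inner A ?s (\<lambda>x. f x - ?s x)"
      by (rule L2_inner_diff_left[OF f s L2_diff[OF f s]])
    also have "L2_inner A f (\<lambda>x. f x - ?s x) = L2_inner A f f - L2_inner A ?s f"
      by (subst L2_inner_commute) (rule L2_inner_diff_left[OF f s f])
    also have "L2_inner A ?s (\<lambda>x. f x - ?s x) = L2_inner A f ?s - L2_inner A ?s ?s"
      by (subst L2_inner_commute) (rule L2_inner_diff_left[OF f s s])
    also have "L2_inner A f ?s = L2_inner A ?s f" by (rule L2_inner_commute)
    finally show ?thesis by simp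
  qed
  also have "L2_inner A ?s ?s = (\<Sum>k<n. c k * c k)"
    using s by (simp add: si es L2_inner_commute[of A "e _" ?s])
  also have "L2_inner A ?s f = (\<Sum>k<n. c k * L2_inner A f (e k))"
    using f by (simp add: si L2_inner_commute[of A f])
  also have "L2_inner A f f - 2 * (\<Sum>k<n. c k * L2_inner A f (e k)) + (\<Sum>k<n. c k * c k) =
    L2_inner A f f - (\<Sum>k<n. (L2_inner A f (e k))\<^sup>2) + (\<Sum>k<n. (L2_inner A f (e k) - c k)\<^sup>2)"
    by (simp add: power2_diff sum.distrib sum_subtractf sum_distrib_left power2_eq_square algebra_simps)
  finally show ?thesis .
qed

lemma orthonormal_norm_diff_sq:
  fixes e :: "nat \<Rightarrow> 'a::euclidean_space \<Rightarrow> real"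
  assumes e: "\<And>k. e k \<in> L2 A" and o: "\<And>j k. L2_inner A (e j) (e k) = (if j = k then 1 else 0)"
    and f: "f \<in> L2 A"
  shows "L2_inner A (\<lambda>x. f x - (\<Sum>k<n. c k * e k x)) (\<lambda>x. f x - (\<Sum>k<n. c k * e k x)) =
    L2_inner A f f - (\<Sum>k<n. (L2_inner A f (e k))\<^sup>2) + (\<Sum>k<n. (L2_inner A f (e k) - c k)\<^sup>2)"
  by (rule orthonormal_norm_diff_sq_lessThan) (use e o f in auto)

lemma Bessel:
  fixes e :: "nat \<Rightarrow> 'a::euclidean_space \<Rightarrow> real"
  assumes e: "\<And>k. e k \<in> L2 A" and o: "\<And>j k. L2_inner A (e j) (e k) = (if j = k then 1 else 0)"
    and f: "f \<in> L2 A"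
  shows "(\<Sum>k<n. (L2_inner A f (e k))\<^sup>2) \<le> L2_inner A f f"
  using orthonormal_norm_diff_sq[OF e o f, of "\<lambda>k. L2_inner A f (e k)" n]
    L2_inner_self_nonneg[of A "\<lambda>x. f x - (\<Sum>k<n. L2_inner A f (e k) * e k x)"]
  by simp

text \<open>The fast-Cauchy criterion needs a rate, so it is applied to partial sums at indices
  \<open>r j\<close> beyond which the squared tail is below 4^-j; monotonicity of the error recovers
  the full sequence.\<close>

lemma Riesz_Fischer:
  fixes e :: "nat \<Rightarrow> 'a::euclidean_space \<Rightarrow> real"
  assumes e: "\<And>k. e k \<in> L2 A" and o: "\<And>j k. L2_inner A (e j) (e k) = (if j = k then 1 else 0)"
    and z: "summable (\<lambda>k. (z k)\<^sup>2)"
  shows "\<exists>f\<in>L2 A. (\<forall>k. L2_inner A f (e k) = z k) \<and>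
     (\<lambda>n. L2_norm A (f - (\<lambda>x. \<Sum>k<n. z k * e k x))) \<longlonglongrightarrow> 0"
proof -
  define s where "s n = (\<lambda>x. \<Sum>k<n. z k * e k x)" for n
  have s: "s n \<in> L2 A" for n unfolding s_def by (intro L2_sum L2_cmult e)
  have es: "L2_inner A (s n) (e j) = (if j < n then z j else 0)" for j n
  proof -
    have "L2_inner A (s n) (e j) = (\<Sum>k<n. L2_inner A (\<lambda>x. z k * e k x) (e j))"
      unfolding s_def by (intro L2_inner_sum_left L2_cmult e) auto
    also have "\<dots> = (\<Sum>k<n. if k = j then z j else 0)"
      by (intro sum.cong) (auto simp: L2_inner_cmult_left o)
    also have "\<dots> = (if j < n then z j else 0)" by (simp add: sum.delta')
    finally show ?thesis .
  qed
  have sn: "L2_inner A (s m) (s m) = (\<Sum>k<m. (z k)\<^sup>2)" for m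
  proof -
    have "L2_inner A (s m) (s m) = (\<Sum>k<m. z k * L2_inner A (s m) (e k))"
      using s[of m] by (subst (2) L2_inner_commute, subst (1) s_def, subst L2_inner_sum_left)
        (auto intro!: L2_cmult e simp: L2_inner_cmult_left L2_inner_commute[of A "e _"])
    then show ?thesis by (simp add: es power2_eq_square)
  qed
  have ns: "(L2_norm A (s m - s n))\<^sup>2 = (\<Sum>k=n..<m. (z k)\<^sup>2)" if "n \<le> m" for n m
  proof -
    have "(L2_norm A (s m - s n))\<^sup>2 = L2_inner A (\<lambda>x. s m x - (\<Sum>k<n. z k * e k x)) (\<lambda>x. s m x - (\<Sum>k<n. z k * e k x))"
      by (simp add: L2_norm_sq s_def fun_diff_def)
    also have "\<dots> = (\<Sum>k<m. (z k)\<^sup>2) - (\<Sum>k<n. (z k)\<^sup>2)"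
      using that by (subst orthonormal_norm_diff_sq[OF e o s]) (simp add: es sn)
    also have "\<dots> = (\<Sum>k=n..<m. (z k)\<^sup>2)" using that
      by (metis sum_diff_nat_ivl atLeast0LessThan zero_le)
    finally show ?thesis .
  qed
  have "\<exists>N. \<forall>m n. m \<ge> N \<longrightarrow> n \<ge> m \<longrightarrow> norm (\<Sum>k=m..<n. (z k)\<^sup>2) < (1/4::real)^j" for j :: nat
  proof -
    have "(0::real) < (1/4) ^ j" by simp
    then obtain N where "\<forall>m\<ge>N. \<forall>n. norm (\<Sum>k=m..<n. (z k)\<^sup>2) < (1/4::real)^j"
      using z[unfolded summable_Cauchy] by blast
    then show ?thesis by blast
  qed
  then obtain N where N: "\<And>j m n. m \<ge> N j \<Longrightarrow> n \<ge> m \<Longrightarrow> norm (\<Sum>k=m..<n. (z k)\<^sup>2) < (1/4::real)^j"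
    by metis
  \<comment> \<open>Cumulative sums make \<open>r\<close> nondecreasing while keeping
    \<open>N j \<le> r j\<close>. The sequence may stay bounded; then all later coefficients
    vanish.\<close>
  define r where "r j = (\<Sum>i\<le>j. N i)" for j
  have rN: "N j \<le> r j" for j unfolding r_def by (rule member_le_sum) auto
  have rm: "r j \<le> r (Suc j)" for j by (simp add: r_def)
  define F where "F j = (\<lambda>x. indicator A x * s (r j) x)" for j
  have Fs: "sq_integrable lborel (F j)" for j
    using s[of "r j"] by (simp add: L2_iff F_def)
  have st: "sqrt (\<integral>x. (F (Suc j) x - F j x)\<^sup>2 \<partial>lborel) \<le> 1 * (1/2) ^ j" for j
  proof -
    have "sqrt (\<integral>x. (F (Suc j) x - F j x)\<^sup>2 \<partial>lborel) = L2_norm A (s (r (Suc j)) - s (r j))"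
      by (simp add: L2_norm_integral F_def right_diff_distrib)
    also have "\<dots> = sqrt (\<Sum>k=r j..<r (Suc j). (z k)\<^sup>2)"
      using ns[OF rm[of j]] by (metis L2_norm_nonneg real_sqrt_unique)
    also have "\<dots> \<le> sqrt ((1/4) ^ j)" using N[OF rN rm, of j] by simp
    also have "\<dots> = 1 * (1/2) ^ j" by (simp add: real_sqrt_power real_sqrt_divide)
    finally show ?thesis .
  qed
  obtain G where G: "sq_integrable lborel G" "AE x in lborel. (\<lambda>n. F n x) \<longlonglongrightarrow> G x"
    "(\<lambda>n. \<integral>\<^sup>+x. ennreal ((F n x - G x)\<^sup>2) \<partial>lborel) \<longlonglongrightarrow> 0"
    by (rule sq_integrable_fast_Cauchy[OF Fs _ _ st]) auto
  have FG: "sq_integrable lborel (\<lambda>x. F n x - G x)" for n by (intro sq_integrable_diff Fs G)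
  have "(\<lambda>n. ennreal (\<integral>x. (F n x - G x)\<^sup>2 \<partial>lborel)) \<longlonglongrightarrow> ennreal 0"
    using G(3) FG by (subst (asm) nn_integral_eq_integral) (auto simp: sq_integrable_def)
  then have "(\<lambda>n. \<integral>x. (F n x - G x)\<^sup>2 \<partial>lborel) \<longlonglongrightarrow> 0"
    by (subst (asm) tendsto_ennreal_iff) auto
  then have nr: "(\<lambda>n. sqrt (\<integral>x. (F n x - G x)\<^sup>2 \<partial>lborel)) \<longlonglongrightarrow> 0"
    using tendsto_real_sqrt by fastforce
  have AG: "AE x in lborel. indicator A x * G x = G x"
    using G(2)
  proof eventually_elim
    fix x assume "(\<lambda>n. F n x) \<longlonglongrightarrow> G x"
    then show "indicator A x * G x = G x"
      by (cases "x \<in> A") (auto simp: F_def LIMSEQ_const_iff)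
  qed
  \<comment> \<open>\<open>G\<close> vanishes outside \<open>A\<close> only almost everywhere.
    Testing whether some \<open>F n x\<close> is nonzero cuts \<open>G\<close> down to a subset of
    \<open>A\<close> while measurability is inherited from the \<open>F n\<close>.\<close>
  define G' where "G' x = (if G x = 0 then 0 else if \<exists>n. F n x \<noteq> 0 then G x else 0)" for x
  have G'm: "G' \<in> borel_measurable lborel"
  proof -
    have [measurable]: "G \<in> borel_measurable lborel" "\<And>n. F n \<in> borel_measurable lborel"
      using G(1) Fs by (auto simp: sq_integrable_def)
    show ?thesis unfolding G'_def by measurable
  qed
  have G'A: "indicator A x * G' x = G' x" for x
    by (auto simp: G'_def F_def indicator_def)
  have G'G: "AE x in lborel. G' x = G x"
    using G(2)
  proof eventually_elim
    fix x assume "(\<lambda>n. F n x) \<longlonglongrightarrow> G x"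
    then show "G' x = G x"
      by (cases "\<exists>n. F n x \<noteq> 0") (auto simp: G'_def LIMSEQ_const_iff)
  qed
  have G'L: "G' \<in> L2 A"
  proof -
    have "integrable lborel (\<lambda>x. (norm (G' x))\<^sup>2)"
      using G'm G'G G(1) by (subst integrable_cong_AE[where g = "\<lambda>x. (norm (G x))\<^sup>2"]) (auto simp: sq_integrable_def)
    then show ?thesis using G'm by (simp add: L2_iff sq_integrable_def G'A)
  qed
  have "L2_norm A (G' - s (r n)) = sqrt (\<integral>x. (F n x - G x)\<^sup>2 \<partial>lborel)" for n
    unfolding L2_norm_integral
  proof (rule arg_cong[of _ _ sqrt], rule integral_cong_AE)
    show "AE x in lborel. (norm (indicat_real A x *\<^sub>R (G' - s (r n)) x))\<^sup>2 = (F n x - G x)\<^sup>2"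
      using G'G
    proof eventually_elim
      fix x assume "G' x = G x"
      have "indicat_real A x *\<^sub>R (G' - s (r n)) x = indicator A x * G' x - F n x"
        by (simp add: F_def right_diff_distrib)
      then show "(norm (indicat_real A x *\<^sub>R (G' - s (r n)) x))\<^sup>2 = (F n x - G x)\<^sup>2"
        using \<open>G' x = G x\<close> G'A[of x] by (simp only: real_norm_def power2_abs power2_commute[of "G x"])
    qed
  qed (use L2_diff'[OF G'L s, of "r n"] FG[of n] borel_measurable_integrable in
      \<open>force simp: L2_iff sq_integrable_def\<close>)+
  with nr have lim: "(\<lambda>n. L2_norm A (G' - s (r n))) \<longlonglongrightarrow> 0" by simp
  have coord: "L2_inner A G' (e k) = z k" for k
  proof -
    have "L2_norm A (e k) = 1" using o[of k k] by (simp add: L2_norm_def)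
    then have "\<bar>L2_inner A (G' - s (r n)) (e k)\<bar> \<le> L2_norm A (G' - s (r n))" for n
      using L2_Cauchy_Schwarz[OF L2_diff'[OF G'L s[of "r n"]] e[of k]] by simp
    then have "(\<lambda>n. L2_inner A (G' - s (r n)) (e k)) \<longlonglongrightarrow> 0"
      by (intro tendsto_0_le[OF lim, of _ 1] always_eventually) (auto simp: L2_norm_nonneg)
    then have 1: "(\<lambda>n. L2_inner A G' (e k) - L2_inner A (s (r n)) (e k)) \<longlonglongrightarrow> 0"
      by (simp add: L2_inner_diff_left'[OF G'L s e])
    show ?thesis
    proof (cases "\<exists>j. k < r j")
      case True
      then obtain j where j: "k < r j" by blast
      have "k < r n" if "n \<ge> j" for n
        using that j rm by (metis lift_Suc_mono_le order_less_le_trans)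
      then have "eventually (\<lambda>n. L2_inner A G' (e k) - L2_inner A (s (r n)) (e k) = L2_inner A G' (e k) - z k) sequentially"
        unfolding eventually_sequentially by (intro exI[of _ j]) (auto simp: es)
      with 1 have "(\<lambda>n::nat. L2_inner A G' (e k) - z k) \<longlonglongrightarrow> 0" by (simp add: tendsto_cong)
      then show ?thesis by (simp add: LIMSEQ_const_iff)
    next
      \<comment> \<open>Every \<open>N j\<close> is now at most \<open>k\<close>, so the tail bound
        applies to the single term with index \<open>k\<close> for each \<open>j\<close>.\<close>
      case False
      then have "L2_inner A (s (r n)) (e k) = 0" for n by (auto simp: es)
      with 1 have "L2_inner A G' (e k) = 0" by (simp add: LIMSEQ_const_iff)
      moreover have "z k = 0"
      proof (rule ccontr)
        assume "z k \<noteq> 0"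
        have "(z k)\<^sup>2 < (1/4) ^ j" for j
          using N[of j k "Suc k"] rN[of j] False by (simp add: not_less) (meson order_trans)
        moreover have "(\<lambda>j. (1/4::real) ^ j) \<longlonglongrightarrow> 0" by (intro LIMSEQ_realpow_zero) auto
        ultimately have "(z k)\<^sup>2 \<le> 0"
          by (intro LIMSEQ_le_const[where X = "\<lambda>j. (1/4::real) ^ j"]) (auto intro: less_imp_le)
        then show False using \<open>z k \<noteq> 0\<close> by simp
      qed
      ultimately show ?thesis by simp
    qed
  qed
  have full: "(L2_norm A (G' - s n))\<^sup>2 = L2_inner A G' G' - (\<Sum>k<n. (z k)\<^sup>2)" for n
    using orthonormal_norm_diff_sq[OF e o G'L, of z n] by (simp add: L2_norm_sq s_def fun_diff_def coord)
  \<comment> \<open>By \<open>full\<close> the error is nonincreasing in the number of terms, so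
    smallness at one index \<open>r j\<close> persists for all larger ones.\<close>
  have dec: "L2_norm A (G' - s n) \<le> L2_norm A (G' - s m)" if "m \<le> n" for m n
  proof (rule power2_le_imp_le[OF _ L2_norm_nonneg])
    have "(\<Sum>k<m. (z k)\<^sup>2) \<le> (\<Sum>k<n. (z k)\<^sup>2)" using that by (intro sum_mono2) auto
    then show "(L2_norm A (G' - s n))\<^sup>2 \<le> (L2_norm A (G' - s m))\<^sup>2" by (simp add: full)
  qed
  have "(\<lambda>n. L2_norm A (G' - s n)) \<longlonglongrightarrow> 0"
  proof (rule LIMSEQ_I)
    fix \<epsilon> :: real assume "0 < \<epsilon>"
    then obtain j where "norm (L2_norm A (G' - s (r j)) - 0) < \<epsilon>" using LIMSEQ_D[OF lim] by blast
    then have "norm (L2_norm A (G' - s n) - 0) < \<epsilon>" if "n \<ge> r j" for n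
      using dec[OF that] L2_norm_nonneg[of A "G' - s n"] by simp
    then show "\<exists>no. \<forall>n\<ge>no. norm (L2_norm A (G' - s n) - 0) < \<epsilon>" by blast
  qed
  with G'L coord show ?thesis unfolding s_def by blast
qed

text \<open>Riesz-Fischer provides the sum \<open>f'\<close> of the series of \<open>f\<close>. Both
  functions have the same coefficients, so completeness of the basis identifies them almost
  everywhere.\<close>

lemma Parseval:
  assumes e: "orthonormal_basis A e" and f: "f \<in> L2 A" and g: "g \<in> L2 A"
  shows "(\<lambda>k. L2_inner A f (e k) * L2_inner A g (e k)) sums L2_inner A f g"
proof -
  have eL: "\<And>k. e k \<in> L2 A" and o: "\<And>j k. L2_inner A (e j) (e k) = (if j = k then 1 else 0)"
    using e by (auto simp: orthonormal_basis_def)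
  define z where "z k = L2_inner A f (e k)" for k
  have "summable (\<lambda>k. (z k)\<^sup>2)"
    by (rule summableI_nonneg_bounded[where x = "L2_inner A f f"])
       (auto simp: z_def Bessel[OF eL o f])
  from Riesz_Fischer[OF eL o this] obtain f' where f': "f' \<in> L2 A"
    "\<And>k. L2_inner A f' (e k) = z k" "(\<lambda>n. L2_norm A (f' - (\<lambda>x. \<Sum>k<n. z k * e k x))) \<longlonglongrightarrow> 0"
    by blast
  have "L2_inner A (f - f') (e k) = 0" for k
    by (simp add: L2_inner_diff_left'[OF f f'(1) eL] f'(2)) (simp add: z_def)
  then have "L2_eq A (f - f') (\<lambda>x. 0)"
    using e L2_diff'[OF f f'(1)] by (auto simp: orthonormal_basis_def)
  then have ff': "L2_eq A f f'" by (simp add: L2_eq_def)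
  have s: "(\<lambda>x. \<Sum>k<n. z k * e k x) \<in> L2 A" for n by (intro L2_sum L2_cmult eL)
  have "(\<lambda>n. L2_inner A f' g - (\<Sum>k<n. z k * L2_inner A g (e k))) \<longlonglongrightarrow> 0"
  proof (rule tendsto_0_le[OF f'(3), of _ "L2_norm A g"], rule always_eventually, intro allI)
    fix n
    have "L2_inner A f' g - (\<Sum>k<n. z k * L2_inner A g (e k)) =
       L2_inner A (f' - (\<lambda>x. \<Sum>k<n. z k * e k x)) g"
      using g by (simp add: L2_inner_diff_left'[OF f'(1) s g])
        (subst L2_inner_sum_left, auto intro!: L2_cmult eL simp: L2_inner_cmult_left L2_inner_commute[of A g])
    then show "norm (L2_inner A f' g - (\<Sum>k<n. z k * L2_inner A g (e k))) \<le>
       norm (L2_norm A (f' - (\<lambda>x. \<Sum>k<n. z k * e k x))) * L2_norm A g"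
      using L2_Cauchy_Schwarz[OF L2_diff'[OF f'(1) s] g] by (simp add: L2_norm_nonneg)
  qed
  from tendsto_diff[OF tendsto_const[of "L2_inner A f' g"] this]
  have "(\<lambda>n. \<Sum>k<n. z k * L2_inner A g (e k)) \<longlonglongrightarrow> L2_inner A f' g" by simp
  moreover have "L2_inner A f' g = L2_inner A f g"
    using L2_inner_cong[OF ff' L2_eq_refl f f'(1) g g] by simp
  ultimately show ?thesis by (simp add: sums_def z_def)
qed

section \<open>Test functions and weak gradients\<close>

subsection \<open>Smooth bumps\<close>

lemma has_derivative_grad:
  assumes "f differentiable at x"
  shows "(f has_derivative (\<lambda>h. grad f x \<bullet> h)) (at x)"
proof -
  let ?F = "frechet_derivative f (at x)"
  have F: "(f has_derivative ?F) (at x)" using assms by (simp add: frechet_derivative_works)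
  have "?F h = grad f x \<bullet> h" for h
  proof -
    have "?F h = ?F (\<Sum>b\<in>Basis. (h \<bullet> b) *\<^sub>R b)" by (simp add: euclidean_representation)
    also have "\<dots> = (\<Sum>b\<in>Basis. (h \<bullet> b) * ?F b)"
      using has_derivative_linear[OF F] by (simp add: linear_sum linear_cmul)
    also have "\<dots> = grad f x \<bullet> h"
      by (simp add: grad_def inner_sum_left inner_commute[of h] mult.commute)
    finally show ?thesis .
  qed
  then show ?thesis using F by (metis has_derivative_eq_rhs ext)
qed

lemma grad_eqI:
  assumes "(f has_derivative (\<lambda>h. G \<bullet> h)) (at x)" shows "grad f x = G"
  unfolding grad_def frechet_derivative_at[OF assms, symmetric]
  by (simp add: euclidean_representation)

lemma Ck_on_UNIV_D:
  assumes "Ck_on (Suc k) UNIV f"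
  shows "f differentiable at x" "b \<in> Basis \<Longrightarrow> Ck_on k UNIV (\<lambda>x. frechet_derivative f (at x) b)"
  using assms by (auto simp: differentiable_on_def)

lemma Ck_on_UNIV_I:
  assumes "\<And>x. (f has_derivative f' x) (at x)" "\<And>b. b \<in> Basis \<Longrightarrow> Ck_on k UNIV (\<lambda>x. f' x b)"
  shows "Ck_on (Suc k) UNIV f"
proof -
  have "f differentiable_on UNIV" using assms(1) by (auto simp: differentiable_on_def differentiable_def)
  moreover have "(\<lambda>x. frechet_derivative f (at x) b) = (\<lambda>x. f' x b)" for b
    by (rule ext) (simp add: frechet_derivative_at[OF assms(1), symmetric])
  ultimately show ?thesis using assms(2) by simp
qed

lemma Ck_on_UNIV_Suc: "Ck_on (Suc k) UNIV f \<Longrightarrow> Ck_on k UNIV f"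
proof (induction k arbitrary: f)
  case 0
  then show ?case by (auto intro: differentiable_imp_continuous_on)
next
  case (Suc k)
  show ?case
  proof (rule Ck_on_UNIV_I)
    show "(f has_derivative frechet_derivative f (at x)) (at x)" for x
      using Ck_on_UNIV_D(1)[OF Suc.prems] by (simp add: frechet_derivative_works)
    show "Ck_on k UNIV (\<lambda>x. frechet_derivative f (at x) b)" if "b \<in> Basis" for b
      by (rule Suc.IH[OF Ck_on_UNIV_D(2)[OF Suc.prems that]])
  qed
qed

lemma Ck_on_UNIV_const: "Ck_on k UNIV (\<lambda>x. c)"
proof (induction k arbitrary: c)
  case (Suc k)
  show ?case by (rule Ck_on_UNIV_I[where f' = "\<lambda>_ _. 0"]) (auto intro: Suc)
qed simp

lemma Ck_on_UNIV_add: "Ck_on k UNIV f \<Longrightarrow> Ck_on k UNIV g \<Longrightarrow> Ck_on k UNIV (\<lambda>x. f x + g x)"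
proof (induction k arbitrary: f g)
  case (Suc k)
  show ?case
  proof (rule Ck_on_UNIV_I)
    show "((\<lambda>x. f x + g x) has_derivative
       (\<lambda>h. frechet_derivative f (at x) h + frechet_derivative g (at x) h)) (at x)" for x
      using Ck_on_UNIV_D(1)[OF Suc.prems(1)] Ck_on_UNIV_D(1)[OF Suc.prems(2)]
      by (intro has_derivative_add) (auto simp: frechet_derivative_works)
    show "Ck_on k UNIV (\<lambda>x. frechet_derivative f (at x) b + frechet_derivative g (at x) b)"
      if "b \<in> Basis" for b
      by (intro Suc.IH Ck_on_UNIV_D(2)[OF _ that] Suc.prems)
  qed
qed (auto intro: continuous_on_add)

lemma Ck_on_UNIV_mult: "Ck_on k UNIV f \<Longrightarrow> Ck_on k UNIV g \<Longrightarrow> Ck_on k UNIV (\<lambda>x. f x * g x)"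
proof (induction k arbitrary: f g)
  case (Suc k)
  show ?case
  proof (rule Ck_on_UNIV_I)
    show "((\<lambda>x. f x * g x) has_derivative
       (\<lambda>h. f x * frechet_derivative g (at x) h + frechet_derivative f (at x) h * g x)) (at x)" for x
      using Ck_on_UNIV_D(1)[OF Suc.prems(1)] Ck_on_UNIV_D(1)[OF Suc.prems(2)]
      by (intro has_derivative_mult) (auto simp: frechet_derivative_works)
    show "Ck_on k UNIV (\<lambda>x. f x * frechet_derivative g (at x) b + frechet_derivative f (at x) b * g x)"
      if "b \<in> Basis" for b
      by (intro Ck_on_UNIV_add Suc.IH Ck_on_UNIV_D(2)[OF _ that] Suc.prems
          Ck_on_UNIV_Suc[OF Suc.prems(1)] Ck_on_UNIV_Suc[OF Suc.prems(2)])
  qed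
qed (auto intro: continuous_on_mult)

lemma Ck_on_UNIV_prod:
  "finite I \<Longrightarrow> (\<And>i. i \<in> I \<Longrightarrow> Ck_on k UNIV (f i)) \<Longrightarrow> Ck_on k UNIV (\<lambda>x. \<Prod>i\<in>I. f i x)"
  by (induction I rule: finite_induct) (auto simp: Ck_on_UNIV_const intro!: Ck_on_UNIV_mult)

text \<open>The family \<open>p(1/y) exp(-1/y)\<close>, \<open>p\<close> a polynomial, is closed under differentiation; this gives
  the smoothness of the cutoffs.\<close>

definition flat :: "real poly \<Rightarrow> real \<Rightarrow> real" where
  "flat p y = (if y > 0 then poly p (1 / y) * exp (- (1 / y)) else 0)"

text \<open>The additional power \<open>u ^ k\<close> lets the induction absorb the factor
  \<open>u\<close> produced by \<open>pCons\<close>.\<close>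

lemma poly_exp_decay: "((\<lambda>u. u ^ k * poly p u * exp (- u)) \<longlongrightarrow> 0) at_top" for p :: "real poly"
proof (induction p arbitrary: k)
  case (pCons a p)
  have "(\<lambda>u. u ^ k * poly (pCons a p) u * exp (- u)) =
     (\<lambda>u::real. a * (u ^ k / exp u) + u ^ Suc k * poly p u * exp (- u))"
    by (simp add: fun_eq_iff algebra_simps exp_minus field_simps)
  moreover have "((\<lambda>u::real. a * (u ^ k / exp u) + u ^ Suc k * poly p u * exp (- u)) \<longlongrightarrow> a * 0 + 0) at_top"
    by (intro tendsto_add tendsto_mult tendsto_const tendsto_power_div_exp_0 pCons.IH)
  ultimately show ?case by simp
qed simp

text \<open>With u = 1/y, the derivative in y of p(u) exp(-u) is u^2 (p(u) - p'(u)) exp(-u), and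
  \<open>[:0, 0, 1:]\<close> stands for u^2. At y = 0 the right difference quotient is u p(u)
  exp(-u) with u tending to infinity.\<close>

lemma flat_deriv:
  "(flat p has_real_derivative flat ([:0, 0, 1:] * (p - pderiv p)) y) (at y)"
proof -
  consider "y > 0" | "y < 0" | "y = 0" by linarith
  then show ?thesis
  proof cases
    case 1
    have "((\<lambda>y. poly p (1 / y) * exp (- (1 / y))) has_real_derivative
       flat ([:0, 0, 1:] * (p - pderiv p)) y) (at y)"
      unfolding flat_def using 1
      by (auto intro!: derivative_eq_intros poly_DERIV[THEN DERIV_chain2] simp: power2_eq_square field_simps)
    then show ?thesis
      by (rule DERIV_cong_ev[OF refl _ refl, THEN iffD1, rotated])
         (use 1 in \<open>auto simp: flat_def intro: eventually_mono[OF eventually_nhds_in_open[of "{0<..}" y]]\<close>)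
  next
    case 2
    have "((\<lambda>y. 0) has_real_derivative flat ([:0, 0, 1:] * (p - pderiv p)) y) (at y)"
      using 2 by (auto simp: flat_def)
    then show ?thesis
      by (rule DERIV_cong_ev[OF refl _ refl, THEN iffD1, rotated])
         (use 2 in \<open>auto simp: flat_def intro: eventually_mono[OF eventually_nhds_in_open[of "{..<0}" y]]\<close>)
  next
    case 3
    have "((\<lambda>h. (flat p (0 + h) - flat p 0) / h) \<longlongrightarrow> 0) (at_right 0)"
    proof -
      have "((\<lambda>h::real. (\<lambda>u. u ^ 1 * poly p u * exp (- u)) (inverse h)) \<longlongrightarrow> 0) (at_right 0)"
        by (rule filterlim_compose[OF poly_exp_decay filterlim_inverse_at_top_right])
      then show ?thesis
        by (rule Lim_transform_eventually)
           (auto simp: eventually_at_filter flat_def inverse_eq_divide intro!: always_eventually)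
    qed
    moreover have "((\<lambda>h. (flat p (0 + h) - flat p 0) / h) \<longlongrightarrow> 0) (at_left 0)"
      by (rule Lim_transform_eventually[OF tendsto_const])
         (auto simp: eventually_at_filter flat_def intro!: always_eventually)
    ultimately have "((\<lambda>h. (flat p (0 + h) - flat p 0) / h) \<longlongrightarrow> 0) (at 0)"
      by (rule filterlim_split_at_real[rotated])
    then show ?thesis using 3 by (simp add: DERIV_def flat_def)
  qed
qed

lemma Ck_on_flat: "Ck_on k UNIV (\<lambda>x::'a::euclidean_space. flat p (c + x \<bullet> w))"
proof (induction k arbitrary: p)
  have der: "((\<lambda>x::'a. flat p (c + x \<bullet> w)) has_derivative
      (\<lambda>h. (h \<bullet> w) * flat ([:0, 0, 1:] * (p - pderiv p)) (c + x \<bullet> w))) (at x)" for p x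
  proof -
    have "((\<lambda>x::'a. c + x \<bullet> w) has_derivative (\<lambda>h. h \<bullet> w)) (at x)"
      by (auto intro!: derivative_eq_intros)
    from has_derivative_compose[OF this flat_deriv[unfolded has_field_derivative_def]]
    show ?thesis by (simp add: mult.commute)
  qed
  {
    case 0
    show ?case using has_derivative_continuous[OF der]
      by (simp add: continuous_at_imp_continuous_on)
  next
    case (Suc k)
    show ?case
      by (rule Ck_on_UNIV_I[OF der]) (rule Ck_on_UNIV_mult[OF Ck_on_UNIV_const Suc.IH])
  }
qed

text \<open>\<open>flat 1\<close> is exp(-1/y) for positive y. The factor n + 1 leaves the support
  unchanged and pushes each factor up to 1 inside the box, so that indicators of boxes become
  bounded limits of test functions.\<close>

definition bump :: "'a::euclidean_space \<Rightarrow> 'a \<Rightarrow> nat \<Rightarrow> 'a \<Rightarrow> real" where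
  "bump a c n x = (\<Prod>b\<in>Basis. flat 1 (real (Suc n) * (x \<bullet> b - a \<bullet> b)) *
     flat 1 (real (Suc n) * (c \<bullet> b - x \<bullet> b)))"

lemma smooth_bump: "smooth_fun_on UNIV (bump a c n)"
proof -
  have "Ck_on k UNIV (bump a c n)" for k
  proof -
    have 1: "real (Suc n) * (x \<bullet> b - a \<bullet> b) = - real (Suc n) * (a \<bullet> b) + x \<bullet> (real (Suc n) *\<^sub>R b)"
      for x b :: 'a by (simp add: algebra_simps)
    have 2: "real (Suc n) * (c \<bullet> b - x \<bullet> b) = real (Suc n) * (c \<bullet> b) + x \<bullet> (- real (Suc n) *\<^sub>R b)"
      for x b :: 'a by (simp add: algebra_simps)
    show ?thesis
      unfolding bump_def[abs_def] 1 2
      by (intro Ck_on_UNIV_prod Ck_on_UNIV_mult Ck_on_flat finite_Basis)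
  qed
  then show ?thesis by (simp add: smooth_fun_on_def)
qed

lemma flat_1_bounds: "0 \<le> flat 1 y" "flat 1 y \<le> 1"
  by (auto simp: flat_def)

lemma bump_bounds: "0 \<le> bump a c n x" "bump a c n x \<le> 1"
  unfolding bump_def
  by (intro prod_nonneg mult_nonneg_nonneg flat_1_bounds,
      intro prod_le_1 conjI mult_nonneg_nonneg flat_1_bounds mult_le_one)

lemma bump_outside: "x \<notin> box a c \<Longrightarrow> bump a c n x = 0"
proof -
  assume "x \<notin> box a c"
  then obtain b where b: "b \<in> Basis" "\<not> (a \<bullet> b < x \<bullet> b \<and> x \<bullet> b < c \<bullet> b)" by (auto simp: mem_box)
  then have "flat 1 (real (Suc n) * (x \<bullet> b - a \<bullet> b)) * flat 1 (real (Suc n) * (c \<bullet> b - x \<bullet> b)) = 0"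
    by (auto simp: flat_def zero_less_mult_iff)
  then show ?thesis unfolding bump_def using b(1) by (intro prod_zero bexI[of _ b]) auto
qed

lemma flat_1_tendsto: "y > 0 \<Longrightarrow> (\<lambda>n. flat 1 (real (Suc n) * y)) \<longlonglongrightarrow> 1"
proof -
  assume y: "y > 0"
  have "(\<lambda>n. inverse (real (Suc n))) \<longlonglongrightarrow> 0" by (rule LIMSEQ_inverse_real_of_nat)
  from tendsto_exp[OF tendsto_minus[OF tendsto_mult_right_zero[OF this, of "1 / y"]]]
  have "(\<lambda>n. exp (- (1 / y * inverse (real (Suc n))))) \<longlonglongrightarrow> 1" by simp
  moreover have "flat 1 (real (Suc n) * y) = exp (- (1 / y * inverse (real (Suc n))))" for n
    using y by (simp add: flat_def field_simps del: of_nat_Suc)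
  ultimately show ?thesis by simp
qed

lemma bump_tendsto: "(\<lambda>n. bump a c n x) \<longlonglongrightarrow> indicator (box a c) x"
proof (cases "x \<in> box a c")
  case True
  have "(\<lambda>n. bump a c n x) \<longlonglongrightarrow> (\<Prod>b\<in>(Basis::'a set). 1 * 1)"
    unfolding bump_def using True
    by (intro tendsto_prod tendsto_mult flat_1_tendsto) (auto simp: mem_box)
  then show ?thesis using True by simp
qed (simp add: bump_outside)

lemma test_fun_bump: "cbox a c \<subseteq> D \<Longrightarrow> test_fun D (bump a c n)"
  unfolding test_fun_def
  by (intro conjI smooth_bump exI[of _ "cbox a c"])
     (auto intro!: bump_outside dest: subsetD[OF box_subset_cbox])

lemma test_fun_C1:
  assumes "test_fun D \<phi>"
  shows "\<phi> differentiable at x" "continuous_on UNIV \<phi>" "continuous_on UNIV (grad \<phi>)"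
proof -
  have C: "Ck_on 1 UNIV \<phi>" using assms by (simp add: test_fun_def smooth_fun_on_def)
  show "\<phi> differentiable at x" using Ck_on_UNIV_D(1)[of 0 \<phi> x] C by simp
  show "continuous_on UNIV \<phi>" using Ck_on_UNIV_Suc[of 0 \<phi>] C by simp
  show "continuous_on UNIV (grad \<phi>)"
    unfolding grad_def[abs_def] using C by (intro continuous_intros) auto
qed

subsection \<open>The fundamental lemma\<close>

definition rational_vectors :: "'a::euclidean_space set" where
  "rational_vectors = {a. \<forall>b\<in>Basis. a \<bullet> b \<in> \<rat>}"

lemma countable_rational_vectors: "countable (rational_vectors :: 'a::euclidean_space set)"
proof -
  have "rational_vectors \<subseteq> (\<lambda>f. \<Sum>b\<in>(Basis::'a set). f b *\<^sub>R b) ` (Basis \<rightarrow>\<^sub>E \<rat>)"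
  proof
    fix a :: 'a assume "a \<in> rational_vectors"
    then show "a \<in> (\<lambda>f. \<Sum>b\<in>(Basis::'a set). f b *\<^sub>R b) ` (Basis \<rightarrow>\<^sub>E \<rat>)"
      by (intro image_eqI[where x = "restrict (\<lambda>b. a \<bullet> b) Basis"])
         (auto simp: rational_vectors_def euclidean_representation)
  qed
  moreover have "countable (Basis \<rightarrow>\<^sub>E (\<rat>::real set) :: ('a \<Rightarrow> real) set)"
    by (intro countable_PiE countable_rat) auto
  ultimately show ?thesis by (meson countable_image countable_subset)
qed

lemma rational_box_sets:
  "sets (borel :: 'a::euclidean_space measure) =
     sigma_sets UNIV ((\<lambda>(a, c). box a c) ` (rational_vectors \<times> rational_vectors))"
proof -
  let ?G = "(\<lambda>(a, c). box a c) ` (rational_vectors \<times> rational_vectors) :: 'a set set"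
  have "sigma_sets UNIV {S :: 'a set. open S} = sigma_sets UNIV ?G"
  proof (rule sigma_sets_eqI)
    fix S :: "'a set" assume "S \<in> {S. open S}"
    then have op: "open S" by simp
    have *: "\<exists>a c. a \<in> rational_vectors \<and> c \<in> rational_vectors \<and> x \<in> box a c \<and> box a c \<subseteq> S" if xS: "x \<in> S" for x
    proof -
      obtain e where "0 < e" "ball x e \<subseteq> S" using op xS by (meson open_contains_ball)
      with rational_boxes[of e x] show ?thesis unfolding rational_vectors_def by blast
    qed
    have SU: "S = \<Union>{B \<in> ?G. B \<subseteq> S}"
    proof (intro equalityI subsetI)
      fix x assume "x \<in> S"
      from *[OF this] obtain a c where "a \<in> rational_vectors" "c \<in> rational_vectors" "x \<in> box a c" "box a c \<subseteq> S"
        by blast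
      then have "box a c \<in> {B \<in> ?G. B \<subseteq> S}" by force
      then show "x \<in> \<Union>{B \<in> ?G. B \<subseteq> S}" using \<open>x \<in> box a c\<close> by (rule UnionI)
    next
      fix x assume "x \<in> \<Union>{B \<in> ?G. B \<subseteq> S}"
      then obtain B where "x \<in> B" "B \<subseteq> S" by auto
      then show "x \<in> S" by (rule subsetD[rotated])
    qed
    have cnt: "countable {B \<in> ?G. B \<subseteq> S}"
      by (rule countable_subset[of _ ?G]) (auto intro!: countable_rational_vectors)
    have "\<Union>{B \<in> ?G. B \<subseteq> S} \<in> sigma_sets UNIV ?G"
      by (rule sigma_sets_UNION[OF cnt sigma_sets.Basic]) simp
    then show "S \<in> sigma_sets UNIV ?G" by (subst SU)
  qed (auto intro!: sigma_sets.Basic)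
  then show ?thesis by (simp add: borel_def)
qed

lemma rational_box_Int:
  assumes "a \<in> rational_vectors" "c \<in> rational_vectors" "a' \<in> rational_vectors" "c' \<in> rational_vectors"
  obtains p q :: "'a::euclidean_space" where "p \<in> rational_vectors" "q \<in> rational_vectors"
    "box a c \<inter> box a' c' = box p q"
proof
  show "box a c \<inter> box a' c' = box (\<Sum>i\<in>Basis. max (a \<bullet> i) (a' \<bullet> i) *\<^sub>R i)
     (\<Sum>i\<in>Basis. min (c \<bullet> i) (c' \<bullet> i) *\<^sub>R i)"
    by (rule box_Int_box)
qed (use assms in \<open>auto simp: rational_vectors_def max_def min_def\<close>)

text \<open>Bumps converge boundedly to indicators of boxes, boxes form an intersection-stable
  generator of the Borel sets, and countably many rational boxes cover \<open>D\<close>. Restricting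
  the hypothesis to rational boxes is what later allows a separating sequence.\<close>

lemma bump_integral_zero_imp_AE_zero:
  fixes D :: "'a::euclidean_space set"
  assumes D: "open D" and f: "set_integrable lborel D f"
    and z: "\<And>a c n. a \<in> rational_vectors \<Longrightarrow> c \<in> rational_vectors \<Longrightarrow> cbox a c \<subseteq> D \<Longrightarrow>
       (LINT x:D|lborel. f x * bump a c n x) = 0"
  shows "AE x in lborel. x \<in> D \<longrightarrow> f x = 0"
proof -
  define F where "F x = indicator D x * f x" for x
  have F: "integrable lborel F" using f by (simp add: F_def[abs_def] set_integrable_def)
  have [measurable]: "F \<in> borel_measurable borel" using F by auto
  have bm: "bump a c n \<in> borel_measurable borel" for a c :: 'a and n
    by (intro borel_measurable_continuous_onI test_fun_C1(2)[OF test_fun_bump[OF subset_UNIV]])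
  have box0: "(\<integral>x. F x * indicator (box a c) x \<partial>lborel) = 0"
    if "a \<in> rational_vectors" "c \<in> rational_vectors" "cbox a c \<subseteq> D" for a c
  proof -
    have "(\<lambda>n. \<integral>x. F x * bump a c n x \<partial>lborel) \<longlonglongrightarrow> (\<integral>x. F x * indicator (box a c) x \<partial>lborel)"
    proof (rule integral_dominated_convergence[where w = "\<lambda>x. norm (F x)"])
      show "AE x in lborel. (\<lambda>n. F x * bump a c n x) \<longlonglongrightarrow> F x * indicator (box a c) x"
        by (intro AE_I2 tendsto_mult tendsto_const bump_tendsto)
      show "AE x in lborel. norm (F x * bump a c n x) \<le> norm (F x)" for n
        using bump_bounds[of a c n] by (intro AE_I2) (auto simp: abs_mult intro!: mult_left_le)
    qed (use F bm in \<open>auto\<close>)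
    moreover have "(\<integral>x. F x * bump a c n x \<partial>lborel) = 0" for n
      using z[OF that] by (simp add: F_def set_lebesgue_integral_def mult.assoc)
    ultimately show ?thesis by (simp add: LIMSEQ_const_iff)
  qed
  have U0: "AE x in lborel. x \<in> box a c \<longrightarrow> F x = 0"
    if ac: "a \<in> rational_vectors" "c \<in> rational_vectors" "cbox a c \<subseteq> D" for a c
  proof -
    \<comment> \<open>Cutting \<open>f\<close> down to one box with closure in \<open>D\<close>
      makes the intersection with any other rational box either empty or again a box with closure in
      \<open>D\<close>.\<close>
    define g where "g x = F x * indicator (box a c) x" for x
    have g: "integrable lborel g" unfolding g_def using F by (intro integrable_real_mult_indicator) auto
    have gbox: "(LINT x:box p q|lborel. g x) = 0"
      if pqr: "p \<in> rational_vectors" "q \<in> rational_vectors" for p q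
    proof -
      obtain p' q' where pq: "p' \<in> rational_vectors" "q' \<in> rational_vectors" "box p q \<inter> box a c = box p' q'"
        using rational_box_Int[OF pqr ac(1,2)] .
      have "(LINT x:box p q|lborel. g x) = (\<integral>x. F x * indicator (box p' q') x \<partial>lborel)"
        unfolding set_lebesgue_integral_def g_def pq(3)[symmetric]
        by (rule Bochner_Integration.integral_cong) (auto simp: indicator_def)
      also have "\<dots> = 0"
      \<comment> \<open>A degenerate open box is empty although its \<open>cbox\<close> may not be,
        so the closure argument is reserved for nonempty boxes.\<close>
      proof (cases "box p' q' = {}")
        case False
        then have "cbox p' q' = closure (box p q \<inter> box a c)" by (simp add: pq(3) closure_box)
        also have "\<dots> \<subseteq> closure (box a c)" by (intro closure_mono) auto
        also have "\<dots> \<subseteq> cbox a c" by (intro closure_minimal box_subset_cbox closed_cbox)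
        also have "\<dots> \<subseteq> D" by fact
        finally show ?thesis using box0 pq by blast
      qed simp
      finally show ?thesis .
    qed
    have "(LINT x:A|lborel. g x) = 0" if "A \<in> sets lborel" for A
    proof -
      have A: "A \<in> sigma_sets UNIV ((\<lambda>(a, c). box a c) ` (rational_vectors \<times> rational_vectors))"
        using that by (simp add: rational_box_sets[symmetric])
      have st: "Int_stable ((\<lambda>(a, c). box a c) ` (rational_vectors \<times> rational_vectors) :: 'a set set)"
      proof (rule Int_stableI, clarsimp)
        fix a c a' c' :: 'a
        assume "a \<in> rational_vectors" "c \<in> rational_vectors" "a' \<in> rational_vectors" "c' \<in> rational_vectors"
        then obtain p q where "p \<in> rational_vectors" "q \<in> rational_vectors" "box a c \<inter> box a' c' = box p q"
          by (rule rational_box_Int)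
        then show "box a c \<inter> box a' c' \<in> (\<lambda>(a, c). box a c) ` (rational_vectors \<times> rational_vectors)"
          by force
      qed
      have si: "set_integrable lborel X g" if "X \<in> sets lborel" for X
        unfolding set_integrable_def using that g by (rule integrable_mult_indicator)
      show ?thesis
      proof (rule sigma_sets_induct_disjoint[OF st _ A])
        show "(LINT x:B|lborel. g x) = 0" if "B \<in> (\<lambda>(a, c). box a c) ` (rational_vectors \<times> rational_vectors)" for B
          using that gbox by auto
        show "(LINT x:{}|lborel. g x) = 0" by (simp add: set_lebesgue_integral_def)
      next
        fix B assume B: "B \<in> sigma_sets UNIV ((\<lambda>(a, c). box a c) ` (rational_vectors \<times> rational_vectors))"
          "(LINT x:B|lborel. g x) = 0"
        have Bm: "B \<in> sets lborel" using B(1) by (simp add: rational_box_sets[symmetric])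
        have "(LINT x:B \<union> (UNIV - B)|lborel. g x) = (LINT x:B|lborel. g x) + (LINT x:UNIV - B|lborel. g x)"
          using Bm by (intro set_integral_Un si) auto
        moreover have "(LINT x:B \<union> (UNIV - B)|lborel. g x) = 0"
          using box0[OF ac] by (simp add: set_lebesgue_integral_def g_def)
        ultimately show "(LINT x:UNIV - B|lborel. g x) = 0" using B by simp
      next
        fix B :: "nat \<Rightarrow> 'a set"
        assume B: "disjoint_family B"
          "range B \<subseteq> sigma_sets UNIV ((\<lambda>(a, c). box a c) ` (rational_vectors \<times> rational_vectors))"
          "\<And>i. (LINT x:B i|lborel. g x) = 0"
        have m: "B i \<in> sets lborel" for i using B(2) by (auto simp: rational_box_sets[symmetric])
        have "(LINT x:(\<Union>i. B i)|lborel. g x) = (\<Sum>i. LINT x:B i|lborel. g x)"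
        proof (rule lebesgue_integral_countable_add)
          show "B i \<inter> B j = {}" if "i \<noteq> j" for i j using B(1) that by (auto simp: disjoint_family_on_def)
          show "set_integrable lborel (\<Union>i. B i) g" using m by (intro si) auto
        qed (rule m)
        then show "(LINT x:(\<Union>i. B i)|lborel. g x) = 0" using B(3) by simp
      qed auto
    qed
    then have "AE x in lborel. g x = 0"
      using g by (intro density_unique_real) (auto simp: set_lebesgue_integral_def)
    then show ?thesis by eventually_elim (auto simp: g_def)
  qed
  define I where "I = {(a, c). a \<in> rational_vectors \<and> c \<in> rational_vectors \<and> cbox a c \<subseteq> D}"
  have "countable I"
    by (rule countable_subset[of _ "rational_vectors \<times> rational_vectors"])
       (auto simp: I_def intro!: countable_rational_vectors)
  then have "AE x in lborel. \<forall>p\<in>I. x \<in> box (fst p) (snd p) \<longrightarrow> F x = 0"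
    by (subst AE_ball_countable) (auto simp: I_def U0)
  then show ?thesis
  proof eventually_elim
    fix x assume *: "\<forall>p\<in>I. x \<in> box (fst p) (snd p) \<longrightarrow> F x = 0"
    show "x \<in> D \<longrightarrow> f x = 0"
    proof
      assume x: "x \<in> D"
      then obtain e where e: "0 < e" "cball x e \<subseteq> D" using D by (meson open_contains_cball)
      obtain a c where ac: "a \<in> rational_vectors" "c \<in> rational_vectors" "x \<in> box a c" "box a c \<subseteq> ball x e"
        using rational_boxes[OF e(1), of x] unfolding rational_vectors_def by blast
      then have "cbox a c = closure (box a c)" by (metis closure_box empty_iff)
      also have "\<dots> \<subseteq> cball x e" using ac(4) by (intro closure_minimal) auto
      finally have "(a, c) \<in> I" using ac e by (auto simp: I_def)
      then have "F x = 0" using * ac(3) by force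
      then show "f x = 0" using x by (simp add: F_def)
    qed
  qed
qed

lemma bounded_set_finite_emeasure:
  fixes D :: "'a::euclidean_space set"
  assumes "bounded D" shows "emeasure lborel D < \<infinity>"
  using emeasure_bounded_finite[OF assms] by (simp add: top.not_eq_extremum)

lemma L2_boundedI:
  fixes f :: "'a::euclidean_space \<Rightarrow> 'b::euclidean_space"
  assumes D: "D \<in> sets borel" "bounded D" and m: "set_borel_measurable lborel D f"
    and b: "\<And>x. x \<in> D \<Longrightarrow> norm (f x) \<le> C"
  shows "f \<in> L2 D"
proof -
  have "integrable lborel (\<lambda>x. (norm (indicator D x *\<^sub>R f x))\<^sup>2)"
  proof (rule Bochner_Integration.integrable_bound[where f = "\<lambda>x. C\<^sup>2 * indicator D x"])
    show "integrable lborel (\<lambda>x. C\<^sup>2 * indicat_real D x)"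
      using D bounded_set_finite_emeasure[OF D(2)] by simp
    show "(\<lambda>x. (norm (indicat_real D x *\<^sub>R f x))\<^sup>2) \<in> borel_measurable lborel"
      using measurable_compose[OF m[unfolded set_borel_measurable_def] borel_measurable_norm]
      by (rule borel_measurable_power)
    show "AE x in lborel. norm ((norm (indicat_real D x *\<^sub>R f x))\<^sup>2) \<le> norm (C\<^sup>2 * indicat_real D x)"
      using b by (intro AE_I2) (auto simp: indicator_def intro!: power_mono)
  qed
  then show ?thesis using m by (simp add: L2_iff sq_integrable_def set_borel_measurable_def)
qed

lemma L2_const:
  assumes "D \<in> sets borel" "bounded D" shows "(\<lambda>x. c) \<in> L2 D"
  using assms by (intro L2_boundedI[where C = "norm c"]) (auto simp: set_borel_measurable_def)

lemma L2_integrable_component: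
  assumes D: "D \<in> sets borel" "bounded D" and f: "f \<in> L2 D"
  shows "set_integrable lborel D (\<lambda>x. f x \<bullet> c)"
  by (intro L2_inner_integrable f L2_const D)

lemma L2_integrable:
  fixes f :: "'a::euclidean_space \<Rightarrow> real"
  assumes D: "D \<in> sets borel" "bounded D" and f: "f \<in> L2 D"
  shows "set_integrable lborel D f"
  using L2_integrable_component[OF assms, of 1] by simp

subsection \<open>Uniqueness of weak gradients\<close>

text \<open>The difference of two candidates has vanishing integral against every bump. Uniqueness
  up to null sets is what makes computations with \<open>wgrad\<close> and \<open>grad_xt\<close>,
  both chosen by \<open>SOME\<close>, meaningful.\<close>

lemma weak_grad_unique:
  assumes D: "open D" "bounded D" and g: "weak_grad D f g" "weak_grad D f g'"
  shows "L2_eq D g g'"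
proof -
  have gL: "g \<in> L2 D" "g' \<in> L2 D" using g by (auto simp: weak_grad_def)
  have "AE x in lborel. x \<in> D \<longrightarrow> (g x - g' x) \<bullet> b = 0" if b: "b \<in> Basis" for b
  proof (rule bump_integral_zero_imp_AE_zero[OF D(1)])
    show "set_integrable lborel D (\<lambda>x. (g x - g' x) \<bullet> b)"
      using D gL by (intro L2_integrable_component L2_diff) auto
    fix a c :: 'a and n assume "cbox a c \<subseteq> D"
    then have t: "test_fun D (bump a c n)" by (rule test_fun_bump)
    have i: "set_integrable lborel D (\<lambda>x. (h x \<bullet> b) * bump a c n x)" if "h \<in> L2 D" for h
    proof -
      have "(\<lambda>x. bump a c n x *\<^sub>R b) \<in> L2 D"
      proof (rule L2_boundedI[where C = "norm b"])
        have "bump a c n \<in> borel_measurable borel"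
          by (intro borel_measurable_continuous_onI test_fun_C1(2)[OF t])
        then show "set_borel_measurable lborel D (\<lambda>x. bump a c n x *\<^sub>R b)"
          using D by (auto simp: set_borel_measurable_def)
      qed (use D bump_bounds[of a c n] in \<open>auto intro!: mult_left_le_one_le\<close>)
      from L2_inner_integrable[OF that this] show ?thesis by (simp add: mult.commute)
    qed
    have "(LINT x:D|lborel. (g x - g' x) \<bullet> b * bump a c n x) =
       (LINT x:D|lborel. (g x \<bullet> b) * bump a c n x) - (LINT x:D|lborel. (g' x \<bullet> b) * bump a c n x)"
      unfolding inner_diff_left left_diff_distrib by (rule set_integral_diff(2)[OF i[OF gL(1)] i[OF gL(2)]])
    also have "\<dots> = 0"
    proof -
      have "(LINT x:D|lborel. f x * frechet_derivative (bump a c n) (at x) b) =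
        - (LINT x:D|lborel. (h x \<bullet> b) * bump a c n x)" if "weak_grad D f h" for h
        using that t b by (simp add: weak_grad_def)
      from this[OF g(1)] this[OF g(2)] show ?thesis by simp
    qed
    finally show "(LINT x:D|lborel. (g x - g' x) \<bullet> b * bump a c n x) = 0" .
  qed
  then have "AE x in lborel. \<forall>b\<in>Basis. x \<in> D \<longrightarrow> (g x - g' x) \<bullet> b = 0"
    by (subst AE_ball_countable) (auto intro: countable_finite)
  then show ?thesis
    unfolding L2_eq_def by eventually_elim (auto intro: euclidean_eqI simp: inner_diff_left)
qed

lemma compact_support_L2:
  fixes w :: "'a::euclidean_space \<Rightarrow> real"
  assumes K: "compact K" "K \<subseteq> D" and w: "continuous_on UNIV w" "\<And>x. x \<notin> K \<Longrightarrow> w x = 0"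
  shows "w \<in> L2 D"
proof -
  have wm: "w \<in> borel_measurable borel" using w by (intro borel_measurable_continuous_onI)
  have "bounded (w ` K)"
    using K w(1) by (intro compact_imp_bounded compact_continuous_image) (auto intro: continuous_on_subset)
  then obtain C where "\<And>x. x \<in> K \<Longrightarrow> norm (w x) \<le> C" by (auto simp: bounded_iff)
  moreover have "K \<in> sets borel" using K by (intro borel_compact)
  ultimately have "w \<in> L2 K" using K wm
    by (intro L2_boundedI[where C = C]) (auto intro: compact_imp_bounded simp: set_borel_measurable_def)
  moreover have "(\<lambda>x. indicat_real D x *\<^sub>R w x) = (\<lambda>x. indicat_real K x *\<^sub>R w x)"
    using w K by (auto simp: indicator_def fun_eq_iff)
  ultimately show ?thesis unfolding L2_iff by simp
qed

lemma test_fun_support: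
  assumes "test_fun D \<phi>"
  obtains K where "compact K" "K \<subseteq> D" "\<And>x. x \<notin> K \<Longrightarrow> \<phi> x = 0" "\<And>x. x \<notin> K \<Longrightarrow> grad \<phi> x = 0"
proof -
  obtain K where K: "compact K" "K \<subseteq> D" "\<And>x. x \<notin> K \<Longrightarrow> \<phi> x = 0"
    using assms by (auto simp: test_fun_def)
  have "grad \<phi> x = 0" if "x \<notin> K" for x
  proof (rule grad_eqI)
    have "((\<lambda>x. 0) has_derivative (\<lambda>h. 0 \<bullet> h)) (at x)" by simp
    then show "(\<phi> has_derivative (\<lambda>h. 0 \<bullet> h)) (at x)"
      by (rule has_derivative_transform_within_open[OF _ open_Compl[OF compact_imp_closed[OF K(1)]]])
         (use K that in auto)
  qed
  with K that show ?thesis by blast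
qed

lemma test_fun_frechet:
  assumes "test_fun D \<phi>" shows "frechet_derivative \<phi> (at x) b = grad \<phi> x \<bullet> b"
  using frechet_derivative_at[OF has_derivative_grad[OF test_fun_C1(1)[OF assms]]] by metis

lemma test_fun_L2:
  assumes t: "test_fun D \<phi>"
  shows "\<phi> \<in> L2 D" "(\<lambda>x. frechet_derivative \<phi> (at x) b) \<in> L2 D"
proof -
  obtain K where K: "compact K" "K \<subseteq> D" "\<And>x. x \<notin> K \<Longrightarrow> \<phi> x = 0" "\<And>x. x \<notin> K \<Longrightarrow> grad \<phi> x = 0"
    using test_fun_support[OF t] by metis
  show "\<phi> \<in> L2 D" using K test_fun_C1(2)[OF t] by (intro compact_support_L2) auto
  show "(\<lambda>x. frechet_derivative \<phi> (at x) b) \<in> L2 D"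
    unfolding test_fun_frechet[OF t]
    using K by (intro compact_support_L2[of K] continuous_on_inner continuous_on_const test_fun_C1(3)[OF t]) auto
qed

lemma L2_component:
  assumes b: "b \<in> Basis" and h: "h \<in> L2 D" shows "(\<lambda>x. h x \<bullet> b) \<in> L2 D"
proof -
  have m: "(\<lambda>x. indicat_real D x *\<^sub>R h x) \<in> borel_measurable lborel"
    and i: "integrable lborel (\<lambda>x. (norm (indicat_real D x *\<^sub>R h x))\<^sup>2)"
    using h by (auto simp: L2_iff sq_integrable_def)
  have m2: "(\<lambda>x. indicat_real D x *\<^sub>R (h x \<bullet> b)) \<in> borel_measurable lborel"
    using borel_measurable_inner[OF m borel_measurable_const[of b]] by simp
  have "integrable lborel (\<lambda>x. (norm (indicat_real D x *\<^sub>R (h x \<bullet> b)))\<^sup>2)"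
  proof (rule Bochner_Integration.integrable_bound[OF i])
    show "AE x in lborel. norm ((norm (indicat_real D x *\<^sub>R (h x \<bullet> b)))\<^sup>2) \<le>
        norm ((norm (indicat_real D x *\<^sub>R h x))\<^sup>2)"
      using Basis_le_norm[OF b] by (intro AE_I2) (auto simp: indicator_def abs_le_square_iff[symmetric])
  qed (use m2 in auto)
  then show ?thesis using m2 by (simp add: L2_iff sq_integrable_def)
qed

lemma weak_grad_linear:
  assumes "weak_grad D f g" "weak_grad D f' g'"
  shows "weak_grad D (\<lambda>x. a * f x + c * f' x) (\<lambda>x. a *\<^sub>R g x + c *\<^sub>R g' x)"
proof -
  have L: "f \<in> L2 D" "g \<in> L2 D" "f' \<in> L2 D" "g' \<in> L2 D" using assms by (auto simp: weak_grad_def)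
  show ?thesis
    unfolding weak_grad_def
  proof (intro conjI allI impI ballI)
    show "(\<lambda>x. a * f x + c * f' x) \<in> L2 D" by (intro L2_add L2_cmult L)
    show "(\<lambda>x. a *\<^sub>R g x + c *\<^sub>R g' x) \<in> L2 D" by (intro L2_add L2_scaleR L)
    fix \<phi> b assume t: "test_fun D \<phi>" and b: "b \<in> (Basis::'a set)"
    note \<phi>L = test_fun_L2(1)[OF t] and d\<phi>L = test_fun_L2(2)[OF t, of b] and gb = L2_component[OF b]
    have 1: "(LINT x:D|lborel. f x * frechet_derivative \<phi> (at x) b) = - (LINT x:D|lborel. (g x \<bullet> b) * \<phi> x)"
      and 2: "(LINT x:D|lborel. f' x * frechet_derivative \<phi> (at x) b) = - (LINT x:D|lborel. (g' x \<bullet> b) * \<phi> x)"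
      using assms t b by (auto simp: weak_grad_def)
    have "(LINT x:D|lborel. (a * f x + c * f' x) * frechet_derivative \<phi> (at x) b) =
      L2_inner D (\<lambda>x. a * f x + c * f' x) (\<lambda>x. frechet_derivative \<phi> (at x) b)"
      by (simp add: L2_inner_def)
    also have "\<dots> = a * L2_inner D f (\<lambda>x. frechet_derivative \<phi> (at x) b) +
       c * L2_inner D f' (\<lambda>x. frechet_derivative \<phi> (at x) b)"
      using L d\<phi>L by (simp add: L2_inner_add_left L2_cmult L2_inner_cmult_left)
    also have "\<dots> = - (a * L2_inner D (\<lambda>x. g x \<bullet> b) \<phi> + c * L2_inner D (\<lambda>x. g' x \<bullet> b) \<phi>)"
      using 1 2 by (simp add: L2_inner_def)
    also have "\<dots> = - L2_inner D (\<lambda>x. a * (g x \<bullet> b) + c * (g' x \<bullet> b)) \<phi>"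
      by (simp add: L2_inner_add_left[OF L2_cmult[OF gb[OF L(2)]] L2_cmult[OF gb[OF L(4)]] \<phi>L]
          L2_inner_cmult_left)
    also have "\<dots> = - (LINT x:D|lborel. (a *\<^sub>R g x + c *\<^sub>R g' x) \<bullet> b * \<phi> x)"
      by (simp add: L2_inner_def inner_add_left)
    finally show "(LINT x:D|lborel. (a * f x + c * f' x) * frechet_derivative \<phi> (at x) b) =
      - (LINT x:D|lborel. (a *\<^sub>R g x + c *\<^sub>R g' x) \<bullet> b * \<phi> x)" .
  qed
qed

lemma weak_grad_wgrad: "f \<in> H1 D \<Longrightarrow> weak_grad D f (wgrad D f)"
  unfolding H1_def wgrad_def using someI_ex[of "weak_grad D f"] by simp

lemma H1_L2: "f \<in> H1 D \<Longrightarrow> f \<in> L2 D" "f \<in> H1 D \<Longrightarrow> wgrad D f \<in> L2 D"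
  using weak_grad_wgrad[of f D] by (auto simp: weak_grad_def)

lemma H1_linear: "f \<in> H1 D \<Longrightarrow> g \<in> H1 D \<Longrightarrow> (\<lambda>x. a * f x + c * g x) \<in> H1 D"
  using weak_grad_linear[OF weak_grad_wgrad weak_grad_wgrad, of f D g a c] by (auto simp: H1_def)

subsection \<open>Classical gradients are weak gradients\<close>

text \<open>Difference quotients integrate to zero by translation invariance of Lebesgue measure.\<close>

lemma integral_directional_derivative_zero:
  fixes w :: "'a::euclidean_space \<Rightarrow> real"
  assumes K: "compact K" and w: "\<And>x. (w has_derivative (\<lambda>h. dw x \<bullet> h)) (at x)"
    and out: "\<And>x. x \<notin> K \<Longrightarrow> w x = 0" and C: "\<And>x. norm (dw x) \<le> C"
  shows "(\<integral>x. dw x \<bullet> b \<partial>lborel) = 0"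
proof -
  define s where "s n = inverse (real (Suc n))" for n
  define q where "q n x = (w (x + s n *\<^sub>R b) - w x) / s n" for n x
  have s: "0 < s n" "s n \<le> 1" for n by (auto simp: s_def inverse_le_1_iff)
  have cw: "continuous_on UNIV w"
    by (intro continuous_at_imp_continuous_on ballI has_derivative_continuous[OF w])
  then have wm[measurable]: "w \<in> borel_measurable borel" by (intro borel_measurable_continuous_onI)
  have "w \<in> L2 K" using K cw out by (intro compact_support_L2) auto
  moreover have "K \<in> sets borel" using K by (intro borel_compact)
  ultimately have "set_integrable lborel K w" using K by (intro L2_integrable compact_imp_bounded)
  moreover have "(\<lambda>x. indicat_real K x *\<^sub>R w x) = w" using out by (auto simp: indicator_def fun_eq_iff)
  ultimately have wi: "integrable lborel w" by (simp add: set_integrable_def)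
  have shift: "integrable lborel (\<lambda>x. w (x + c))" "(\<integral>x. w (x + c) \<partial>lborel) = integral\<^sup>L lborel w" for c
  proof -
    have d: "distr lborel borel ((+) c) = (lborel :: 'a measure)" by (rule lborel_distr_plus)
    have "integrable (distr lborel borel ((+) c)) w" unfolding d by (rule wi)
    then show "integrable lborel (\<lambda>x. w (x + c))" by (subst (asm) integrable_distr_eq) (auto simp: add.commute)
    have "integral\<^sup>L (distr lborel borel ((+) c)) w = (\<integral>x. w (c + x) \<partial>lborel)"
      by (rule integral_distr) auto
    then show "(\<integral>x. w (x + c) \<partial>lborel) = integral\<^sup>L lborel w" unfolding d by (simp add: add.commute)
  qed
  have q0: "(\<integral>x. q n x \<partial>lborel) = 0" for n
    unfolding q_def using shift[of "s n *\<^sub>R b"] wi by simp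
  have C0: "0 \<le> C" using order_trans[OF norm_ge_zero C] .
  have lip: "\<bar>w y - w x\<bar> \<le> C * norm (y - x)" for x y
  proof -
    have "norm (w y - w x) \<le> C * norm (y - x)"
    proof (rule differentiable_bound[where S = UNIV and f' = "\<lambda>x h. dw x \<bullet> h"])
      show "(w has_derivative (\<lambda>h. dw x \<bullet> h)) (at x within UNIV)" for x using w by simp
      show "onorm (\<lambda>h. dw x \<bullet> h) \<le> C" for x
      proof (rule onorm_bound[OF C0])
        fix h
        have "norm (dw x \<bullet> h) \<le> norm (dw x) * norm h" using Cauchy_Schwarz_ineq2[of "dw x" h] by simp
        also have "\<dots> \<le> C * norm h" by (intro mult_right_mono C) auto
        finally show "norm (dw x \<bullet> h) \<le> C * norm h" .
      qed
    qed auto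
    then show ?thesis by simp
  qed
  have lim: "(\<lambda>n. q n x) \<longlonglongrightarrow> dw x \<bullet> b" for x
  proof -
    have "((\<lambda>t. x + t *\<^sub>R b) has_derivative (\<lambda>t. t *\<^sub>R b)) (at 0)"
      by (auto intro!: derivative_eq_intros)
    then have "((\<lambda>t. w (x + t *\<^sub>R b)) has_derivative (\<lambda>t. dw x \<bullet> (t *\<^sub>R b))) (at 0)"
      by (rule has_derivative_compose) (use w[of x] in simp)
    then have "((\<lambda>t. w (x + t *\<^sub>R b)) has_real_derivative dw x \<bullet> b) (at 0)"
      by (simp add: has_field_derivative_def mult.commute[of _ "dw x \<bullet> b"])
    then have "((\<lambda>h. (w (x + h *\<^sub>R b) - w x) / h) \<longlongrightarrow> dw x \<bullet> b) (at 0)" by (simp add: DERIV_def)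
    moreover have "filterlim s (at 0) sequentially"
      unfolding s_def by (intro filterlim_atI LIMSEQ_inverse_real_of_nat) auto
    ultimately show ?thesis unfolding q_def by (rule filterlim_compose)
  qed
  obtain R where R: "\<And>x. x \<in> K \<Longrightarrow> norm x \<le> R" using compact_imp_bounded[OF K] by (auto simp: bounded_iff)
  \<comment> \<open>The shifts have length at most |b|, so all difference quotients vanish outside
    this enlarged ball and share one integrable majorant.\<close>
  define K1 where "K1 = cball (0::'a) (R + norm b)"
  have bd: "norm (q n x) \<le> C * norm b * indicator K1 x" for n x
  proof (cases "x \<in> K1")
    case True
    have "\<bar>w (x + s n *\<^sub>R b) - w x\<bar> / s n \<le> C * norm (s n *\<^sub>R b) / s n"
      using lip[of "x + s n *\<^sub>R b" x] s[of n] by (intro divide_right_mono) auto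
    then show ?thesis using True s[of n] by (simp add: q_def abs_divide)
  next
    case False
    have nb: "norm (s n *\<^sub>R b) \<le> norm b" using s[of n] by (simp add: mult_left_le_one_le)
    have "x \<notin> K" using False R[of x] norm_ge_zero[of b] by (auto simp: K1_def simp del: norm_ge_zero)
    moreover have "x + s n *\<^sub>R b \<notin> K"
    proof
      assume "x + s n *\<^sub>R b \<in> K"
      then have "norm (x + s n *\<^sub>R b) \<le> R" by (rule R)
      then have "norm x \<le> R + norm b" using nb norm_diff_ineq[of x "s n *\<^sub>R b"] by linarith
      then show False using False by (simp add: K1_def)
    qed
    ultimately show ?thesis using False out by (simp add: q_def)
  qed
  have "dw x \<bullet> b = lim (\<lambda>n. q n x)" for x using limI[OF lim[of x]] by simp
  moreover have qm[measurable]: "q n \<in> borel_measurable borel" for n unfolding q_def by measurable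
  ultimately have dm: "(\<lambda>x. dw x \<bullet> b) \<in> borel_measurable borel" by simp
  have "(\<lambda>n. \<integral>x. q n x \<partial>lborel) \<longlonglongrightarrow> (\<integral>x. dw x \<bullet> b \<partial>lborel)"
  proof (rule integral_dominated_convergence[where w = "\<lambda>x. C * norm b * indicator K1 x"])
    show "integrable lborel (\<lambda>x. C * norm b * indicat_real K1 x)"
      using bounded_set_finite_emeasure[of K1] by (simp add: K1_def)
  qed (use dm lim bd in auto)
  then show ?thesis by (simp add: q0 LIMSEQ_const_iff)
qed

text \<open>The product of \<open>f\<close> with a test function, extended by zero, is
  differentiable on the whole space because the support of the test function is compact in
  \<open>D\<close>. The integral of its directional derivative vanishes, which is the integration by
  parts formula.\<close>

lemma weak_grad_C1:
  assumes D: "open D" and f: "\<And>x. x \<in> D \<Longrightarrow> (f has_derivative (\<lambda>h. G x \<bullet> h)) (at x)"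
    and G: "continuous_on D G" and L: "f \<in> L2 D" "G \<in> L2 D"
  shows "weak_grad D f G"
  unfolding weak_grad_def
proof (intro conjI L allI impI ballI)
  fix \<phi> b assume t: "test_fun D \<phi>" and b: "b \<in> (Basis :: 'a set)"
  obtain K where K: "compact K" "K \<subseteq> D" "\<And>x. x \<notin> K \<Longrightarrow> \<phi> x = 0" "\<And>x. x \<notin> K \<Longrightarrow> grad \<phi> x = 0"
    using test_fun_support[OF t] by metis
  define w where "w x = (if x \<in> D then f x * \<phi> x else 0)" for x
  define dw where "dw x = (if x \<in> D then \<phi> x *\<^sub>R G x + f x *\<^sub>R grad \<phi> x else 0)" for x
  have w: "(w has_derivative (\<lambda>h. dw x \<bullet> h)) (at x)" for x
  proof (cases "x \<in> D")
    case True
    have "((\<lambda>x. f x * \<phi> x) has_derivative (\<lambda>h. f x * (grad \<phi> x \<bullet> h) + (G x \<bullet> h) * \<phi> x)) (at x)"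
      by (intro has_derivative_mult f True has_derivative_grad test_fun_C1(1)[OF t])
    also have "(\<lambda>h. f x * (grad \<phi> x \<bullet> h) + (G x \<bullet> h) * \<phi> x) = (\<lambda>h. dw x \<bullet> h)"
      using True by (simp add: dw_def inner_add_left fun_eq_iff)
    finally show ?thesis
      by (rule has_derivative_transform_within_open[OF _ D True]) (simp add: w_def)
  next
    case False
    have "((\<lambda>x. 0) has_derivative (\<lambda>h. dw x \<bullet> h)) (at x)" using False by (simp add: dw_def)
    then show ?thesis
      by (rule has_derivative_transform_within_open[OF _ open_Compl[OF compact_imp_closed[OF K(1)]]])
         (use K False in \<open>auto simp: w_def\<close>)
  qed
  have fc: "continuous_on D f"
    by (intro continuous_at_imp_continuous_on ballI has_derivative_continuous[OF f])
  have "continuous_on K (\<lambda>x. \<phi> x *\<^sub>R G x + f x *\<^sub>R grad \<phi> x)"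
    by (intro continuous_intros continuous_on_subset[OF test_fun_C1(2)[OF t]]
        continuous_on_subset[OF test_fun_C1(3)[OF t]] continuous_on_subset[OF fc] continuous_on_subset[OF G] K) auto
  then have "bounded ((\<lambda>x. \<phi> x *\<^sub>R G x + f x *\<^sub>R grad \<phi> x) ` K)"
    using K by (intro compact_imp_bounded compact_continuous_image)
  then obtain C where C: "\<And>x. x \<in> K \<Longrightarrow> norm (\<phi> x *\<^sub>R G x + f x *\<^sub>R grad \<phi> x) \<le> C"
    by (auto simp: bounded_iff)
  have "norm (dw x) \<le> \<bar>C\<bar>" for x
    using C[of x] K(2) K(3,4)[of x] by (cases "x \<in> K") (auto simp: dw_def)
  from integral_directional_derivative_zero[OF K(1) w _ this]
  have "0 = (\<integral>x. dw x \<bullet> b \<partial>lborel)" using K by (simp add: w_def)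
  also have "\<dots> = (LINT x:D|lborel. (G x \<bullet> b) * \<phi> x + f x * frechet_derivative \<phi> (at x) b)"
    unfolding set_lebesgue_integral_def
    by (rule Bochner_Integration.integral_cong)
       (auto simp: dw_def indicator_def inner_add_left test_fun_frechet[OF t])
  also have "\<dots> = (LINT x:D|lborel. (G x \<bullet> b) * \<phi> x) + (LINT x:D|lborel. f x * frechet_derivative \<phi> (at x) b)"
    using L2_inner_integrable[OF L2_component[OF b L(2)] test_fun_L2(1)[OF t]]
      L2_inner_integrable[OF L(1) test_fun_L2(2)[OF t, of b]]
    by (intro set_integral_add) auto
  finally show "(LINT x:D|lborel. f x * frechet_derivative \<phi> (at x) b) = - (LINT x:D|lborel. (G x \<bullet> b) * \<phi> x)"
    by simp
qed

lemma test_fun_H1: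
  assumes D: "open D" and t: "test_fun D \<phi>" shows "\<phi> \<in> H1 D"
proof -
  obtain K where K: "compact K" "K \<subseteq> D" "\<And>x. x \<notin> K \<Longrightarrow> \<phi> x = 0" "\<And>x. x \<notin> K \<Longrightarrow> grad \<phi> x = 0"
    using test_fun_support[OF t] by metis
  have "K \<in> sets borel" using K by (intro borel_compact)
  moreover have "grad \<phi> \<in> borel_measurable borel"
    by (intro borel_measurable_continuous_onI test_fun_C1(3)[OF t])
  moreover have "bounded (grad \<phi> ` K)"
    using K test_fun_C1(3)[OF t] by (intro compact_imp_bounded compact_continuous_image) (auto intro: continuous_on_subset)
  then obtain C where "\<And>x. x \<in> K \<Longrightarrow> norm (grad \<phi> x) \<le> C" by (auto simp: bounded_iff)
  ultimately have "grad \<phi> \<in> L2 K" using K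
    by (intro L2_boundedI[where C = C]) (auto intro: compact_imp_bounded simp: set_borel_measurable_def)
  moreover have "(\<lambda>x. indicat_real D x *\<^sub>R grad \<phi> x) = (\<lambda>x. indicat_real K x *\<^sub>R grad \<phi> x)"
    using K by (auto simp: indicator_def fun_eq_iff)
  ultimately have "grad \<phi> \<in> L2 D" unfolding L2_iff by simp
  then have "weak_grad D \<phi> (grad \<phi>)"
    using test_fun_L2(1)[OF t] continuous_on_subset[OF test_fun_C1(3)[OF t]]
    by (intro weak_grad_C1 D has_derivative_grad test_fun_C1(1)[OF t]) auto
  then show ?thesis by (auto simp: H1_def)
qed

subsection \<open>An orthonormal basis inside $H^1$\<close>

text \<open>Bumps over rational boxes with closure in \<open>D\<close> are countably many and
  already suffice for the fundamental lemma.\<close>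

lemma separating_test_functions:
  fixes D :: "'a::euclidean_space set"
  assumes D: "open D" "bounded D"
  obtains \<phi> :: "nat \<Rightarrow> 'a \<Rightarrow> real" where "\<And>l. \<phi> l \<in> H1 D"
    "\<And>h. h \<in> L2 D \<Longrightarrow> (\<And>l. L2_inner D h (\<phi> l) = 0) \<Longrightarrow> L2_eq D h (\<lambda>x. 0)"
proof -
  define I where "I = {(a, c, n::nat). a \<in> rational_vectors \<and> c \<in> rational_vectors \<and> cbox a c \<subseteq> D}"
  have cI: "countable I"
    by (rule countable_subset[of _ "rational_vectors \<times> rational_vectors \<times> UNIV"])
       (auto simp: I_def intro!: countable_SIGMA countable_rational_vectors)
  \<comment> \<open>The upper corner lies below the lower one, so this \<open>cbox\<close> is empty
    and trivially contained in \<open>D\<close>; the index set is thereby nonempty and can be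
    enumerated.\<close>
  have "(0 :: 'a, - (\<Sum>b\<in>Basis. b), 0) \<in> I"
    by (auto simp: I_def rational_vectors_def inner_sum_left inner_Basis cbox_def sum.delta
        cong: if_cong) (metis SOME_Basis le_minus_one_simps(3) order_trans)
  then have I0: "I \<noteq> {}" by blast
  define \<phi> where "\<phi> l = (case from_nat_into I l of (a, c, n) \<Rightarrow> bump a c n)" for l
  show ?thesis
  proof (rule that)
    fix l
    obtain a c n where eq: "from_nat_into I l = (a, c, n)" by (metis prod.exhaust)
    then have "cbox a c \<subseteq> D" using from_nat_into[OF I0, of l] by (auto simp: I_def)
    then show "\<phi> l \<in> H1 D" using D by (auto simp: \<phi>_def eq intro!: test_fun_H1 test_fun_bump)
  next
    fix h :: "'a \<Rightarrow> real" assume h: "h \<in> L2 D" "\<And>l. L2_inner D h (\<phi> l) = 0"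
    have "(LINT x:D|lborel. h x * bump a c n x) = 0"
      if "a \<in> rational_vectors" "c \<in> rational_vectors" "cbox a c \<subseteq> D" for a c n
    proof -
      have "(a, c, n) \<in> I" using that by (simp add: I_def)
      then obtain l where "from_nat_into I l = (a, c, n)"
        using from_nat_into_surj[OF cI] by blast
      then show ?thesis using h(2)[of l] by (simp add: \<phi>_def L2_inner_def)
    qed
    then show "L2_eq D h (\<lambda>x. 0)"
      unfolding L2_eq_def using D h(1)
      by (intro bump_integral_zero_imp_AE_zero L2_integrable) auto
  qed
qed

lemma H1_zero: "D \<in> sets borel \<Longrightarrow> (\<lambda>x. 0) \<in> H1 D"
  unfolding H1_def weak_grad_def
  by (auto intro!: exI[of _ "\<lambda>x. 0"] simp: L2_zero)

lemma H1_cmult: "D \<in> sets borel \<Longrightarrow> f \<in> H1 D \<Longrightarrow> (\<lambda>x. a * f x) \<in> H1 D"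
  using H1_linear[OF _ H1_zero, of f D a 0] by simp

lemma H1_diff: "f \<in> H1 D \<Longrightarrow> g \<in> H1 D \<Longrightarrow> (\<lambda>x. f x - g x) \<in> H1 D"
  using H1_linear[of f D g 1 "-1"] by simp

lemma H1_sum:
  assumes "D \<in> sets borel" "\<And>i. i \<in> I \<Longrightarrow> f i \<in> H1 D"
  shows "(\<lambda>x. \<Sum>i\<in>I. c i * f i x) \<in> H1 D"
  using assms(2)
proof (induction I rule: infinite_finite_induct)
  case (insert i I)
  then show ?case using H1_linear[of "f i" D "\<lambda>x. \<Sum>i\<in>I. c i * f i x" "c i" 1] by auto
qed (auto simp: H1_zero assms(1))

text \<open>Gram--Schmidt applied to a separating sequence of test functions; the given basis \<open>f\<close> only
  serves to see that $L^2(D)$ is infinite-dimensional, so that the process never stops.\<close>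

lemma exists_H1_orthonormal_basis:
  fixes D :: "'a::euclidean_space set"
  assumes D: "open D" "bounded D" and f: "orthonormal_basis D f"
  obtains e where "orthonormal_basis D e" "\<And>k. e k \<in> H1 D"
proof -
  have Db: "D \<in> sets borel" using D by simp
  have fL: "\<And>k. f k \<in> L2 D" and fo: "\<And>j k. L2_inner D (f j) (f k) = (if j = k then 1 else 0)"
    using f by (auto simp: orthonormal_basis_def)
  obtain \<phi> :: "nat \<Rightarrow> 'a \<Rightarrow> real" where \<phi>: "\<And>l. \<phi> l \<in> H1 D"
    and sep: "\<And>h. h \<in> L2 D \<Longrightarrow> (\<And>l. L2_inner D h (\<phi> l) = 0) \<Longrightarrow> L2_eq D h (\<lambda>x. 0)"
    using separating_test_functions[OF D] by metis
  \<comment> \<open>The last clause expresses that \<open>\<phi> n\<close> lies in the span of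
    \<open>e 0, ..., e (n-1), r\<close>, in the dual form that is needed for completeness:
    orthogonality to these vectors implies orthogonality to \<open>\<phi> n\<close>.\<close>
  define P where "P e n r \<longleftrightarrow> r \<in> H1 D \<and> L2_inner D r r = 1 \<and> (\<forall>i<n. L2_inner D r (e i) = 0) \<and>
    (\<forall>h\<in>L2 D. (\<forall>i<n. L2_inner D h (e i) = 0) \<longrightarrow> L2_inner D h r = 0 \<longrightarrow> L2_inner D h (\<phi> n) = 0)"
    for e :: "nat \<Rightarrow> 'a \<Rightarrow> real" and n r
  have "\<exists>e. \<forall>n. P e n (e n)"
  proof (rule dependent_wellorder_choice)
    fix r :: "'a \<Rightarrow> real" and e e' :: "nat \<Rightarrow> 'a \<Rightarrow> real" and n
    assume "\<And>y. y < n \<Longrightarrow> e y = e' y"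
    then show "P e n r = P e' n r" by (simp add: P_def)
  next
    fix n :: nat and e :: "nat \<Rightarrow> 'a \<Rightarrow> real" assume e: "\<And>y. y < n \<Longrightarrow> P e y (e y)"
    have eH: "e i \<in> H1 D" if "i < n" for i using e[OF that] by (simp add: P_def)
    have eL: "e i \<in> L2 D" if "i < n" for i using H1_L2(1)[OF eH[OF that]] .
    have o: "L2_inner D (e j) (e k) = (if j = k then 1 else 0)" if "j < n" "k < n" for j k
    proof -
      consider "j = k" | "j < k" | "k < j" by linarith
      then show ?thesis
        using e[OF that(1)] e[OF that(2)] by cases (auto simp: P_def L2_inner_commute)
    qed
    define R where "R h = (\<lambda>x. h x - (\<Sum>k<n. L2_inner D h (e k) * e k x))" for h
    have RH: "R h \<in> H1 D" if "h \<in> H1 D" for h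
      unfolding R_def using that eH by (intro H1_diff H1_sum Db) auto
    have sL: "(\<lambda>x. \<Sum>k<n. c k * e k x) \<in> L2 D" for c using eL by (intro L2_sum L2_cmult) auto
    have RL: "R h \<in> L2 D" if "h \<in> L2 D" for h
      unfolding R_def by (intro L2_diff that sL)
    have sI: "L2_inner D (\<lambda>x. \<Sum>k<n. c k * e k x) g = (\<Sum>k<n. c k * L2_inner D (e k) g)"
      if "g \<in> L2 D" for c g
      using that eL by (subst L2_inner_sum_left) (auto intro!: L2_cmult simp: L2_inner_cmult_left)
    have RI: "L2_inner D (R h) g = L2_inner D h g - (\<Sum>k<n. L2_inner D h (e k) * L2_inner D (e k) g)"
      if "h \<in> L2 D" "g \<in> L2 D" for h g
      unfolding R_def by (simp add: L2_inner_diff_left[OF that(1) sL that(2)] sI[OF that(2)])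
    have Re: "L2_inner D (R h) (e j) = 0" if "h \<in> L2 D" "j < n" for h j
    proof -
      have "(\<Sum>k<n. L2_inner D h (e k) * L2_inner D (e k) (e j)) = (\<Sum>k<n. if k = j then L2_inner D h (e j) else 0)"
        using that by (intro sum.cong) (auto simp: o)
      then show ?thesis using that by (simp add: RI eL sum.delta')
    qed
    have RN: "L2_inner D (R h) (R h) = L2_inner D h h - (\<Sum>k<n. (L2_inner D h (e k))\<^sup>2)" if "h \<in> L2 D" for h
      unfolding R_def by (subst orthonormal_norm_diff_sq_lessThan) (use that eL o in auto)
    \<comment> \<open>If every \<open>\<phi> l\<close> had zero residual, then the residual of any
      \<open>f k\<close>, which is orthogonal to the earlier \<open>e i\<close>, would be orthogonal
      to all \<open>\<phi> l\<close> and hence be zero by separation.\<close>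
    have "\<exists>l. L2_inner D (R (\<phi> l)) (R (\<phi> l)) \<noteq> 0"
    proof (rule ccontr)
      assume "\<nexists>l. L2_inner D (R (\<phi> l)) (R (\<phi> l)) \<noteq> 0"
      then have "L2_norm D (R (\<phi> l)) = 0" for l by (simp add: L2_norm_def)
      then have R0: "L2_eq D (R (\<phi> l)) (\<lambda>x. 0)" for l
        using L2_norm_zero_iff[OF RL[OF H1_L2(1)[OF \<phi>]]] by blast
      \<comment> \<open>Otherwise n + 1 orthonormal vectors would lie in the span of n others:
        summing their unit norms and exchanging the sums gives n + 1 on one side and, by Bessel for
        the system \<open>f\<close>, at most n on the other.\<close>
      have "\<exists>k\<le>n. L2_inner D (R (f k)) (R (f k)) \<noteq> 0"
      proof (rule ccontr)
        assume "\<not> (\<exists>k\<le>n. L2_inner D (R (f k)) (R (f k)) \<noteq> 0)"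
        then have "(\<Sum>i<n. (L2_inner D (f k) (e i))\<^sup>2) = 1" if "k \<le> n" for k
          using RN[OF fL, of k] that by (simp add: fo)
        then have "real (Suc n) = (\<Sum>k<Suc n. \<Sum>i<n. (L2_inner D (f k) (e i))\<^sup>2)" by simp
        also have "\<dots> = (\<Sum>i<n. \<Sum>k<Suc n. (L2_inner D (e i) (f k))\<^sup>2)"
          by (subst sum.swap) (simp add: L2_inner_commute)
        also have "\<dots> \<le> (\<Sum>i<n. 1)"
        proof (rule sum_mono)
          fix i assume "i \<in> {..<n}"
          then show "(\<Sum>k<Suc n. (L2_inner D (e i) (f k))\<^sup>2) \<le> 1"
            using Bessel[OF fL fo eL, of i "Suc n"] o[of i i] by simp
        qed
        finally show False by simp
      qed
      then obtain k where k: "L2_inner D (R (f k)) (R (f k)) \<noteq> 0" by blast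
      let ?h = "R (f k)"
      have hL: "?h \<in> L2 D" by (intro RL fL)
      have "L2_inner D ?h (\<phi> l) = 0" for l
      proof -
        have "L2_inner D (R (\<phi> l)) ?h = 0"
          using L2_inner_cong[OF R0[of l] L2_eq_refl[of D ?h] RL[OF H1_L2(1)[OF \<phi>]] L2_zero hL hL]
          by (simp add: L2_inner_zero_left)
        then have "L2_inner D (\<phi> l) ?h = 0"
          using Re[OF fL, of _ k] by (simp add: RI[OF H1_L2(1)[OF \<phi>] hL] L2_inner_commute[of D "e _" ?h])
        then show ?thesis by (simp add: L2_inner_commute)
      qed
      then have "L2_norm D ?h = 0" using sep[OF hL] L2_norm_zero_iff[OF hL] by simp
      then show False using k by (simp add: L2_norm_def)
    qed
    then obtain l0 where l0: "L2_inner D (R (\<phi> l0)) (R (\<phi> l0)) \<noteq> 0" by blast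
    \<comment> \<open>When \<open>\<phi> n\<close> already lies in the span of the earlier vectors,
      a different \<open>\<phi> l0\<close> supplies the new direction, and the clause about
      \<open>\<phi> n\<close> holds by itself.\<close>
    define l where "l = (if L2_inner D (R (\<phi> n)) (R (\<phi> n)) \<noteq> 0 then n else l0)"
    have l: "L2_inner D (R (\<phi> l)) (R (\<phi> l)) \<noteq> 0" using l0 by (simp add: l_def)
    define s where "s = L2_norm D (R (\<phi> l))"
    have s: "s \<noteq> 0" "s * s = L2_inner D (R (\<phi> l)) (R (\<phi> l))"
      using l L2_norm_sq[of D "R (\<phi> l)"] by (auto simp: s_def power2_eq_square L2_norm_def)
    define r where "r = (\<lambda>x. (1 / s) * R (\<phi> l) x)"
    have rI: "L2_inner D r g = (1 / s) * L2_inner D (R (\<phi> l)) g" for g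
      unfolding r_def by (rule L2_inner_cmult_left)
    have "P e n r"
      unfolding P_def
    proof (intro conjI allI impI ballI)
      show "r \<in> H1 D" unfolding r_def by (intro H1_cmult Db RH \<phi>)
      have "L2_inner D r r = (1 / s) * ((1 / s) * L2_inner D (R (\<phi> l)) (R (\<phi> l)))"
        by (subst rI, subst L2_inner_commute, subst rI) simp
      then show "L2_inner D r r = 1" using s(1) unfolding s(2)[symmetric] by simp
      show "L2_inner D r (e i) = 0" if "i < n" for i using Re[OF H1_L2(1)[OF \<phi>] that] by (simp add: rI)
      fix h assume h: "h \<in> L2 D" "\<forall>i<n. L2_inner D h (e i) = 0" "L2_inner D h r = 0"
      have e1: "L2_inner D (\<phi> n) h = L2_inner D (R (\<phi> n)) h"
        using h(2) by (simp add: RI[OF H1_L2(1)[OF \<phi>] h(1)] L2_inner_commute[of D "e _" h])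
      show "L2_inner D h (\<phi> n) = 0"
      proof (cases "L2_inner D (R (\<phi> n)) (R (\<phi> n)) = 0")
        case True
        have RnL: "R (\<phi> n) \<in> L2 D" by (intro RL H1_L2(1) \<phi>)
        have "L2_norm D (R (\<phi> n)) = 0" using True by (simp add: L2_norm_def)
        then have "L2_inner D (R (\<phi> n)) h = 0"
          using L2_Cauchy_Schwarz[OF RnL h(1)] by simp
        then show ?thesis using e1 by (simp add: L2_inner_commute)
      next
        case False
        then have "L2_inner D (R (\<phi> n)) h = s * L2_inner D r h" using s by (simp add: rI l_def)
        then show ?thesis using e1 h(3) by (simp add: L2_inner_commute)
      qed
    qed
    then show "\<exists>r. P e n r" by - (rule exI[of "P e n" r])
  qed
  then obtain e where e: "\<And>n. P e n (e n)" by blast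
  have eH: "e k \<in> H1 D" for k using e[of k] by (simp add: P_def)
  have o: "L2_inner D (e j) (e k) = (if j = k then 1 else 0)" for j k
  proof -
    consider "j = k" | "j < k" | "k < j" by linarith
    then show ?thesis
      using e[of j] e[of k] by cases (auto simp: P_def L2_inner_commute)
  qed
  have "orthonormal_basis D e"
    unfolding orthonormal_basis_def
  proof (intro conjI allI ballI impI o H1_L2(1) eH)
    fix h assume h: "h \<in> L2 D" "\<forall>k. L2_inner D h (e k) = 0"
    then have "L2_inner D h (\<phi> l) = 0" for l using e[of l] by (simp add: P_def)
    then show "L2_eq D h (\<lambda>x. 0)" by (rule sep[OF h(1)])
  qed
  with that eH show ?thesis by blast
qed

section \<open>Borel sets of pseudometrics\<close>

lemma space_pm_borel: "space (pm_borel S d) = S"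
  unfolding pm_borel_def by (rule space_measure_of) auto

lemma sets_pm_borel: "sets (pm_borel S d) =
  sigma_sets S {U. U \<subseteq> S \<and> (\<forall>x\<in>U. \<exists>r>0. \<forall>y\<in>S. d x y < r \<longrightarrow> y \<in> U)}"
  unfolding pm_borel_def by (rule sets_measure_of) auto

lemma pm_borel_continuous_measurable:
  fixes g :: "'x \<Rightarrow> real"
  assumes "\<And>x \<epsilon>. x \<in> S \<Longrightarrow> 0 < \<epsilon> \<Longrightarrow> \<exists>\<delta>>0. \<forall>y\<in>S. d x y < \<delta> \<longrightarrow> \<bar>g y - g x\<bar> < \<epsilon>"
  shows "g \<in> borel_measurable (pm_borel S d)"
proof (rule borel_measurableI)
  fix U :: "real set" assume U: "open U"
  have "\<exists>r>0. \<forall>y\<in>S. d x y < r \<longrightarrow> y \<in> g -` U \<inter> S" if x: "x \<in> g -` U \<inter> S" for x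
  proof -
    obtain \<epsilon> where e: "0 < \<epsilon>" "\<And>z. dist z (g x) < \<epsilon> \<Longrightarrow> z \<in> U"
      using U x unfolding open_dist by blast
    obtain \<delta> where d: "0 < \<delta>" "\<forall>y\<in>S. d x y < \<delta> \<longrightarrow> \<bar>g y - g x\<bar> < \<epsilon>" using assms[of x \<epsilon>] x e(1) by blast
    show ?thesis
    proof (intro exI[of _ \<delta>] conjI ballI impI d(1))
      fix y assume "y \<in> S" "d x y < \<delta>"
      then have "dist (g y) (g x) < \<epsilon>" using d(2) by (simp add: dist_real_def)
      then show "y \<in> g -` U \<inter> S" using e(2) \<open>y \<in> S\<close> by simp
    qed
  qed
  then show "g -` U \<inter> space (pm_borel S d) \<in> sets (pm_borel S d)"
    unfolding space_pm_borel sets_pm_borel by (intro sigma_sets.Basic) auto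
qed

lemma space_L2_borel: "space (L2_borel D) = L2 D"
  by (simp add: L2_borel_def space_pm_borel)

lemma L2_inner_measurable:
  assumes h: "h \<in> L2 D" shows "(\<lambda>f. L2_inner D f h) \<in> borel_measurable (L2_borel D)"
  unfolding L2_borel_def
proof (rule pm_borel_continuous_measurable)
  fix f \<epsilon> :: real and g :: "'a \<Rightarrow> real" assume g: "g \<in> L2 D" and e: "0 < (\<epsilon>::real)"
  let ?c = "L2_norm D h + 1"
  have c: "0 < ?c" using L2_norm_nonneg[of D h] by simp
  show "\<exists>\<delta>>0. \<forall>y\<in>L2 D. L2_norm D (g - y) < \<delta> \<longrightarrow> \<bar>L2_inner D y h - L2_inner D g h\<bar> < \<epsilon>"
  proof (intro exI[of _ "\<epsilon> / ?c"] conjI ballI impI)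
    fix y assume y: "y \<in> L2 D" "L2_norm D (g - y) < \<epsilon> / ?c"
    have "\<bar>L2_inner D y h - L2_inner D g h\<bar> = \<bar>L2_inner D (g - y) h\<bar>"
      by (simp add: L2_inner_diff_left'[OF g y(1) h])
    also have "\<dots> \<le> L2_norm D (g - y) * L2_norm D h" by (intro L2_Cauchy_Schwarz L2_diff' g y h)
    also have "\<dots> \<le> L2_norm D (g - y) * ?c" by (intro mult_left_mono L2_norm_nonneg) auto
    also have "\<dots> < \<epsilon>" using y(2) c by (simp add: pos_less_divide_eq)
    finally show "\<bar>L2_inner D y h - L2_inner D g h\<bar> < \<epsilon>" .
  qed (use e c in auto)
qed

text \<open>Functions that agree almost everywhere have distance zero, so no open set separates
  them, and saturation survives complements and countable unions. Random functions may therefore be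
  replaced by other representatives inside events.\<close>

lemma L2_borel_saturated:
  assumes A: "A \<in> sets (L2_borel D)" and fg: "f \<in> L2 D" "g \<in> L2 D" "L2_eq D f g"
  shows "f \<in> A \<longleftrightarrow> g \<in> A"
  using A unfolding L2_borel_def sets_pm_borel
proof (induction rule: sigma_sets.induct)
  case (Basic U)
  have z: "L2_norm D (f - g) = 0" "L2_norm D (g - f) = 0"
    using L2_norm_diff_zero_iff[OF fg(1,2)] L2_norm_diff_zero_iff[OF fg(2,1)] fg(3) L2_eq_sym by auto
  show ?case
  proof
    assume "f \<in> U"
    then obtain r where "0 < r" "\<forall>y\<in>L2 D. L2_norm D (f - y) < r \<longrightarrow> y \<in> U" using Basic by blast
    then show "g \<in> U" using z fg by simp
  next
    assume "g \<in> U"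
    then obtain r where "0 < r" "\<forall>y\<in>L2 D. L2_norm D (g - y) < r \<longrightarrow> y \<in> U" using Basic by blast
    then show "f \<in> U" using z fg by simp
  qed
qed (use fg in auto)

lemma Parseval_norm_diff:
  assumes e: "orthonormal_basis D e" and f: "f \<in> L2 D" and g: "g \<in> L2 D"
  shows "(\<lambda>k. (L2_inner D f (e k) - L2_inner D g (e k))\<^sup>2) sums (L2_norm D (f - g))\<^sup>2"
proof -
  have "\<And>k. e k \<in> L2 D" using e by (auto simp: orthonormal_basis_def)
  then show ?thesis
    using Parseval[OF e L2_diff'[OF f g] L2_diff'[OF f g]]
    unfolding L2_norm_sq by (simp add: power2_eq_square L2_inner_diff_left'[OF f g])
qed

text \<open>Truncating the expansion and rounding its coefficients each cost at most half of the
  squared tolerance. Lists of rationals serve as a countable index type for the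
  approximants.\<close>

lemma orthonormal_rational_dense:
  assumes e: "orthonormal_basis D e" and f: "f \<in> L2 D" and "0 < \<epsilon>"
  shows "\<exists>q :: rat list. L2_norm D (f - (\<lambda>x. \<Sum>k<length q. real_of_rat (q ! k) * e k x)) < \<epsilon>"
proof -
  have eL: "\<And>k. e k \<in> L2 D" and o: "\<And>j k. L2_inner D (e j) (e k) = (if j = k then 1 else 0)"
    using e by (auto simp: orthonormal_basis_def)
  define z where "z k = L2_inner D f (e k)" for k
  have "(\<lambda>n. \<Sum>k<n. (z k)\<^sup>2) \<longlonglongrightarrow> L2_inner D f f"
    using Parseval[OF e f f] by (simp add: sums_def z_def power2_eq_square)
  moreover have "L2_inner D f f - \<epsilon>\<^sup>2 / 2 < L2_inner D f f" using \<open>0 < \<epsilon>\<close> by simp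
  ultimately have "eventually (\<lambda>n. L2_inner D f f - \<epsilon>\<^sup>2 / 2 < (\<Sum>k<n. (z k)\<^sup>2)) sequentially"
    by (rule order_tendstoD)
  then obtain n where n: "L2_inner D f f - \<epsilon>\<^sup>2 / 2 < (\<Sum>k<n. (z k)\<^sup>2)"
    by (auto simp: eventually_sequentially)
  \<comment> \<open>Rounding n coefficients by less than \<eta> costs at most n \<eta>^2, which
    stays below \<epsilon>^2/2; \<open>Suc n\<close> avoids division by zero.\<close>
  define \<eta> where "\<eta> = sqrt (\<epsilon>\<^sup>2 / (2 * real (Suc n)))"
  have "0 < \<eta>" using \<open>0 < \<epsilon>\<close> by (simp add: \<eta>_def)
  have "\<exists>q. \<bar>z k - real_of_rat q\<bar> < \<eta>" for k
  proof -
    obtain q where "z k < real_of_rat q" "real_of_rat q < z k + \<eta>"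
      using of_rat_dense[of "z k" "z k + \<eta>"] \<open>0 < \<eta>\<close> by auto
    then show ?thesis by (intro exI[of _ q]) auto
  qed
  then obtain q where q: "\<And>k. \<bar>z k - real_of_rat (q k)\<bar> < \<eta>" by metis
  have q2: "(z k - real_of_rat (q k))\<^sup>2 \<le> \<epsilon>\<^sup>2 / (2 * real (Suc n))" for k
  proof -
    have "\<bar>z k - real_of_rat (q k)\<bar>\<^sup>2 \<le> \<eta>\<^sup>2" using q[of k] by (intro power_mono) auto
    then show ?thesis by (simp add: \<eta>_def)
  qed
  let ?q = "map q [0..<n]"
  have "(L2_norm D (f - (\<lambda>x. \<Sum>k<length ?q. real_of_rat (?q ! k) * e k x)))\<^sup>2 =
     L2_inner D f f - (\<Sum>k<n. (z k)\<^sup>2) + (\<Sum>k<n. (z k - real_of_rat (q k))\<^sup>2)"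
    using orthonormal_norm_diff_sq[OF eL o f, of "\<lambda>k. real_of_rat (q k)" n]
    by (simp add: L2_norm_sq fun_diff_def z_def)
  also have "\<dots> < \<epsilon>\<^sup>2 / 2 + (\<Sum>k<n. \<epsilon>\<^sup>2 / (2 * real (Suc n)))"
    using n q2 by (intro add_less_le_mono sum_mono) auto
  also have "\<dots> \<le> \<epsilon>\<^sup>2" using \<open>0 < \<epsilon>\<close> by (simp add: field_simps)
  finally have "L2_norm D (f - (\<lambda>x. \<Sum>k<length ?q. real_of_rat (?q ! k) * e k x)) < \<epsilon>"
    using \<open>0 < \<epsilon>\<close> by (intro power2_less_imp_less[of _ \<epsilon>]) auto
  then show ?thesis by blast
qed

text \<open>Separability makes the coordinates sufficient: open sets are countable unions of balls.\<close>

lemma L2_borel_measurableI: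
  fixes X :: "'w \<Rightarrow> 'a::euclidean_space \<Rightarrow> real"
  assumes e: "orthonormal_basis D e" and X: "\<And>\<omega>. \<omega> \<in> space M \<Longrightarrow> X \<omega> \<in> L2 D"
    and c: "\<And>k. (\<lambda>\<omega>. L2_inner D (X \<omega>) (e k)) \<in> borel_measurable M"
  shows "X \<in> M \<rightarrow>\<^sub>M L2_borel D"
  unfolding L2_borel_def pm_borel_def
proof (rule measurable_measure_of)
  show "X \<in> space M \<rightarrow> L2 D" using X by auto
  fix U :: "('a \<Rightarrow> real) set" assume "U \<in> {U. U \<subseteq> L2 D \<and> (\<forall>x\<in>U. \<exists>r>0. \<forall>y\<in>L2 D. L2_norm D (x - y) < r \<longrightarrow> y \<in> U)}"
  then have U: "U \<subseteq> L2 D" "\<And>x. x \<in> U \<Longrightarrow> \<exists>r>0. \<forall>y\<in>L2 D. L2_norm D (x - y) < r \<longrightarrow> y \<in> U" by auto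
  have eL: "\<And>k. e k \<in> L2 D" using e by (auto simp: orthonormal_basis_def)
  define C where "C q = (\<lambda>x. \<Sum>k<length q. real_of_rat (q ! k) * e k x)" for q
  have CL: "C q \<in> L2 D" for q unfolding C_def by (intro L2_sum L2_cmult eL)
  define B where "B q r = {\<omega> \<in> space M. L2_norm D (X \<omega> - C q) < real_of_rat r}" for q r
  \<comment> \<open>Through Parseval the distance to a fixed centre is a series in the coordinates,
    which are measurable by assumption.\<close>
  have [measurable]: "(\<lambda>\<omega>. L2_norm D (X \<omega> - C q)) \<in> borel_measurable M" for q
  proof -
    have "L2_norm D (X \<omega> - C q) = sqrt (\<Sum>k. (L2_inner D (X \<omega>) (e k) - L2_inner D (C q) (e k))\<^sup>2)"
      if "\<omega> \<in> space M" for \<omega>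
      by (simp only: sums_unique[OF Parseval_norm_diff[OF e X[OF that] CL[of q]], symmetric]
          real_sqrt_abs abs_of_nonneg[OF L2_norm_nonneg])
    moreover have "(\<lambda>\<omega>. sqrt (\<Sum>k. (L2_inner D (X \<omega>) (e k) - L2_inner D (C q) (e k))\<^sup>2)) \<in> borel_measurable M"
      using c by measurable
    ultimately show ?thesis by (simp cong: measurable_cong)
  qed
  have Bm: "B q r \<in> sets M" for q r unfolding B_def by measurable
  define I where "I = {(q, r). \<forall>y\<in>L2 D. L2_norm D (y - C q) < real_of_rat r \<longrightarrow> y \<in> U}"
  have "X -` U \<inter> space M = (\<Union>p\<in>I. B (fst p) (snd p))"
  proof (intro equalityI subsetI)
    fix \<omega> assume w: "\<omega> \<in> X -` U \<inter> space M"
    then obtain r where r: "0 < r" "\<forall>y\<in>L2 D. L2_norm D (X \<omega> - y) < r \<longrightarrow> y \<in> U" using U by blast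
    \<comment> \<open>With half the radius, a ball about a centre within r' of
      \<open>X \<omega>\<close> stays inside the ball of radius r about
      \<open>X \<omega>\<close>.\<close>
    obtain r' where r': "0 < real_of_rat r'" "real_of_rat r' < r / 2"
      using of_rat_dense[of 0 "r / 2"] r by auto
    obtain q where q: "L2_norm D (X \<omega> - C q) < real_of_rat r'"
      using orthonormal_rational_dense[OF e X r'(1)] w unfolding C_def by blast
    have "(q, r') \<in> I"
      unfolding I_def
    proof (clarify)
      fix y assume y: "y \<in> L2 D" "L2_norm D (y - C q) < real_of_rat r'"
      have "L2_norm D (X \<omega> - y) \<le> L2_norm D (X \<omega> - C q) + L2_norm D (C q - y)"
        using w by (intro L2_dist_triangle X CL y) auto
      also have "L2_norm D (C q - y) = L2_norm D (y - C q)" by (rule L2_norm_minus_commute)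
      finally have "L2_norm D (X \<omega> - y) < r" using q y(2) r'(2) by linarith
      then show "y \<in> U" using r(2) y(1) by blast
    qed
    moreover have "\<omega> \<in> B q r'" using w q by (simp add: B_def)
    ultimately show "\<omega> \<in> (\<Union>p\<in>I. B (fst p) (snd p))" by force
  next
    fix \<omega> assume "\<omega> \<in> (\<Union>p\<in>I. B (fst p) (snd p))"
    then show "\<omega> \<in> X -` U \<inter> space M" using X by (auto simp: I_def B_def)
  qed
  moreover have "countable I" by auto
  ultimately show "X -` U \<inter> space M \<in> sets M" using Bm by (auto intro!: sets.countable_UN')
qed auto

subsection \<open>Synthesis from coordinates\<close>

text \<open>Inverse of the map from functions to coordinates. Sequences that are not square summable
  are sent to a function with zero coordinates; this makes the map total and keeps its coordinates
  measurable in the parameter.\<close>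

definition synth :: "'a::euclidean_space set \<Rightarrow> (nat \<Rightarrow> 'a \<Rightarrow> real) \<Rightarrow> (nat \<Rightarrow> real) \<Rightarrow> 'a \<Rightarrow> real" where
  "synth D e z = (SOME f. f \<in> L2 D \<and> (\<forall>k. L2_inner D f (e k) = (if summable (\<lambda>k. (z k)\<^sup>2) then z k else 0)))"

lemma synth:
  assumes e: "orthonormal_basis D e"
  shows "synth D e z \<in> L2 D" "L2_inner D (synth D e z) (e k) = (if summable (\<lambda>k. (z k)\<^sup>2) then z k else 0)"
proof -
  have eL: "\<And>k. e k \<in> L2 D" and o: "\<And>j k. L2_inner D (e j) (e k) = (if j = k then 1 else 0)"
    using e by (auto simp: orthonormal_basis_def)
  have "\<exists>f. f \<in> L2 D \<and> (\<forall>k. L2_inner D f (e k) = (if summable (\<lambda>k. (z k)\<^sup>2) then z k else 0))"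
  proof (cases "summable (\<lambda>k. (z k)\<^sup>2)")
    case True
    from Riesz_Fischer[OF eL o this] True show ?thesis by auto
  next
    case False
    then show ?thesis by (intro exI[of _ "\<lambda>x. 0"]) (auto simp: L2_zero L2_inner_zero_left)
  qed
  from someI_ex[OF this] show "synth D e z \<in> L2 D"
    "L2_inner D (synth D e z) (e k) = (if summable (\<lambda>k. (z k)\<^sup>2) then z k else 0)"
    unfolding synth_def by auto
qed

lemma L2_eqI_coordinates:
  assumes e: "orthonormal_basis D e" and f: "f \<in> L2 D" "g \<in> L2 D"
    and c: "\<And>k. L2_inner D f (e k) = L2_inner D g (e k)"
  shows "L2_eq D f g"
proof -
  have "(\<lambda>k. 0) sums (L2_norm D (f - g))\<^sup>2" using Parseval_norm_diff[OF e f] by (simp add: c)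
  then have "L2_norm D (f - g) = 0" using sums_unique2[OF sums_zero] by fastforce
  then show ?thesis using L2_norm_diff_zero_iff[OF f] by simp
qed

lemma summable_coordinates:
  assumes e: "orthonormal_basis D e" and f: "f \<in> L2 D"
  shows "summable (\<lambda>k. (L2_inner D f (e k))\<^sup>2)"
  using Parseval[OF e f f] by (simp add: power2_eq_square sums_iff)

lemma synth_coordinates:
  assumes e: "orthonormal_basis D e" and f: "f \<in> L2 D"
  shows "L2_eq D (synth D e (\<lambda>k. L2_inner D f (e k))) f"
  using summable_coordinates[OF assms] by (intro L2_eqI_coordinates[OF e] synth[OF e] f) (simp add: synth[OF e])

text \<open>For nonnegative terms summability is finiteness of the extended real series, and that
  series is measurable in the parameter.\<close>

lemma measurable_summable_sq[measurable]:
  assumes [measurable]: "\<And>k. (\<lambda>\<omega>. z k \<omega>) \<in> borel_measurable M"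
  shows "Measurable.pred M (\<lambda>\<omega>. summable (\<lambda>k. (z k \<omega> :: real)\<^sup>2))"
proof -
  have "summable (\<lambda>k. (z k \<omega>)\<^sup>2) \<longleftrightarrow> (\<Sum>k. ennreal ((z k \<omega>)\<^sup>2)) \<noteq> top" for \<omega>
  proof
    assume "summable (\<lambda>k. (z k \<omega>)\<^sup>2)"
    then show "(\<Sum>k. ennreal ((z k \<omega>)\<^sup>2)) \<noteq> top" by (subst suminf_ennreal2) auto
  qed (auto intro: summable_suminf_not_top)
  then show ?thesis by simp
qed

lemma synth_measurable:
  assumes e: "orthonormal_basis D e" and z: "\<And>k. (\<lambda>\<omega>. z \<omega> k) \<in> borel_measurable M"
  shows "(\<lambda>\<omega>. synth D e (z \<omega>)) \<in> M \<rightarrow>\<^sub>M L2_borel D"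
proof (rule L2_borel_measurableI[OF e])
  note [measurable] = z
  show "(\<lambda>\<omega>. L2_inner D (synth D e (z \<omega>)) (e k)) \<in> borel_measurable M" for k
    unfolding synth(2)[OF e] by measurable
qed (rule synth[OF e])

section \<open>Functionals on the path spaces\<close>

subsection \<open>Evaluation on $C([0,T];L^2)$\<close>

lemma L2_norm_diff_continuous:
  assumes u: "\<And>t. t \<in> I \<Longrightarrow> u t \<in> L2 D" and w: "\<And>t. t \<in> I \<Longrightarrow> w t \<in> L2 D"
    and uc: "((\<lambda>s. L2_norm D (u s - u t)) \<longlongrightarrow> 0) (at t within I)"
    and wc: "((\<lambda>s. L2_norm D (w s - w t)) \<longlongrightarrow> 0) (at t within I)" and t: "t \<in> I"
  shows "((\<lambda>s. L2_norm D (u s - w s)) \<longlongrightarrow> L2_norm D (u t - w t)) (at t within I)"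
proof -
  have "((\<lambda>s. L2_norm D (u s - w s) - L2_norm D (u t - w t)) \<longlongrightarrow> 0) (at t within I)"
  proof (rule Lim_null_comparison)
    show "((\<lambda>s. L2_norm D (u s - u t) + L2_norm D (w s - w t)) \<longlongrightarrow> 0) (at t within I)"
      using tendsto_add[OF uc wc] by simp
    show "\<forall>\<^sub>F s in at t within I. norm (L2_norm D (u s - w s) - L2_norm D (u t - w t)) \<le>
        L2_norm D (u s - u t) + L2_norm D (w s - w t)"
      unfolding eventually_at_filter
    proof (intro always_eventually allI impI)
      fix s assume s: "s \<in> I"
      have "L2_norm D (u s - w s) \<le> L2_norm D (u s - u t) + L2_norm D (u t - w s)"
        using s t by (intro L2_dist_triangle u w)
      moreover have "L2_norm D (u t - w s) \<le> L2_norm D (u t - w t) + L2_norm D (w t - w s)"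
        using s t by (intro L2_dist_triangle u w)
      moreover have "L2_norm D (u t - w t) \<le> L2_norm D (u t - u s) + L2_norm D (u s - w t)"
        using s t by (intro L2_dist_triangle u w)
      moreover have "L2_norm D (u s - w t) \<le> L2_norm D (u s - w s) + L2_norm D (w s - w t)"
        using s t by (intro L2_dist_triangle u w)
      ultimately show "norm (L2_norm D (u s - w s) - L2_norm D (u t - w t)) \<le>
        L2_norm D (u s - u t) + L2_norm D (w s - w t)"
        using L2_norm_minus_commute[of D "u s" "u t"] L2_norm_minus_commute[of D "w s" "w t"] by auto
    qed
  qed
  then show ?thesis by (simp add: LIM_zero_iff)
qed

lemma L2_inner_tendsto:
  assumes u: "\<forall>\<^sub>F s in F. u s \<in> L2 D" "l \<in> L2 D" "h \<in> L2 D"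
    and uc: "((\<lambda>s. L2_norm D (u s - l)) \<longlongrightarrow> 0) F"
  shows "((\<lambda>s. L2_inner D (u s) h) \<longlongrightarrow> L2_inner D l h) F"
proof -
  have "((\<lambda>s. L2_inner D (u s) h - L2_inner D l h) \<longlongrightarrow> 0) F"
  proof (rule tendsto_0_le[OF uc, of _ "L2_norm D h"], use u(1) in eventually_elim)
    fix s assume s: "u s \<in> L2 D"
    show "norm (L2_inner D (u s) h - L2_inner D l h) \<le> norm (L2_norm D (u s - l)) * L2_norm D h"
      using L2_Cauchy_Schwarz[OF L2_diff'[OF s u(2)] u(3)]
      by (simp add: L2_inner_diff_left'[OF s u(2,3)] L2_norm_nonneg)
  qed
  then show ?thesis by (simp add: LIM_zero_iff)
qed

lemma L2_inner_path_continuous: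
  assumes u: "\<And>t. t \<in> I \<Longrightarrow> u t \<in> L2 D" and h: "h \<in> L2 D"
    and uc: "\<And>t. t \<in> I \<Longrightarrow> ((\<lambda>s. L2_norm D (u s - u t)) \<longlongrightarrow> 0) (at t within I)"
  shows "continuous_on I (\<lambda>t. L2_inner D (u t) h)"
  unfolding continuous_on_def
proof
  fix t assume t: "t \<in> I"
  show "((\<lambda>t. L2_inner D (u t) h) \<longlongrightarrow> L2_inner D (u t) h) (at t within I)"
    by (rule L2_inner_tendsto[OF _ u[OF t] h uc[OF t]]) (auto simp: eventually_at_filter u)
qed

text \<open>A real-valued \<open>SUP\<close> is an upper bound only for sets bounded above;
  boundedness follows from continuity of the distance on the compact interval.\<close>

lemma C_L2_norm_le_Sup:
  assumes u: "u \<in> C_L2 T D" and w: "w \<in> C_L2 T D" and t: "t \<in> {0..T}"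
  shows "L2_norm D (u t - w t) \<le> (SUP t\<in>{0..T}. L2_norm D (u t - w t))"
proof (rule cSUP_upper[OF t])
  have "continuous_on {0..T} (\<lambda>t. L2_norm D (u t - w t))"
    unfolding continuous_on_def
    using u w by (intro ballI L2_norm_diff_continuous) (auto simp: C_L2_def)
  then have "compact ((\<lambda>t. L2_norm D (u t - w t)) ` {0..T})" by (intro compact_continuous_image) auto
  then show "bdd_above ((\<lambda>t. L2_norm D (u t - w t)) ` {0..T})"
    by (intro bounded_imp_bdd_above compact_imp_bounded)
qed

lemma C_L2_inner_measurable:
  assumes t: "t \<in> {0..T}" and h: "h \<in> L2 D"
  shows "(\<lambda>u. L2_inner D (u t) h) \<in> borel_measurable (C_L2_borel T D)"
  unfolding C_L2_borel_def
proof (rule pm_borel_continuous_measurable)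
  fix \<epsilon> :: real and u :: "real \<Rightarrow> 'a \<Rightarrow> real" assume u: "u \<in> C_L2 T D" and e: "0 < \<epsilon>"
  let ?c = "L2_norm D h + 1"
  have c: "0 < ?c" using L2_norm_nonneg[of D h] by simp
  show "\<exists>\<delta>>0. \<forall>y\<in>C_L2 T D. (SUP t\<in>{0..T}. L2_norm D (u t - y t)) < \<delta> \<longrightarrow>
     \<bar>L2_inner D (y t) h - L2_inner D (u t) h\<bar> < \<epsilon>"
  proof (intro exI[of _ "\<epsilon> / ?c"] conjI ballI impI)
    fix y assume y: "y \<in> C_L2 T D" "(SUP t\<in>{0..T}. L2_norm D (u t - y t)) < \<epsilon> / ?c"
    have L: "u t \<in> L2 D" "y t \<in> L2 D" using u y t by (auto simp: C_L2_def)
    have "\<bar>L2_inner D (y t) h - L2_inner D (u t) h\<bar> = \<bar>L2_inner D (u t - y t) h\<bar>"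
      by (simp add: L2_inner_diff_left'[OF L h])
    also have "\<dots> \<le> L2_norm D (u t - y t) * L2_norm D h" by (intro L2_Cauchy_Schwarz L2_diff' L h)
    also have "\<dots> \<le> L2_norm D (u t - y t) * ?c" by (intro mult_left_mono L2_norm_nonneg) auto
    also have "\<dots> < \<epsilon>" using C_L2_norm_le_Sup[OF u y(1) t] y(2) c
      by (simp add: pos_less_divide_eq[symmetric])
    finally show "\<bar>L2_inner D (y t) h - L2_inner D (u t) h\<bar> < \<epsilon>" .
  qed (use e c in auto)
qed

subsection \<open>The gradient functional on $L^2(0,T;H^1)$\<close>

lemma L2_slices:
  fixes g :: "real \<Rightarrow> 'a::euclidean_space \<Rightarrow> 'b::euclidean_space"
  assumes g: "case_prod g \<in> L2 (I \<times> D)"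
  shows "AE s in lborel. s \<in> I \<longrightarrow> g s \<in> L2 D"
proof -
  have m: "(\<lambda>p. indicator (I \<times> D) p *\<^sub>R case_prod g p) \<in> borel_measurable (lborel \<Otimes>\<^sub>M lborel)"
    and i: "integrable (lborel \<Otimes>\<^sub>M lborel) (\<lambda>p. (norm (indicator (I \<times> D) p *\<^sub>R case_prod g p))\<^sup>2)"
    using g by (auto simp: L2_iff sq_integrable_def lborel_prod)
  have "AE s in lborel. integrable lborel (\<lambda>x. (norm (indicator (I \<times> D) (s, x) *\<^sub>R g s x))\<^sup>2)"
    using lborel_pair.AE_integrable_fst'[OF i] by simp
  then show ?thesis
  proof (eventually_elim, intro impI)
    fix s assume int: "integrable lborel (\<lambda>x. (norm (indicator (I \<times> D) (s, x) *\<^sub>R g s x))\<^sup>2)" and s: "s \<in> I"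
    have eq: "indicator (I \<times> D) (s, x) *\<^sub>R g s x = indicator D x *\<^sub>R g s x" for x
      using s by (auto simp: indicator_def)
    have "(\<lambda>x. indicator (I \<times> D) (s, x) *\<^sub>R case_prod g (s, x)) \<in> borel_measurable lborel"
      by (rule measurable_compose[OF _ m]) simp
    then show "g s \<in> L2 D" using int unfolding L2_iff sq_integrable_def case_prod_conv eq by simp
  qed
qed

lemma L2_inner_Fubini:
  fixes g h :: "real \<Rightarrow> 'a::euclidean_space \<Rightarrow> 'b::euclidean_space"
  assumes g: "case_prod g \<in> L2 (I \<times> D)" and h: "case_prod h \<in> L2 (I \<times> D)"
  shows "L2_inner (I \<times> D) (case_prod g) (case_prod h) = (LINT s:I|lborel. L2_inner D (g s) (h s))"
    and "set_integrable lborel I (\<lambda>s. L2_inner D (g s) (h s))"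
proof -
  let ?f = "\<lambda>p. indicat_real (I \<times> D) p *\<^sub>R (case_prod g p \<bullet> case_prod h p)"
  have i: "integrable (lborel \<Otimes>\<^sub>M lborel) ?f"
    using L2_inner_integrable[OF g h] by (simp add: set_integrable_def lborel_prod)
  have eq: "(\<integral>x. ?f (s, x) \<partial>lborel) = indicat_real I s *\<^sub>R L2_inner D (g s) (h s)" for s
    by (auto simp: L2_inner_def set_lebesgue_integral_def indicator_times mult.assoc)
  show "L2_inner (I \<times> D) (case_prod g) (case_prod h) = (LINT s:I|lborel. L2_inner D (g s) (h s))"
    using lborel_pair.integral_fst'[OF i] unfolding eq
    by (simp add: L2_inner_def set_lebesgue_integral_def lborel_prod)
  show "set_integrable lborel I (\<lambda>s. L2_inner D (g s) (h s))"
    using lborel_pair.integrable_fst'[OF i] unfolding eq by (simp add: set_integrable_def)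
qed

lemma L2_eq_slicesI:
  fixes g h :: "real \<Rightarrow> 'a::euclidean_space \<Rightarrow> 'b::euclidean_space"
  assumes g: "case_prod g \<in> L2 (I \<times> D)" and h: "case_prod h \<in> L2 (I \<times> D)"
    and eq: "AE s in lborel. s \<in> I \<longrightarrow> L2_eq D (g s) (h s)"
  shows "L2_eq (I \<times> D) (case_prod g) (case_prod h)"
proof -
  define F where "F = (\<lambda>p. indicat_real (I \<times> D) p *\<^sub>R (case_prod g p - case_prod h p))"
  have "F = (\<lambda>p. indicat_real (I \<times> D) p *\<^sub>R case_prod g p - indicat_real (I \<times> D) p *\<^sub>R case_prod h p)"
    unfolding F_def by (rule ext) (simp only: scaleR_diff_right)
  moreover have "(\<lambda>p. indicat_real (I \<times> D) p *\<^sub>R case_prod g p) \<in> borel_measurable (lborel \<Otimes>\<^sub>M lborel)"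
    "(\<lambda>p. indicat_real (I \<times> D) p *\<^sub>R case_prod h p) \<in> borel_measurable (lborel \<Otimes>\<^sub>M lborel)"
    using g h by (auto simp: L2_iff sq_integrable_def lborel_prod)
  ultimately have Fm[measurable]: "F \<in> borel_measurable (lborel \<Otimes>\<^sub>M lborel)" by simp
  have "AE p in lborel \<Otimes>\<^sub>M lborel. F p = 0"
  proof (rule lborel_pair.AE_pair_measure)
    show "{p \<in> space (lborel \<Otimes>\<^sub>M lborel). F p = 0} \<in> sets (lborel \<Otimes>\<^sub>M lborel)" by measurable
    show "AE s in lborel. AE x in lborel. F (s, x) = 0"
      using eq
    proof eventually_elim
      fix s assume s: "s \<in> I \<longrightarrow> L2_eq D (g s) (h s)"
      show "AE x in lborel. F (s, x) = 0"
      proof (cases "s \<in> I")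
        case True
        then have "AE x in lborel. x \<in> D \<longrightarrow> g s x = h s x" using s by (simp add: L2_eq_def)
        then show ?thesis by eventually_elim (auto simp: F_def indicator_def)
      qed (simp add: F_def)
    qed
  qed
  then show ?thesis
    unfolding L2_eq_def lborel_prod by eventually_elim (auto simp: F_def)
qed

lemma weak_grad_xt_unique:
  assumes D: "open D" "bounded D" and g: "weak_grad_xt T D v g" "weak_grad_xt T D v g'"
  shows "L2_eq ({0..T} \<times> D) (case_prod g) (case_prod g')"
proof (rule L2_eq_slicesI)
  have "AE s in lborel. s \<in> {0..T} \<longrightarrow> weak_grad D (v s) (g s)"
    "AE s in lborel. s \<in> {0..T} \<longrightarrow> weak_grad D (v s) (g' s)"
    using g by (auto simp: weak_grad_xt_def)
  then show "AE s in lborel. s \<in> {0..T} \<longrightarrow> L2_eq D (g s) (g' s)"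
    by eventually_elim (auto intro: weak_grad_unique[OF D])
qed (use g in \<open>auto simp: weak_grad_xt_def\<close>)

lemma weak_grad_xt_grad_xt:
  assumes "v \<in> L2_H1 T D" shows "weak_grad_xt T D v (grad_xt T D v)"
  using assms unfolding L2_H1_def grad_xt_def by (auto intro: someI_ex[of "weak_grad_xt T D v"])

lemma grad_xt_L2: "v \<in> L2_H1 T D \<Longrightarrow> case_prod (grad_xt T D v) \<in> L2 ({0..T} \<times> D)"
  using weak_grad_xt_grad_xt by (auto simp: weak_grad_xt_def)

lemma weak_grad_xt_linear:
  assumes "weak_grad_xt T D v g" "weak_grad_xt T D w h"
  shows "weak_grad_xt T D (\<lambda>t x. a * v t x + b * w t x) (\<lambda>t x. a *\<^sub>R g t x + b *\<^sub>R h t x)"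
proof -
  have "(\<lambda>p. a *\<^sub>R case_prod g p + b *\<^sub>R case_prod h p) \<in> L2 ({0..T} \<times> D)"
    using assms by (intro L2_add L2_scaleR) (auto simp: weak_grad_xt_def)
  moreover have "case_prod (\<lambda>t x. a *\<^sub>R g t x + b *\<^sub>R h t x) = (\<lambda>p. a *\<^sub>R case_prod g p + b *\<^sub>R case_prod h p)"
    by auto
  moreover have "AE s in lborel. s \<in> {0..T} \<longrightarrow> weak_grad D (v s) (g s)"
    "AE s in lborel. s \<in> {0..T} \<longrightarrow> weak_grad D (w s) (h s)"
    using assms by (auto simp: weak_grad_xt_def)
  then have "AE s in lborel. s \<in> {0..T} \<longrightarrow>
      weak_grad D (\<lambda>x. a * v s x + b * w s x) (\<lambda>x. a *\<^sub>R g s x + b *\<^sub>R h s x)"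
    by eventually_elim (auto intro: weak_grad_linear)
  ultimately show ?thesis by (simp add: weak_grad_xt_def)
qed

lemma L2_H1_linear:
  assumes "v \<in> L2_H1 T D" "w \<in> L2_H1 T D"
  shows "(\<lambda>t x. a * v t x + b * w t x) \<in> L2_H1 T D"
proof -
  have "(\<lambda>p. a * case_prod v p + b * case_prod w p) \<in> L2 ({0..T} \<times> D)"
    using assms by (intro L2_add L2_cmult) (auto simp: L2_H1_def)
  moreover have "case_prod (\<lambda>t x. a * v t x + b * w t x) = (\<lambda>p. a * case_prod v p + b * case_prod w p)"
    by auto
  ultimately show ?thesis
    using weak_grad_xt_linear[OF weak_grad_xt_grad_xt[OF assms(1)] weak_grad_xt_grad_xt[OF assms(2)]]
    by (auto simp: L2_H1_def)
qed

text \<open>The gradient is picked by choice separately for each function, so linearity can hold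
  only up to null sets, by uniqueness of weak gradients on almost every time slice.\<close>

lemma grad_xt_linear:
  assumes D: "open D" "bounded D" and v: "v \<in> L2_H1 T D" and w: "w \<in> L2_H1 T D"
  shows "L2_eq ({0..T} \<times> D) (case_prod (grad_xt T D (\<lambda>t x. a * v t x + b * w t x)))
     (\<lambda>p. a *\<^sub>R case_prod (grad_xt T D v) p + b *\<^sub>R case_prod (grad_xt T D w) p)"
proof -
  have "case_prod (\<lambda>t x. a *\<^sub>R grad_xt T D v t x + b *\<^sub>R grad_xt T D w t x) =
     (\<lambda>p. a *\<^sub>R case_prod (grad_xt T D v) p + b *\<^sub>R case_prod (grad_xt T D w) p)" by auto
  then show ?thesis
    using weak_grad_xt_unique[OF D weak_grad_xt_grad_xt[OF L2_H1_linear[OF v w]]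
        weak_grad_xt_linear[OF weak_grad_xt_grad_xt[OF v] weak_grad_xt_grad_xt[OF w]], of a b]
    by simp
qed

definition grad_functional :: "real \<Rightarrow> 'a::euclidean_space set \<Rightarrow> real \<Rightarrow> ('a \<Rightarrow> real)
    \<Rightarrow> (real \<Rightarrow> 'a \<Rightarrow> real) \<Rightarrow> real" where
  "grad_functional T D t \<phi> v = (LINT s:{0..t}|lborel. L2_inner D (grad_xt T D v s) (wgrad D \<phi>))"

lemma L2_time_cutoff:
  fixes t T :: real
  assumes D: "D \<in> sets borel" and h: "h \<in> L2 D"
  shows "case_prod (\<lambda>s. \<lambda>x. indicat_real {0..t} s *\<^sub>R h x) \<in> L2 ({0..T} \<times> D)"
proof -
  let ?H = "\<lambda>x. indicat_real D x *\<^sub>R h x"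
  have hm[measurable]: "?H \<in> borel_measurable lborel" and hi: "integrable lborel (\<lambda>x. (norm (?H x))\<^sup>2)"
    using h by (auto simp: L2_iff sq_integrable_def)
  have eq: "(\<lambda>p. indicat_real ({0..T} \<times> D) p *\<^sub>R case_prod (\<lambda>s. \<lambda>x. indicat_real {0..t} s *\<^sub>R h x) p) =
     (\<lambda>p. indicat_real {0..min t T} (fst p) *\<^sub>R ?H (snd p))"
    by (auto simp: fun_eq_iff indicator_def min.bounded_iff)
  have "(\<lambda>p. indicat_real {0..min t T} (fst p) *\<^sub>R ?H (snd p)) \<in> borel_measurable (lborel \<Otimes>\<^sub>M lborel)"
    by measurable
  moreover have "integrable (lborel \<Otimes>\<^sub>M lborel) (\<lambda>(s, x). indicat_real {0..min t T} s * (norm (?H x))\<^sup>2)"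
  proof (rule lborel_pair.Fubini_integrable)
    have "integrable lborel (\<lambda>s. indicat_real {0..min t T} s * (\<integral>x. (norm (?H x))\<^sup>2 \<partial>lborel))"
      by (intro integrable_mult_left) (simp add: emeasure_lborel_Icc_eq)
    then show "integrable lborel (\<lambda>s. \<integral>x. norm (case (s, x) of (s, x) \<Rightarrow>
        indicat_real {0..min t T} s * (norm (?H x))\<^sup>2) \<partial>lborel)"
      by (simp add: abs_mult)
  qed (use hi in auto)
  moreover have "(\<lambda>(s, x). indicat_real {0..min t T} s * (norm (?H x))\<^sup>2) =
     (\<lambda>p. (norm (indicat_real {0..min t T} (fst p) *\<^sub>R ?H (snd p)))\<^sup>2)"
    by (auto simp: fun_eq_iff indicator_def power_mult_distrib)
  ultimately show ?thesis unfolding L2_iff sq_integrable_def eq lborel_prod by simp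
qed

text \<open>Multiplying the fixed field \<open>wgrad D \<phi>\<close> by the indicator of [0,t]
  turns the time integral into one inner product on space-time. Boundedness, linearity and
  integrability in time can then be read off.\<close>

lemma grad_functional_inner:
  assumes D: "D \<in> sets borel" and t: "t \<le> T" and v: "v \<in> L2_H1 T D" and \<phi>: "\<phi> \<in> H1 D"
  shows "grad_functional T D t \<phi> v = L2_inner ({0..T} \<times> D) (case_prod (grad_xt T D v))
     (case_prod (\<lambda>s x. indicat_real {0..t} s *\<^sub>R wgrad D \<phi> x))"
    and "set_integrable lborel {0..t} (\<lambda>s. L2_inner D (grad_xt T D v s) (wgrad D \<phi>))"
proof -
  note F = L2_inner_Fubini[OF grad_xt_L2[OF v] L2_time_cutoff[OF D H1_L2(2)[OF \<phi>], of t T]]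
  have eq: "indicat_real {0..T} s *\<^sub>R L2_inner D (grad_xt T D v s) (\<lambda>x. indicat_real {0..t} s *\<^sub>R wgrad D \<phi> x) =
     indicat_real {0..t} s *\<^sub>R L2_inner D (grad_xt T D v s) (wgrad D \<phi>)" for s
    using t by (subst (1 2) L2_inner_commute) (auto simp: L2_inner_scaleR_left indicator_def)
  show "grad_functional T D t \<phi> v = L2_inner ({0..T} \<times> D) (case_prod (grad_xt T D v))
     (case_prod (\<lambda>s x. indicat_real {0..t} s *\<^sub>R wgrad D \<phi> x))"
    using F(1) unfolding grad_functional_def set_lebesgue_integral_def eq by simp
  show "set_integrable lborel {0..t} (\<lambda>s. L2_inner D (grad_xt T D v s) (wgrad D \<phi>))"
    using F(2) unfolding set_integrable_def eq .
qed

text \<open>Membership in the dual space is used twice: it gives Borel measurability on the path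
  space, and it is exactly what weak convergence of \<open>v\<close> can pass to the limit.\<close>

lemma grad_functional_linear_bounded:
  assumes D: "open D" "bounded D" and t: "t \<le> T" and \<phi>: "\<phi> \<in> H1 D"
  shows "L2_H1_functional T D (grad_functional T D t \<phi>)"
proof -
  have Db: "D \<in> sets borel" using D by simp
  let ?h = "case_prod (\<lambda>s x. indicat_real {0..t} s *\<^sub>R wgrad D \<phi> x)"
  have h: "?h \<in> L2 ({0..T} \<times> D)" by (rule L2_time_cutoff[OF Db H1_L2(2)[OF \<phi>]])
  have inner: "grad_functional T D t \<phi> v = L2_inner ({0..T} \<times> D) (case_prod (grad_xt T D v)) ?h"
    if "v \<in> L2_H1 T D" for v by (rule grad_functional_inner[OF Db t that \<phi>])
  show ?thesis
    unfolding L2_H1_functional_def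
  proof (intro conjI ballI allI exI)
    fix v w a b assume v: "v \<in> L2_H1 T D" and w: "w \<in> L2_H1 T D"
    have "grad_functional T D t \<phi> (\<lambda>t x. a * v t x + b * w t x) =
      L2_inner ({0..T} \<times> D) (\<lambda>p. a *\<^sub>R case_prod (grad_xt T D v) p + b *\<^sub>R case_prod (grad_xt T D w) p) ?h"
      unfolding inner[OF L2_H1_linear[OF v w]]
      by (rule L2_inner_cong[OF grad_xt_linear[OF D v w] L2_eq_refl])
         (intro grad_xt_L2 L2_H1_linear v w h L2_add L2_scaleR)+
    also have "\<dots> = a * grad_functional T D t \<phi> v + b * grad_functional T D t \<phi> w"
      by (simp add: L2_inner_add_left[OF L2_scaleR[OF grad_xt_L2[OF v]] L2_scaleR[OF grad_xt_L2[OF w]] h]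
          L2_inner_scaleR_left inner[OF v] inner[OF w])
    finally show "grad_functional T D t \<phi> (\<lambda>t x. a * v t x + b * w t x) =
      a * grad_functional T D t \<phi> v + b * grad_functional T D t \<phi> w" .
  next
    fix v assume v: "v \<in> L2_H1 T D"
    have "\<bar>grad_functional T D t \<phi> v\<bar> \<le>
       L2_norm ({0..T} \<times> D) (case_prod (grad_xt T D v)) * L2_norm ({0..T} \<times> D) ?h"
      unfolding inner[OF v] by (intro L2_Cauchy_Schwarz grad_xt_L2 v h)
    also have "\<dots> \<le> L2_H1_norm T D v * L2_norm ({0..T} \<times> D) ?h"
    proof (rule mult_right_mono[OF _ L2_norm_nonneg])
      show "L2_norm ({0..T} \<times> D) (case_prod (grad_xt T D v)) \<le> L2_H1_norm T D v"
        unfolding L2_H1_norm_def by (rule real_le_rsqrt) simp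
    qed
    finally show "\<bar>grad_functional T D t \<phi> v\<bar> \<le> L2_norm ({0..T} \<times> D) ?h * L2_H1_norm T D v"
      by (simp add: mult.commute)
  qed
qed

lemma L2_H1_functional_measurable:
  assumes l: "L2_H1_functional T D l"
  shows "l \<in> borel_measurable (L2_H1_borel T D)"
  unfolding L2_H1_borel_def
proof (rule pm_borel_continuous_measurable)
  fix v :: "real \<Rightarrow> 'a \<Rightarrow> real" and \<epsilon> :: real assume v: "v \<in> L2_H1 T D" and e: "0 < \<epsilon>"
  obtain C where C: "\<And>v. v \<in> L2_H1 T D \<Longrightarrow> \<bar>l v\<bar> \<le> C * L2_H1_norm T D v"
    using l unfolding L2_H1_functional_def by blast
  let ?C = "\<bar>C\<bar> + 1"
  show "\<exists>\<delta>>0. \<forall>y\<in>L2_H1 T D. L2_H1_norm T D (v - y) < \<delta> \<longrightarrow> \<bar>l y - l v\<bar> < \<epsilon>"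
  proof (intro exI[of _ "\<epsilon> / ?C"] conjI ballI impI)
    fix y assume y: "y \<in> L2_H1 T D" "L2_H1_norm T D (v - y) < \<epsilon> / ?C"
    have eq: "v - y = (\<lambda>t x. 1 * v t x + (-1) * y t x)" by (simp add: fun_eq_iff)
    have "l (v - y) = 1 * l v + (-1) * l y"
      unfolding eq using l v y(1) unfolding L2_H1_functional_def by blast
    then have "\<bar>l y - l v\<bar> = \<bar>l (v - y)\<bar>" by simp
    also have "\<dots> \<le> C * L2_H1_norm T D (v - y)"
      using L2_H1_linear[OF v y(1), of 1 "-1"] by (intro C) (simp add: eq)
    also have "\<dots> \<le> ?C * L2_H1_norm T D (v - y)"
      by (intro mult_right_mono) (auto simp: L2_H1_norm_def)
    also have "\<dots> < \<epsilon>" using y(2) by (simp add: field_simps)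
    finally show "\<bar>l y - l v\<bar> < \<epsilon>" .
  qed (use e in auto)
qed

definition noise_functional :: "real \<Rightarrow> 'a::euclidean_space set \<Rightarrow> real \<Rightarrow> ('a \<Rightarrow> real)
    \<Rightarrow> (real \<Rightarrow> 'a \<Rightarrow> real) \<Rightarrow> (real \<Rightarrow> 'a \<Rightarrow> real) \<Rightarrow> real" where
  "noise_functional T D t \<phi> u v =
     L2_inner D (u t) \<phi> - L2_inner D (u 0) \<phi> + grad_functional T D t \<phi> v"

lemma noise_functional_measurable:
  assumes D: "open D" "bounded D" and t: "t \<in> {0..T}" and \<phi>: "\<phi> \<in> H1 D"
  shows "(\<lambda>p. noise_functional T D t \<phi> (fst p) (snd p)) \<in>
    borel_measurable (C_L2_borel T D \<Otimes>\<^sub>M L2_H1_borel T D)"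
proof -
  have [measurable]: "(\<lambda>u. L2_inner D (u t) \<phi>) \<in> borel_measurable (C_L2_borel T D)"
    "(\<lambda>u. L2_inner D (u 0) \<phi>) \<in> borel_measurable (C_L2_borel T D)"
    using t by (auto intro!: C_L2_inner_measurable H1_L2(1) \<phi>)
  have [measurable]: "grad_functional T D t \<phi> \<in> borel_measurable (L2_H1_borel T D)"
    using t by (intro L2_H1_functional_measurable grad_functional_linear_bounded D \<phi>) auto
  show ?thesis unfolding noise_functional_def by measurable
qed

section \<open>Mollified noise\<close>

text \<open>The derivative is continuous and vanishes off [-1,1], hence it is bounded.\<close>

lemma noise_kernel_Lipschitz:
  assumes "noise_kernel \<rho>"
  shows "\<exists>L\<ge>0. \<forall>x y. \<bar>\<rho> x - \<rho> y\<bar> \<le> L * \<bar>x - y\<bar>"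
proof -
  have C: "Ck_on 1 UNIV \<rho>" and out: "\<And>t. t \<notin> {-1..1} \<Longrightarrow> \<rho> t = 0"
    using assms by (auto simp: noise_kernel_def smooth_fun_on_def)
  have d: "\<rho> differentiable at x" for x using Ck_on_UNIV_D(1)[of 0 \<rho> x] C by simp
  have gc: "continuous_on UNIV (grad \<rho>)"
    unfolding grad_def[abs_def] using C by (intro continuous_intros) auto
  have g0: "grad \<rho> x = 0" if "x \<notin> {-1..1}" for x
  proof (rule grad_eqI)
    have "((\<lambda>x. 0) has_derivative (\<lambda>h. 0 \<bullet> h)) (at x)" by simp
    then show "(\<rho> has_derivative (\<lambda>h. 0 \<bullet> h)) (at x)"
      by (rule has_derivative_transform_within_open[of _ _ _ _ "- {-1..1}"])
        (use that out in \<open>auto intro: open_Compl\<close>)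
  qed
  have "bounded (grad \<rho> ` {-1..1})"
    using gc by (intro compact_imp_bounded compact_continuous_image) (auto intro: continuous_on_subset)
  then obtain L where L: "\<And>x. x \<in> {-1..1} \<Longrightarrow> \<bar>grad \<rho> x\<bar> \<le> L" by (auto simp: bounded_iff simp del: atLeastAtMost_iff)
  have L2: "\<bar>grad \<rho> x\<bar> \<le> \<bar>L\<bar>" for x using L[of x] g0[of x] by (cases "x \<in> {-1..1}") auto
  have "norm (\<rho> x - \<rho> y) \<le> \<bar>L\<bar> * norm (x - y)" for x y
  proof (rule field_differentiable_bound[where S = UNIV and f' = "grad \<rho>"])
    show "(\<rho> has_field_derivative grad \<rho> z) (at z within UNIV)" for z
      using has_derivative_grad[OF d[of z]] by (simp add: has_field_derivative_def)
  qed (use L2 in auto)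
  then show ?thesis by (intro exI[of _ "\<bar>L\<bar>"]) auto
qed

text \<open>Positivity, unit mass and the support radius \<open>a\<close> give convergence of the
  smoothed paths; the Lipschitz condition gives the regularity in time needed to integrate the
  derivative of the smoothed noise.\<close>

definition mollifier :: "real \<Rightarrow> (real \<Rightarrow> real) \<Rightarrow> bool" where
  "mollifier a \<kappa> \<longleftrightarrow> (\<exists>L\<ge>0. \<forall>x y. \<bar>\<kappa> x - \<kappa> y\<bar> \<le> L * \<bar>x - y\<bar>) \<and> (\<forall>x. a < \<bar>x\<bar> \<longrightarrow> \<kappa> x = 0) \<and>
     (\<forall>x. 0 \<le> \<kappa> x) \<and> has_bochner_integral lborel \<kappa> 1"

text \<open>In the Lipschitz constant L/a^2 one factor 1/a comes from the normalisation and one from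
  the rescaled argument.\<close>

lemma mollifier_rescaled_kernel:
  assumes r: "noise_kernel \<rho>" and e: "0 < \<epsilon>"
  shows "mollifier (\<epsilon> powr \<gamma>) (rescaled_kernel \<rho> \<gamma> \<epsilon>)"
proof -
  define a where "a = \<epsilon> powr \<gamma>"
  have a: "0 < a" using e by (simp add: a_def)
  have eq: "rescaled_kernel \<rho> \<gamma> \<epsilon> t = \<rho> (t / a) / a" for t
    by (simp add: rescaled_kernel_def a_def powr_minus divide_inverse)
  obtain L where L: "L \<ge> 0" "\<And>x y. \<bar>\<rho> x - \<rho> y\<bar> \<le> L * \<bar>x - y\<bar>" using noise_kernel_Lipschitz[OF r] by blast
  have lip: "\<bar>\<rho> (x / a) / a - \<rho> (y / a) / a\<bar> \<le> L / a\<^sup>2 * \<bar>x - y\<bar>" for x y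
  proof -
    have "\<bar>\<rho> (x / a) / a - \<rho> (y / a) / a\<bar> = \<bar>\<rho> (x / a) - \<rho> (y / a)\<bar> / a"
      using a by (simp add: diff_divide_distrib[symmetric])
    also have "\<dots> \<le> L * \<bar>x / a - y / a\<bar> / a" using a L(2) by (intro divide_right_mono) auto
    also have "\<dots> = L / a\<^sup>2 * \<bar>x - y\<bar>"
      using a by (simp add: diff_divide_distrib[symmetric] power2_eq_square)
    finally show ?thesis .
  qed
  have int1: "(\<integral>t. \<rho> t \<partial>lborel) = 1" using r by (simp add: noise_kernel_def)
  \<comment> \<open>The integral of a function that is not integrable is 0 by convention, so the
    value 1 already shows integrability.\<close>
  then have int: "integrable lborel \<rho>" using not_integrable_integral_eq by force
  have "has_bochner_integral lborel (\<lambda>t. \<rho> (t / a) / a) 1"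
  proof -
    have "integrable lborel (\<lambda>t. \<rho> (0 + (1 / a) * t))"
      using lborel_integrable_real_affine[OF int, of "1 / a" 0] a by simp
    moreover have "(\<integral>t. \<rho> t \<partial>lborel) = \<bar>1 / a\<bar> *\<^sub>R (\<integral>t. \<rho> (0 + (1 / a) * t) \<partial>lborel)"
      using a by (intro lborel_integral_real_affine) auto
    ultimately show ?thesis using a int1 by (simp add: has_bochner_integral_iff)
  qed
  moreover have "\<rho> (x / a) = 0" if "a < \<bar>x\<bar>" for x
  proof -
    have "x / a \<notin> {-1..1}" using that a by (auto simp: field_simps abs_if split: if_splits)
    then show ?thesis using r unfolding noise_kernel_def by blast
  qed
  moreover have "0 \<le> \<rho> x" for x using r by (simp add: noise_kernel_def)
  ultimately show ?thesis
    unfolding mollifier_def a_def[symmetric] eq using a lip L(1)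
    by (auto intro!: exI[of _ "L / a\<^sup>2"])
qed

text \<open>For t and t' in [-R,R] the difference of the two shifted kernels vanishes off the
  compact interval \<open>?K\<close>, on which \<open>c\<close> is bounded.\<close>

lemma mollified_local_Lipschitz:
  assumes m: "mollifier a \<kappa>" and c: "continuous_on UNIV c"
    and g: "\<And>t. has_bochner_integral lborel (\<lambda>s. \<kappa> (t - s) * c s) (g t)"
  shows "\<exists>M\<ge>0. \<forall>t\<in>{-R..R}. \<forall>t'\<in>{-R..R}. \<bar>g t - g t'\<bar> \<le> M * \<bar>t - t'\<bar>"
proof -
  obtain L where L: "L \<ge> 0" "\<And>x y. \<bar>\<kappa> x - \<kappa> y\<bar> \<le> L * \<bar>x - y\<bar>" and out: "\<And>x. a < \<bar>x\<bar> \<Longrightarrow> \<kappa> x = 0"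
    using m unfolding mollifier_def by blast
  let ?K = "{- (\<bar>R\<bar> + \<bar>a\<bar>)..\<bar>R\<bar> + \<bar>a\<bar>}"
  have "bounded (c ` ?K)"
    using c by (intro compact_imp_bounded compact_continuous_image) (auto intro: continuous_on_subset)
  then obtain B where B: "\<And>x. x \<in> ?K \<Longrightarrow> \<bar>c x\<bar> \<le> B" by (auto simp: bounded_iff simp del: atLeastAtMost_iff)
  have iK: "integrable lborel (\<lambda>s. q * indicat_real ?K s)" for q
    by (intro integrable_mult_right) (simp add: emeasure_lborel_Icc_eq)
  define M where "M = L * \<bar>B\<bar> * (\<integral>s. indicator ?K s \<partial>lborel)"
  show ?thesis
  proof (intro exI[of _ M] conjI ballI)
    show "0 \<le> M" using L(1) by (auto simp: M_def intro!: mult_nonneg_nonneg)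
    fix t t' assume t: "t \<in> {-R..R}" "t' \<in> {-R..R}"
    have "has_bochner_integral lborel (\<lambda>s. \<kappa> (t - s) * c s - \<kappa> (t' - s) * c s) (g t - g t')"
      by (intro has_bochner_integral_diff g)
    then have "g t - g t' = (\<integral>s. \<kappa> (t - s) * c s - \<kappa> (t' - s) * c s \<partial>lborel)"
      and i: "integrable lborel (\<lambda>s. \<kappa> (t - s) * c s - \<kappa> (t' - s) * c s)"
      by (auto simp: has_bochner_integral_iff)
    then have "\<bar>g t - g t'\<bar> \<le> (\<integral>s. \<bar>\<kappa> (t - s) * c s - \<kappa> (t' - s) * c s\<bar> \<partial>lborel)"
      by (simp add: integral_abs_bound)
    also have "\<dots> \<le> (\<integral>s. L * \<bar>t - t'\<bar> * \<bar>B\<bar> * indicator ?K s \<partial>lborel)"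
    proof (rule integral_mono[OF integrable_abs[OF i] iK])
      fix s
      show "\<bar>\<kappa> (t - s) * c s - \<kappa> (t' - s) * c s\<bar> \<le> L * \<bar>t - t'\<bar> * \<bar>B\<bar> * indicator ?K s"
      proof (cases "s \<in> ?K")
        case True
        have "\<bar>\<kappa> (t - s) * c s - \<kappa> (t' - s) * c s\<bar> = \<bar>\<kappa> (t - s) - \<kappa> (t' - s)\<bar> * \<bar>c s\<bar>"
          by (simp add: left_diff_distrib[symmetric] abs_mult)
        also have "\<dots> \<le> (L * \<bar>t - t'\<bar>) * \<bar>B\<bar>"
          using L(1) L(2)[of "t - s" "t' - s"] B[OF True] by (intro mult_mono) auto
        finally show ?thesis using True by simp
      next
        case False
        then have "a < \<bar>t - s\<bar>" "a < \<bar>t' - s\<bar>" using t by auto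
        then show ?thesis using out False by simp
      qed
    qed
    also have "\<dots> = M * \<bar>t - t'\<bar>" by (simp add: M_def)
    finally show "\<bar>g t - g t'\<bar> \<le> M * \<bar>t - t'\<bar>" .
  qed
qed

text \<open>Unit mass allows \<open>c t\<close> to be written under the same integral; once the
  support radius is below the modulus of continuity of \<open>c\<close> at t, the integrand is at
  most r/2 times the kernel.\<close>

lemma mollified_tendsto:
  assumes m: "\<And>k. mollifier (a k) (\<kappa> k)" and a: "a \<longlonglongrightarrow> 0" and c: "continuous_on UNIV c"
    and g: "\<And>k. has_bochner_integral lborel (\<lambda>s. \<kappa> k (t - s) * c s) (g k)"
  shows "g \<longlonglongrightarrow> c t"
proof (rule LIMSEQ_I)
  fix r :: real assume "0 < r"
  then obtain d where d: "0 < d" "\<And>s. \<bar>s - t\<bar> < d \<Longrightarrow> \<bar>c s - c t\<bar> < r / 2"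
    using c unfolding continuous_on_iff dist_real_def by (metis UNIV_I half_gt_zero)
  from a d(1) have "eventually (\<lambda>k. a k < d) sequentially" by (rule order_tendstoD)
  then have "eventually (\<lambda>k. norm (g k - c t) < r) sequentially"
  proof eventually_elim
    fix k assume k: "a k < d"
    have out: "\<And>x. a k < \<bar>x\<bar> \<Longrightarrow> \<kappa> k x = 0" and pos: "\<And>x. 0 \<le> \<kappa> k x"
      and i: "integrable lborel (\<kappa> k)" "(\<integral>s. \<kappa> k s \<partial>lborel) = 1"
      using m[of k] by (auto simp: mollifier_def has_bochner_integral_iff)
    have i': "integrable lborel (\<lambda>s. \<kappa> k (t - s))"
      using lborel_integrable_real_affine[OF i(1), of "-1" t] by simp
    have i1: "(\<integral>s. \<kappa> k (t - s) \<partial>lborel) = 1"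
      using lborel_integral_real_affine[of "-1" "\<kappa> k" t] i(2) by simp
    have gi: "integrable lborel (\<lambda>s. \<kappa> k (t - s) * c s)" "g k = (\<integral>s. \<kappa> k (t - s) * c s \<partial>lborel)"
      using g[of k] by (auto simp: has_bochner_integral_iff)
    have "g k - c t = (\<integral>s. \<kappa> k (t - s) * c s - \<kappa> k (t - s) * c t \<partial>lborel)"
      using gi i' i1 by simp
    then have "\<bar>g k - c t\<bar> \<le> (\<integral>s. \<bar>\<kappa> k (t - s) * c s - \<kappa> k (t - s) * c t\<bar> \<partial>lborel)"
      by (simp add: integral_abs_bound)
    also have "\<dots> \<le> (\<integral>s. \<kappa> k (t - s) * (r / 2) \<partial>lborel)"
    proof (rule integral_mono)
      fix s
      show "\<bar>\<kappa> k (t - s) * c s - \<kappa> k (t - s) * c t\<bar> \<le> \<kappa> k (t - s) * (r / 2)"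
      proof (cases "\<bar>s - t\<bar> < d")
        case True
        have "\<bar>\<kappa> k (t - s) * c s - \<kappa> k (t - s) * c t\<bar> = \<kappa> k (t - s) * \<bar>c s - c t\<bar>"
          using pos by (simp add: right_diff_distrib[symmetric] abs_mult)
        also have "\<dots> \<le> \<kappa> k (t - s) * (r / 2)" using d(2)[OF True] pos by (intro mult_left_mono) auto
        finally show ?thesis .
      next
        case False
        then have "\<kappa> k (t - s) = 0" using k by (intro out) auto
        then show ?thesis by simp
      qed
    qed (use i' gi in auto)
    also have "\<dots> = r / 2" using i1 by simp
    finally show "norm (g k - c t) < r" using \<open>0 < r\<close> by simp
  qed
  then show "\<exists>no. \<forall>k\<ge>no. norm (g k - c t) < r" by (simp add: eventually_sequentially)
qed

text \<open>As \<open>d\<close> need not be continuous, the fundamental theorem for the gauge integral is used; the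
  Lipschitz bound then makes \<open>d\<close> Lebesgue integrable.\<close>

lemma locally_Lipschitz_FTC:
  fixes g d :: "real \<Rightarrow> real"
  assumes g: "\<And>t. (g has_real_derivative d t) (at t)" and t: "0 \<le> t"
    and M: "\<And>x y. x \<in> {-(t+1)..t+1} \<Longrightarrow> y \<in> {-(t+1)..t+1} \<Longrightarrow> \<bar>g x - g y\<bar> \<le> M * \<bar>x - y\<bar>"
  shows "set_integrable lborel {0..t} d" "(LINT s:{0..t}|lborel. d s) = g t - g 0"
proof -
  define s where "s n = inverse (real (Suc n))" for n
  have s: "0 < s n" "s n \<le> 1" for n by (auto simp: s_def inverse_le_1_iff)
  have sl: "filterlim s (at 0) sequentially"
    unfolding s_def by (intro filterlim_atI LIMSEQ_inverse_real_of_nat) auto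
  have lim: "(\<lambda>n. (g (x + s n) - g x) / s n) \<longlonglongrightarrow> d x" for x
    using g[of x] unfolding DERIV_def by (rule filterlim_compose[OF _ sl])
  have gm[measurable]: "g \<in> borel_measurable borel"
    using g by (intro borel_measurable_continuous_onI continuous_at_imp_continuous_on) (auto intro: DERIV_isCont)
  have dm: "d \<in> borel_measurable borel"
    by (rule borel_measurable_LIMSEQ_real[OF lim]) measurable
  \<comment> \<open>The quotient evaluates \<open>g\<close> at distance at most 1 from x; this is
    why the Lipschitz bound is required on an interval enlarged by one.\<close>
  have bd: "\<bar>d x\<bar> \<le> M" if "x \<in> {0..t}" for x
  proof (rule LIMSEQ_le_const2[OF tendsto_rabs[OF lim]], intro exI[of _ 0] allI impI)
    fix n
    have "\<bar>g (x + s n) - g x\<bar> \<le> M * \<bar>x + s n - x\<bar>" using that s[of n] by (intro M) auto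
    then show "\<bar>(g (x + s n) - g x) / s n\<bar> \<le> M"
      using s[of n] by (simp add: abs_divide divide_le_eq)
  qed
  show i: "set_integrable lborel {0..t} d"
    unfolding set_integrable_def
  proof (rule Bochner_Integration.integrable_bound[where f = "\<lambda>x. M * indicator {0..t} x"])
    show "integrable lborel (\<lambda>x. M * indicat_real {0..t} x)"
      by (intro integrable_mult_right) (simp add: emeasure_lborel_Icc_eq)
    show "AE x in lborel. norm (indicat_real {0..t} x *\<^sub>R d x) \<le> norm (M * indicat_real {0..t} x)"
      using bd by (intro AE_I2) (auto simp: indicator_def intro: order_trans[OF _ abs_ge_self])
  qed (use dm in auto)
  have "(d has_integral (g t - g 0)) {0..t}"
    using g t by (intro fundamental_theorem_of_calculus)
      (auto simp: has_real_derivative_iff_has_vector_derivative[symmetric] intro: DERIV_subset)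
  then show "(LINT s:{0..t}|lborel. d s) = g t - g 0"
    using set_borel_integral_eq_integral(2)[OF i] by (simp add: integral_unique)
qed

lemma has_L2_derivative_inner:
  assumes w: "\<And>t. w t \<in> L2 D" and d: "has_L2_derivative D w w' t" and h: "h \<in> L2 D"
  shows "((\<lambda>s. L2_inner D (w s) h) has_real_derivative L2_inner D w' h) (at t)"
proof -
  have w': "w' \<in> L2 D" and l: "((\<lambda>k. L2_norm D (\<lambda>x. (w (t + k) x - w t x) / k - w' x)) \<longlongrightarrow> 0) (at 0)"
    using d by (auto simp: has_L2_derivative_def)
  have q: "(\<lambda>x. (w (t + k) x - w t x) / k) \<in> L2 D" for k
    using L2_cmult[OF L2_diff[OF w w], of "1 / k" "t + k" t] by simp
  have "L2_inner D (\<lambda>x. (w (t + k) x - w t x) / k) h = (L2_inner D (w (t + k)) h - L2_inner D (w t) h) / k" for k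
    using L2_inner_cmult_left[of D "1 / k" "\<lambda>x. w (t + k) x - w t x" h]
    by (simp add: L2_inner_diff_left[OF w w h])
  moreover have "((\<lambda>k. L2_inner D (\<lambda>x. (w (t + k) x - w t x) / k) h) \<longlongrightarrow> L2_inner D w' h) (at 0)"
    using l q by (intro L2_inner_tendsto[OF _ w' h]) (auto simp: fun_diff_def)
  ultimately show ?thesis unfolding DERIV_def by simp
qed

subsection \<open>The weak equation expresses the mollified noise\<close>

text \<open>Moving the gradient term of the integrated equation to the left leaves the time integral
  of the noise. The noise is the derivative of the mollified Wiener path, so the fundamental theorem
  turns that integral into an increment.\<close>

lemma noise_functional_RCH:
  assumes D: "open D" "bounded D" and sol: "RCH_solution T D \<epsilon> u0 \<xi> u v" and m: "mollifier a \<kappa>"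
    and w: "\<And>t. w t \<in> L2 D" "\<And>t. ((\<lambda>s. L2_norm D (w s - w t)) \<longlongrightarrow> 0) (at t)"
    and W: "\<And>t. has_L2_integral D (\<lambda>s x. \<kappa> (t - s) * w s x) (W t)"
    and \<xi>: "\<And>t. has_L2_derivative D W (\<xi> t) t"
    and t: "t \<in> {0..T}" and \<phi>: "\<phi> \<in> H1 D"
  shows "noise_functional T D t \<phi> u v = L2_inner D (W t) \<phi> - L2_inner D (W 0) \<phi>"
proof -
  have \<phi>L: "\<phi> \<in> L2 D" using H1_L2(1)[OF \<phi>] .
  have WL: "W t \<in> L2 D" for t using W by (auto simp: has_L2_integral_def)
  have c: "continuous_on UNIV (\<lambda>s. L2_inner D (w s) \<phi>)"
    by (intro L2_inner_path_continuous w \<phi>L)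
  have "has_bochner_integral lborel (\<lambda>s. \<kappa> (t - s) * L2_inner D (w s) \<phi>) (L2_inner D (W t) \<phi>)" for t
    using W[of t] \<phi>L unfolding has_L2_integral_def L2_inner_cmult_left by blast
  from mollified_local_Lipschitz[OF m c this, of "t + 1"] obtain M where
    M: "\<And>x y. x \<in> {-(t+1)..t+1} \<Longrightarrow> y \<in> {-(t+1)..t+1} \<Longrightarrow>
       \<bar>L2_inner D (W x) \<phi> - L2_inner D (W y) \<phi>\<bar> \<le> M * \<bar>x - y\<bar>"
    by blast
  have t0: "0 \<le> t" "t \<le> T" using t by auto
  have FTC: "set_integrable lborel {0..t} (\<lambda>s. L2_inner D (\<xi> s) \<phi>)"
    "(LINT s:{0..t}|lborel. L2_inner D (\<xi> s) \<phi>) = L2_inner D (W t) \<phi> - L2_inner D (W 0) \<phi>"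
    by (rule locally_Lipschitz_FTC[OF has_L2_derivative_inner[OF WL \<xi> \<phi>L] t0(1)], erule (1) M)+
  have v: "v \<in> L2_H1 T D" using sol by (simp add: RCH_solution_def)
  have gi: "set_integrable lborel {0..t} (\<lambda>s. L2_inner D (grad_xt T D v s) (wgrad D \<phi>))"
    using D by (intro grad_functional_inner(2)[OF _ t0(2) v \<phi>]) auto
  have eq: "L2_inner D (u t) \<phi> = L2_inner D u0 \<phi> +
      (LINT s:{0..t}|lborel. - L2_inner D (grad_xt T D v s) (wgrad D \<phi>) + L2_inner D (\<xi> s) \<phi>)"
    if "t \<in> {0..T}" for t
    using sol \<phi> that unfolding RCH_solution_def by blast
  \<comment> \<open>Evaluating the equation at time 0 shows that \<open>u 0\<close> and the initial
    datum have the same pairing with \<open>\<phi>\<close>, which is needed because the functional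
    starts from \<open>u 0\<close>.\<close>
  have "(LINT s:{0::real..0}|lborel. k s) = 0" for k :: "real \<Rightarrow> real"
    unfolding set_lebesgue_integral_def
  proof (rule integral_eq_zero_AE)
    have "AE s in lborel. s \<noteq> (0::real)" by (rule AE_lborel_singleton)
    then show "AE s in lborel. indicat_real {0..0} s *\<^sub>R k s = 0" by eventually_elim auto
  qed
  then have "L2_inner D (u 0) \<phi> = L2_inner D u0 \<phi>" using eq[of 0] t0 by simp
  moreover have "(LINT s:{0..t}|lborel. - L2_inner D (grad_xt T D v s) (wgrad D \<phi>) + L2_inner D (\<xi> s) \<phi>) =
     - grad_functional T D t \<phi> v + (L2_inner D (W t) \<phi> - L2_inner D (W 0) \<phi>)"
    unfolding grad_functional_def FTC(2)[symmetric] set_integral_uminus[OF gi, symmetric]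
    using gi by (intro set_integral_add(2) FTC(1)) (simp add: set_integrable_def)
  ultimately show ?thesis using eq[OF t] by (simp add: noise_functional_def)
qed

section \<open>Passing to the limit in law\<close>

text \<open>Almost sure convergence passes expectations of bounded continuous functions to the limit
  on both spaces, and these determine the law. It is stated for metric spaces so that it applies to
  real sequences, with countably many pairs (t, \<phi>) treated jointly.\<close>

lemma distr_limit_eq:
  fixes X :: "nat \<Rightarrow> 'w \<Rightarrow> 'b::metric_space" and Y :: "nat \<Rightarrow> 'v \<Rightarrow> 'b"
  assumes M: "prob_space M" and N: "prob_space N"
    and X[measurable]: "\<And>k. X k \<in> borel_measurable M" "X' \<in> borel_measurable M"
    and Y[measurable]: "\<And>k. Y k \<in> borel_measurable N" "Y' \<in> borel_measurable N"
    and eq: "\<And>k. distr M borel (X k) = distr N borel (Y k)"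
    and Xl: "AE \<omega> in M. (\<lambda>k. X k \<omega>) \<longlonglongrightarrow> X' \<omega>" and Yl: "AE \<omega> in N. (\<lambda>k. Y k \<omega>) \<longlonglongrightarrow> Y' \<omega>"
  shows "distr M borel X' = distr N borel Y'"
proof -
  interpret M: prob_space M by fact
  interpret N: prob_space N by fact
  interpret X': prob_space "distr M borel X'" by (rule M.prob_space_distr) measurable
  interpret Y': prob_space "distr N borel Y'" by (rule N.prob_space_distr) measurable
  have closed: "emeasure (distr M borel X') C = emeasure (distr N borel Y') C" if C: "closed C" for C
  proof (cases "C = {}")
    case False
    \<comment> \<open>These continuous functions decrease to the indicator of the closed set
      \<open>C\<close> as \<open>m\<close> grows.\<close>
    define f where "f m x = max 0 (1 - real m * infdist x C)" for m :: nat and x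
    have fc: "continuous_on UNIV (f m)" for m unfolding f_def by (intro continuous_intros)
    then have fm[measurable]: "f m \<in> borel_measurable borel" for m by (intro borel_measurable_continuous_onI)
    have fb: "norm (f m x) \<le> 1" for m x by (auto simp: f_def infdist_nonneg)
    have fl: "(\<lambda>m. f m x) \<longlonglongrightarrow> indicator C x" for x
    proof (cases "x \<in> C")
      case True
      then show ?thesis by (simp add: f_def)
    next
      case F: False
      then have pos: "0 < infdist x C" using in_closed_iff_infdist_zero[OF C False] infdist_nonneg[of x C] by auto
      obtain m0 :: nat where m0: "1 / infdist x C < real m0" using reals_Archimedean2 by blast
      have "f m x = 0" if "m \<ge> m0" for m
      proof -
        have "1 / infdist x C \<le> real m" using m0 that by linarith
        then show ?thesis using pos by (simp add: f_def divide_le_eq)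
      qed
      then have "eventually (\<lambda>m. f m x = indicator C x) sequentially"
        using F unfolding eventually_sequentially by auto
      then show ?thesis by (rule tendsto_eventually)
    qed
    have Ef: "(\<integral>\<omega>. f m (X' \<omega>) \<partial>M) = (\<integral>\<omega>. f m (Y' \<omega>) \<partial>N)" for m
    proof (rule LIMSEQ_unique)
      show "(\<lambda>k. \<integral>\<omega>. f m (X k \<omega>) \<partial>M) \<longlonglongrightarrow> (\<integral>\<omega>. f m (X' \<omega>) \<partial>M)"
      proof (rule integral_dominated_convergence[where w = "\<lambda>_. 1"])
        show "AE \<omega> in M. (\<lambda>k. f m (X k \<omega>)) \<longlonglongrightarrow> f m (X' \<omega>)"
          using Xl by eventually_elim (auto intro: continuous_on_tendsto_compose[OF fc])
      qed (auto simp: fb[simplified])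
      have "(\<integral>\<omega>. f m (X k \<omega>) \<partial>M) = (\<integral>\<omega>. f m (Y k \<omega>) \<partial>N)" for k
        using integral_distr[OF X(1)[of k] fm[of m]] integral_distr[OF Y(1)[of k] fm[of m]] eq[of k] by simp
      moreover have "(\<lambda>k. \<integral>\<omega>. f m (Y k \<omega>) \<partial>N) \<longlonglongrightarrow> (\<integral>\<omega>. f m (Y' \<omega>) \<partial>N)"
      proof (rule integral_dominated_convergence[where w = "\<lambda>_. 1"])
        show "AE \<omega> in N. (\<lambda>k. f m (Y k \<omega>)) \<longlonglongrightarrow> f m (Y' \<omega>)"
          using Yl by eventually_elim (auto intro: continuous_on_tendsto_compose[OF fc])
      qed (auto simp: fb[simplified])
      ultimately show "(\<lambda>k. \<integral>\<omega>. f m (X k \<omega>) \<partial>M) \<longlonglongrightarrow> (\<integral>\<omega>. f m (Y' \<omega>) \<partial>N)" by simp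
    qed
    have Cm[measurable]: "C \<in> sets borel" using C by (rule borel_closed)
    have lM: "(\<lambda>m. \<integral>\<omega>. f m (X' \<omega>) \<partial>M) \<longlonglongrightarrow> (\<integral>\<omega>. indicat_real C (X' \<omega>) \<partial>M)"
      by (rule integral_dominated_convergence[where w = "\<lambda>_. 1"]) (auto simp: fb[simplified] fl)
    have lN: "(\<lambda>m. \<integral>\<omega>. f m (Y' \<omega>) \<partial>N) \<longlonglongrightarrow> (\<integral>\<omega>. indicat_real C (Y' \<omega>) \<partial>N)"
      by (rule integral_dominated_convergence[where w = "\<lambda>_. 1"]) (auto simp: fb[simplified] fl)
    have "(\<integral>\<omega>. indicat_real C (X' \<omega>) \<partial>M) = (\<integral>\<omega>. indicat_real C (Y' \<omega>) \<partial>N)"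
      using LIMSEQ_unique[OF lM[unfolded Ef] lN] .
    then have "measure (distr M borel X') C = measure (distr N borel Y') C"
      using integral_distr[OF X(2), of "indicat_real C"] integral_distr[OF Y(2), of "indicat_real C"] by simp
    then show ?thesis by (simp add: X'.emeasure_eq_measure Y'.emeasure_eq_measure)
  qed simp
  show ?thesis
  proof (rule measure_eqI_generator_eq[where E = "Collect closed" and \<Omega> = UNIV and A = "\<lambda>_. UNIV"])
    show "sets (distr M borel X') = sigma_sets UNIV (Collect closed)"
      "sets (distr N borel Y') = sigma_sets UNIV (Collect closed)"
      by (simp_all add: borel_eq_closed)
  qed (auto simp: closed Int_stable_def)
qed

section \<open>Uniform continuity of paths\<close>

text \<open>Heine-Cantor for the L^2 distance, by extracting a convergent subsequence from a
  sequence of counterexamples. The modulus is written as 1/(N+1) so that it is a condition with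
  quantifiers over the natural numbers.\<close>

lemma L2_path_uniformly_continuous:
  assumes u: "\<And>t. t \<in> {0..T} \<Longrightarrow> u t \<in> L2 D"
    and c: "\<And>t. t \<in> {0..T} \<Longrightarrow> ((\<lambda>s. L2_norm D (u s - u t)) \<longlongrightarrow> 0) (at t within {0..T})"
    and e: "0 < \<epsilon>"
  shows "\<exists>N::nat. \<forall>s\<in>{0..T}. \<forall>t\<in>{0..T}. \<bar>s - t\<bar> < 1 / real (Suc N) \<longrightarrow> L2_norm D (u s - u t) < \<epsilon>"
proof (rule ccontr)
  assume "\<not> ?thesis"
  then have "\<forall>n. \<exists>s\<in>{0..T}. \<exists>t\<in>{0..T}. \<bar>s - t\<bar> < 1 / real (Suc n) \<and> \<epsilon> \<le> L2_norm D (u s - u t)"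
    by (meson linorder_not_less)
  then obtain s t where st: "\<And>n. s n \<in> {0..T}" "\<And>n. t n \<in> {0..T}"
    "\<And>n. \<bar>s n - t n\<bar> < 1 / real (Suc n)" "\<And>n. \<epsilon> \<le> L2_norm D (u (s n) - u (t n))"
    by metis
  have "compact {0..T}" by simp
  then obtain l r where l: "l \<in> {0..T}" "strict_mono r" "(s \<circ> r) \<longlonglongrightarrow> l"
    unfolding compact_def using st(1) by metis
  have sl: "(\<lambda>n. s (r n)) \<longlonglongrightarrow> l" using l(3) by (simp add: o_def)
  have "(\<lambda>n. t n - s n) \<longlonglongrightarrow> 0"
    using st(3) by (intro Lim_null_comparison[OF _ LIMSEQ_inverse_real_of_nat] always_eventually)
      (auto simp: inverse_eq_divide abs_minus_commute intro: less_imp_le)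
  then have "(\<lambda>n. t (r n) - s (r n)) \<longlonglongrightarrow> 0" using LIMSEQ_subseq_LIMSEQ[OF _ l(2)] by (force simp: o_def)
  from tendsto_add[OF this sl] have tl: "(\<lambda>n. t (r n)) \<longlonglongrightarrow> l" by simp
  have ll: "L2_norm D (u l - u l) = 0"
    using L2_norm_zero_iff[OF L2_zero[of D]] by (simp add: fun_diff_def L2_eq_def)
  have cl: "continuous_on {0..T} (\<lambda>s. L2_norm D (u s - u l))"
    unfolding continuous_on_def
  proof
    fix x assume x: "x \<in> {0..T}"
    show "((\<lambda>s. L2_norm D (u s - u l)) \<longlongrightarrow> L2_norm D (u x - u l)) (at x within {0..T})"
      by (rule L2_norm_diff_continuous[where w = "\<lambda>_. u l", OF u u[OF l(1)] c[OF x] _ x])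
        (simp_all add: ll del: minus_apply)
  qed
  have "(\<lambda>n. L2_norm D (u (s (r n)) - u l)) \<longlonglongrightarrow> 0"
    using continuous_on_tendsto_compose[OF cl sl l(1)] st(1) ll by simp
  moreover have "(\<lambda>n. L2_norm D (u (t (r n)) - u l)) \<longlonglongrightarrow> 0"
    using continuous_on_tendsto_compose[OF cl tl l(1)] st(2) ll by simp
  ultimately have "(\<lambda>n. L2_norm D (u (s (r n)) - u l) + L2_norm D (u (t (r n)) - u l)) \<longlonglongrightarrow> 0 + 0"
    by (rule tendsto_add)
  moreover have "\<epsilon> \<le> L2_norm D (u (s (r n)) - u l) + L2_norm D (u (t (r n)) - u l)" for n
    using st(4)[of "r n"] L2_dist_triangle[OF u[OF st(1)] u[OF l(1)] u[OF st(2)], of "r n" "r n"]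
      L2_norm_minus_commute[of D "u l" "u (t (r n))"] by simp
  ultimately have "\<epsilon> \<le> 0 + 0" by (intro LIMSEQ_le_const) auto
  then show False using e by simp
qed

section \<open>Transfer of the Wiener process\<close>

lemma Q_Wiener_process_L2:
  "Q_Wiener_process D Q M I W \<Longrightarrow> t \<in> I \<Longrightarrow> \<omega> \<in> space M \<Longrightarrow> W t \<omega> \<in> L2 D"
  using measurable_space[of "W t" M "L2_borel D" \<omega>] by (auto simp: Q_Wiener_process_def space_L2_borel)

lemma Q_Wiener_process_inner_measurable:
  assumes W: "Q_Wiener_process D Q M I W" and t: "s \<in> I" "t \<in> I" and h: "h \<in> L2 D"
  shows "(\<lambda>\<omega>. L2_inner D (W t \<omega> - W s \<omega>) h) \<in> borel_measurable M"
proof -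
  have "(\<lambda>\<omega>. L2_inner D (W r \<omega>) h) \<in> borel_measurable M" if "r \<in> I" for r
    using W that by (intro measurable_compose[OF _ L2_inner_measurable[OF h]]) (auto simp: Q_Wiener_process_def)
  then have "(\<lambda>\<omega>. L2_inner D (W t \<omega>) h - L2_inner D (W s \<omega>) h) \<in> borel_measurable M"
    using t by (intro borel_measurable_diff)
  then show ?thesis
    by (subst measurable_cong[where g = "\<lambda>\<omega>. L2_inner D (W t \<omega>) h - L2_inner D (W s \<omega>) h"])
      (use Q_Wiener_process_L2[OF W] t h in \<open>auto simp: L2_inner_diff_left'\<close>)
qed

text \<open>\<open>Z t \<phi>\<close> plays the role of \<open>\<langle>W'\<^sub>t, \<phi>\<rangle>\<close>: for \<open>\<phi>\<close> in $H^1$ it is read off the limit equation, and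
  it has the joint law of the increments of the given \<open>Q\<close>-Wiener process \<open>W\<close>.\<close>

locale wiener_transfer =
  fixes D :: "'a::euclidean_space set" and T :: real and Q :: "('a \<Rightarrow> real) \<Rightarrow> 'a \<Rightarrow> real"
    and P :: "'w measure" and W :: "real \<Rightarrow> 'w \<Rightarrow> 'a \<Rightarrow> real"
    and P' :: "'v measure" and Z :: "real \<Rightarrow> ('a \<Rightarrow> real) \<Rightarrow> 'v \<Rightarrow> real"
    and e :: "nat \<Rightarrow> 'a \<Rightarrow> real"
  assumes T: "0 < T"
    and P: "prob_space P" and P': "prob_space P'"
    and W: "Q_Wiener_process D Q P UNIV W"
    and e: "orthonormal_basis D e" and eH: "\<And>k. e k \<in> H1 D"
    and Z_law: "\<And>\<tau> \<phi>. (\<And>n::nat. \<tau> n \<in> {0..T}) \<Longrightarrow> (\<And>n. \<phi> n \<in> H1 D) \<Longrightarrow>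
      distr P' borel (\<lambda>\<omega> n. Z (\<tau> n) (\<phi> n) \<omega>) =
      distr P borel (\<lambda>\<omega> n. L2_inner D (W (\<tau> n) \<omega> - W 0 \<omega>) (\<phi> n))"
    and Z_measurable: "\<And>t \<phi>. t \<in> {0..T} \<Longrightarrow> \<phi> \<in> H1 D \<Longrightarrow> Z t \<phi> \<in> borel_measurable P'"
    and Z_continuous: "AE \<omega> in P'. \<forall>\<phi>\<in>H1 D. continuous_on {0..T} (\<lambda>t. Z t \<phi> \<omega>)"
    and Z_0: "AE \<omega> in P'. \<forall>\<phi>\<in>H1 D. Z 0 \<phi> \<omega> = 0"
begin

lemma eL: "e k \<in> L2 D" and eo: "L2_inner D (e j) (e k) = (if j = k then 1 else 0)"
  using e by (auto simp: orthonormal_basis_def)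

lemma W_L2: "\<omega> \<in> space P \<Longrightarrow> W t \<omega> \<in> L2 D"
  by (rule Q_Wiener_process_L2[OF W UNIV_I])

lemma W_inner_measurable:
  "h \<in> L2 D \<Longrightarrow> (\<lambda>\<omega>. L2_inner D (W t \<omega> - W s \<omega>) h) \<in> borel_measurable P"
  by (rule Q_Wiener_process_inner_measurable[OF W UNIV_I UNIV_I])

lemma transfer_measurable:
  assumes "\<And>n::nat. \<tau> n \<in> {0..T}" "\<And>n. \<phi> n \<in> H1 D"
  shows "(\<lambda>\<omega> n. Z (\<tau> n) (\<phi> n) \<omega>) \<in> borel_measurable P'"
    "(\<lambda>\<omega> n. L2_inner D (W (\<tau> n) \<omega> - W 0 \<omega>) (\<phi> n)) \<in> borel_measurable P"
proof -
  show "(\<lambda>\<omega> n. Z (\<tau> n) (\<phi> n) \<omega>) \<in> borel_measurable P'"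
    by (rule measurable_coordinatewise_then_product) (rule Z_measurable, (rule assms)+)
  show "(\<lambda>\<omega> n. L2_inner D (W (\<tau> n) \<omega> - W 0 \<omega>) (\<phi> n)) \<in> borel_measurable P"
    by (rule measurable_coordinatewise_then_product) (rule W_inner_measurable, rule H1_L2(1), rule assms(2))
qed

lemma transfer_measure:
  assumes "\<And>n::nat. \<tau> n \<in> {0..T}" "\<And>n. \<phi> n \<in> H1 D" "B \<in> sets borel"
  shows "measure P' {\<omega> \<in> space P'. (\<lambda>n. Z (\<tau> n) (\<phi> n) \<omega>) \<in> B} =
    measure P {\<omega> \<in> space P. (\<lambda>n. L2_inner D (W (\<tau> n) \<omega> - W 0 \<omega>) (\<phi> n)) \<in> B}"
  using arg_cong[OF Z_law[of \<tau> \<phi>, OF assms(1,2)], of "\<lambda>M. measure M B"] assms(3)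
    transfer_measurable[of \<tau> \<phi>, OF assms(1,2)]
  by (simp add: measure_distr vimage_def Int_def conj_commute)

text \<open>An almost sure statement expressed by a Borel predicate of a real sequence depends only
  on the law of that sequence.\<close>

lemma transfer_AE:
  assumes "\<And>n::nat. \<tau> n \<in> {0..T}" "\<And>n. \<phi> n \<in> H1 D" "Measurable.pred borel R"
    and "AE \<omega> in P. R (\<lambda>n. L2_inner D (W (\<tau> n) \<omega> - W 0 \<omega>) (\<phi> n))"
  shows "AE \<omega> in P'. R (\<lambda>n. Z (\<tau> n) (\<phi> n) \<omega>)"
proof -
  have R: "{x \<in> space borel. R x} \<in> sets borel" using assms(3) by (simp add: pred_def)
  have "AE x in distr P borel (\<lambda>\<omega> n. L2_inner D (W (\<tau> n) \<omega> - W 0 \<omega>) (\<phi> n)). R x"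
    using assms(4) by (subst AE_distr_iff[OF transfer_measurable(2)[of \<tau> \<phi>, OF assms(1,2)] R])
  then show ?thesis
    unfolding Z_law[of \<tau> \<phi>, OF assms(1,2), symmetric]
    by (subst (asm) AE_distr_iff[OF transfer_measurable(1)[of \<tau> \<phi>, OF assms(1,2)] R])
qed

definition W' :: "real \<Rightarrow> 'v \<Rightarrow> 'a \<Rightarrow> real" where
  "W' t \<omega> = synth D e (\<lambda>k. Z t (e k) \<omega>)"

lemma W'_L2: "W' t \<omega> \<in> L2 D"
  unfolding W'_def by (rule synth[OF e])

lemma W'_measurable: "t \<in> {0..T} \<Longrightarrow> W' t \<in> P' \<rightarrow>\<^sub>M L2_borel D"
  unfolding W'_def[abs_def] by (intro synth_measurable e Z_measurable eH)

lemma W_continuous: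
  "AE \<omega> in P. \<forall>t. ((\<lambda>s. L2_norm D (W s \<omega> - W t \<omega>)) \<longlongrightarrow> 0) (at t)"
  using W by (simp add: Q_Wiener_process_def)

text \<open>Uniform continuity in norm, rewritten through Bessel as a bound on all finite partial
  sums of squared coordinate differences. This form can be tested on countably many coordinates and
  survives limits in s and t. Paths enter through W - W 0, since that is what the law of
  \<open>Z\<close> describes.\<close>

lemma W_coordinate_modulus:
  assumes \<omega>: "\<omega> \<in> space P" and c: "\<forall>t. ((\<lambda>s. L2_norm D (W s \<omega> - W t \<omega>)) \<longlongrightarrow> 0) (at t)"
  shows "\<exists>N::nat. \<forall>s\<in>{0..T}. \<forall>t\<in>{0..T}. \<bar>s - t\<bar> < 1 / real (Suc N) \<longrightarrow> (\<forall>K.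
    (\<Sum>k<K. (L2_inner D (W s \<omega> - W 0 \<omega>) (e k) - L2_inner D (W t \<omega> - W 0 \<omega>) (e k))\<^sup>2) \<le> 1 / real (Suc m))"
proof -
  obtain N :: nat where N: "\<And>s t. s \<in> {0..T} \<Longrightarrow> t \<in> {0..T} \<Longrightarrow> \<bar>s - t\<bar> < 1 / real (Suc N) \<Longrightarrow>
      L2_norm D (W s \<omega> - W t \<omega>) < sqrt (1 / real (Suc m))"
    using L2_path_uniformly_continuous[of T "\<lambda>t. W t \<omega>" D "sqrt (1 / real (Suc m))"] W_L2[OF \<omega>] c
      tendsto_within_subset[of _ _ _ UNIV "{0..T}"] by (metis (no_types, lifting) of_nat_0_less_iff
        real_sqrt_gt_0_iff subset_UNIV zero_less_Suc zero_less_divide_1_iff)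
  show ?thesis
  proof (intro exI[of _ N] ballI impI allI)
    fix s t K assume st: "s \<in> {0..T}" "t \<in> {0..T}" "\<bar>s - t\<bar> < 1 / real (Suc N)"
    note L = W_L2[OF \<omega>]
    have "(\<Sum>k<K. (L2_inner D (W s \<omega> - W 0 \<omega>) (e k) - L2_inner D (W t \<omega> - W 0 \<omega>) (e k))\<^sup>2) =
      (\<Sum>k<K. (L2_inner D (W s \<omega> - W t \<omega>) (e k))\<^sup>2)"
      by (simp add: L2_inner_diff_left'[OF L L eL])
    also have "\<dots> \<le> L2_inner D (W s \<omega> - W t \<omega>) (W s \<omega> - W t \<omega>)"
      by (intro Bessel eL eo L2_diff' L)
    also have "\<dots> = (L2_norm D (W s \<omega> - W t \<omega>))\<^sup>2" by (simp add: L2_norm_sq)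
    also have "\<dots> \<le> (sqrt (1 / real (Suc m)))\<^sup>2"
      using N[OF st] by (intro power_mono L2_norm_nonneg) auto
    finally show "(\<Sum>k<K. (L2_inner D (W s \<omega> - W 0 \<omega>) (e k) - L2_inner D (W t \<omega> - W 0 \<omega>) (e k))\<^sup>2) \<le>
      1 / real (Suc m)" by simp
  qed
qed

lemma rational_times_dense:
  assumes "t \<in> {0..T}"
  obtains r where "\<And>n::nat. r n \<in> {0..T} \<inter> \<rat>" "r \<longlonglongrightarrow> t"
proof -
  have "\<exists>q. q \<in> {0..T} \<inter> \<rat> \<and> \<bar>q - t\<bar> \<le> 1 / real (Suc n)" for n
  proof (cases "t < T")
    case True
    then obtain q where "q \<in> \<rat>" "t < q" "q < min (t + 1 / real (Suc n)) T"
      using Rats_dense_in_real[of t "min (t + 1 / real (Suc n)) T"] by auto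
    then show ?thesis using assms by (intro exI[of _ q]) auto
  next
    case False
    then obtain q where "q \<in> \<rat>" "max (t - 1 / real (Suc n)) 0 < q" "q < t"
      using Rats_dense_in_real[of "max (t - 1 / real (Suc n)) 0" t] assms T by auto
    then show ?thesis using assms by (intro exI[of _ q]) auto
  qed
  then obtain r where r: "\<And>n. r n \<in> {0..T} \<inter> \<rat>" "\<And>n. \<bar>r n - t\<bar> \<le> 1 / real (Suc n)" by metis
  have "(\<lambda>n. r n - t) \<longlonglongrightarrow> 0"
    using r(2) by (intro Lim_null_comparison[OF _ LIMSEQ_inverse_real_of_nat] always_eventually)
      (auto simp: inverse_eq_divide)
  then have "r \<longlonglongrightarrow> t" by (simp add: LIM_zero_iff)
  with r(1) that show ?thesis by blast
qed

text \<open>Uniform continuity of the L^2-valued path cannot be transferred directly, since it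
  involves uncountably many times. At rational times it is a Borel condition on a sequence, and
  continuity of each single coordinate of \<open>Z\<close> then extends it to all times.\<close>

lemma Z_coordinate_modulus:
  "AE \<omega> in P'. (\<forall>m. \<exists>N::nat. \<forall>s\<in>{0..T}. \<forall>t\<in>{0..T}. \<bar>s - t\<bar> < 1 / real (Suc N) \<longrightarrow>
     (\<forall>K. (\<Sum>k<K. (Z s (e k) \<omega> - Z t (e k) \<omega>)\<^sup>2) \<le> 1 / real (Suc m))) \<and>
     (\<forall>t\<in>{0..T}. summable (\<lambda>k. (Z t (e k) \<omega>)\<^sup>2))"
proof -
  define \<tau> where "\<tau> = from_nat_into ({0..T} \<inter> \<rat>)"
  have ne: "{0..T} \<inter> \<rat> \<noteq> {}" using T by force
  have cnt: "countable ({0..T} \<inter> \<rat>)" using countable_rat by (rule countable_subset[rotated]) auto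
  have \<tau>: "\<tau> i \<in> {0..T}" for i using from_nat_into[OF ne, of i] by (auto simp: \<tau>_def)
  \<comment> \<open>The sequence holds coordinate \<open>k\<close> at the \<open>i\<close>-th
    rational time in the slot \<open>prod_encode (i, k)\<close>.\<close>
  define R where "R x \<longleftrightarrow> (\<forall>m. \<exists>N::nat. \<forall>i j. \<bar>\<tau> i - \<tau> j\<bar> < 1 / real (Suc N) \<longrightarrow>
     (\<forall>K. (\<Sum>k<K. (x (prod_encode (i, k)) - x (prod_encode (j, k)))\<^sup>2) \<le> 1 / real (Suc m))) \<and>
     (\<forall>i. summable (\<lambda>k. (x (prod_encode (i, k)))\<^sup>2))" for x :: "nat \<Rightarrow> real"
  have xm[measurable]: "(\<lambda>x. x n) \<in> borel_measurable borel" for n :: nat and x :: "nat \<Rightarrow> real"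
    by (intro borel_measurable_continuous_onI continuous_on_product_coordinates)
  have Rm: "Measurable.pred borel R" unfolding R_def by measurable
  have "AE \<omega> in P'. R (\<lambda>n. Z (\<tau> (fst (prod_decode n))) (e (snd (prod_decode n))) \<omega>)"
  proof (rule transfer_AE[OF _ _ Rm])
    show "AE \<omega> in P. R (\<lambda>n. L2_inner D (W (\<tau> (fst (prod_decode n))) \<omega> - W 0 \<omega>) (e (snd (prod_decode n))))"
      using W_continuous AE_space
    proof eventually_elim
      fix \<omega> assume c: "\<forall>t. ((\<lambda>s. L2_norm D (W s \<omega> - W t \<omega>)) \<longlongrightarrow> 0) (at t)" and \<omega>: "\<omega> \<in> space P"
      have "\<exists>N::nat. \<forall>i j. \<bar>\<tau> i - \<tau> j\<bar> < 1 / real (Suc N) \<longrightarrow> (\<forall>K.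
        (\<Sum>k<K. (L2_inner D (W (\<tau> i) \<omega> - W 0 \<omega>) (e k) - L2_inner D (W (\<tau> j) \<omega> - W 0 \<omega>) (e k))\<^sup>2) \<le> 1 / real (Suc m))" for m
        using W_coordinate_modulus[OF \<omega> c, of m] \<tau> by blast
      moreover have "summable (\<lambda>k. (L2_inner D (W (\<tau> i) \<omega> - W 0 \<omega>) (e k))\<^sup>2)" for i
        by (intro summable_coordinates e L2_diff' W_L2 \<omega>)
      ultimately show "R (\<lambda>n. L2_inner D (W (\<tau> (fst (prod_decode n))) \<omega> - W 0 \<omega>) (e (snd (prod_decode n))))"
        by (simp add: R_def)
    qed
  qed (rule \<tau> eH)+
  then show ?thesis
    using Z_continuous
  proof eventually_elim
    fix \<omega>
    assume R: "R (\<lambda>n. Z (\<tau> (fst (prod_decode n))) (e (snd (prod_decode n))) \<omega>)"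
      and c: "\<forall>\<phi>\<in>H1 D. continuous_on {0..T} (\<lambda>t. Z t \<phi> \<omega>)"
    have lim: "(\<lambda>n. Z (r n) (e k) \<omega>) \<longlonglongrightarrow> Z t (e k) \<omega>"
      if "\<And>n::nat. r n \<in> {0..T} \<inter> \<rat>" "r \<longlonglongrightarrow> t" "t \<in> {0..T}" for r t k
      using that by (intro continuous_on_tendsto_compose[OF c[rule_format, OF eH[of k]]]) auto
    have surj: "\<exists>i. \<tau> i = q" if "q \<in> {0..T} \<inter> \<rat>" for q
      using from_nat_into_surj[OF cnt that] by (auto simp: \<tau>_def)
    have mod: "\<exists>N::nat. \<forall>s\<in>{0..T}. \<forall>t\<in>{0..T}. \<bar>s - t\<bar> < 1 / real (Suc N) \<longrightarrow>
      (\<forall>K. (\<Sum>k<K. (Z s (e k) \<omega> - Z t (e k) \<omega>)\<^sup>2) \<le> 1 / real (Suc m))" for m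
    proof -
      obtain N :: nat where N: "\<And>i j K. \<bar>\<tau> i - \<tau> j\<bar> < 1 / real (Suc N) \<Longrightarrow>
        (\<Sum>k<K. (Z (\<tau> i) (e k) \<omega> - Z (\<tau> j) (e k) \<omega>)\<^sup>2) \<le> 1 / real (Suc m)"
        using R unfolding R_def by (simp only: prod_encode_inverse fst_conv snd_conv) blast
      show ?thesis
      proof (intro exI[of _ N] ballI impI allI)
        fix s t K assume st: "s \<in> {0..T}" "t \<in> {0..T}" "\<bar>s - t\<bar> < 1 / real (Suc N)"
        obtain a where a: "\<And>n. a n \<in> {0..T} \<inter> \<rat>" "a \<longlonglongrightarrow> s" using rational_times_dense[OF st(1)] by metis
        obtain b where b: "\<And>n. b n \<in> {0..T} \<inter> \<rat>" "b \<longlonglongrightarrow> t" using rational_times_dense[OF st(2)] by metis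
        have "(\<lambda>n. \<Sum>k<K. (Z (a n) (e k) \<omega> - Z (b n) (e k) \<omega>)\<^sup>2) \<longlonglongrightarrow>
          (\<Sum>k<K. (Z s (e k) \<omega> - Z t (e k) \<omega>)\<^sup>2)"
          by (intro tendsto_sum tendsto_power tendsto_diff lim a b st)
        moreover have "(\<lambda>n. \<bar>a n - b n\<bar>) \<longlonglongrightarrow> \<bar>s - t\<bar>" by (intro tendsto_rabs tendsto_diff a b)
        then have "eventually (\<lambda>n. \<bar>a n - b n\<bar> < 1 / real (Suc N)) sequentially"
          using st(3) by (rule order_tendstoD)
        then have "eventually (\<lambda>n. (\<Sum>k<K. (Z (a n) (e k) \<omega> - Z (b n) (e k) \<omega>)\<^sup>2) \<le> 1 / real (Suc m)) sequentially"
        proof eventually_elim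
          fix n assume *: "\<bar>a n - b n\<bar> < 1 / real (Suc N)"
          obtain i where i: "\<tau> i = a n" using surj[OF a(1)] by blast
          obtain j where j: "\<tau> j = b n" using surj[OF b(1)] by blast
          show "(\<Sum>k<K. (Z (a n) (e k) \<omega> - Z (b n) (e k) \<omega>)\<^sup>2) \<le> 1 / real (Suc m)"
            using N[of i j K] * unfolding i j by simp
        qed
        ultimately show "(\<Sum>k<K. (Z s (e k) \<omega> - Z t (e k) \<omega>)\<^sup>2) \<le> 1 / real (Suc m)"
          by (rule tendsto_upperbound) simp
      qed
    qed
    \<comment> \<open>The transferred summability concerns rational times; a rational time close to
      t differs from t by a square summable sequence, thanks to the modulus.\<close>
    moreover have "summable (\<lambda>k. (Z t (e k) \<omega>)\<^sup>2)" if t: "t \<in> {0..T}" for t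
    proof -
      obtain N :: nat where N: "\<And>s t K. s \<in> {0..T} \<Longrightarrow> t \<in> {0..T} \<Longrightarrow> \<bar>s - t\<bar> < 1 / real (Suc N) \<Longrightarrow>
        (\<Sum>k<K. (Z s (e k) \<omega> - Z t (e k) \<omega>)\<^sup>2) \<le> 1 / real (Suc 0)"
        using mod[of 0] by blast
      obtain a where a: "\<And>n. a n \<in> {0..T} \<inter> \<rat>" "a \<longlonglongrightarrow> t" using rational_times_dense[OF t] by metis
      have "eventually (\<lambda>n. dist (a n) t < 1 / real (Suc N)) sequentially"
        using a(2) by (rule tendstoD) simp
      then obtain n where "\<bar>t - a n\<bar> < 1 / real (Suc N)"
        by (auto simp: eventually_sequentially dist_real_def abs_minus_commute)
      moreover obtain i where i: "\<tau> i = a n" using surj[OF a(1)] by blast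
      ultimately have bd: "(\<Sum>k<K. (Z t (e k) \<omega> - Z (\<tau> i) (e k) \<omega>)\<^sup>2) \<le> 1 / real (Suc 0)" for K
        using N[of t "a n" K] t a(1)[of n] by simp
      have "summable (\<lambda>k. (Z t (e k) \<omega> - Z (\<tau> i) (e k) \<omega>)\<^sup>2)"
        using bd by (intro summableI_nonneg_bounded[where x = "1 / real (Suc 0)"]) auto
      moreover have "summable (\<lambda>k. (Z (\<tau> i) (e k) \<omega>)\<^sup>2)" using R by (simp add: R_def)
      ultimately have "summable (\<lambda>k. 2 * (Z t (e k) \<omega> - Z (\<tau> i) (e k) \<omega>)\<^sup>2 + 2 * (Z (\<tau> i) (e k) \<omega>)\<^sup>2)"
        by (intro summable_add summable_mult)
      then show ?thesis
      proof (rule summable_comparison_test[rotated], intro exI[of _ 0] allI impI)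
        fix k
        \<comment> \<open>With a and b the coordinates at t and at the rational time, the difference
          2 (a - b)^2 + 2 b^2 - a^2 equals (a - 2 b)^2.\<close>
        have "0 \<le> (Z t (e k) \<omega> - 2 * Z (\<tau> i) (e k) \<omega>)\<^sup>2" by simp
        then show "norm ((Z t (e k) \<omega>)\<^sup>2) \<le>
            2 * (Z t (e k) \<omega> - Z (\<tau> i) (e k) \<omega>)\<^sup>2 + 2 * (Z (\<tau> i) (e k) \<omega>)\<^sup>2"
          by (simp add: power2_eq_square algebra_simps)
      qed
    qed
    ultimately show "(\<forall>m. \<exists>N::nat. \<forall>s\<in>{0..T}. \<forall>t\<in>{0..T}. \<bar>s - t\<bar> < 1 / real (Suc N) \<longrightarrow>
     (\<forall>K. (\<Sum>k<K. (Z s (e k) \<omega> - Z t (e k) \<omega>)\<^sup>2) \<le> 1 / real (Suc m))) \<and>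
     (\<forall>t\<in>{0..T}. summable (\<lambda>k. (Z t (e k) \<omega>)\<^sup>2))" by blast
  qed
qed

text \<open>Off one null set the coordinates of \<open>W' t\<close> are \<open>Z t (e k)\<close> at
  all times simultaneously, and Parseval turns the bound on partial sums into a modulus in
  norm.\<close>

lemma W'_continuous:
  "AE \<omega> in P'. \<forall>t\<in>{0..T}. ((\<lambda>s. L2_norm D (W' s \<omega> - W' t \<omega>)) \<longlongrightarrow> 0) (at t within {0..T})"
  using Z_coordinate_modulus
proof eventually_elim
  fix \<omega>
  assume H: "(\<forall>m. \<exists>N::nat. \<forall>s\<in>{0..T}. \<forall>t\<in>{0..T}. \<bar>s - t\<bar> < 1 / real (Suc N) \<longrightarrow>
     (\<forall>K. (\<Sum>k<K. (Z s (e k) \<omega> - Z t (e k) \<omega>)\<^sup>2) \<le> 1 / real (Suc m))) \<and>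
     (\<forall>t\<in>{0..T}. summable (\<lambda>k. (Z t (e k) \<omega>)\<^sup>2))"
  have co: "L2_inner D (W' t \<omega>) (e k) = Z t (e k) \<omega>" if "t \<in> {0..T}" for t k
    using H that by (simp add: W'_def synth[OF e])
  show "\<forall>t\<in>{0..T}. ((\<lambda>s. L2_norm D (W' s \<omega> - W' t \<omega>)) \<longlongrightarrow> 0) (at t within {0..T})"
  proof (intro ballI tendstoI)
    fix t \<epsilon> :: real assume t: "t \<in> {0..T}" and \<epsilon>: "0 < \<epsilon>"
    obtain m where m: "inverse (real (Suc m)) < \<epsilon>\<^sup>2" using reals_Archimedean[of "\<epsilon>\<^sup>2"] \<epsilon> by auto
    obtain N :: nat where N: "\<And>s K. s \<in> {0..T} \<Longrightarrow> \<bar>s - t\<bar> < 1 / real (Suc N) \<Longrightarrow>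
        (\<Sum>k<K. (Z s (e k) \<omega> - Z t (e k) \<omega>)\<^sup>2) \<le> 1 / real (Suc m)"
      using conjunct1[OF H, rule_format, of m] t by blast
    have "L2_norm D (W' s \<omega> - W' t \<omega>) < \<epsilon>" if s: "s \<in> {0..T}" "dist s t < 1 / real (Suc N)" for s
    proof (rule power2_less_imp_less)
      have "(\<lambda>k. (Z s (e k) \<omega> - Z t (e k) \<omega>)\<^sup>2) sums (L2_norm D (W' s \<omega> - W' t \<omega>))\<^sup>2"
        using Parseval_norm_diff[OF e W'_L2 W'_L2, of s \<omega> t \<omega>] by (simp only: co[OF s(1)] co[OF t])
      then have "(L2_norm D (W' s \<omega> - W' t \<omega>))\<^sup>2 \<le> 1 / real (Suc m)"
        unfolding sums_def using N[OF s(1)] s(2)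
        by (intro LIMSEQ_le_const2) (auto simp: dist_real_def)
      then show "(L2_norm D (W' s \<omega> - W' t \<omega>))\<^sup>2 < \<epsilon>\<^sup>2" using m by (simp add: inverse_eq_divide)
    qed (use \<epsilon> in simp)
    then show "\<forall>\<^sub>F s in at t within {0..T}. dist (L2_norm D (W' s \<omega> - W' t \<omega>)) 0 < \<epsilon>"
      unfolding eventually_at by (intro exI[of _ "1 / real (Suc N)"]) (auto simp: L2_norm_nonneg)
  qed
qed

lemma W'_start: "AE \<omega> in P'. L2_eq D (W' 0 \<omega>) (\<lambda>x. 0)"
  using Z_0
proof eventually_elim
  fix \<omega> assume "\<forall>\<phi>\<in>H1 D. Z 0 \<phi> \<omega> = 0"
  then have "Z 0 (e k) \<omega> = 0" for k using eH by simp
  then show "L2_eq D (W' 0 \<omega>) (\<lambda>x. 0)"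
    by (intro L2_eqI_coordinates[OF e W'_L2 L2_zero]) (simp add: W'_def synth[OF e] L2_inner_zero_left)
qed

lemma W'_inner:
  assumes t: "t \<in> {0..T}" and \<phi>: "\<phi> \<in> H1 D"
  shows "AE \<omega> in P'. L2_inner D (W' t \<omega>) \<phi> = Z t \<phi> \<omega>"
proof -
  \<comment> \<open>Slot 0 holds the tested function, slot k + 1 the basis vector
    \<open>e k\<close>.\<close>
  define \<psi> where "\<psi> n = (case n of 0 \<Rightarrow> \<phi> | Suc k \<Rightarrow> e k)" for n
  have \<psi>: "\<psi> n \<in> H1 D" for n using \<phi> eH by (cases n) (auto simp: \<psi>_def)
  define R where "R x \<longleftrightarrow> L2_inner D (synth D e (\<lambda>k. x (Suc k))) \<phi> = x 0" for x :: "nat \<Rightarrow> real"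
  have xm[measurable]: "(\<lambda>x. x n) \<in> borel_measurable borel" for n :: nat and x :: "nat \<Rightarrow> real"
    by (intro borel_measurable_continuous_onI continuous_on_product_coordinates)
  have im: "(\<lambda>x. L2_inner D (synth D e (\<lambda>k. x (Suc k))) \<phi>) \<in> borel_measurable borel"
    by (rule measurable_compose[OF synth_measurable[OF e] L2_inner_measurable[OF H1_L2(1)[OF \<phi>]]]) (rule xm)
  have Rm: "Measurable.pred borel R" unfolding R_def[abs_def] pred_def by (rule borel_measurable_eq[OF im xm])
  have "AE \<omega> in P'. R (\<lambda>n. Z t (\<psi> n) \<omega>)"
  proof (rule transfer_AE[OF _ _ Rm])
    show "AE \<omega> in P. R (\<lambda>n. L2_inner D (W t \<omega> - W 0 \<omega>) (\<psi> n))"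
      using AE_space
    proof eventually_elim
      fix \<omega> assume \<omega>: "\<omega> \<in> space P"
      have d: "W t \<omega> - W 0 \<omega> \<in> L2 D" by (intro L2_diff' W_L2 \<omega>)
      show "R (\<lambda>n. L2_inner D (W t \<omega> - W 0 \<omega>) (\<psi> n))"
        unfolding R_def \<psi>_def nat.case
        by (intro L2_inner_cong synth_coordinates synth e d L2_eq_refl H1_L2(1) \<phi>)
    qed
  qed (rule t \<psi>)+
  then show ?thesis by eventually_elim (simp add: R_def \<psi>_def W'_def)
qed

text \<open>Joint laws of finitely many L^2-valued increments agree. A single increment gives the
  Gaussian law, several give independence.\<close>

lemma increment_law:
  assumes t: "\<And>i. i \<le> n \<Longrightarrow> t i \<in> {0..T}" and J: "finite J" "J \<subseteq> {..<n}"
    and B: "\<And>j. j \<in> J \<Longrightarrow> B j \<in> sets (L2_borel D)"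
  shows "measure P' {\<omega> \<in> space P'. \<forall>j\<in>J. W' (t (Suc j)) \<omega> - W' (t j) \<omega> \<in> B j} =
    measure P {\<omega> \<in> space P. \<forall>j\<in>J. W (t (Suc j)) \<omega> - W (t j) \<omega> \<in> B j}"
proof -
  \<comment> \<open>The transfer needs an infinite sequence of times in [0,T], so indices beyond
    \<open>n\<close> receive the time 0.\<close>
  define r where "r i = (if i \<le> n then t i else 0)" for i
  have r: "r i \<in> {0..T}" for i using t T by (simp add: r_def)
  define Y where "Y i x = synth D e (\<lambda>k. x (prod_encode (i, k)))" for i and x :: "nat \<Rightarrow> real"
  have xm[measurable]: "(\<lambda>x. x n) \<in> borel_measurable borel" for n :: nat and x :: "nat \<Rightarrow> real"
    by (intro borel_measurable_continuous_onI continuous_on_product_coordinates)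
  have YL: "Y i x \<in> L2 D" for i x unfolding Y_def by (rule synth[OF e])
  have Ym: "Y i \<in> borel \<rightarrow>\<^sub>M L2_borel D" for i
    unfolding Y_def[abs_def] by (intro synth_measurable e) measurable
  have dm: "(\<lambda>x. Y (Suc j) x - Y j x) \<in> borel \<rightarrow>\<^sub>M L2_borel D" for j
  proof (rule L2_borel_measurableI[OF e])
    show "(\<lambda>x. L2_inner D (Y (Suc j) x - Y j x) (e k)) \<in> borel_measurable borel" for k
      unfolding L2_inner_diff_left'[OF YL YL eL]
      by (intro borel_measurable_diff measurable_compose[OF Ym L2_inner_measurable] eL)
  qed (intro L2_diff' YL)
  define S where "S = {x. \<forall>j\<in>J. Y (Suc j) x - Y j x \<in> B j}"
  have "S = (\<Inter>j\<in>J. (\<lambda>x. Y (Suc j) x - Y j x) -` B j \<inter> space borel) \<inter> space borel"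
    by (auto simp: S_def)
  also have "\<dots> \<in> sets borel"
  proof (cases "J = {}")
    case False
    have "(\<lambda>x. Y (Suc j) x - Y j x) -` B j \<inter> space borel \<in> sets borel" if "j \<in> J" for j
      by (rule measurable_sets[OF dm B[OF that]])
    then show ?thesis using False J(1) by (intro sets.Int sets.finite_INT) auto
  qed auto
  finally have S: "S \<in> sets borel" .
  define X' where "X' \<omega> n = Z (r (fst (prod_decode n))) (e (snd (prod_decode n))) \<omega>" for \<omega> n
  define X where "X \<omega> n = L2_inner D (W (r (fst (prod_decode n))) \<omega> - W 0 \<omega>) (e (snd (prod_decode n)))" for \<omega> n
  have "Y i (X' \<omega>) = W' (r i) \<omega>" for i \<omega> by (simp add: Y_def X'_def W'_def)
  then have 1: "X' \<omega> \<in> S \<longleftrightarrow> (\<forall>j\<in>J. W' (t (Suc j)) \<omega> - W' (t j) \<omega> \<in> B j)" for \<omega>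
    using J(2) by (auto simp: S_def r_def subset_eq Suc_le_eq)
  have 2: "X \<omega> \<in> S \<longleftrightarrow> (\<forall>j\<in>J. W (t (Suc j)) \<omega> - W (t j) \<omega> \<in> B j)" if \<omega>: "\<omega> \<in> space P" for \<omega>
  proof -
    note L = W_L2[OF \<omega>]
    \<comment> \<open>\<open>Y\<close> rebuilds only some representative of the increment of
      \<open>W\<close>, which is enough because Borel sets are saturated.\<close>
    have "Y (Suc j) (X \<omega>) - Y j (X \<omega>) \<in> B j \<longleftrightarrow> W (t (Suc j)) \<omega> - W (t j) \<omega> \<in> B j" if "j \<in> J" for j
    proof (rule L2_borel_saturated[OF B[OF that]])
      have ji: "j < n" using that J by auto
      have "L2_inner D (Y i (X \<omega>)) (e k) = L2_inner D (W (r i) \<omega> - W 0 \<omega>) (e k)" for i k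
        using summable_coordinates[OF e L2_diff'[OF L L], of "r i" 0] by (simp add: Y_def X_def synth[OF e])
      then show "L2_eq D (Y (Suc j) (X \<omega>) - Y j (X \<omega>)) (W (t (Suc j)) \<omega> - W (t j) \<omega>)"
        using ji by (intro L2_eqI_coordinates[OF e] L2_diff' YL L)
          (simp add: L2_inner_diff_left'[OF YL YL eL] L2_inner_diff_left'[OF L L eL] r_def)
    qed (intro L2_diff' YL L)+
    then show ?thesis by (auto simp: S_def)
  qed
  have "measure P' {\<omega> \<in> space P'. X' \<omega> \<in> S} = measure P {\<omega> \<in> space P. X \<omega> \<in> S}"
    unfolding X_def X'_def by (intro transfer_measure r eH S)
  then show ?thesis using 1 2 by (simp cong: conj_cong)
qed

lemma W'_increment_measurable:
  assumes "s \<in> {0..T}" "t \<in> {0..T}"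
  shows "(\<lambda>\<omega>. W' t \<omega> - W' s \<omega>) \<in> P' \<rightarrow>\<^sub>M L2_borel D"
proof (rule L2_borel_measurableI[OF e])
  show "(\<lambda>\<omega>. L2_inner D (W' t \<omega> - W' s \<omega>) (e k)) \<in> borel_measurable P'" for k
    unfolding L2_inner_diff_left'[OF W'_L2 W'_L2 eL] using assms
    by (intro borel_measurable_diff measurable_compose[OF W'_measurable L2_inner_measurable] eL)
qed (intro L2_diff' W'_L2)

lemma W_increment_measurable: "(\<lambda>\<omega>. W t \<omega> - W s \<omega>) \<in> P \<rightarrow>\<^sub>M L2_borel D"
  by (intro L2_borel_measurableI[OF e] L2_diff' W_L2 W_inner_measurable eL)

text \<open>Comparing the laws of the increments as elements of L^2 allows every \<open>h\<close> in
  L^2 to be tested, although \<open>Z\<close> is described on H^1. Zero variance is separate because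
  there is no density then.\<close>

lemma W'_gaussian:
  assumes st: "s \<in> {0..T}" "t \<in> {0..T}" "s < t" and h: "h \<in> L2 D"
  shows "centred_gaussian P' (\<lambda>\<omega>. L2_inner D (W' t \<omega> - W' s \<omega>) h) ((t - s) * L2_inner D (Q h) h)"
proof -
  interpret P: prob_space P by (rule P)
  interpret P': prob_space P' by (rule P')
  define d' where "d' \<omega> = W' t \<omega> - W' s \<omega>" for \<omega>
  define d where "d \<omega> = W t \<omega> - W s \<omega>" for \<omega>
  have d'm: "d' \<in> P' \<rightarrow>\<^sub>M L2_borel D" unfolding d'_def[abs_def] by (rule W'_increment_measurable) fact+
  have dm: "d \<in> P \<rightarrow>\<^sub>M L2_borel D" unfolding d_def[abs_def] by (rule W_increment_measurable)
  have law: "distr P' (L2_borel D) d' = distr P (L2_borel D) d"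
  proof (rule measure_eqI)
    fix A assume "A \<in> sets (distr P' (L2_borel D) d')"
    then have A: "A \<in> sets (L2_borel D)" by simp
    have "measure P' {\<omega> \<in> space P'. d' \<omega> \<in> A} = measure P {\<omega> \<in> space P. d \<omega> \<in> A}"
      using increment_law[of 1 "\<lambda>i. if i = 0 then s else t" "{0}" "\<lambda>_. A"] st A
      by (simp add: d_def d'_def)
    then show "emeasure (distr P' (L2_borel D) d') A = emeasure (distr P (L2_borel D) d) A"
      using A d'm dm by (simp add: emeasure_distr P.emeasure_eq_measure P'.emeasure_eq_measure
          vimage_def Int_def conj_commute)
  qed simp
  note im = L2_inner_measurable[OF h]
  have law2: "distr P' borel (\<lambda>\<omega>. L2_inner D (d' \<omega>) h) = distr P borel (\<lambda>\<omega>. L2_inner D (d \<omega>) h)"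
    using distr_distr[OF im d'm] distr_distr[OF im dm] law by (simp add: o_def)
  have m: "(\<lambda>\<omega>. L2_inner D (d' \<omega>) h) \<in> borel_measurable P'" "(\<lambda>\<omega>. L2_inner D (d \<omega>) h) \<in> borel_measurable P"
    using measurable_compose[OF d'm im] measurable_compose[OF dm im] by auto
  have g: "centred_gaussian P (\<lambda>\<omega>. L2_inner D (d \<omega>) h) ((t - s) * L2_inner D (Q h) h)"
    using W st h unfolding Q_Wiener_process_def d_def by blast
  have "centred_gaussian P' (\<lambda>\<omega>. L2_inner D (d' \<omega>) h) ((t - s) * L2_inner D (Q h) h)"
  proof (cases "(t - s) * L2_inner D (Q h) h = 0")
    case True
    then have "AE \<omega> in P. L2_inner D (d \<omega>) h = 0" using g by (simp add: centred_gaussian_def)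
    then have "AE x in distr P borel (\<lambda>\<omega>. L2_inner D (d \<omega>) h). x = 0"
      by (subst AE_distr_iff[OF m(2)]) auto
    then have "AE \<omega> in P'. L2_inner D (d' \<omega>) h = 0"
      unfolding law2[symmetric] by (subst (asm) AE_distr_iff[OF m(1)]) auto
    then show ?thesis using True m(1) by (simp add: centred_gaussian_def)
  next
    case False
    then have "distributed P lborel (\<lambda>\<omega>. L2_inner D (d \<omega>) h) (normal_density 0 (sqrt ((t - s) * L2_inner D (Q h) h)))"
      using g by (simp add: centred_gaussian_def)
    moreover have "distr P' lborel (\<lambda>\<omega>. L2_inner D (d' \<omega>) h) = distr P lborel (\<lambda>\<omega>. L2_inner D (d \<omega>) h)"
      using law2 distr_cong[of P' P' lborel borel "\<lambda>\<omega>. L2_inner D (d' \<omega>) h"]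
        distr_cong[of P P lborel borel "\<lambda>\<omega>. L2_inner D (d \<omega>) h"] by simp
    ultimately show ?thesis using False m(1) by (simp add: centred_gaussian_def distributed_def)
  qed
  then show ?thesis by (simp add: d'_def)
qed

text \<open>Independence is the product formula for finite subfamilies; both the joint probability
  and each single factor are rewritten on the original space by
  \<open>increment_law\<close>.\<close>

lemma W'_independent:
  assumes t: "\<And>i. i \<le> n \<Longrightarrow> t i \<in> {0..T}" and mono: "\<And>i. i < n \<Longrightarrow> t i < t (Suc i)"
  shows "prob_space.indep_vars P' (\<lambda>_. L2_borel D) (\<lambda>i \<omega>. W' (t (Suc i)) \<omega> - W' (t i) \<omega>) {..<n}"
proof -
  interpret P: prob_space P by (rule P)
  interpret P': prob_space P' by (rule P')
  have ind: "P.indep_vars (\<lambda>_. L2_borel D) (\<lambda>i \<omega>. W (t (Suc i)) \<omega> - W (t i) \<omega>) {..<n}"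
    using W mono unfolding Q_Wiener_process_def by blast
  show ?thesis
    unfolding P'.indep_vars_def2
  proof (intro conjI ballI)
    fix i assume "i \<in> {..<n}"
    then show "P'.random_variable (L2_borel D) (\<lambda>\<omega>. W' (t (Suc i)) \<omega> - W' (t i) \<omega>)"
      using t by (intro W'_increment_measurable) auto
  next
    show "P'.indep_sets (\<lambda>i. {(\<lambda>\<omega>. W' (t (Suc i)) \<omega> - W' (t i) \<omega>) -` A \<inter> space P' |A. A \<in> sets (L2_borel D)}) {..<n}"
    proof (rule P'.indep_setsI)
      fix i assume "i \<in> {..<n}"
      then have "(\<lambda>\<omega>. W' (t (Suc i)) \<omega> - W' (t i) \<omega>) \<in> P' \<rightarrow>\<^sub>M L2_borel D"
        using t by (intro W'_increment_measurable) auto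
      then show "{(\<lambda>\<omega>. W' (t (Suc i)) \<omega> - W' (t i) \<omega>) -` A \<inter> space P' |A. A \<in> sets (L2_borel D)} \<subseteq> P'.events"
        by (auto intro: measurable_sets)
    next
      fix A J assume J: "J \<noteq> {}" "J \<subseteq> {..<n}" "finite J"
        and A: "\<forall>j\<in>J. A j \<in> {(\<lambda>\<omega>. W' (t (Suc j)) \<omega> - W' (t j) \<omega>) -` A \<inter> space P' |A. A \<in> sets (L2_borel D)}"
      then have "\<forall>j\<in>J. \<exists>B. B \<in> sets (L2_borel D) \<and> A j = (\<lambda>\<omega>. W' (t (Suc j)) \<omega> - W' (t j) \<omega>) -` B \<inter> space P'"
        by blast
      then obtain B where B: "\<And>j. j \<in> J \<Longrightarrow> B j \<in> sets (L2_borel D)"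
        "\<And>j. j \<in> J \<Longrightarrow> A j = (\<lambda>\<omega>. W' (t (Suc j)) \<omega> - W' (t j) \<omega>) -` B j \<inter> space P'" by metis
      have "(\<Inter>j\<in>J. A j) = {\<omega> \<in> space P'. \<forall>j\<in>J. W' (t (Suc j)) \<omega> - W' (t j) \<omega> \<in> B j}"
        using J(1) B(2) by auto
      then have "P'.prob (\<Inter>j\<in>J. A j) = P.prob {\<omega> \<in> space P. \<forall>j\<in>J. W (t (Suc j)) \<omega> - W (t j) \<omega> \<in> B j}"
        using increment_law[of n t J B] t J B(1) by simp
      also have "{\<omega> \<in> space P. \<forall>j\<in>J. W (t (Suc j)) \<omega> - W (t j) \<omega> \<in> B j} =
        (\<Inter>j\<in>J. (\<lambda>\<omega>. W (t (Suc j)) \<omega> - W (t j) \<omega>) -` B j \<inter> space P)" using J(1) by auto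
      also have "P.prob \<dots> = (\<Prod>j\<in>J. P.prob ((\<lambda>\<omega>. W (t (Suc j)) \<omega> - W (t j) \<omega>) -` B j \<inter> space P))"
        using ind B(1) unfolding P.indep_vars_def2
        by (intro P.indep_setsD[OF _ J(2,1,3)]) auto
      also have "\<dots> = (\<Prod>j\<in>J. P'.prob (A j))"
      proof (rule prod.cong[OF refl])
        fix j assume j: "j \<in> J"
        have "P'.prob (A j) = P'.prob {\<omega> \<in> space P'. \<forall>i\<in>{j}. W' (t (Suc i)) \<omega> - W' (t i) \<omega> \<in> B i}"
          using B(2)[OF j] by (simp add: vimage_def Int_def conj_commute)
        also have "\<dots> = P.prob {\<omega> \<in> space P. \<forall>i\<in>{j}. W (t (Suc i)) \<omega> - W (t i) \<omega> \<in> B i}"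
          using j J(2) B(1) by (intro increment_law[of n] t) auto
        also have "\<dots> = P.prob ((\<lambda>\<omega>. W (t (Suc j)) \<omega> - W (t j) \<omega>) -` B j \<inter> space P)"
          by (simp add: vimage_def Int_def conj_commute)
        finally show "P.prob ((\<lambda>\<omega>. W (t (Suc j)) \<omega> - W (t j) \<omega>) -` B j \<inter> space P) = P'.prob (A j)" ..
      qed
      finally show "P'.prob (\<Inter>j\<in>J. A j) = (\<Prod>j\<in>J. P'.prob (A j))" .
    qed
  qed
qed

lemma Q_Wiener_process_W': "Q_Wiener_process D Q P' {0..T} W'"
  unfolding Q_Wiener_process_def
  using W'_measurable W'_start W'_continuous W'_gaussian W'_independent by blast

end

section \<open>The Wiener integral\<close>

subsection \<open>Dyadic partitions\<close>

definition dyadic :: "real \<Rightarrow> nat \<Rightarrow> nat \<Rightarrow> real" where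
  "dyadic t k i = t * real i / 2 ^ k"

lemma dyadic_simps:
  "dyadic t k 0 = 0" "dyadic t k (2 ^ k) = t" "dyadic t k (Suc i) - dyadic t k i = t / 2 ^ k"
  "dyadic t (Suc k) (2 * i) = dyadic t k i"
  by (auto simp: dyadic_def field_simps)

lemma dyadic_bounds:
  assumes "0 \<le> t" "i \<le> 2 ^ k" shows "0 \<le> dyadic t k i" "dyadic t k i \<le> t"
proof -
  have "real i \<le> 2 ^ k" using assms(2) by (metis of_nat_le_iff of_nat_numeral of_nat_power)
  then have "t * real i \<le> t * 2 ^ k" using assms(1) by (intro mult_left_mono)
  then show "dyadic t k i \<le> t" by (simp add: dyadic_def divide_le_eq)
  show "0 \<le> dyadic t k i" using assms(1) by (simp add: dyadic_def)
qed

lemma dyadic_mono: "0 \<le> t \<Longrightarrow> i \<le> j \<Longrightarrow> dyadic t k i \<le> dyadic t k j"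
  by (auto simp: dyadic_def intro!: divide_right_mono mult_left_mono)

text \<open>Cells are open on the left, as in \<open>step_fun\<close>, so a positive time lies in
  exactly one of them and any sum over cells collapses to one term. The index is one less than the
  rounded-up value of \<tau> 2^k / t.\<close>

lemma dyadic_cell:
  assumes t: "0 < \<tau>" "\<tau> \<le> t"
  obtains i where "i < 2 ^ k" "dyadic t k i < \<tau>" "\<tau> \<le> dyadic t k (Suc i)"
    "\<forall>c :: nat \<Rightarrow> real. (\<Sum>j<2 ^ k. indicator {dyadic t k j<..dyadic t k (Suc j)} \<tau> * c j) = c i"
proof -
  define y where "y = \<tau> * 2 ^ k / t"
  have t0: "0 < t" using t by simp
  have y: "0 < y" "y \<le> 2 ^ k" using t t0 by (auto simp: y_def divide_le_eq)
  have lt: "dyadic t k j < \<tau> \<longleftrightarrow> real j < y" for j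
    using t0 by (simp add: dyadic_def y_def divide_less_eq less_divide_eq mult.commute)
  have le: "\<tau> \<le> dyadic t k j \<longleftrightarrow> y \<le> real j" for j
    using t0 by (simp add: dyadic_def y_def divide_le_eq le_divide_eq mult.commute)
  define n where "n = nat \<lceil>y\<rceil>"
  have n: "y \<le> real n" "real n < y + 1" using y by (auto simp: n_def) linarith+
  have n0: "0 < n" using n(1) y(1) by (cases n) auto
  have "real n < real (2 ^ k + 1)" using n y by simp
  then have n2: "n \<le> 2 ^ k" unfolding of_nat_less_iff by simp
  define i where "i = n - 1"
  have i: "real i < y" "y \<le> real (Suc i)" "i < 2 ^ k" using n n0 n2 by (auto simp: i_def of_nat_diff)
  have "j = i" if "real j < y" "y \<le> real (Suc j)" for j
    using that i(1,2) by linarith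
  then have ind: "indicator {dyadic t k j<..dyadic t k (Suc j)} \<tau> = (if j = i then 1 else 0 :: real)" for j
    using i(1,2) by (auto simp: indicator_def lt le)
  have "(\<Sum>j<2 ^ k. indicator {dyadic t k j<..dyadic t k (Suc j)} \<tau> * c j) = c i" for c :: "nat \<Rightarrow> real"
  proof -
    have "(\<Sum>j<2 ^ k. indicator {dyadic t k j<..dyadic t k (Suc j)} \<tau> * c j) = (\<Sum>j<2 ^ k. if j = i then c j else 0)"
      unfolding ind by (intro sum.cong) auto
    then show ?thesis using i(3) by (simp add: sum.delta')
  qed
  with that i show ?thesis by (simp add: lt le)
qed

lemma sum_dyadic_refine: "(\<Sum>i<2 ^ Suc k. c i) = (\<Sum>i<2 ^ k. c (2 * i) + c (Suc (2 * i)) :: real)"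
proof -
  have "(\<Sum>i<2 * n. c i) = (\<Sum>i<n. c (2 * i) + c (Suc (2 * i)))" for n :: nat
    by (induction n) auto
  then show ?thesis by simp
qed

subsection \<open>Second moments\<close>

lemma centred_gaussian_second_moment:
  assumes M: "prob_space M" and X: "centred_gaussian M X v" and v: "0 \<le> v"
  shows "sq_integrable M X" "(\<integral>\<omega>. (X \<omega>)\<^sup>2 \<partial>M) = v"
proof -
  interpret prob_space M by fact
  have Xm: "X \<in> borel_measurable M" using X by (simp add: centred_gaussian_def)
  have "integrable M (\<lambda>\<omega>. (X \<omega>)\<^sup>2) \<and> (\<integral>\<omega>. (X \<omega>)\<^sup>2 \<partial>M) = v"
  proof (cases "v = 0")
    case True
    then have "AE \<omega> in M. (X \<omega>)\<^sup>2 = 0" using X by (simp add: centred_gaussian_def)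
    then show ?thesis using Xm True
      by (subst integrable_cong_AE[where g = "\<lambda>_. 0"], simp, simp, simp) (auto intro: integral_eq_zero_AE)
  next
    case False
    then have s: "0 < sqrt v" using v by simp
    have d: "distributed M lborel X (normal_density 0 (sqrt v))"
      using X False by (simp add: centred_gaussian_def)
    have "integrable lborel (\<lambda>x. normal_density 0 (sqrt v) x * (x - 0)^2)"
      by (rule integrable_normal_moment[OF s])
    then have "integrable M (\<lambda>\<omega>. (X \<omega>)\<^sup>2)"
      using distributed_integrable[OF d, of "\<lambda>x. x\<^sup>2"] by simp
    moreover have "expectation X = 0" using normal_distributed_expectation[OF s d] .
    then have "(\<integral>\<omega>. (X \<omega>)\<^sup>2 \<partial>M) = v" using normal_distributed_variance[OF s d] v by simp
    ultimately show ?thesis ..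
  qed
  then show "sq_integrable M X" "(\<integral>\<omega>. (X \<omega>)\<^sup>2 \<partial>M) = v" using Xm by (auto simp: sq_integrable_def)
qed

lemma sq_integrable_sum:
  fixes f :: "nat \<Rightarrow> 'x \<Rightarrow> real"
  assumes "\<And>i. i < n \<Longrightarrow> sq_integrable M (f i)"
  shows "sq_integrable M (\<lambda>x. \<Sum>i<n. f i x)"
    "sqrt (\<integral>x. (\<Sum>i<n. f i x)\<^sup>2 \<partial>M) \<le> (\<Sum>i<n. sqrt (\<integral>x. (f i x)\<^sup>2 \<partial>M))"
  using assms
proof (induction n)
  case 0
  { case 1 show ?case by (simp add: sq_integrable_def) }
  { case 2 show ?case by simp }
next
  case (Suc n)
  { case 1 then show ?case using Suc.IH(1) by (simp add: sq_integrable_add) }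
  { case 2 then show ?case
      using sq_integrable_triangle[OF Suc.IH(1), of "f n"] Suc.IH(2) by fastforce }
qed

text \<open>Cauchy-Schwarz and boundedness of \<open>Q\<close>; the absolute value of the constant
  is taken because its sign is not prescribed.\<close>

lemma covariance_operator_bound:
  assumes "covariance_operator D Q"
  obtains C where "0 \<le> C" "\<And>h. h \<in> L2 D \<Longrightarrow> L2_inner D (Q h) h \<le> C * (L2_norm D h)\<^sup>2"
    "\<And>h. h \<in> L2 D \<Longrightarrow> 0 \<le> L2_inner D (Q h) h"
proof -
  obtain C where C: "\<And>f. f \<in> L2 D \<Longrightarrow> L2_norm D (Q f) \<le> C * L2_norm D f"
    and QL: "\<And>f. f \<in> L2 D \<Longrightarrow> Q f \<in> L2 D" and pos: "\<And>f. f \<in> L2 D \<Longrightarrow> 0 \<le> L2_inner D (Q f) f"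
    using assms unfolding covariance_operator_def by blast
  have "L2_inner D (Q h) h \<le> \<bar>C\<bar> * (L2_norm D h)\<^sup>2" if h: "h \<in> L2 D" for h
  proof -
    have "L2_inner D (Q h) h \<le> L2_norm D (Q h) * L2_norm D h"
      using L2_Cauchy_Schwarz[OF QL[OF h] h] by simp
    also have "\<dots> \<le> (\<bar>C\<bar> * L2_norm D h) * L2_norm D h"
      using C[OF h] mult_right_mono[OF abs_ge_self[of C] L2_norm_nonneg[of D h]]
      by (intro mult_right_mono L2_norm_nonneg) linarith
    finally show ?thesis by (simp add: power2_eq_square mult.assoc)
  qed
  with that pos show ?thesis by (meson abs_ge_zero)
qed

lemma L2_norm_bounded:
  fixes f :: "'a::euclidean_space \<Rightarrow> 'b::euclidean_space"
  assumes D: "D \<in> sets borel" "bounded D" and f: "f \<in> L2 D" and c: "0 \<le> c" "\<And>x. x \<in> D \<Longrightarrow> norm (f x) \<le> c"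
  shows "(L2_norm D f)\<^sup>2 \<le> c\<^sup>2 * measure lborel D"
proof -
  have "(L2_norm D f)\<^sup>2 = (\<integral>x. indicator D x * (norm (f x))\<^sup>2 \<partial>lborel)"
    unfolding L2_norm_sq power2_norm_eq_inner by (simp add: L2_inner_def set_lebesgue_integral_def)
  also have "\<dots> \<le> (\<integral>x. indicator D x * c\<^sup>2 \<partial>lborel)"
  proof (rule integral_mono)
    show "integrable lborel (\<lambda>x. indicat_real D x * (norm (f x))\<^sup>2)"
      using f by (simp add: L2_def set_integrable_def)
    show "integrable lborel (\<lambda>x. indicat_real D x * c\<^sup>2)"
      using D bounded_set_finite_emeasure[OF D(2)] by simp
    fix x show "indicat_real D x * (norm (f x))\<^sup>2 \<le> indicat_real D x * c\<^sup>2"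
      using c(2)[of x] c(1) by (auto simp: indicator_def intro!: power_mono)
  qed
  also have "\<dots> = c\<^sup>2 * measure lborel D" using D by simp
  finally show ?thesis .
qed

context wiener_transfer
begin

text \<open>The case \<open>s = r\<close> is included because all dyadic points coincide when t =
  0.\<close>

lemma W'_increment_moment:
  assumes st: "s \<in> {0..T}" "r \<in> {0..T}" "s \<le> r" and h: "h \<in> L2 D" and Q: "covariance_operator D Q"
  shows "sq_integrable P' (\<lambda>\<omega>. L2_inner D h (W' r \<omega> - W' s \<omega>))"
    "(\<integral>\<omega>. (L2_inner D h (W' r \<omega> - W' s \<omega>))\<^sup>2 \<partial>P') = (r - s) * L2_inner D (Q h) h"
proof -
  have "sq_integrable P' (\<lambda>\<omega>. L2_inner D h (W' r \<omega> - W' s \<omega>)) \<and>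
    (\<integral>\<omega>. (L2_inner D h (W' r \<omega> - W' s \<omega>))\<^sup>2 \<partial>P') = (r - s) * L2_inner D (Q h) h"
  proof (cases "s = r")
    case True
    have "L2_inner D h (f - f) = 0" for f :: "'a \<Rightarrow> real" by (simp add: L2_inner_def)
    then show ?thesis using True by (simp add: sq_integrable_def)
  next
    case False
    then have "s < r" using st by simp
    moreover have "0 \<le> (r - s) * L2_inner D (Q h) h"
      using Q h st by (intro mult_nonneg_nonneg) (auto simp: covariance_operator_def)
    ultimately show ?thesis
      using centred_gaussian_second_moment[OF P' W'_gaussian[OF st(1,2) _ h]]
      by (simp add: L2_inner_commute[of D h])
  qed
  then show "sq_integrable P' (\<lambda>\<omega>. L2_inner D h (W' r \<omega> - W' s \<omega>))"
    "(\<integral>\<omega>. (L2_inner D h (W' r \<omega> - W' s \<omega>))\<^sup>2 \<partial>P') = (r - s) * L2_inner D (Q h) h" by auto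
qed

text \<open>Passing from one dyadic level to the next changes the integrand only on the left half of each
  cell, by \<open>O(2\<^sup>-\<^sup>k)\<close>; there are \<open>2\<^sup>k\<close> cells, on each of which the increment of \<open>W'\<close> has standard
  deviation \<open>O(2\<^sup>-\<^sup>k\<^sup>/\<^sup>2)\<close>.  The triangle inequality then suffices for geometric convergence.\<close>

lemma dyadic_Wiener_integral:
  assumes D: "open D" "bounded D" and Q: "covariance_operator D Q" and t: "t \<in> {0..T}"
    and \<psi>L: "\<And>s. s \<in> {0..t} \<Longrightarrow> \<psi> s \<in> L2 D" and \<psi>H: "\<And>s. s \<in> {0<..t} \<Longrightarrow> \<psi> s \<in> H1 D"
    and \<psi>0: "t = 0 \<Longrightarrow> \<psi> 0 \<in> H1 D"
    and C: "0 \<le> C" "\<And>a b x. a \<in> {0..t} \<Longrightarrow> b \<in> {0..t} \<Longrightarrow> x \<in> D \<Longrightarrow> \<bar>\<psi> a x - \<psi> b x\<bar> \<le> C * \<bar>a - b\<bar>"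
  obtains X where "has_Wiener_integral P' D W' t \<psi> X"
    "AE \<omega> in P'. (\<lambda>k. \<Sum>i<2 ^ k. Z (dyadic t k (Suc i)) (\<psi> (dyadic t k (Suc i))) \<omega> -
       Z (dyadic t k i) (\<psi> (dyadic t k (Suc i))) \<omega>) \<longlonglongrightarrow> X \<omega>"
proof -
  have Db: "D \<in> sets borel" using D by simp
  have t0: "0 \<le> t" "t \<le> T" using t by auto
  let ?s = "dyadic t"
  have s: "?s k i \<in> {0..t}" if "i \<le> 2 ^ k" for k i using dyadic_bounds[OF t0(1) that] by auto
  have sT: "?s k i \<in> {0..T}" if "i \<le> 2 ^ k" for k i using s[OF that] t0 by auto
  have sm: "?s k i \<le> ?s k (Suc i)" for k i by (rule dyadic_mono[OF t0(1)]) simp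
  \<comment> \<open>The integrand is sampled at right endpoints: membership of
    \<open>\<psi> s\<close> in H^1 is available for positive s, and right endpoints are positive
    unless t = 0.\<close>
  define I where "I k \<omega> = step_integral D W' (2 ^ k) (?s k) (\<lambda>i. \<psi> (?s k (Suc i))) \<omega>" for k \<omega>
  define d where "d k i = (\<lambda>x. \<psi> (?s (Suc k) (Suc (2 * i))) x - \<psi> (?s k (Suc i)) x)" for k i
  define J where "J k i \<omega> = L2_inner D (d k i) (W' (?s (Suc k) (Suc (2 * i))) \<omega> - W' (?s k i) \<omega>)" for k i \<omega>
  have mid: "Suc (2 * i) \<le> 2 ^ Suc k" if "i < 2 ^ k" for i k :: nat using that by simp
  have dL: "d k i \<in> L2 D" if "i < 2 ^ k" for k i
    unfolding d_def using s[OF mid[OF that]] s[of "Suc i" k] that by (intro L2_diff \<psi>L) auto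
  have gap: "?s (Suc k) (Suc (2 * i)) - ?s k i = t / 2 ^ Suc k" for k i
    using dyadic_simps(3)[of t "Suc k" "2 * i"] by (simp add: dyadic_simps(4))
  have gap2: "?s k (Suc i) - ?s (Suc k) (Suc (2 * i)) = t / 2 ^ Suc k" for k i
    using dyadic_simps(3)[of t "Suc k" "Suc (2 * i)"] dyadic_simps(4)[of t k "Suc i"] by simp
  obtain CQ where CQ: "0 \<le> CQ" "\<And>h. h \<in> L2 D \<Longrightarrow> L2_inner D (Q h) h \<le> CQ * (L2_norm D h)\<^sup>2"
    using covariance_operator_bound[OF Q] by metis
  define q where "q k = C * (t / 2 ^ Suc k)" for k
  have q0: "0 \<le> q k" for k unfolding q_def using C t0 by simp
  \<comment> \<open>The root collects the standard deviation of an increment over half a cell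
    together with the norm of \<open>Q\<close> and the volume of \<open>D\<close>; the factor C t/2
    is the oscillation \<open>q k\<close> without its power of 2.\<close>
  define A where "A = sqrt (t / 2 * (CQ * measure lborel D)) * (C * t / 2)"
  have J: "sq_integrable P' (J k i)"
    "sqrt (\<integral>\<omega>. (J k i \<omega>)\<^sup>2 \<partial>P') \<le> A * sqrt (1/2) ^ k / 2 ^ k" if i: "i < 2 ^ k" for k i
  proof -
    have le: "?s k i \<le> ?s (Suc k) (Suc (2 * i))" using gap[of k i] t0 by (simp add: algebra_simps)
    note mom = W'_increment_moment[OF sT[of i k] sT[OF mid[OF i]] le dL[OF i] Q]
    show "sq_integrable P' (J k i)" unfolding J_def using i by (intro mom(1)) auto
    have "(\<integral>\<omega>. (J k i \<omega>)\<^sup>2 \<partial>P') = t / 2 ^ Suc k * L2_inner D (Q (d k i)) (d k i)"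
      unfolding J_def gap[of k i, symmetric] using i by (intro mom(2)) auto
    also have "\<dots> \<le> t / 2 ^ Suc k * (CQ * ((q k)\<^sup>2 * measure lborel D))"
    proof (intro mult_left_mono)
      have "norm (d k i x) \<le> q k" if "x \<in> D" for x
      proof -
        have "norm (d k i x) \<le> C * \<bar>?s (Suc k) (Suc (2 * i)) - ?s k (Suc i)\<bar>"
          unfolding d_def real_norm_def using s[OF mid[OF i]] s[of "Suc i" k] i that by (intro C) auto
        also have "\<bar>?s (Suc k) (Suc (2 * i)) - ?s k (Suc i)\<bar> = t / 2 ^ Suc k"
          using gap2[of k i] t0 by (simp add: abs_minus_commute)
        finally show ?thesis by (simp add: q_def)
      qed
      then have "CQ * (L2_norm D (d k i))\<^sup>2 \<le> CQ * ((q k)\<^sup>2 * measure lborel D)"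
        by (intro mult_left_mono L2_norm_bounded Db D(2) dL i q0 CQ(1))
      then show "L2_inner D (Q (d k i)) (d k i) \<le> CQ * ((q k)\<^sup>2 * measure lborel D)"
        using CQ(2)[OF dL[OF i]] by linarith
    qed (use t0 in simp)
    finally have "sqrt (\<integral>\<omega>. (J k i \<omega>)\<^sup>2 \<partial>P') \<le> sqrt (t / 2 ^ Suc k * (CQ * ((q k)\<^sup>2 * measure lborel D)))"
      by (rule real_sqrt_le_mono)
    also have "t / 2 ^ Suc k * (CQ * ((q k)\<^sup>2 * measure lborel D)) =
        (t / 2 * (CQ * measure lborel D)) * (1/2) ^ k * (q k)\<^sup>2"
      by (simp add: field_simps)
    also have "sqrt \<dots> = sqrt (t / 2 * (CQ * measure lborel D)) * sqrt (1/2) ^ k * q k"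
      using q0[of k] by (simp only: real_sqrt_mult real_sqrt_power[symmetric] real_sqrt_abs abs_of_nonneg)
    also have "\<dots> = A * sqrt (1/2) ^ k / 2 ^ k" by (simp add: A_def q_def)
    finally show "sqrt (\<integral>\<omega>. (J k i \<omega>)\<^sup>2 \<partial>P') \<le> A * sqrt (1/2) ^ k / 2 ^ k" .
  qed
  have Isq: "sq_integrable P' (I k)" for k
    unfolding I_def[abs_def] step_integral_def
    using sT s[of "Suc _" k] sm by (intro sq_integrable_sum(1) W'_increment_moment(1) Q \<psi>L) auto
  \<comment> \<open>On the right half of a cell the refined sum samples the same endpoint as the
    coarse one, so only the left halves contribute.\<close>
  have diff: "I (Suc k) \<omega> - I k \<omega> = (\<Sum>i<2 ^ k. J k i \<omega>)" for k \<omega>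
  proof -
    let ?w = "\<lambda>k i. W' (?s k i) \<omega>"
    have "I (Suc k) \<omega> = (\<Sum>i<2 ^ k.
       L2_inner D (\<psi> (?s (Suc k) (Suc (2 * i)))) (?w (Suc k) (Suc (2 * i)) - ?w k i) +
       L2_inner D (\<psi> (?s k (Suc i))) (?w k (Suc i) - ?w (Suc k) (Suc (2 * i))))"
      using dyadic_simps(4)[of t k "Suc i" for i]
      unfolding I_def step_integral_def sum_dyadic_refine by (simp add: dyadic_simps(4))
    moreover have "L2_inner D (\<psi> (?s (Suc k) (Suc (2 * i)))) (?w (Suc k) (Suc (2 * i)) - ?w k i) +
       L2_inner D (\<psi> (?s k (Suc i))) (?w k (Suc i) - ?w (Suc k) (Suc (2 * i))) -
       L2_inner D (\<psi> (?s k (Suc i))) (?w k (Suc i) - ?w k i) = J k i \<omega>" if i: "i < 2 ^ k" for i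
    proof -
      have a: "\<psi> (?s k (Suc i)) \<in> L2 D" "\<psi> (?s (Suc k) (Suc (2 * i))) \<in> L2 D"
        using s[OF mid[OF i]] s[of "Suc i" k] i by (auto intro!: \<psi>L)
      have sp: "L2_inner D h (W' a \<omega> - W' b \<omega>) = L2_inner D h (W' a \<omega>) - L2_inner D h (W' b \<omega>)"
        if "h \<in> L2 D" for h a b
        using L2_inner_diff_left'[OF W'_L2 W'_L2 that] by (simp add: L2_inner_commute[of D h])
      show ?thesis
        unfolding J_def sp[OF a(1)] sp[OF a(2)] sp[OF dL[OF i]]
        unfolding d_def by (simp add: L2_inner_diff_left[OF a(2,1) W'_L2])
    qed
    ultimately show ?thesis
      unfolding I_def[of k] step_integral_def by (simp add: sum_subtractf[symmetric])
  qed
  have step: "sqrt (\<integral>\<omega>. (I (Suc k) \<omega> - I k \<omega>)\<^sup>2 \<partial>P') \<le> A * sqrt (1/2) ^ k" for k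
  proof -
    have "sqrt (\<integral>\<omega>. (\<Sum>i<2 ^ k. J k i \<omega>)\<^sup>2 \<partial>P') \<le> (\<Sum>i<2 ^ k. sqrt (\<integral>\<omega>. (J k i \<omega>)\<^sup>2 \<partial>P'))"
      by (rule sq_integrable_sum(2)) (rule J(1))
    also have "\<dots> \<le> (\<Sum>i<(2::nat) ^ k. A * sqrt (1/2) ^ k / 2 ^ k)"
      by (intro sum_mono J(2)) auto
    also have "\<dots> = A * sqrt (1/2) ^ k" by simp
    finally show ?thesis by (simp add: diff)
  qed
  have r: "0 < sqrt (1/2::real)" "sqrt (1/2::real) < 1" by auto
  obtain X where X: "sq_integrable P' X" "AE \<omega> in P'. (\<lambda>k. I k \<omega>) \<longlonglongrightarrow> X \<omega>"
    "(\<lambda>k. \<integral>\<^sup>+\<omega>. ennreal ((I k \<omega> - X \<omega>)\<^sup>2) \<partial>P') \<longlonglongrightarrow> 0"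
    by (rule sq_integrable_fast_Cauchy[OF Isq r step])
  have approx: "(\<lambda>k. \<integral>\<^sup>+\<tau>\<in>{0..t}. ennreal ((L2_norm D (step_fun (2 ^ k) (?s k)
      (\<lambda>i. \<psi> (?s k (Suc i))) \<tau> - \<psi> \<tau>))\<^sup>2) \<partial>lborel) \<longlonglongrightarrow> 0"
  proof -
    let ?b = "\<lambda>k::nat. (C * (t / 2 ^ k))\<^sup>2 * measure lborel D"
    have le: "(\<integral>\<^sup>+\<tau>\<in>{0..t}. ennreal ((L2_norm D (step_fun (2 ^ k) (?s k)
      (\<lambda>i. \<psi> (?s k (Suc i))) \<tau> - \<psi> \<tau>))\<^sup>2) \<partial>lborel) \<le> ennreal (?b k * t)" for k
    proof -
      \<comment> \<open>Time 0 belongs to no left-open cell, so the step function vanishes there; it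
        is discarded as a null set.\<close>
      have "AE \<tau> in lborel. \<tau> \<noteq> (0::real)" by (rule AE_lborel_singleton)
      then have "(\<integral>\<^sup>+\<tau>\<in>{0..t}. ennreal ((L2_norm D (step_fun (2 ^ k) (?s k)
        (\<lambda>i. \<psi> (?s k (Suc i))) \<tau> - \<psi> \<tau>))\<^sup>2) \<partial>lborel) \<le> (\<integral>\<^sup>+\<tau>. ennreal (?b k) * indicator {0..t} \<tau> \<partial>lborel)"
      proof (intro nn_integral_mono_AE, eventually_elim)
        fix \<tau> :: real assume "\<tau> \<noteq> 0"
        show "ennreal ((L2_norm D (step_fun (2 ^ k) (?s k) (\<lambda>i. \<psi> (?s k (Suc i))) \<tau> - \<psi> \<tau>))\<^sup>2) * indicator {0..t} \<tau>
          \<le> ennreal (?b k) * indicator {0..t} \<tau>"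
        proof (cases "\<tau> \<in> {0..t}")
          case True
          then have "0 < \<tau>" "\<tau> \<le> t" using \<open>\<tau> \<noteq> 0\<close> by auto
          then obtain i where i: "i < 2 ^ k" "?s k i < \<tau>" "\<tau> \<le> ?s k (Suc i)"
            "\<forall>c. (\<Sum>j<2 ^ k. indicator {?s k j<..?s k (Suc j)} \<tau> * c j) = (c i :: real)"
            by (rule dyadic_cell)
          have eq: "step_fun (2 ^ k) (?s k) (\<lambda>i. \<psi> (?s k (Suc i))) \<tau> - \<psi> \<tau> = (\<lambda>x. \<psi> (?s k (Suc i)) x - \<psi> \<tau> x)"
            by (simp add: fun_eq_iff step_fun_def i(4))
          have si: "?s k (Suc i) \<in> {0..t}" using i(1) by (intro s) simp
          have "(L2_norm D (\<lambda>x. \<psi> (?s k (Suc i)) x - \<psi> \<tau> x))\<^sup>2 \<le> ?b k"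
          proof (rule L2_norm_bounded[OF Db D(2)])
            show "(\<lambda>x. \<psi> (?s k (Suc i)) x - \<psi> \<tau> x) \<in> L2 D" by (intro L2_diff \<psi>L si True)
            show "0 \<le> C * (t / 2 ^ k)" using C t0 by simp
            fix x assume "x \<in> D"
            then have "norm (\<psi> (?s k (Suc i)) x - \<psi> \<tau> x) \<le> C * \<bar>?s k (Suc i) - \<tau>\<bar>"
              unfolding real_norm_def by (intro C si True)
            also have "\<dots> \<le> C * (t / 2 ^ k)"
              using i(2,3) dyadic_simps(3)[of t k i] by (intro mult_left_mono C(1)) auto
            finally show "norm (\<psi> (?s k (Suc i)) x - \<psi> \<tau> x) \<le> C * (t / 2 ^ k)" .
          qed
          then show ?thesis unfolding eq using True by (simp add: ennreal_leI)
        qed simp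
      qed
      also have "\<dots> = ennreal (?b k * t)"
        using t0 by (simp add: nn_integral_cmult ennreal_mult'')
      finally show ?thesis .
    qed
    have "(\<lambda>k. ?b k * t) = (\<lambda>k. ((C * t)\<^sup>2 * measure lborel D * t) * (1/4) ^ k)"
    proof
      fix k :: nat
      have "((2::real) ^ k)\<^sup>2 = 4 ^ k" by (simp add: power2_eq_square power_mult_distrib[symmetric])
      then show "?b k * t = ((C * t)\<^sup>2 * measure lborel D * t) * (1/4) ^ k"
        by (simp add: power_divide power_mult_distrib)
    qed
    moreover have "(\<lambda>k. ((C * t)\<^sup>2 * measure lborel D * t) * (1/4::real) ^ k) \<longlonglongrightarrow> ((C * t)\<^sup>2 * measure lborel D * t) * 0"
      by (intro tendsto_mult tendsto_const LIMSEQ_realpow_zero) auto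
    ultimately have "(\<lambda>k. ennreal (?b k * t)) \<longlonglongrightarrow> ennreal 0" by (intro tendsto_ennrealI) simp
    then have "(\<lambda>k. ennreal (?b k * t)) \<longlonglongrightarrow> 0" by simp
    then show ?thesis
      by (rule tendsto_sandwich[OF always_eventually[OF allI] always_eventually[OF allI] tendsto_const, rotated 2])
        (rule zero_le, rule le)
  qed
  have "has_Wiener_integral P' D W' t \<psi> X"
    unfolding has_Wiener_integral_def
  proof (intro conjI exI[of _ "\<lambda>k. 2 ^ k"] exI[of _ ?s] exI[of _ "\<lambda>k i. \<psi> (?s k (Suc i))"] allI impI)
    show "X \<in> borel_measurable P'" "integrable P' (\<lambda>\<omega>. (X \<omega>)\<^sup>2)" using X(1) by (auto simp: sq_integrable_def)
    show "\<psi> (?s k (Suc i)) \<in> L2 D" if "i < 2 ^ k" for k i using that by (intro \<psi>L s) simp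
    show "(\<lambda>k. \<integral>\<^sup>+\<omega>. ennreal ((step_integral D W' (2 ^ k) (?s k) (\<lambda>i. \<psi> (?s k (Suc i))) \<omega> - X \<omega>)\<^sup>2) \<partial>P') \<longlonglongrightarrow> 0"
      using X(3) by (simp add: I_def)
  qed (use approx sm in \<open>auto simp: dyadic_simps\<close>)
  moreover
  have \<psi>s: "\<psi> (?s k (Suc i)) \<in> H1 D" if "i < 2 ^ k" for k i
  proof (cases "t = 0")
    case True
    then show ?thesis using \<psi>0 by (simp add: dyadic_def)
  next
    case False
    then have "0 < ?s k (Suc i)" using t0 by (simp add: dyadic_def)
    moreover have "?s k (Suc i) \<le> t" using s[of "Suc i" k] that by simp
    ultimately show ?thesis by (intro \<psi>H) simp
  qed
  \<comment> \<open>All dyadic points together give countably many pairs (t, \<phi>), so their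
    exceptional sets have a common null union.\<close>
  have "AE \<omega> in P'. \<forall>k. \<forall>i\<in>{..<2 ^ k}. L2_inner D (W' (?s k (Suc i)) \<omega>) (\<psi> (?s k (Suc i))) = Z (?s k (Suc i)) (\<psi> (?s k (Suc i))) \<omega> \<and>
     L2_inner D (W' (?s k i) \<omega>) (\<psi> (?s k (Suc i))) = Z (?s k i) (\<psi> (?s k (Suc i))) \<omega>"
    unfolding AE_all_countable
    by (intro allI AE_ball_countable' AE_conjI W'_inner sT \<psi>s) auto
  then have "AE \<omega> in P'. (\<lambda>k. \<Sum>i<2 ^ k. Z (?s k (Suc i)) (\<psi> (?s k (Suc i))) \<omega> -
       Z (?s k i) (\<psi> (?s k (Suc i))) \<omega>) \<longlonglongrightarrow> X \<omega>"
    using X(2)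
  proof eventually_elim
    fix \<omega>
    assume *: "\<forall>k. \<forall>i\<in>{..<2 ^ k}. L2_inner D (W' (?s k (Suc i)) \<omega>) (\<psi> (?s k (Suc i))) = Z (?s k (Suc i)) (\<psi> (?s k (Suc i))) \<omega> \<and>
     L2_inner D (W' (?s k i) \<omega>) (\<psi> (?s k (Suc i))) = Z (?s k i) (\<psi> (?s k (Suc i))) \<omega>"
      and lim: "(\<lambda>k. I k \<omega>) \<longlonglongrightarrow> X \<omega>"
    have "I k \<omega> = (\<Sum>i<2 ^ k. Z (?s k (Suc i)) (\<psi> (?s k (Suc i))) \<omega> - Z (?s k i) (\<psi> (?s k (Suc i))) \<omega>)" for k
      unfolding I_def step_integral_def
    proof (rule sum.cong[OF refl])
      fix i assume i: "i \<in> {..<(2::nat) ^ k}"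
      then have L: "\<psi> (?s k (Suc i)) \<in> L2 D" by (intro \<psi>L s) simp
      show "L2_inner D (\<psi> (?s k (Suc i))) (W' (?s k (Suc i)) \<omega> - W' (?s k i) \<omega>) =
        Z (?s k (Suc i)) (\<psi> (?s k (Suc i))) \<omega> - Z (?s k i) (\<psi> (?s k (Suc i))) \<omega>"
        using * i L2_inner_diff_left'[OF W'_L2 W'_L2 L] by (simp add: L2_inner_commute[of D "\<psi> _"])
    qed
    then show "(\<lambda>k. \<Sum>i<2 ^ k. Z (?s k (Suc i)) (\<psi> (?s k (Suc i))) \<omega> - Z (?s k i) (\<psi> (?s k (Suc i))) \<omega>) \<longlonglongrightarrow> X \<omega>"
      using lim by simp
  qed
  ultimately show ?thesis by (rule that)
qed

end

section \<open>Test functions in $C^1_c$ and the pathwise limit\<close>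

text \<open>Compact support in [0,t) times the closure of \<open>D\<close> upgrades interior
  differentiability to derivatives bounded on the open strip, a Lipschitz bound in time up to and
  including t, and vanishing at t. One constant \<open>C\<close> serves for both bounds.\<close>

lemma C1c_properties:
  fixes \<psi> :: "real \<Rightarrow> 'a::euclidean_space \<Rightarrow> real"
  assumes D: "open D" "bounded D" and \<psi>: "\<psi> \<in> C1c t D" and t: "0 < t"
  obtains G C where
    "\<And>\<tau> x. \<tau> \<in> {0<..<t} \<Longrightarrow> x \<in> D \<Longrightarrow> ((\<lambda>s. \<psi> s x) has_real_derivative fst (G (\<tau>, x))) (at \<tau>)"
    "\<And>\<tau> x. \<tau> \<in> {0<..<t} \<Longrightarrow> x \<in> D \<Longrightarrow> (\<psi> \<tau> has_derivative (\<lambda>h. snd (G (\<tau>, x)) \<bullet> h)) (at x)"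
    "continuous_on ({0<..<t} \<times> D) G"
    "0 \<le> C" "\<And>\<tau> x. \<tau> \<in> {0<..<t} \<Longrightarrow> x \<in> D \<Longrightarrow> norm (G (\<tau>, x)) \<le> C"
    "\<And>x. \<psi> t x = 0"
    "\<And>a. a \<in> {0..t} \<Longrightarrow> \<psi> a \<in> L2 D"
    "\<And>a b x. a \<in> {0..t} \<Longrightarrow> b \<in> {0..t} \<Longrightarrow> x \<in> D \<Longrightarrow> \<bar>\<psi> a x - \<psi> b x\<bar> \<le> C * \<bar>a - b\<bar>"
    "\<And>a. a \<in> {0<..<t} \<Longrightarrow> weak_grad D (\<psi> a) (\<lambda>x. snd (G (a, x)))"
    "\<And>x. x \<in> D \<Longrightarrow> continuous_on {0..<t} (\<lambda>s. \<psi> s x)"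
proof -
  have Db: "D \<in> sets borel" using D by simp
  obtain K G where K: "compact K" "K \<subseteq> {0..<t} \<times> closure D" "\<And>\<tau> x. (\<tau>, x) \<notin> K \<Longrightarrow> \<psi> \<tau> x = 0"
    and cont: "continuous_on ({0..<t} \<times> closure D) (case_prod \<psi>)"
    and Gc: "continuous_on ({0..<t} \<times> closure D) G"
    and der: "\<And>p. p \<in> {0<..<t} \<times> D \<Longrightarrow> (case_prod \<psi> has_derivative (\<lambda>q. G p \<bullet> q)) (at p)"
    using \<psi> unfolding C1c_def by blast
  have der_t: "((\<lambda>s. \<psi> s x) has_real_derivative fst (G (\<tau>, x))) (at \<tau>)" if "\<tau> \<in> {0<..<t}" "x \<in> D" for \<tau> x
  proof -
    have "((\<lambda>s. (s, x)) has_derivative (\<lambda>h. (h, 0))) (at \<tau>)" by (auto intro!: derivative_eq_intros)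
    then have "((\<lambda>s. case_prod \<psi> (s, x)) has_derivative (\<lambda>h. G (\<tau>, x) \<bullet> (h, 0))) (at \<tau>)"
      by (rule has_derivative_compose) (use der[of "(\<tau>, x)"] that in simp)
    moreover have "(\<lambda>h. G (\<tau>, x) \<bullet> (h, 0)) = (*) (fst (G (\<tau>, x)))" by (auto simp: inner_prod_def)
    ultimately show ?thesis by (simp add: has_field_derivative_def)
  qed
  have der_x: "(\<psi> \<tau> has_derivative (\<lambda>h. snd (G (\<tau>, x)) \<bullet> h)) (at x)" if "\<tau> \<in> {0<..<t}" "x \<in> D" for \<tau> x
  proof -
    have "((\<lambda>y. (\<tau>, y)) has_derivative (\<lambda>h. (0, h))) (at x)" by (auto intro!: derivative_eq_intros)
    then have "((\<lambda>y. case_prod \<psi> (\<tau>, y)) has_derivative (\<lambda>h. G (\<tau>, x) \<bullet> (0, h))) (at x)"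
      by (rule has_derivative_compose) (use der[of "(\<tau>, x)"] that in simp)
    then show ?thesis by (simp add: inner_prod_def)
  qed
  have Gc': "continuous_on ({0<..<t} \<times> D) G"
    using Gc by (rule continuous_on_subset) (use closure_subset in auto)
  have "bounded (G ` K)"
    using K Gc by (intro compact_imp_bounded compact_continuous_image) (auto intro: continuous_on_subset)
  then obtain C0 where C0: "\<And>p. p \<in> K \<Longrightarrow> norm (G p) \<le> C0" by (auto simp: bounded_iff)
  have oD: "open ({0<..<t} \<times> D)" using D by (intro open_Times) auto
  \<comment> \<open>Off the support \<psi> vanishes on a neighbourhood, so \<open>G\<close> is zero
    there; on the compact set \<open>K\<close> it is bounded by continuity.\<close>
  have Gout: "G p = 0" if p: "p \<in> {0<..<t} \<times> D" "p \<notin> K" for p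
  proof -
    have "((\<lambda>p. 0) has_derivative (\<lambda>q. 0 \<bullet> q)) (at p)" by simp
    then have "(case_prod \<psi> has_derivative (\<lambda>q. 0 \<bullet> q)) (at p)"
      by (rule has_derivative_transform_within_open[OF _ open_Compl[OF compact_imp_closed[OF K(1)]]])
         (use K(3) p(2) in auto)
    from grad_eqI[OF this] grad_eqI[OF der[OF p(1)]] show ?thesis by simp
  qed
  have GC: "norm (G p) \<le> \<bar>C0\<bar>" if "p \<in> {0<..<t} \<times> D" for p
    using C0[of p] Gout[OF that] by (cases "p \<in> K") auto
  have tK: "t \<notin> fst ` K" using K(2) by auto
  have \<psi>t: "\<psi> t x = 0" for x using tK by (intro K(3)) force
  \<comment> \<open>The projection of the support to the time axis is compact, so it has a largest
    time m < t; the midpoint of m and t lies beyond it.\<close>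
  have "\<exists>t'. 0 \<le> t' \<and> t' < t \<and> (\<forall>s\<ge>t'. \<forall>x. \<psi> s x = 0)"
  proof (cases "K = {}")
    case True
    then show ?thesis using K(3) t by (intro exI[of _ 0]) auto
  next
    case False
    have "compact (fst ` K)" using K by (intro compact_continuous_image continuous_on_fst continuous_on_id)
    then obtain m where m: "m \<in> fst ` K" "\<And>s. s \<in> fst ` K \<Longrightarrow> s \<le> m"
      using compact_attains_sup[of "fst ` K"] False by auto
    then have mt: "0 \<le> m" "m < t" using K(2) by auto
    have "\<psi> s x = 0" if "s \<ge> (m + t) / 2" for s x
    proof (rule K(3))
      show "(s, x) \<notin> K"
      proof
        assume "(s, x) \<in> K"
        then have "s \<le> m" using m(2)[of s] by force
        then show False using that mt by (simp add: field_simps)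
      qed
    qed
    then show ?thesis using mt by (intro exI[of _ "(m + t) / 2"]) auto
  qed
  then obtain t' where t': "0 \<le> t'" "t' < t" "\<And>s x. s \<ge> t' \<Longrightarrow> \<psi> s x = 0" by blast
  have \<psi>c: "continuous_on {0..<t} (\<lambda>s. \<psi> s x)" if "x \<in> D" for x
  proof -
    have "continuous_on {0..<t} (\<lambda>s. case_prod \<psi> (s, x))"
      using that closure_subset[of D]
      by (intro continuous_on_compose2[OF cont] continuous_intros) auto
    then show ?thesis by simp
  qed
  have lip1: "\<bar>\<psi> b x - \<psi> a x\<bar> \<le> \<bar>C0\<bar> * (b - a)" if "0 \<le> a" "a < b" "b < t" "x \<in> D" for a b x
  proof -
    have "\<exists>l z. a < z \<and> z < b \<and> ((\<lambda>s. \<psi> s x) has_real_derivative l) (at z) \<and> \<psi> b x - \<psi> a x = (b - a) * l"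
    proof (rule MVT[OF that(2)])
      show "continuous_on {a..b} (\<lambda>s. \<psi> s x)" by (rule continuous_on_subset[OF \<psi>c[OF that(4)]]) (use that in auto)
      show "(\<lambda>s. \<psi> s x) differentiable (at z)" if "a < z" "z < b" for z
        using der_t[of z x] \<open>0 \<le> a\<close> \<open>b < t\<close> \<open>x \<in> D\<close> that by (auto simp: real_differentiable_def)
    qed
    then obtain l z where z: "a < z" "z < b" "((\<lambda>s. \<psi> s x) has_real_derivative l) (at z)"
      "\<psi> b x - \<psi> a x = (b - a) * l" by blast
    have zt: "z \<in> {0<..<t}" using z that by auto
    have "l = fst (G (z, x))" using DERIV_unique[OF z(3) der_t[OF zt that(4)]] .
    then have "\<bar>l\<bar> \<le> \<bar>C0\<bar>" using GC[of "(z, x)"] norm_fst_le[of "fst (G (z, x))" "snd (G (z, x))"] zt that by simp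
    then show ?thesis using z(4) that by (simp add: abs_mult mult.commute[of "b - a"] mult_right_mono)
  qed
  \<comment> \<open>The mean value argument stops short of t. When b = t, the value there is
    replaced by the one at t' < t, where \<psi> already vanishes.\<close>
  have lip2: "\<bar>\<psi> b x - \<psi> a x\<bar> \<le> \<bar>C0\<bar> * (b - a)" if "0 \<le> a" "a \<le> b" "b \<le> t" "x \<in> D" for a b x
  proof (cases "a < t'")
    case True
    show ?thesis
    proof (cases "b < t")
      case True
      then show ?thesis using lip1[of a b x] that by (cases "a = b") auto
    next
      case False
      then have "b = t" using that by simp
      then have "\<psi> b x = \<psi> t' x" using t' by simp
      then have "\<bar>\<psi> b x - \<psi> a x\<bar> \<le> \<bar>C0\<bar> * (t' - a)" using lip1[of a t' x] True \<open>a < t'\<close> that t' by simp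
      also have "\<dots> \<le> \<bar>C0\<bar> * (b - a)" using \<open>b = t\<close> t' by (intro mult_left_mono) auto
      finally show ?thesis .
    qed
  next
    case False
    then show ?thesis using t'(3)[of a x] t'(3)[of b x] that by simp
  qed
  have lip: "\<bar>\<psi> a x - \<psi> b x\<bar> \<le> \<bar>C0\<bar> * \<bar>a - b\<bar>" if "a \<in> {0..t}" "b \<in> {0..t}" "x \<in> D" for a b x
    using lip2[of a b x] lip2[of b a x] that by (cases "a \<le> b") (auto simp: abs_minus_commute)
  have \<psi>L: "\<psi> a \<in> L2 D" if a: "a \<in> {0..t}" for a
  proof (cases "a = t")
    case True
    then have "\<psi> a = (\<lambda>x. 0)" using \<psi>t by auto
    then show ?thesis by (simp add: L2_zero)
  next
    case False
    have "continuous_on D (\<lambda>x. case_prod \<psi> (a, x))"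
      using a False closure_subset[of D] by (intro continuous_on_compose2[OF cont] continuous_intros) auto
    then have m: "set_borel_measurable lborel D (\<psi> a)"
      unfolding set_borel_measurable_def using borel_measurable_continuous_on_indicator[OF Db, of "\<psi> a"] by simp
    have "norm (\<psi> a x) \<le> \<bar>C0\<bar> * t" if x: "x \<in> D" for x
    proof -
      have "\<bar>\<psi> a x - \<psi> t x\<bar> \<le> \<bar>C0\<bar> * \<bar>a - t\<bar>" using lip[of a t x] a t x by simp
      also have "\<dots> \<le> \<bar>C0\<bar> * t" using a by (intro mult_left_mono) auto
      finally show ?thesis by (simp add: \<psi>t)
    qed
    then show ?thesis by (intro L2_boundedI[OF Db D(2) m])
  qed
  have wg: "weak_grad D (\<psi> a) (\<lambda>x. snd (G (a, x)))" if a: "a \<in> {0<..<t}" for a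
  proof (rule weak_grad_C1[OF D(1)])
    show "(\<psi> a has_derivative (\<bullet>) (snd (G (a, x)))) (at x)" if "x \<in> D" for x using der_x[OF a that] .
    show sc: "continuous_on D (\<lambda>x. snd (G (a, x)))"
      using a by (intro continuous_on_snd continuous_on_compose2[OF Gc'] continuous_intros) auto
    show "\<psi> a \<in> L2 D" using a by (intro \<psi>L) auto
    show "(\<lambda>x. snd (G (a, x))) \<in> L2 D"
    proof (rule L2_boundedI[OF Db D(2)])
      show "set_borel_measurable lborel D (\<lambda>x. snd (G (a, x)))"
        unfolding set_borel_measurable_def using borel_measurable_continuous_on_indicator[OF Db sc] by simp
      show "norm (snd (G (a, x))) \<le> \<bar>C0\<bar>" if "x \<in> D" for x
        using GC[of "(a, x)"] norm_snd_le[of "snd (G (a, x))" "fst (G (a, x))"] a that by simp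
    qed
  qed
  show ?thesis
    by (rule that[of G "\<bar>C0\<bar>"]) (use der_t der_x Gc' GC \<psi>t \<psi>L lip wg \<psi>c in auto)
qed

lemma set_integral_bound:
  fixes f :: "'a::euclidean_space \<Rightarrow> real"
  assumes D: "D \<in> sets borel" "bounded D" and f: "set_integrable lborel D f" and c: "\<And>x. x \<in> D \<Longrightarrow> \<bar>f x\<bar> \<le> h x"
    and h: "set_integrable lborel D h"
  shows "\<bar>LINT x:D|lborel. f x\<bar> \<le> (LINT x:D|lborel. h x)"
proof -
  have "\<bar>LINT x:D|lborel. f x\<bar> \<le> (\<integral>x. \<bar>indicator D x *\<^sub>R f x\<bar> \<partial>lborel)"
    unfolding set_lebesgue_integral_def by (rule integral_abs_bound)
  also have "\<dots> \<le> (\<integral>x. indicator D x *\<^sub>R h x \<partial>lborel)"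
    using f h c unfolding set_integrable_def by (intro integral_mono integrable_abs) (auto simp: indicator_def)
  finally show ?thesis by (simp add: set_lebesgue_integral_def)
qed

lemma grad_functional_increment:
  assumes D: "open D" "bounded D" and t: "0 \<le> a" "a \<le> b" "b \<le> T" and v: "v \<in> L2_H1 T D" and \<phi>: "\<phi> \<in> H1 D"
  shows "has_bochner_integral lborel (\<lambda>s. indicator {a<..b} s * L2_inner D (grad_xt T D v s) (wgrad D \<phi>))
    (grad_functional T D b \<phi> v - grad_functional T D a \<phi> v)"
proof -
  have Db: "D \<in> sets borel" using D by simp
  let ?f = "\<lambda>s. L2_inner D (grad_xt T D v s) (wgrad D \<phi>)"
  have i: "set_integrable lborel {0..b} ?f" "set_integrable lborel {0..a} ?f"
    using t by (auto intro!: grad_functional_inner(2)[OF Db _ v \<phi>])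
  have j: "set_integrable lborel {a<..b} ?f" using t by (intro set_integrable_subset[OF i(1)]) auto
  have dis: "{0..a} \<inter> {a<..b} = {}" by auto
  have "{0..a} \<union> {a<..b} = {0..b}" using t by auto
  then have "grad_functional T D b \<phi> v = grad_functional T D a \<phi> v + (LINT s:{a<..b}|lborel. ?f s)"
    unfolding grad_functional_def using set_integral_Un[OF dis i(2) j] by simp
  then show ?thesis
    using j by (simp add: has_bochner_integral_iff set_integrable_def set_lebesgue_integral_def)
qed

lemma C_L1_tendsto:
  assumes D: "open D" "bounded D" and g: "g \<in> C_L1 T D" and r: "r \<longlonglongrightarrow> \<tau>" "\<And>k. r k \<in> {0..T}" "\<tau> \<in> {0..T}"
  shows "(\<lambda>k. LINT x:D|lborel. \<bar>g (r k) x - g \<tau> x\<bar>) \<longlonglongrightarrow> 0"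
proof -
  let ?f = "\<lambda>s. LINT x:D|lborel. \<bar>g s x - g \<tau> x\<bar>"
  have "(?f \<longlongrightarrow> ?f \<tau>) (at \<tau> within {0..T})" using g r(3) by (simp add: C_L1_def)
  then have "((\<lambda>k. ?f (r k)) \<longlongrightarrow> ?f \<tau>) sequentially"
    using r by (intro continuous_within_tendsto_compose'[of \<tau> "{0..T}" ?f]) (auto simp: continuous_within)
  then show ?thesis by simp
qed

text \<open>The statement is deterministic, for one sample path. Summation by parts moves the
  increments from \<open>g\<close>, which is merely continuous in time, onto \<psi>. The
  \<open>g 0\<close> terms of \<open>Z\<close> cancel within each difference, and of the telescoping
  sum only the contribution at time 0 survives since \<open>\<psi> t\<close> is zero. What remains
  is the time integral of \<open>F k\<close>.\<close>

lemma dyadic_sum_tendsto: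
  fixes \<psi> :: "real \<Rightarrow> 'a::euclidean_space \<Rightarrow> real"
  assumes D: "open D" "bounded D" and t: "0 < t" "t \<le> T" and \<psi>: "\<psi> \<in> C1c t D" and v: "v \<in> L2_H1 T D"
    and gm: "case_prod g \<in> borel_measurable borel" and gb: "\<And>s x. \<bar>g s x\<bar> \<le> 1" and gc: "g \<in> C_L1 T D"
    and Z: "\<And>s \<phi>. Z s \<phi> = 2 * L2_inner D (g s) \<phi> - 2 * L2_inner D (g 0) \<phi> + grad_functional T D s \<phi> v"
  shows "(\<lambda>k. \<Sum>i<2 ^ k. Z (dyadic t k (Suc i)) (\<psi> (dyadic t k (Suc i))) -
       Z (dyadic t k i) (\<psi> (dyadic t k (Suc i)))) \<longlonglongrightarrow>
    (LINT \<tau>:{0..t}|lborel. (LINT x:D|lborel. - 2 * g \<tau> x * deriv (\<lambda>s. \<psi> s x) \<tau> +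
       grad_xt T D v \<tau> x \<bullet> grad (\<psi> \<tau>) x)) - (LINT x:D|lborel. 2 * g 0 x * \<psi> 0 x)"
proof -
  have Db: "D \<in> sets borel" using D by simp
  let ?s = "dyadic t"
  let ?\<mu> = "measure lborel D"
  obtain G C where
    der_t: "\<And>\<tau> x. \<tau> \<in> {0<..<t} \<Longrightarrow> x \<in> D \<Longrightarrow> ((\<lambda>s. \<psi> s x) has_real_derivative fst (G (\<tau>, x))) (at \<tau>)"
    and der_x: "\<And>\<tau> x. \<tau> \<in> {0<..<t} \<Longrightarrow> x \<in> D \<Longrightarrow> (\<psi> \<tau> has_derivative (\<lambda>h. snd (G (\<tau>, x)) \<bullet> h)) (at x)"
    and Gc: "continuous_on ({0<..<t} \<times> D) G"
    and C0: "0 \<le> C" and GC: "\<And>\<tau> x. \<tau> \<in> {0<..<t} \<Longrightarrow> x \<in> D \<Longrightarrow> norm (G (\<tau>, x)) \<le> C"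
    and \<psi>t: "\<And>x. \<psi> t x = 0"
    and \<psi>L: "\<And>a. a \<in> {0..t} \<Longrightarrow> \<psi> a \<in> L2 D"
    and lip: "\<And>a b x. a \<in> {0..t} \<Longrightarrow> b \<in> {0..t} \<Longrightarrow> x \<in> D \<Longrightarrow> \<bar>\<psi> a x - \<psi> b x\<bar> \<le> C * \<bar>a - b\<bar>"
    and wg: "\<And>a. a \<in> {0<..<t} \<Longrightarrow> weak_grad D (\<psi> a) (\<lambda>x. snd (G (a, x)))"
    and \<psi>c: "\<And>x. x \<in> D \<Longrightarrow> continuous_on {0..<t} (\<lambda>s. \<psi> s x)"
    by (rule C1c_properties[OF D \<psi> t(1)]) blast
  have s: "?s k i \<in> {0..t}" if "i \<le> 2 ^ k" for k i using dyadic_bounds[OF _ that, of t] t by auto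
  have sm: "?s k i \<le> ?s k (Suc i)" for k i by (rule dyadic_mono) (use t in auto)
  have mesh: "?s k (Suc i) - ?s k i = t / 2 ^ k" for k i by (rule dyadic_simps)
  have gL: "g a \<in> L2 D" for a
  proof (rule L2_boundedI[OF Db D(2)])
    have "(\<lambda>x. case_prod g (a, x)) \<in> borel_measurable borel"
      by (rule measurable_compose[OF _ gm]) (intro borel_measurable_continuous_onI continuous_intros)
    then show "set_borel_measurable lborel D (g a)" using Db by (simp add: set_borel_measurable_def)
  qed (use gb in simp)
  have t\<psi>: "\<psi> t = (\<lambda>x. 0)" using \<psi>t by auto
  have wg0: "weak_grad D (\<psi> t) (\<lambda>x. 0)" by (simp add: t\<psi> weak_grad_def L2_zero)
  \<comment> \<open>The field \<open>G\<close> describes derivatives before time t only; as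
    \<open>\<psi> t\<close> is zero, the zero field serves as weak gradient at the last right
    endpoint.\<close>
  define G' where "G' a x = (if a < t then snd (G (a, x)) else 0)" for a x
  have wG: "weak_grad D (\<psi> a) (G' a)" if "a \<in> {0<..t}" for a
    using that wg[of a] wg0 by (cases "a < t") (auto simp: G'_def[abs_def])
  have G'C: "norm (G' a x) \<le> C" if "a \<in> {0<..t}" "x \<in> D" for a x
    using GC[of a x] norm_snd_le[of "snd (G (a, x))" "fst (G (a, x))"] that C0 by (auto simp: G'_def)
  have \<psi>H: "\<psi> a \<in> H1 D" if "a \<in> {0<..t}" for a using wG[OF that] by (auto simp: H1_def)
  have G'L: "G' a \<in> L2 D" if "a \<in> {0<..t}" for a using wG[OF that] by (auto simp: weak_grad_def)
  have G'eq: "L2_eq D (wgrad D (\<psi> a)) (G' a)" if "a \<in> {0<..t}" for a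
    by (rule weak_grad_unique[OF D weak_grad_wgrad[OF \<psi>H[OF that]] wG[OF that]])
  have s': "?s k (Suc i) \<in> {0<..t}" if "i < 2 ^ k" for k i
  proof -
    have "0 < ?s k (Suc i)" using t by (simp add: dyadic_def)
    then show ?thesis using s[of "Suc i" k] that by auto
  qed

  \<comment> \<open>Summation by parts, written as one time integral per dyadic level\<close>
  let ?V = "grad_xt T D v"
  define c where "c k i = L2_inner D (g (?s k i)) (\<lambda>x. \<psi> (?s k (Suc i)) x - \<psi> (?s k i) x)" for k i
  \<comment> \<open>The factor 2^k/t makes \<open>c k i\<close> a difference quotient, so that
    integrating over the cell, which has length t/2^k, gives \<open>c k i\<close> back.\<close>
  define F where "F k \<tau> = (\<Sum>i<2 ^ k. indicator {?s k i<..?s k (Suc i)} \<tau> *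
     (L2_inner D (?V \<tau>) (wgrad D (\<psi> (?s k (Suc i)))) - 2 * (c k i * (2 ^ k / t))))" for k \<tau>
  define N where "N k = (\<Sum>i<2 ^ k. Z (?s k (Suc i)) (\<psi> (?s k (Suc i))) - Z (?s k i) (\<psi> (?s k (Suc i))))" for k
  have Fint: "has_bochner_integral lborel (F k) (\<Sum>i<2 ^ k. (grad_functional T D (?s k (Suc i)) (\<psi> (?s k (Suc i))) v -
      grad_functional T D (?s k i) (\<psi> (?s k (Suc i))) v) - 2 * c k i)" for k
    unfolding F_def right_diff_distrib
  proof (intro has_bochner_integral_sum has_bochner_integral_diff)
    fix i assume i: "i \<in> {..<(2::nat) ^ k}"
    show "has_bochner_integral lborel (\<lambda>\<tau>. indicator {?s k i<..?s k (Suc i)} \<tau> *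
       L2_inner D (?V \<tau>) (wgrad D (\<psi> (?s k (Suc i)))))
       (grad_functional T D (?s k (Suc i)) (\<psi> (?s k (Suc i))) v - grad_functional T D (?s k i) (\<psi> (?s k (Suc i))) v)"
      using s[of i k] s[of "Suc i" k] i t by (intro grad_functional_increment D v \<psi>H s' sm) auto
    have "has_bochner_integral lborel (\<lambda>\<tau>. indicator {?s k i<..?s k (Suc i)} \<tau> *\<^sub>R (2 * (c k i * (2 ^ k / t))))
       (measure lborel {?s k i<..?s k (Suc i)} *\<^sub>R (2 * (c k i * (2 ^ k / t))))"
      using sm[of k i]
      by (intro has_bochner_integral_scaleR_left has_bochner_integral_real_indicator) (auto simp: emeasure_lborel_Ioc)
    then show "has_bochner_integral lborel (\<lambda>\<tau>. indicator {?s k i<..?s k (Suc i)} \<tau> * (2 * (c k i * (2 ^ k / t)))) (2 * c k i)"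
      using t sm[of k i] by (simp add: mesh)
  qed
  have NF: "N k = (\<integral>\<tau>. F k \<tau> \<partial>lborel) - (LINT x:D|lborel. 2 * g 0 x * \<psi> 0 x)" for k
  proof -
    let ?p = "\<lambda>i. 2 * L2_inner D (g (?s k i)) (\<psi> (?s k i))"
    have ci: "c k i = L2_inner D (g (?s k i)) (\<psi> (?s k (Suc i))) - L2_inner D (g (?s k i)) (\<psi> (?s k i))"
      if "i < 2 ^ k" for i
      unfolding c_def using L2_inner_diff_left[OF \<psi>L \<psi>L gL, of "?s k (Suc i)" "?s k i" "?s k i"] s[of i k] s[of "Suc i" k] that
      by (simp add: L2_inner_commute[of D "g _"])
    have "N k = (\<Sum>i<2 ^ k. (?p (Suc i) - ?p i) + ((grad_functional T D (?s k (Suc i)) (\<psi> (?s k (Suc i))) v -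
      grad_functional T D (?s k i) (\<psi> (?s k (Suc i))) v) - 2 * c k i))"
      unfolding N_def Z by (intro sum.cong) (auto simp: ci)
    also have "\<dots> = (\<Sum>i<2 ^ k. ?p (Suc i) - ?p i) + (\<integral>\<tau>. F k \<tau> \<partial>lborel)"
      using Fint[of k] by (simp add: has_bochner_integral_iff sum.distrib)
    also have "(\<Sum>i<2 ^ k. ?p (Suc i) - ?p i) = ?p (2 ^ k) - ?p 0" by (rule sum_lessThan_telescope)
    also have "?p (2 ^ k) = 0"
      using L2_inner_zero_left[of D "g t"] by (simp add: dyadic_simps t\<psi> L2_inner_commute[of D "g t"])
    also have "?p 0 = (LINT x:D|lborel. 2 * g 0 x * \<psi> 0 x)"
      by (simp add: dyadic_simps L2_inner_def mult.assoc)
    finally show ?thesis by simp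
  qed

  \<comment> \<open>The dyadic cell containing a given time\<close>
  define cell where "cell k \<tau> i \<longleftrightarrow> i < 2 ^ k \<and> ?s k i < \<tau> \<and> \<tau> \<le> ?s k (Suc i) \<and>
      (\<forall>c. (\<Sum>j<2 ^ k. indicator {?s k j<..?s k (Suc j)} \<tau> * c j) = (c i :: real))" for k \<tau> i
  define idx where "idx k \<tau> = (SOME i. cell k \<tau> i)" for k \<tau>
  have cell: "cell k \<tau> (idx k \<tau>)" if "0 < \<tau> \<and> \<tau> \<le> t" for k \<tau>
  proof -
    have "\<exists>i. cell k \<tau> i"
      unfolding cell_def by (rule dyadic_cell[of \<tau> t k]) (use that in blast)+
    then show ?thesis unfolding idx_def by (rule someI_ex)
  qed
  note idx = cell[unfolded cell_def]
  define lo where "lo k \<tau> = ?s k (idx k \<tau>)" for k \<tau>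
  define hi where "hi k \<tau> = ?s k (Suc (idx k \<tau>))" for k \<tau>
  define q where "q k \<tau> x = (\<psi> (hi k \<tau>) x - \<psi> (lo k \<tau>) x) * (2 ^ k / t)" for k \<tau> x
  have lohi: "lo k \<tau> < \<tau>" "\<tau> \<le> hi k \<tau>" "lo k \<tau> \<in> {0..t}" "hi k \<tau> \<in> {0<..t}" "hi k \<tau> - lo k \<tau> = t / 2 ^ k"
    if "0 < \<tau>" "\<tau> \<le> t" for k \<tau>
    using idx[of \<tau> k] that s[of "idx k \<tau>" k] s'[of "idx k \<tau>" k] mesh[of k "idx k \<tau>"] by (auto simp: lo_def hi_def)
  have qL: "q k \<tau> \<in> L2 D" if "0 < \<tau>" "\<tau> \<le> t" for k \<tau>
    using lohi[OF that, of k] L2_cmult[OF L2_diff[OF \<psi>L \<psi>L], of "hi k \<tau>" "lo k \<tau>" "2 ^ k / t"]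
    by (auto simp: q_def[abs_def] mult.commute)
  have qC: "\<bar>q k \<tau> x\<bar> \<le> C" if "0 < \<tau>" "\<tau> \<le> t" "x \<in> D" for k \<tau> x
  proof -
    have "\<bar>\<psi> (hi k \<tau>) x - \<psi> (lo k \<tau>) x\<bar> \<le> C * \<bar>hi k \<tau> - lo k \<tau>\<bar>"
      using lohi[OF that(1,2), of k] that by (intro lip) auto
    then have "\<bar>\<psi> (hi k \<tau>) x - \<psi> (lo k \<tau>) x\<bar> * (2 ^ k / t) \<le> C * (t / 2 ^ k) * (2 ^ k / t)"
      using lohi(5)[OF that(1,2), of k] t by (intro mult_right_mono) auto
    then show ?thesis using t by (simp add: q_def abs_mult)
  qed
  have Feq: "F k \<tau> = L2_inner D (?V \<tau>) (wgrad D (\<psi> (hi k \<tau>))) - 2 * L2_inner D (g (lo k \<tau>)) (q k \<tau>)"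
    if "0 < \<tau>" "\<tau> \<le> t" for k \<tau>
  proof -
    have "c k (idx k \<tau>) * (2 ^ k / t) = L2_inner D (g (lo k \<tau>)) (q k \<tau>)"
      using L2_inner_cmult_left[of D "2 ^ k / t" "\<lambda>x. \<psi> (hi k \<tau>) x - \<psi> (lo k \<tau>) x" "g (lo k \<tau>)"]
      by (simp add: c_def lo_def hi_def q_def[abs_def] L2_inner_commute[of D "g _"] mult.commute)
    then show ?thesis
      using idx[of \<tau> k] that unfolding F_def by (simp add: hi_def)
  qed
  have Fzero: "F k \<tau> = 0" if "\<not> (0 < \<tau> \<and> \<tau> \<le> t)" for k \<tau>
  proof -
    have "\<not> (?s k i < \<tau> \<and> \<tau> \<le> ?s k (Suc i))" if "i < 2 ^ k" for i
      using s[of i k] s[of "Suc i" k] that \<open>\<not> (0 < \<tau> \<and> \<tau> \<le> t)\<close> by auto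
    then show ?thesis unfolding F_def by (intro sum.neutral) (auto simp: indicator_def)
  qed

  \<comment> \<open>An integrable majorant\<close>
  have VL: "AE \<tau> in lborel. \<tau> \<in> {0..T} \<longrightarrow> ?V \<tau> \<in> L2 D" by (rule L2_slices[OF grad_xt_L2[OF v]])
  define L where "L \<tau> = (LINT x:D|lborel. - 2 * g \<tau> x * fst (G (\<tau>, x)) + ?V \<tau> x \<bullet> snd (G (\<tau>, x)))" for \<tau>
  \<comment> \<open>The gradient and the difference quotient of \<psi> have norm at most C
    sqrt(|D|), \<open>g\<close> has norm at most sqrt(|D|), and the norm of the gradient of
    \<open>v\<close> is bounded by 1 plus its square, which is integrable in time.\<close>
  define B where "B \<tau> = indicator {0..T} \<tau> * (C * sqrt ?\<mu> * (1 + L2_inner D (?V \<tau>) (?V \<tau>)) + 2 * (sqrt ?\<mu> * (C * sqrt ?\<mu>)))" for \<tau>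
  have Bint: "integrable lborel B"
  proof -
    have "integrable lborel (\<lambda>\<tau>. indicat_real {0..T} \<tau> * L2_inner D (?V \<tau>) (?V \<tau>))"
      using L2_inner_Fubini(2)[OF grad_xt_L2[OF v] grad_xt_L2[OF v]] by (simp add: set_integrable_def)
    moreover have "integrable lborel (indicat_real {0..T})" by (simp add: emeasure_lborel_Icc_eq)
    ultimately have "integrable lborel (\<lambda>\<tau>. (C * sqrt ?\<mu> + 2 * (sqrt ?\<mu> * (C * sqrt ?\<mu>))) * indicat_real {0..T} \<tau> +
       C * sqrt ?\<mu> * (indicat_real {0..T} \<tau> * L2_inner D (?V \<tau>) (?V \<tau>)))"
      by (intro Bochner_Integration.integrable_add integrable_mult_right)
    then show ?thesis by (simp add: B_def[abs_def] algebra_simps)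
  qed
  have gn: "L2_norm D (g a) \<le> sqrt ?\<mu>" for a
    using L2_norm_bounded[OF Db D(2) gL, of 1 a] gb by (intro real_le_rsqrt) simp
  have bound: "\<bar>F k \<tau>\<bar> \<le> B \<tau>" if V: "\<tau> \<in> {0..T} \<longrightarrow> ?V \<tau> \<in> L2 D" for k \<tau>
  proof (cases "0 < \<tau> \<and> \<tau> \<le> t")
    case True
    then have \<tau>: "0 < \<tau>" "\<tau> \<le> t" "\<tau> \<in> {0..T}" using t by auto
    have V': "?V \<tau> \<in> L2 D" using V \<tau> by simp
    note h = lohi(4)[OF \<tau>(1,2), of k]
    have "L2_norm D (wgrad D (\<psi> (hi k \<tau>))) = L2_norm D (G' (hi k \<tau>))"
      by (rule L2_norm_cong[OF G'eq[OF h] H1_L2(2)[OF \<psi>H[OF h]] G'L[OF h]])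
    also have "\<dots> \<le> sqrt (C\<^sup>2 * ?\<mu>)"
      using L2_norm_bounded[OF Db D(2) G'L[OF h] C0 G'C[OF h]] by (intro real_le_rsqrt) simp
    finally have w: "L2_norm D (wgrad D (\<psi> (hi k \<tau>))) \<le> C * sqrt ?\<mu>" using C0 by (simp add: real_sqrt_mult)
    have "L2_norm D (q k \<tau>) \<le> sqrt (C\<^sup>2 * ?\<mu>)"
      using L2_norm_bounded[OF Db D(2) qL[OF \<tau>(1,2)] C0, of k] qC[OF \<tau>(1,2)] by (intro real_le_rsqrt) simp
    then have qn: "L2_norm D (q k \<tau>) \<le> C * sqrt ?\<mu>" using C0 by (simp add: real_sqrt_mult)
    have "\<bar>L2_inner D (?V \<tau>) (wgrad D (\<psi> (hi k \<tau>)))\<bar> \<le> L2_norm D (?V \<tau>) * L2_norm D (wgrad D (\<psi> (hi k \<tau>)))"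
      by (intro L2_Cauchy_Schwarz V' H1_L2(2) \<psi>H h)
    also have "\<dots> \<le> (1 + L2_inner D (?V \<tau>) (?V \<tau>)) * (C * sqrt ?\<mu>)"
    proof (rule mult_mono[OF _ w])
      have "0 \<le> (L2_norm D (?V \<tau>) - 1)\<^sup>2" by simp
      then have "2 * L2_norm D (?V \<tau>) \<le> 1 + (L2_norm D (?V \<tau>))\<^sup>2" by (simp add: power2_diff)
      then show "L2_norm D (?V \<tau>) \<le> 1 + L2_inner D (?V \<tau>) (?V \<tau>)"
        using L2_norm_nonneg[of D "?V \<tau>"] unfolding L2_norm_sq by linarith
    qed (auto simp: L2_norm_nonneg L2_inner_self_nonneg)
    finally have 1: "\<bar>L2_inner D (?V \<tau>) (wgrad D (\<psi> (hi k \<tau>)))\<bar> \<le> (1 + L2_inner D (?V \<tau>) (?V \<tau>)) * (C * sqrt ?\<mu>)" .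
    have "\<bar>L2_inner D (g (lo k \<tau>)) (q k \<tau>)\<bar> \<le> L2_norm D (g (lo k \<tau>)) * L2_norm D (q k \<tau>)"
      by (intro L2_Cauchy_Schwarz gL qL \<tau>)
    also have "\<dots> \<le> sqrt ?\<mu> * (C * sqrt ?\<mu>)" by (intro mult_mono gn qn L2_norm_nonneg) auto
    finally have 2: "\<bar>L2_inner D (g (lo k \<tau>)) (q k \<tau>)\<bar> \<le> sqrt ?\<mu> * (C * sqrt ?\<mu>)" .
    have "\<bar>F k \<tau>\<bar> \<le> (1 + L2_inner D (?V \<tau>) (?V \<tau>)) * (C * sqrt ?\<mu>) + 2 * (sqrt ?\<mu> * (C * sqrt ?\<mu>))"
      unfolding Feq[OF \<tau>(1,2)] using 1 2 by linarith
    then show ?thesis using \<tau>(3) by (simp add: B_def mult.commute)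
  next
    case False
    have "0 \<le> B \<tau>" using C0 by (auto simp: B_def L2_inner_self_nonneg intro!: mult_nonneg_nonneg add_nonneg_nonneg)
    then show ?thesis using Fzero[OF False] by simp
  qed

  \<comment> \<open>Pointwise limit of the integrands in time\<close>
  have conv: "(\<lambda>k. F k \<tau>) \<longlonglongrightarrow> L \<tau>" if \<tau>: "0 < \<tau>" "\<tau> < t" and V: "?V \<tau> \<in> L2 D" for \<tau>
  proof -
    have \<tau>t: "\<tau> \<le> t" using \<tau> by simp
    note lh = lohi[OF \<tau>(1) \<tau>t]
    have m0: "(\<lambda>k::nat. t / 2 ^ k) \<longlonglongrightarrow> 0"
      using tendsto_mult_right_zero[OF LIMSEQ_realpow_zero[of "1/2::real"], of t] by (simp add: power_divide)
    have hil: "(\<lambda>k. hi k \<tau>) \<longlonglongrightarrow> \<tau>"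
    proof (rule LIM_zero_cancel, rule Lim_null_comparison[OF _ m0], intro always_eventually allI)
      show "norm (hi k \<tau> - \<tau>) \<le> t / 2 ^ k" for k using lh(1,2,5)[of k] by auto
    qed
    have lol: "(\<lambda>k. lo k \<tau>) \<longlonglongrightarrow> \<tau>"
    proof (rule LIM_zero_cancel, rule Lim_null_comparison[OF _ m0], intro always_eventually allI)
      show "norm (lo k \<tau> - \<tau>) \<le> t / 2 ^ k" for k using lh(1,2,5)[of k] by auto
    qed
    \<comment> \<open>From some level on the whole cell lies before t, where \<open>G\<close> really
      is the derivative of \<psi>.\<close>
    have hit: "eventually (\<lambda>k. hi k \<tau> < t) sequentially" by (rule order_tendstoD(2)[OF hil \<tau>(2)])
    have Gl: "(\<lambda>k. G (r k, x)) \<longlonglongrightarrow> G (\<tau>, x)"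
      if "r \<longlonglongrightarrow> \<tau>" "eventually (\<lambda>k. r k \<in> {0<..<t}) sequentially" "x \<in> D" for r x
      using that \<tau> by (intro continuous_on_tendsto_compose[OF Gc] tendsto_Pair tendsto_const) (auto elim: eventually_mono)
    have GL: "(\<lambda>x. snd (G (\<tau>, x))) \<in> L2 D" using wg[of \<tau>] \<tau> by (auto simp: weak_grad_def)
    have Vn: "integrable lborel (\<lambda>x. C * norm (indicator D x *\<^sub>R ?V \<tau> x))"
    proof (rule integrable_mult_right)
      have "integrable lborel (\<lambda>x. indicat_real D x + (norm (indicator D x *\<^sub>R ?V \<tau> x))\<^sup>2)"
        using V Db bounded_set_finite_emeasure[OF D(2)] by (simp add: L2_iff sq_integrable_def)
      then show "integrable lborel (\<lambda>x. norm (indicat_real D x *\<^sub>R ?V \<tau> x))"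
      proof (rule Bochner_Integration.integrable_bound)
        show "(\<lambda>x. norm (indicat_real D x *\<^sub>R ?V \<tau> x)) \<in> borel_measurable lborel"
          using V measurable_compose[OF _ borel_measurable_norm] unfolding L2_iff sq_integrable_def by blast
        show "AE x in lborel. norm (norm (indicat_real D x *\<^sub>R ?V \<tau> x)) \<le>
            norm (indicat_real D x + (norm (indicat_real D x *\<^sub>R ?V \<tau> x))\<^sup>2)"
        proof (rule AE_I2)
          fix x
          have "0 \<le> (norm (?V \<tau> x) - 1)\<^sup>2" by simp
          then have "2 * norm (?V \<tau> x) \<le> 1 + (norm (?V \<tau> x))\<^sup>2" by (simp add: power2_diff)
          then have le: "norm (?V \<tau> x) \<le> 1 + (norm (?V \<tau> x))\<^sup>2"
            using norm_ge_zero[of "?V \<tau> x"] by linarith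
          show "norm (norm (indicat_real D x *\<^sub>R ?V \<tau> x)) \<le>
            norm (indicat_real D x + (norm (indicat_real D x *\<^sub>R ?V \<tau> x))\<^sup>2)"
            using le by (auto simp: indicator_def)
        qed
      qed
    qed
    have im: "(\<lambda>x. (indicator D x *\<^sub>R f x) \<bullet> (indicator D x *\<^sub>R h x)) \<in> borel_measurable lborel"
      if "f \<in> L2 D" "h \<in> L2 D" for f h :: "'a \<Rightarrow> 'b::euclidean_space"
      using that by (intro borel_measurable_inner) (auto simp: L2_iff sq_integrable_def)
    have "(\<lambda>k. L2_inner D (?V \<tau>) (G' (hi k \<tau>))) \<longlonglongrightarrow> L2_inner D (?V \<tau>) (\<lambda>x. snd (G (\<tau>, x)))"
      unfolding L2_inner_integral
    proof (rule integral_dominated_convergence[OF im[OF V GL] im[OF V G'L[OF lh(4)]] Vn])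
      show "AE x in lborel. (\<lambda>k. (indicat_real D x *\<^sub>R ?V \<tau> x) \<bullet> (indicat_real D x *\<^sub>R G' (hi k \<tau>) x))
        \<longlonglongrightarrow> (indicat_real D x *\<^sub>R ?V \<tau> x) \<bullet> (indicat_real D x *\<^sub>R snd (G (\<tau>, x)))"
      proof (rule AE_I2)
        fix x
        show "(\<lambda>k. (indicat_real D x *\<^sub>R ?V \<tau> x) \<bullet> (indicat_real D x *\<^sub>R G' (hi k \<tau>) x))
          \<longlonglongrightarrow> (indicat_real D x *\<^sub>R ?V \<tau> x) \<bullet> (indicat_real D x *\<^sub>R snd (G (\<tau>, x)))"
        proof (cases "x \<in> D")
          case True
          have "eventually (\<lambda>k. hi k \<tau> \<in> {0<..<t}) sequentially"
            using hit by eventually_elim (use lh(4) in auto)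
          from tendsto_snd[OF Gl[OF hil this True]]
          have "(\<lambda>k. snd (G (hi k \<tau>, x))) \<longlonglongrightarrow> snd (G (\<tau>, x))" .
          then have "(\<lambda>k. G' (hi k \<tau>) x) \<longlonglongrightarrow> snd (G (\<tau>, x))"
            by (rule Lim_transform_eventually) (use hit in \<open>auto elim!: eventually_mono simp: G'_def\<close>)
          then show ?thesis by (intro tendsto_intros)
        qed simp
      qed
      show "AE x in lborel. norm ((indicat_real D x *\<^sub>R ?V \<tau> x) \<bullet> (indicat_real D x *\<^sub>R G' (hi k \<tau>) x))
         \<le> C * norm (indicat_real D x *\<^sub>R ?V \<tau> x)" for k
      proof (rule AE_I2)
        fix x
        show "norm ((indicat_real D x *\<^sub>R ?V \<tau> x) \<bullet> (indicat_real D x *\<^sub>R G' (hi k \<tau>) x))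
         \<le> C * norm (indicat_real D x *\<^sub>R ?V \<tau> x)"
        proof (cases "x \<in> D")
          case True
          have "\<bar>?V \<tau> x \<bullet> G' (hi k \<tau>) x\<bar> \<le> norm (?V \<tau> x) * norm (G' (hi k \<tau>) x)" by (rule Cauchy_Schwarz_ineq2)
          also have "\<dots> \<le> norm (?V \<tau> x) * C" using G'C[OF lh(4) True] by (intro mult_left_mono) auto
          finally show ?thesis using True by (simp add: mult.commute)
        qed simp
      qed
    qed
    moreover have "L2_inner D (?V \<tau>) (wgrad D (\<psi> (hi k \<tau>))) = L2_inner D (?V \<tau>) (G' (hi k \<tau>))" for k
      by (rule L2_inner_cong[OF L2_eq_refl G'eq[OF lh(4)] V V H1_L2(2)[OF \<psi>H[OF lh(4)]] G'L[OF lh(4)]])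
    ultimately have l1: "(\<lambda>k. L2_inner D (?V \<tau>) (wgrad D (\<psi> (hi k \<tau>)))) \<longlonglongrightarrow> L2_inner D (?V \<tau>) (\<lambda>x. snd (G (\<tau>, x)))"
      by simp
    have ql: "(\<lambda>k. q k \<tau> x) \<longlonglongrightarrow> fst (G (\<tau>, x))" if x: "x \<in> D" for x
    proof -
      \<comment> \<open>The mean value theorem replaces the difference quotient by the derivative at
        a time squeezed between the two endpoints, so continuity of \<open>G\<close> gives the
        limit.\<close>
      have "\<exists>z. lo k \<tau> < z \<and> z < hi k \<tau> \<and> q k \<tau> x = fst (G (z, x))" if hk: "hi k \<tau> < t" for k
      proof -
        have lt: "lo k \<tau> < hi k \<tau>" using lh(1,2)[of k] by simp
        have "\<exists>l z. lo k \<tau> < z \<and> z < hi k \<tau> \<and> ((\<lambda>s. \<psi> s x) has_real_derivative l) (at z) \<and>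
          \<psi> (hi k \<tau>) x - \<psi> (lo k \<tau>) x = (hi k \<tau> - lo k \<tau>) * l"
        proof (rule MVT[OF lt])
          show "continuous_on {lo k \<tau>..hi k \<tau>} (\<lambda>s. \<psi> s x)"
            using lh(3)[of k] hk by (intro continuous_on_subset[OF \<psi>c[OF x]]) auto
          show "(\<lambda>s. \<psi> s x) differentiable (at z)" if "lo k \<tau> < z" "z < hi k \<tau>" for z
            using der_t[of z x] lh(3)[of k] hk x that by (auto simp: real_differentiable_def)
        qed
        then obtain l z where z: "lo k \<tau> < z" "z < hi k \<tau>" "((\<lambda>s. \<psi> s x) has_real_derivative l) (at z)"
          "\<psi> (hi k \<tau>) x - \<psi> (lo k \<tau>) x = (hi k \<tau> - lo k \<tau>) * l" by blast
        have "z \<in> {0<..<t}" using z(1,2) lh(3)[of k] hk by auto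
        then have "l = fst (G (z, x))" using DERIV_unique[OF z(3) der_t] x by blast
        then have "q k \<tau> x = fst (G (z, x))" using z(4) lh(5)[of k] t by (simp add: q_def)
        then show ?thesis using z by blast
      qed
      then obtain z where z: "\<And>k. hi k \<tau> < t \<Longrightarrow> lo k \<tau> < z k \<and> z k < hi k \<tau> \<and> q k \<tau> x = fst (G (z k, x))" by metis
      have zl: "z \<longlonglongrightarrow> \<tau>"
        by (rule tendsto_sandwich[OF _ _ lol hil]) (use hit z in \<open>auto elim!: eventually_mono intro: less_imp_le\<close>)
      have "eventually (\<lambda>k. z k \<in> {0<..<t}) sequentially"
        using hit
      proof eventually_elim
        fix k assume "hi k \<tau> < t"
        then show "z k \<in> {0<..<t}" using z[of k] lh(3)[of k] by auto
      qed
      from tendsto_fst[OF Gl[OF zl this x]]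
      have "(\<lambda>k. fst (G (z k, x))) \<longlonglongrightarrow> fst (G (\<tau>, x))" .
      then show ?thesis by (rule Lim_transform_eventually) (use hit z in \<open>auto elim!: eventually_mono\<close>)
    qed
    \<comment> \<open>Measurability of the time derivative of \<psi> on \<open>D\<close> is obtained
      from its being the pointwise limit of the quotients.\<close>
    define d where "d x = indicat_real D x *\<^sub>R fst (G (\<tau>, x))" for x
    have qm: "(\<lambda>x. indicat_real D x *\<^sub>R q k \<tau> x) \<in> borel_measurable lborel" for k
      using qL[OF \<tau>(1) \<tau>t] by (simp add: L2_iff sq_integrable_def)
    have dl: "(\<lambda>k. indicat_real D x *\<^sub>R q k \<tau> x) \<longlonglongrightarrow> d x" for x
      using ql[of x] by (cases "x \<in> D") (auto simp: d_def)
    have dm: "d \<in> borel_measurable lborel" by (rule borel_measurable_LIMSEQ_metric[OF qm dl])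
    have gdm: "(\<lambda>x. (indicat_real D x *\<^sub>R g \<tau> x) * d x) \<in> borel_measurable lborel"
      using gL[of \<tau>] dm by (intro borel_measurable_times) (auto simp: L2_iff sq_integrable_def)
    have cD: "integrable lborel (\<lambda>x. C * indicat_real D x)" using Db bounded_set_finite_emeasure[OF D(2)] by simp
    have gq: "\<bar>g a x * q k \<tau> x\<bar> \<le> C" if "x \<in> D" for a x k
      using mult_mono[OF gb[of a x] qC[OF \<tau>(1) \<tau>t that, of k]] by (simp add: abs_mult)
    have "(\<lambda>k. L2_inner D (g \<tau>) (q k \<tau>)) \<longlonglongrightarrow> (\<integral>x. (indicat_real D x *\<^sub>R g \<tau> x) * d x \<partial>lborel)"
      unfolding L2_inner_integral
    proof (rule integral_dominated_convergence[OF gdm im[OF gL qL[OF \<tau>(1) \<tau>t]] cD])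
      show "AE x in lborel. (\<lambda>k. (indicat_real D x *\<^sub>R g \<tau> x) \<bullet> (indicat_real D x *\<^sub>R q k \<tau> x)) \<longlonglongrightarrow>
        (indicat_real D x *\<^sub>R g \<tau> x) * d x"
        unfolding inner_real_def by (intro AE_I2 tendsto_mult tendsto_const dl)
      show "AE x in lborel. norm ((indicat_real D x *\<^sub>R g \<tau> x) \<bullet> (indicat_real D x *\<^sub>R q k \<tau> x)) \<le> C * indicat_real D x" for k
        using gq by (intro AE_I2) (auto simp: indicator_def)
    qed
    \<comment> \<open>Replacing the left endpoint by \<tau> costs at most C times the L^1 distance
      of the two slices of \<open>g\<close>, since the quotients are bounded by C.\<close>
    moreover have "(\<lambda>k. L2_inner D (g (lo k \<tau>)) (q k \<tau>) - L2_inner D (g \<tau>) (q k \<tau>)) \<longlonglongrightarrow> 0"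
    proof (rule Lim_null_comparison)
      have "(\<lambda>k. LINT x:D|lborel. \<bar>g (lo k \<tau>) x - g \<tau> x\<bar>) \<longlonglongrightarrow> 0"
      proof (rule C_L1_tendsto[OF D gc lol])
        show "lo k \<tau> \<in> {0..T}" for k using lh(3)[of k] t by simp
        show "\<tau> \<in> {0..T}" using \<tau> t by simp
      qed
      from tendsto_mult_right_zero[OF this, of C]
      show "(\<lambda>k. C * (LINT x:D|lborel. \<bar>g (lo k \<tau>) x - g \<tau> x\<bar>)) \<longlonglongrightarrow> 0" .
      show "\<forall>\<^sub>F k in sequentially. norm (L2_inner D (g (lo k \<tau>)) (q k \<tau>) - L2_inner D (g \<tau>) (q k \<tau>)) \<le>
        C * (LINT x:D|lborel. \<bar>g (lo k \<tau>) x - g \<tau> x\<bar>)"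
      proof (intro always_eventually allI)
        fix k
        let ?d = "\<lambda>x. g (lo k \<tau>) x - g \<tau> x"
        have dL: "?d \<in> L2 D" by (intro L2_diff gL)
        have "L2_inner D (g (lo k \<tau>)) (q k \<tau>) - L2_inner D (g \<tau>) (q k \<tau>) = (LINT x:D|lborel. ?d x * q k \<tau> x)"
          using L2_inner_diff_left[OF gL gL qL[OF \<tau>(1) \<tau>t], of "lo k \<tau>" \<tau> k] by (simp add: L2_inner_def)
        moreover have "\<bar>LINT x:D|lborel. ?d x * q k \<tau> x\<bar> \<le> (LINT x:D|lborel. C * \<bar>?d x\<bar>)"
        proof (rule set_integral_bound[OF Db D(2)])
          show "set_integrable lborel D (\<lambda>x. ?d x * q k \<tau> x)"
            using L2_inner_integrable[OF dL qL[OF \<tau>(1) \<tau>t]] by simp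
          show "set_integrable lborel D (\<lambda>x. C * \<bar>?d x\<bar>)"
            using set_integrable_abs[OF L2_integrable[OF Db D(2) dL]] by (intro set_integrable_mult_right)
          show "\<bar>?d x * q k \<tau> x\<bar> \<le> C * \<bar>?d x\<bar>" if "x \<in> D" for x
            using mult_left_mono[OF qC[OF \<tau>(1) \<tau>t that, of k], of "\<bar>?d x\<bar>"] by (simp add: abs_mult mult.commute)
        qed
        ultimately show "norm (L2_inner D (g (lo k \<tau>)) (q k \<tau>) - L2_inner D (g \<tau>) (q k \<tau>)) \<le>
          C * (LINT x:D|lborel. \<bar>?d x\<bar>)" by simp
      qed
    qed
    ultimately have l2: "(\<lambda>k. L2_inner D (g (lo k \<tau>)) (q k \<tau>)) \<longlonglongrightarrow> (\<integral>x. (indicat_real D x *\<^sub>R g \<tau> x) * d x \<partial>lborel)"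
      by (rule Lim_transform)
    have "L \<tau> = L2_inner D (?V \<tau>) (\<lambda>x. snd (G (\<tau>, x))) - 2 * (\<integral>x. (indicat_real D x *\<^sub>R g \<tau> x) * d x \<partial>lborel)"
    proof -
      have i1: "integrable lborel (\<lambda>x. (indicat_real D x *\<^sub>R g \<tau> x) * d x)"
      proof (rule Bochner_Integration.integrable_bound[OF cD gdm])
        show "AE x in lborel. norm (indicat_real D x *\<^sub>R g \<tau> x * d x) \<le> norm (C * indicat_real D x)"
        proof (rule AE_I2)
          fix x
          show "norm (indicat_real D x *\<^sub>R g \<tau> x * d x) \<le> norm (C * indicat_real D x)"
          proof (cases "x \<in> D")
            case True
            have "\<bar>fst (G (\<tau>, x))\<bar> \<le> C"
              using GC[of \<tau> x] \<tau> True norm_fst_le[of "fst (G (\<tau>, x))" "snd (G (\<tau>, x))"] by simp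
            from mult_mono[OF gb[of \<tau> x] this] show ?thesis using True C0 by (simp add: d_def abs_mult)
          qed simp
        qed
      qed
      have i2: "set_integrable lborel D (\<lambda>x. ?V \<tau> x \<bullet> snd (G (\<tau>, x)))" by (rule L2_inner_integrable[OF V GL])
      have "L \<tau> = (\<integral>x. indicat_real D x *\<^sub>R (?V \<tau> x \<bullet> snd (G (\<tau>, x))) - 2 * ((indicat_real D x *\<^sub>R g \<tau> x) * d x) \<partial>lborel)"
        unfolding L_def set_lebesgue_integral_def
        by (rule Bochner_Integration.integral_cong) (auto simp: d_def indicator_def)
      also have "\<dots> = L2_inner D (?V \<tau>) (\<lambda>x. snd (G (\<tau>, x))) - 2 * (\<integral>x. (indicat_real D x *\<^sub>R g \<tau> x) * d x \<partial>lborel)"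
        using i1 i2 unfolding L2_inner_def set_lebesgue_integral_def set_integrable_def
        by (subst Bochner_Integration.integral_diff) auto
      finally show ?thesis .
    qed
    then show ?thesis
      using tendsto_diff[OF l1 tendsto_mult[OF tendsto_const[of 2] l2]] by (simp add: Feq[OF \<tau>(1) \<tau>t])
  qed

  \<comment> \<open>Passage to the limit under the time integral\<close>
  define L0 where "L0 \<tau> = (\<integral>x. indicator ({0<..<t} \<times> D) (\<tau>, x) *
     (- 2 * g \<tau> x * fst (G (\<tau>, x)) + ?V \<tau> x \<bullet> snd (G (\<tau>, x))) \<partial>lborel)" for \<tau>
  \<comment> \<open>With the indicator of the open strip included, the integrand is jointly
    measurable, and integrating out x leaves a measurable function of time.\<close>
  have L0m: "L0 \<in> borel_measurable lborel"
  proof -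
    have oD: "open ({0<..<t} \<times> D)" using D by (intro open_Times) auto
    then have oDb: "{0<..<t} \<times> D \<in> sets borel" by (rule borel_open)
    have G[measurable]: "(\<lambda>p. indicator ({0<..<t} \<times> D) p *\<^sub>R G p) \<in> borel_measurable (lborel \<Otimes>\<^sub>M lborel)"
      using borel_measurable_continuous_on_indicator[OF oDb Gc] by (simp add: lborel_prod)
    have V[measurable]: "(\<lambda>p. indicator ({0..T} \<times> D) p *\<^sub>R case_prod ?V p) \<in> borel_measurable (lborel \<Otimes>\<^sub>M lborel)"
      using grad_xt_L2[OF v] by (simp add: L2_iff sq_integrable_def lborel_prod)
    have g[measurable]: "case_prod g \<in> borel_measurable (lborel \<Otimes>\<^sub>M lborel)"
      using gm by (simp add: lborel_prod)
    let ?G = "\<lambda>p. indicator ({0<..<t} \<times> D) p *\<^sub>R G p"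
    have "(\<lambda>p. - 2 * case_prod g p * fst (?G p) + (indicator ({0..T} \<times> D) p *\<^sub>R case_prod ?V p) \<bullet> snd (?G p))
      \<in> borel_measurable (lborel \<Otimes>\<^sub>M lborel)"
    proof (intro borel_measurable_add borel_measurable_times borel_measurable_inner measurable_const)
      show "(\<lambda>p. fst (?G p)) \<in> borel_measurable (lborel \<Otimes>\<^sub>M lborel)"
        by (rule borel_measurable_continuous_on[OF continuous_on_fst[OF continuous_on_id] G])
      show "(\<lambda>p. snd (?G p)) \<in> borel_measurable (lborel \<Otimes>\<^sub>M lborel)"
        by (rule borel_measurable_continuous_on[OF continuous_on_snd[OF continuous_on_id] G])
    qed (use g V in auto)
    also have "(\<lambda>p. - 2 * case_prod g p * fst (?G p) + (indicator ({0..T} \<times> D) p *\<^sub>R case_prod ?V p) \<bullet> snd (?G p)) =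
       (\<lambda>(\<tau>, x). indicator ({0<..<t} \<times> D) (\<tau>, x) * (- 2 * g \<tau> x * fst (G (\<tau>, x)) + ?V \<tau> x \<bullet> snd (G (\<tau>, x))))"
      using t by (auto simp: fun_eq_iff indicator_def)
    finally show ?thesis unfolding L0_def by (rule lborel.borel_measurable_lebesgue_integral)
  qed
  have L0: "L0 \<tau> = indicator {0<..<t} \<tau> * L \<tau>" for \<tau>
    unfolding L0_def L_def set_lebesgue_integral_def
    by (cases "\<tau> \<in> {0<..<t}") (auto simp: indicator_def intro!: Bochner_Integration.integral_cong)
  have Flim: "(\<lambda>k. \<integral>\<tau>. F k \<tau> \<partial>lborel) \<longlonglongrightarrow> (\<integral>\<tau>. L0 \<tau> \<partial>lborel)"
  proof (rule integral_dominated_convergence[OF L0m _ Bint])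
    show "F k \<in> borel_measurable lborel" for k using Fint[of k] by (auto simp: has_bochner_integral_iff)
    show "AE \<tau> in lborel. norm (F k \<tau>) \<le> B \<tau>" for k using VL by eventually_elim (use bound in simp)
    have "AE \<tau> in lborel. \<tau> \<noteq> t" by (rule AE_lborel_singleton)
    then show "AE \<tau> in lborel. (\<lambda>k. F k \<tau>) \<longlonglongrightarrow> L0 \<tau>"
      using VL
    proof eventually_elim
      fix \<tau> assume a: "\<tau> \<noteq> t" "\<tau> \<in> {0..T} \<longrightarrow> ?V \<tau> \<in> L2 D"
      show "(\<lambda>k. F k \<tau>) \<longlonglongrightarrow> L0 \<tau>"
      proof (cases "0 < \<tau> \<and> \<tau> < t")
        case True
        then show ?thesis using conv[of \<tau>] a t by (simp add: L0)
      next
        case False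
        then have "\<not> (0 < \<tau> \<and> \<tau> \<le> t)" using a by auto
        from Fzero[OF this] False show ?thesis by (simp add: L0)
      qed
    qed
  qed
  define H where "H \<tau> = (LINT x:D|lborel. - 2 * g \<tau> x * deriv (\<lambda>s. \<psi> s x) \<tau> + ?V \<tau> x \<bullet> grad (\<psi> \<tau>) x)" for \<tau>
  have "H \<tau> = L \<tau>" if \<tau>: "\<tau> \<in> {0<..<t}" for \<tau>
    unfolding H_def L_def
    by (rule set_lebesgue_integral_cong)
      (use Db DERIV_imp_deriv[OF der_t[OF \<tau>]] grad_eqI[OF der_x[OF \<tau>]] in auto)
  \<comment> \<open>\<open>deriv\<close> and \<open>grad\<close> are identified with the components
    of \<open>G\<close> only at interior times; the two endpoints are split off as null
    sets.\<close>
  then have Heq: "indicator {0..t} \<tau> * H \<tau> = L0 \<tau> + indicator {0} \<tau> * H 0 + indicator {t} \<tau> * H t" for \<tau>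
    using t by (auto simp: L0 indicator_def)
  have "(LINT \<tau>:{0..t}|lborel. H \<tau>) = (\<integral>\<tau>. L0 \<tau> + indicator {0} \<tau> * H 0 + indicator {t} \<tau> * H t \<partial>lborel)"
    unfolding set_lebesgue_integral_def real_scaleR_def Heq ..
  also have "\<dots> = (\<integral>\<tau>. L0 \<tau> \<partial>lborel)"
  proof (rule integral_cong_AE)
    have "AE \<tau> in lborel. \<tau> \<noteq> (0::real)" "AE \<tau> in lborel. \<tau> \<noteq> t" by (rule AE_lborel_singleton)+
    then show "AE \<tau> in lborel. L0 \<tau> + indicator {0} \<tau> * H 0 + indicator {t} \<tau> * H t = L0 \<tau>"
      by eventually_elim simp
  qed (use L0m in auto)
  finally have "(LINT \<tau>:{0..t}|lborel. H \<tau>) = (\<integral>\<tau>. L0 \<tau> \<partial>lborel)" .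
  then have "(\<lambda>k. (\<integral>\<tau>. F k \<tau> \<partial>lborel) - (LINT x:D|lborel. 2 * g 0 x * \<psi> 0 x)) \<longlonglongrightarrow>
     (LINT \<tau>:{0..t}|lborel. H \<tau>) - (LINT x:D|lborel. 2 * g 0 x * \<psi> 0 x)"
    using Flim by (intro tendsto_diff tendsto_const) simp
  then show ?thesis unfolding NF[symmetric] N_def H_def .
qed

section \<open>Limit of the noise functional and path continuity of its limit\<close>

lemma tendsto_coordinatewise:
  fixes f :: "nat \<Rightarrow> 'i \<Rightarrow> 'b::topological_space"
  assumes "\<And>i. (\<lambda>k. f k i) \<longlonglongrightarrow> l i" shows "f \<longlonglongrightarrow> l"
proof -
  have "limitin (product_topology (\<lambda>i::'i. euclidean) UNIV) f l sequentially"
    using assms by (simp add: limitin_componentwise)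
  then show ?thesis by (simp add: euclidean_product_topology)
qed

text \<open>The difference takes the values -1, 0 and 1, so its square is its absolute value; L^1
  continuity of the indicator path thereby becomes L^2 continuity.\<close>

lemma L2_norm_indicator_diff:
  fixes S S' :: "'a::euclidean_space set"
  shows "(L2_norm D (indicat_real S - indicat_real S'))\<^sup>2 = (LINT x:D|lborel. \<bar>indicat_real S x - indicat_real S' x\<bar>)"
  unfolding L2_norm_sq L2_inner_def
  by (rule arg_cong[of _ _ "set_lebesgue_integral lborel D"]) (auto simp: fun_eq_iff indicator_def inner_real_def)

lemma indicator_path_continuous:
  fixes S :: "real \<Rightarrow> 'a::euclidean_space set"
  assumes S: "\<And>t. t \<in> {0..T} \<Longrightarrow> indicat_real (S t) \<in> L2 D" and c: "(\<lambda>t. indicat_real (S t)) \<in> C_L1 T D"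
    and h: "h \<in> L2 D"
  shows "continuous_on {0..T} (\<lambda>t. L2_inner D (indicat_real (S t)) h)"
proof (rule L2_inner_path_continuous[OF S h])
  fix t assume "t \<in> {0..T}"
  then have "((\<lambda>s. sqrt (LINT x:D|lborel. \<bar>indicat_real (S s) x - indicat_real (S t) x\<bar>)) \<longlongrightarrow> sqrt 0) (at t within {0..T})"
    using c by (intro tendsto_real_sqrt) (simp add: C_L1_def)
  then show "((\<lambda>s. L2_norm D (indicat_real (S s) - indicat_real (S t))) \<longlongrightarrow> 0) (at t within {0..T})"
    by (simp only: L2_norm_indicator_diff[symmetric] real_sqrt_abs abs_of_nonneg[OF L2_norm_nonneg] real_sqrt_zero)
qed

lemma grad_functional_continuous:
  assumes D: "open D" "bounded D" and v: "v \<in> L2_H1 T D" and \<phi>: "\<phi> \<in> H1 D"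
  shows "continuous_on {0..T} (\<lambda>t. grad_functional T D t \<phi> v)"
proof -
  have Db: "D \<in> sets borel" using D by simp
  let ?f = "\<lambda>s. L2_inner D (grad_xt T D v s) (wgrad D \<phi>)"
  have i: "set_integrable lborel {0..t} ?f" if "t \<le> T" for t
    by (rule grad_functional_inner(2)[OF Db that v \<phi>])
  have "continuous_on {0..T} (\<lambda>t. integral {0..t} ?f)"
    by (rule indefinite_integral_continuous_1[OF set_borel_integral_eq_integral(1)[OF i]]) simp
  then show ?thesis
    by (rule continuous_on_eq) (simp add: grad_functional_def set_borel_integral_eq_integral(2)[OF i])
qed

lemma set_integral_singleton_zero: "(LINT s:{a::real}|lborel. f s) = (0::real)"
  unfolding set_lebesgue_integral_def
proof (rule integral_eq_zero_AE)
  have "AE s in lborel. s \<noteq> a" by (rule AE_lborel_singleton)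
  then show "AE s in lborel. indicat_real {a} s *\<^sub>R f s = 0" by eventually_elim auto
qed

lemma converges_Holder_tendsto:
  assumes "converges_Holder \<beta> T D u w" "t \<in> {0..T}"
  shows "(\<lambda>k. L2_norm D (u k t - w t)) \<longlonglongrightarrow> 0"
proof -
  have H: "(\<lambda>k. Holder_norm \<beta> T D (u k - w)) \<longlonglongrightarrow> 0" using assms(1) by (simp add: converges_Holder_def)
  have le: "ennreal (L2_norm D (u k t - w t)) \<le> Holder_norm \<beta> T D (u k - w)" for k
  proof -
    have "ennreal (L2_norm D ((u k - w) t)) \<le> (SUP t\<in>{0..T}. ennreal (L2_norm D ((u k - w) t)))"
      by (rule SUP_upper[OF assms(2)])
    also have "\<dots> \<le> Holder_norm \<beta> T D (u k - w)" unfolding Holder_norm_def by simp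
    finally show ?thesis by simp
  qed
  have "(\<lambda>k. ennreal (L2_norm D (u k t - w t))) \<longlonglongrightarrow> 0"
    by (rule tendsto_sandwich[OF always_eventually[OF allI] always_eventually[OF allI] tendsto_const H])
      (rule zero_le, rule le)
  then have "(\<lambda>k. ennreal (L2_norm D (u k t - w t))) \<longlonglongrightarrow> ennreal 0" by simp
  then show ?thesis by (subst (asm) tendsto_ennreal_iff) (auto simp: L2_norm_nonneg)
qed

text \<open>The supremum part of the Holder norm gives L^2 convergence at each fixed time, and the
  gradient term is a bounded functional of the weakly convergent part. The constant -1 cancels
  between the times t and 0, leaving the factor 2.\<close>

lemma noise_functional_limit:
  assumes D: "open D" "bounded D" and conv: "converges_Holder \<beta> T D u (\<lambda>t x. - 1 + 2 * g t x)"
    and vconv: "weakly_converges_L2_H1 T D v v'" and uL: "\<And>k. u k \<in> C_L2 T D" and gL: "\<And>t. g t \<in> L2 D"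
    and t: "t \<in> {0..T}" and \<phi>: "\<phi> \<in> H1 D"
  shows "(\<lambda>k. noise_functional T D t \<phi> (u k) (v k)) \<longlonglongrightarrow>
    2 * L2_inner D (g t) \<phi> - 2 * L2_inner D (g 0) \<phi> + grad_functional T D t \<phi> v'"
proof -
  have Db: "D \<in> sets borel" using D by simp
  have \<phi>L: "\<phi> \<in> L2 D" by (rule H1_L2(1)[OF \<phi>])
  define w where "w t x = - 1 + 2 * g t x" for t x
  have wL: "w s \<in> L2 D" for s
    unfolding w_def[abs_def] by (intro L2_add L2_const L2_cmult gL Db D(2))
  have wi: "L2_inner D (w s) \<phi> = L2_inner D (\<lambda>x. - 1) \<phi> + 2 * L2_inner D (g s) \<phi>" for s
    unfolding w_def[abs_def]
      L2_inner_add_left[OF L2_const[OF Db D(2)] L2_cmult[OF gL] \<phi>L] L2_inner_cmult_left ..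
  have lim: "(\<lambda>k. L2_inner D (u k s) \<phi>) \<longlonglongrightarrow> L2_inner D (w s) \<phi>" if s: "s \<in> {0..T}" for s
  proof (rule L2_inner_tendsto[OF _ wL \<phi>L])
    show "\<forall>\<^sub>F k in sequentially. u k s \<in> L2 D" using uL s by (intro always_eventually) (auto simp: C_L2_def)
    show "(\<lambda>k. L2_norm D (u k s - w s)) \<longlonglongrightarrow> 0"
      using converges_Holder_tendsto[OF conv s] by (simp add: w_def[abs_def])
  qed
  have "(\<lambda>k. grad_functional T D t \<phi> (v k)) \<longlonglongrightarrow> grad_functional T D t \<phi> v'"
    using vconv grad_functional_linear_bounded[OF D _ \<phi>, of t T] t unfolding weakly_converges_L2_H1_def by auto
  from tendsto_add[OF tendsto_diff[OF lim[OF t] lim[of 0]] this] t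
  show ?thesis by (simp add: noise_functional_def wi)
qed

theorem theorem5p6:
  fixes D :: "'a::euclidean_space set"
    and T \<gamma> \<E>\<^sub>0 m\<^sub>0 :: real
    and Q :: "('a \<Rightarrow> real) \<Rightarrow> 'a \<Rightarrow> real"
    and \<rho> :: "real \<Rightarrow> real"
    and P :: "'w measure"
    and W :: "real \<Rightarrow> 'w \<Rightarrow> 'a \<Rightarrow> real"
    and W\<^sub>\<epsilon> \<xi> u v :: "real \<Rightarrow> 'w \<Rightarrow> real \<Rightarrow> 'a \<Rightarrow> real"
    and u0 :: "real \<Rightarrow> 'a \<Rightarrow> real"
    and P' :: "'v measure"
    and u' v' :: "real \<Rightarrow> 'v \<Rightarrow> real \<Rightarrow> 'a \<Rightarrow> real"
    and eps :: "nat \<Rightarrow> real"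
    and E :: "('v \<times> real \<times> 'a) set"
    and v_lim :: "'v \<Rightarrow> real \<Rightarrow> 'a \<Rightarrow> real"
  assumes "DIM('a) \<in> {2, 3}" and "smooth_bounded_domain D" and "T > 0" and "\<gamma> > 0"
    and "condition_Q D Q"
    and "condition_I D u0 \<E>\<^sub>0 m\<^sub>0"
    and "noise_kernel \<rho>"
    and "prob_space P" and "Q_Wiener_process D Q P UNIV W"
    and mollified_noise: "\<And>\<epsilon>. \<epsilon> \<in> {0<..1} \<Longrightarrow> AE \<omega> in P. \<forall>t.
          has_L2_integral D (\<lambda>s x. rescaled_kernel \<rho> \<gamma> \<epsilon> (t - s) * W s \<omega> x) (W\<^sub>\<epsilon> \<epsilon> \<omega> t) \<and>
          has_L2_derivative D (W\<^sub>\<epsilon> \<epsilon> \<omega>) (\<xi> \<epsilon> \<omega> t) t"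
    and u_rv: "\<And>\<epsilon>. \<epsilon> \<in> {0<..1} \<Longrightarrow> u \<epsilon> \<in> P \<rightarrow>\<^sub>M C_L2_borel T D"
    and v_rv: "\<And>\<epsilon>. \<epsilon> \<in> {0<..1} \<Longrightarrow> v \<epsilon> \<in> P \<rightarrow>\<^sub>M L2_H1_borel T D"
    and RCH: "\<And>\<epsilon>. \<epsilon> \<in> {0<..1} \<Longrightarrow>
          AE \<omega> in P. RCH_solution T D \<epsilon> (u0 \<epsilon>) (\<xi> \<epsilon> \<omega>) (u \<epsilon> \<omega>) (v \<epsilon> \<omega>)"
    and "prob_space P'"
    and u'_rv: "\<And>\<epsilon>. \<epsilon> \<in> {0<..1} \<Longrightarrow> u' \<epsilon> \<in> P' \<rightarrow>\<^sub>M C_L2_borel T D"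
    and v'_rv: "\<And>\<epsilon>. \<epsilon> \<in> {0<..1} \<Longrightarrow> v' \<epsilon> \<in> P' \<rightarrow>\<^sub>M L2_H1_borel T D"
    and same_law: "\<And>\<epsilon>. \<epsilon> \<in> {0<..1} \<Longrightarrow>
          distr P' (C_L2_borel T D \<Otimes>\<^sub>M L2_H1_borel T D) (\<lambda>\<omega>. (u' \<epsilon> \<omega>, v' \<epsilon> \<omega>)) =
          distr P (C_L2_borel T D \<Otimes>\<^sub>M L2_H1_borel T D) (\<lambda>\<omega>. (u \<epsilon> \<omega>, v \<epsilon> \<omega>))"
    and "\<And>k. eps k \<in> {0<..1}" and "decseq eps" and "eps \<longlonglongrightarrow> 0"
    and "E \<subseteq> space P' \<times> {0..T} \<times> D" and "E \<in> sets (P' \<Otimes>\<^sub>M (borel :: (real \<times> 'a) measure))"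
    and "v_lim \<in> P' \<rightarrow>\<^sub>M L2_H1_borel T D"
    and lim_ae: "AE \<omega> in P'. AE p in lborel. p \<in> {0..T} \<times> D \<longrightarrow>
          (\<lambda>k. u' (eps k) \<omega> (fst p) (snd p))
            \<longlonglongrightarrow> - 1 + 2 * indicator (slice E \<omega> (fst p)) (snd p)"
    and lim_Holder: "AE \<omega> in P'. \<forall>\<beta>\<in>{0<..<1/12}.
          converges_Holder \<beta> T D (\<lambda>k. u' (eps k) \<omega>) (\<lambda>t x. - 1 + 2 * indicator (slice E \<omega> t) x)"
    and lim_v: "AE \<omega> in P'. weakly_converges_L2_H1 T D (\<lambda>k. v' (eps k) \<omega>) (v_lim \<omega>)"
    and chi_E: "AE \<omega> in P'. (\<lambda>t. indicator (slice E \<omega> t)) \<in> C_L1 T D \<inter> Linf_BV T D"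
  shows "\<exists>W' :: real \<Rightarrow> 'v \<Rightarrow> 'a \<Rightarrow> real. Q_Wiener_process D Q P' {0..T} W' \<and>
    (\<forall>t\<in>{0..T}. \<forall>\<psi>\<in>C1c t D. \<exists>X. has_Wiener_integral P' D W' t \<psi> X \<and>
      (AE \<omega> in P'.
        (LINT \<tau>:{0..t}|lborel. (LINT x:D|lborel.
            - 2 * indicator (slice E \<omega> \<tau>) x * deriv (\<lambda>s. \<psi> s x) \<tau>
            + grad_xt T D (v_lim \<omega>) \<tau> x \<bullet> grad (\<psi> \<tau>) x))
        = (LINT x:D|lborel. 2 * indicator (slice E \<omega> 0) x * \<psi> 0 x) + X \<omega>))"
proof -

  \<comment> \<open>An orthonormal basis in H^1 and measurability of the limit objects\<close>
  have D: "open D" "bounded D" using \<open>smooth_bounded_domain D\<close> by (auto simp: smooth_bounded_domain_def)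
  have Db: "D \<in> sets borel" using D by simp
  have Qc: "covariance_operator D Q" using \<open>condition_Q D Q\<close> by (simp add: condition_Q_def)
  then obtain f where f: "orthonormal_basis D f"
    unfolding covariance_operator_def finite_trace_def by blast
  obtain e where e: "orthonormal_basis D e" "\<And>k. e k \<in> H1 D"
    using exists_H1_orthonormal_basis[OF D f] by metis
  note eps = \<open>\<And>k. eps k \<in> {0<..1}\<close>
  interpret P: prob_space P by fact
  interpret P': prob_space P' by fact
  define g where "g \<omega> s = indicat_real (slice E \<omega> s)" for \<omega> s
  have E: "E \<in> sets (P' \<Otimes>\<^sub>M borel)" by fact
  \<comment> \<open>Sections of a product measurable set are Borel at every sample point, so no null
    set is lost here.\<close>
  have gm: "case_prod (g \<omega>) \<in> borel_measurable borel" for \<omega>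
  proof -
    have "case_prod (g \<omega>) = indicat_real (Pair \<omega> -` E)"
      by (auto simp: g_def slice_def indicator_def fun_eq_iff)
    then show ?thesis using sets_Pair1[OF E, of \<omega>] by simp
  qed
  have gb: "\<bar>g \<omega> s x\<bar> \<le> 1" for \<omega> s x by (simp add: g_def indicator_def)
  have gL: "g \<omega> s \<in> L2 D" for \<omega> s
  proof (rule L2_boundedI[OF Db D(2)])
    have "(\<lambda>x. case_prod (g \<omega>) (s, x)) \<in> borel_measurable borel"
      by (rule measurable_compose[OF _ gm]) (intro borel_measurable_continuous_onI continuous_intros)
    then show "set_borel_measurable lborel D (g \<omega> s)" using Db by (simp add: set_borel_measurable_def)
  qed (use gb in simp)
  define Z where "Z s \<phi> \<omega> = 2 * L2_inner D (g \<omega> s) \<phi> - 2 * L2_inner D (g \<omega> 0) \<phi> + grad_functional T D s \<phi> (v_lim \<omega>)"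
    for s \<phi> \<omega>
  have g_inner: "(\<lambda>\<omega>. L2_inner D (g \<omega> s) \<phi>) \<in> borel_measurable P'" if \<phi>: "\<phi> \<in> L2 D" for s \<phi>
  proof -
    have [measurable]: "(\<lambda>x. indicat_real D x *\<^sub>R \<phi> x) \<in> borel_measurable lborel"
      using \<phi> by (simp add: L2_iff sq_integrable_def)
    have [measurable]: "E \<in> sets (P' \<Otimes>\<^sub>M (borel \<Otimes>\<^sub>M borel))" unfolding borel_prod by (rule E)
    have "(\<lambda>(\<omega>, x). indicat_real E (\<omega>, s, x) * (indicat_real D x *\<^sub>R \<phi> x)) \<in> borel_measurable (P' \<Otimes>\<^sub>M lborel)"
      by measurable
    then have "(\<lambda>\<omega>. \<integral>x. indicat_real E (\<omega>, s, x) * (indicat_real D x *\<^sub>R \<phi> x) \<partial>lborel) \<in> borel_measurable P'"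
      by (rule lborel.borel_measurable_lebesgue_integral)
    moreover have "L2_inner D (g \<omega> s) \<phi> = (\<integral>x. indicat_real E (\<omega>, s, x) * (indicat_real D x *\<^sub>R \<phi> x) \<partial>lborel)" for \<omega>
      unfolding L2_inner_def set_lebesgue_integral_def
      by (rule Bochner_Integration.integral_cong) (auto simp: g_def slice_def indicator_def)
    ultimately show ?thesis by simp
  qed
  have v_lim: "v_lim \<omega> \<in> L2_H1 T D" if "\<omega> \<in> space P'" for \<omega>
    using measurable_space[OF \<open>v_lim \<in> P' \<rightarrow>\<^sub>M L2_H1_borel T D\<close> that] by (simp add: L2_H1_borel_def space_pm_borel)
  have chi: "AE \<omega> in P'. g \<omega> \<in> C_L1 T D"
    using chi_E by eventually_elim (simp add: g_def[abs_def])

  \<comment> \<open>Identification of the law of the limiting functional\<close>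
  interpret wiener_transfer D T Q P W P' Z e
  proof
    fix \<tau> :: "nat \<Rightarrow> real" and \<phi> :: "nat \<Rightarrow> 'a \<Rightarrow> real"
    assume \<tau>: "\<And>n. \<tau> n \<in> {0..T}" and \<phi>: "\<And>n. \<phi> n \<in> H1 D"
    \<comment> \<open>One Borel map from the path space into real sequences carries all chosen pairs
      at once, so \<open>same_law\<close> gives equality of joint laws for each level.\<close>
    define \<Phi> where "\<Phi> p n = noise_functional T D (\<tau> n) (\<phi> n) (fst p) (snd p)" for p n
    let ?N = "C_L2_borel T D \<Otimes>\<^sub>M L2_H1_borel T D"
    have \<Phi>: "\<Phi> \<in> borel_measurable ?N"
      unfolding \<Phi>_def[abs_def]
      by (rule measurable_coordinatewise_then_product) (rule noise_functional_measurable[OF D \<tau> \<phi>])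
    have m': "(\<lambda>\<omega>. (u' (eps k) \<omega>, v' (eps k) \<omega>)) \<in> P' \<rightarrow>\<^sub>M ?N" for k
      using u'_rv[OF eps] v'_rv[OF eps] by (rule measurable_Pair)
    have m: "(\<lambda>\<omega>. (u (eps k) \<omega>, v (eps k) \<omega>)) \<in> P \<rightarrow>\<^sub>M ?N" for k
      using u_rv[OF eps] v_rv[OF eps] by (rule measurable_Pair)
    note W = Q_Wiener_process_L2[OF \<open>Q_Wiener_process D Q P UNIV W\<close> UNIV_I]
    note Wm = Q_Wiener_process_inner_measurable[OF \<open>Q_Wiener_process D Q P UNIV W\<close> UNIV_I UNIV_I]
    show "distr P' borel (\<lambda>\<omega> n. Z (\<tau> n) (\<phi> n) \<omega>) =
      distr P borel (\<lambda>\<omega> n. L2_inner D (W (\<tau> n) \<omega> - W 0 \<omega>) (\<phi> n))"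
    proof (rule distr_limit_eq[where X = "\<lambda>k \<omega>. \<Phi> (u' (eps k) \<omega>, v' (eps k) \<omega>)"
          and Y = "\<lambda>k \<omega>. \<Phi> (u (eps k) \<omega>, v (eps k) \<omega>)"])
      show "prob_space P'" "prob_space P" by fact+
      show "(\<lambda>\<omega>. \<Phi> (u' (eps k) \<omega>, v' (eps k) \<omega>)) \<in> borel_measurable P'" for k
        by (rule measurable_compose[OF m' \<Phi>])
      show "(\<lambda>\<omega>. \<Phi> (u (eps k) \<omega>, v (eps k) \<omega>)) \<in> borel_measurable P" for k
        by (rule measurable_compose[OF m \<Phi>])
      show "(\<lambda>\<omega> n. L2_inner D (W (\<tau> n) \<omega> - W 0 \<omega>) (\<phi> n)) \<in> borel_measurable P"
        by (rule measurable_coordinatewise_then_product) (rule Wm[OF H1_L2(1)[OF \<phi>]])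
      show "(\<lambda>\<omega> n. Z (\<tau> n) (\<phi> n) \<omega>) \<in> borel_measurable P'"
        unfolding Z_def using \<tau>
        by (intro measurable_coordinatewise_then_product borel_measurable_add borel_measurable_diff
            borel_measurable_times measurable_const g_inner H1_L2(1)[OF \<phi>]
            measurable_compose[OF \<open>v_lim \<in> P' \<rightarrow>\<^sub>M L2_H1_borel T D\<close>]
            L2_H1_functional_measurable grad_functional_linear_bounded D \<phi>) auto
      show "distr P' borel (\<lambda>\<omega>. \<Phi> (u' (eps k) \<omega>, v' (eps k) \<omega>)) =
         distr P borel (\<lambda>\<omega>. \<Phi> (u (eps k) \<omega>, v (eps k) \<omega>))" for k
        using distr_distr[OF \<Phi> m'[of k]] distr_distr[OF \<Phi> m[of k]] same_law[OF eps[of k]] by (simp add: o_def)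
      show "AE \<omega> in P'. (\<lambda>k. \<Phi> (u' (eps k) \<omega>, v' (eps k) \<omega>)) \<longlonglongrightarrow> (\<lambda>n. Z (\<tau> n) (\<phi> n) \<omega>)"
        using lim_Holder lim_v AE_space
      proof eventually_elim
        fix \<omega>
        assume h: "\<forall>\<beta>\<in>{0<..<1/12}. converges_Holder \<beta> T D (\<lambda>k. u' (eps k) \<omega>) (\<lambda>t x. - 1 + 2 * indicator (slice E \<omega> t) x)"
          and vl: "weakly_converges_L2_H1 T D (\<lambda>k. v' (eps k) \<omega>) (v_lim \<omega>)" and \<omega>: "\<omega> \<in> space P'"
        have uL: "u' (eps k) \<omega> \<in> C_L2 T D" for k
          using measurable_space[OF u'_rv[OF eps] \<omega>] by (simp add: C_L2_borel_def space_pm_borel)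
        \<comment> \<open>Any exponent in the open interval will do; 1/24 is its midpoint.\<close>
        have "converges_Holder (1/24) T D (\<lambda>k. u' (eps k) \<omega>) (\<lambda>t x. - 1 + 2 * g \<omega> t x)"
          using bspec[OF h, of "1/24"] by (simp add: g_def)
        from noise_functional_limit[OF D this vl uL gL \<tau> \<phi>]
        show "(\<lambda>k. \<Phi> (u' (eps k) \<omega>, v' (eps k) \<omega>)) \<longlonglongrightarrow> (\<lambda>n. Z (\<tau> n) (\<phi> n) \<omega>)"
          unfolding \<Phi>_def Z_def fst_conv snd_conv by (rule tendsto_coordinatewise)
      qed
      \<comment> \<open>Each value of \<epsilon> has its own null set; along the sequence
        \<open>eps\<close> there are countably many, so one null set serves all k.\<close>
      have "AE \<omega> in P. \<forall>k. (\<forall>t.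
          has_L2_integral D (\<lambda>s x. rescaled_kernel \<rho> \<gamma> (eps k) (t - s) * W s \<omega> x) (W\<^sub>\<epsilon> (eps k) \<omega> t) \<and>
          has_L2_derivative D (W\<^sub>\<epsilon> (eps k) \<omega>) (\<xi> (eps k) \<omega> t) t) \<and>
          RCH_solution T D (eps k) (u0 (eps k)) (\<xi> (eps k) \<omega>) (u (eps k) \<omega>) (v (eps k) \<omega>)"
        unfolding AE_all_countable by (intro allI AE_conjI mollified_noise RCH eps)
      moreover have "AE \<omega> in P. \<forall>t. ((\<lambda>s. L2_norm D (W s \<omega> - W t \<omega>)) \<longlongrightarrow> 0) (at t)"
        using \<open>Q_Wiener_process D Q P UNIV W\<close> by (simp add: Q_Wiener_process_def)
      ultimately show "AE \<omega> in P. (\<lambda>k. \<Phi> (u (eps k) \<omega>, v (eps k) \<omega>)) \<longlonglongrightarrow>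
          (\<lambda>n. L2_inner D (W (\<tau> n) \<omega> - W 0 \<omega>) (\<phi> n))"
        using AE_space
      proof eventually_elim
        fix \<omega>
        assume sol: "\<forall>k. (\<forall>t.
          has_L2_integral D (\<lambda>s x. rescaled_kernel \<rho> \<gamma> (eps k) (t - s) * W s \<omega> x) (W\<^sub>\<epsilon> (eps k) \<omega> t) \<and>
          has_L2_derivative D (W\<^sub>\<epsilon> (eps k) \<omega>) (\<xi> (eps k) \<omega> t) t) \<and>
          RCH_solution T D (eps k) (u0 (eps k)) (\<xi> (eps k) \<omega>) (u (eps k) \<omega>) (v (eps k) \<omega>)"
          and c: "\<forall>t. ((\<lambda>s. L2_norm D (W s \<omega> - W t \<omega>)) \<longlongrightarrow> 0) (at t)" and \<omega>: "\<omega> \<in> space P"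
        have mol: "mollifier (eps k powr \<gamma>) (rescaled_kernel \<rho> \<gamma> (eps k))" for k
          using eps[of k] by (intro mollifier_rescaled_kernel \<open>noise_kernel \<rho>\<close>) simp
        have eq: "noise_functional T D (\<tau> n) (\<phi> n) (u (eps k) \<omega>) (v (eps k) \<omega>) =
            L2_inner D (W\<^sub>\<epsilon> (eps k) \<omega> (\<tau> n)) (\<phi> n) - L2_inner D (W\<^sub>\<epsilon> (eps k) \<omega> 0) (\<phi> n)" for k n
          by (rule noise_functional_RCH[OF D _ mol W[OF \<omega>] c[rule_format] _ _ \<tau> \<phi>]) (use sol in blast)+
        have a0: "(\<lambda>k. eps k powr \<gamma>) \<longlonglongrightarrow> 0"
          using \<open>eps \<longlonglongrightarrow> 0\<close> eps \<open>\<gamma> > 0\<close>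
          by (intro tendsto_zero_powrI[OF _ tendsto_const]) (auto intro!: always_eventually less_imp_le)
        have lim: "(\<lambda>k. L2_inner D (W\<^sub>\<epsilon> (eps k) \<omega> t) h) \<longlonglongrightarrow> L2_inner D (W t \<omega>) h" if h: "h \<in> L2 D" for t h
        proof (rule mollified_tendsto[OF mol a0, where c = "\<lambda>s. L2_inner D (W s \<omega>) h" and t = t])
          show "continuous_on UNIV (\<lambda>s. L2_inner D (W s \<omega>) h)"
            using c by (intro L2_inner_path_continuous W[OF \<omega>] h) auto
          show "has_bochner_integral lborel (\<lambda>s. rescaled_kernel \<rho> \<gamma> (eps k) (t - s) * L2_inner D (W s \<omega>) h)
             (L2_inner D (W\<^sub>\<epsilon> (eps k) \<omega> t) h)" for k
            using sol h unfolding has_L2_integral_def L2_inner_cmult_left by blast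
        qed
        show "(\<lambda>k. \<Phi> (u (eps k) \<omega>, v (eps k) \<omega>)) \<longlonglongrightarrow> (\<lambda>n. L2_inner D (W (\<tau> n) \<omega> - W 0 \<omega>) (\<phi> n))"
          unfolding \<Phi>_def fst_conv snd_conv eq L2_inner_diff_left'[OF W[OF \<omega>] W[OF \<omega>] H1_L2(1)[OF \<phi>]]
          by (intro tendsto_coordinatewise tendsto_diff lim H1_L2(1)[OF \<phi>])
      qed
    qed
  next
    fix t \<phi> assume t: "t \<in> {0..T}" and \<phi>: "\<phi> \<in> H1 D"
    show "Z t \<phi> \<in> borel_measurable P'"
      unfolding Z_def[abs_def] using t
      by (intro borel_measurable_add borel_measurable_diff
          borel_measurable_times measurable_const g_inner H1_L2(1)[OF \<phi>]
          measurable_compose[OF \<open>v_lim \<in> P' \<rightarrow>\<^sub>M L2_H1_borel T D\<close>]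
          L2_H1_functional_measurable grad_functional_linear_bounded D \<phi>) auto
  next
    show "AE \<omega> in P'. \<forall>\<phi>\<in>H1 D. continuous_on {0..T} (\<lambda>t. Z t \<phi> \<omega>)"
      using chi AE_space
    proof eventually_elim
      fix \<omega> assume "g \<omega> \<in> C_L1 T D" "\<omega> \<in> space P'"
      then have c: "continuous_on {0..T} (\<lambda>t. L2_inner D (g \<omega> t) h)" if "h \<in> L2 D" for h
        using gL[of \<omega>] that unfolding g_def by (intro indicator_path_continuous) auto
      show "\<forall>\<phi>\<in>H1 D. continuous_on {0..T} (\<lambda>t. Z t \<phi> \<omega>)"
        unfolding Z_def using \<open>\<omega> \<in> space P'\<close>
        by (intro ballI continuous_on_add continuous_on_diff continuous_on_mult continuous_on_const
            c grad_functional_continuous D v_lim) (auto intro: H1_L2(1))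
    qed
    show "AE \<omega> in P'. \<forall>\<phi>\<in>H1 D. Z 0 \<phi> \<omega> = 0"
      by (simp add: Z_def grad_functional_def set_integral_singleton_zero)
  qed (fact e \<open>T > 0\<close> \<open>Q_Wiener_process D Q P UNIV W\<close>)+

  \<comment> \<open>The limit equation\<close>
  show ?thesis
  proof (intro exI[of _ W'] conjI ballI Q_Wiener_process_W')
    fix t \<psi> assume t: "t \<in> {0..T}" and \<psi>: "\<psi> \<in> C1c t D"
    let ?L = "\<lambda>\<omega>. LINT \<tau>:{0..t}|lborel. (LINT x:D|lborel.
            - 2 * indicator (slice E \<omega> \<tau>) x * deriv (\<lambda>s. \<psi> s x) \<tau>
            + grad_xt T D (v_lim \<omega>) \<tau> x \<bullet> grad (\<psi> \<tau>) x)"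
    let ?R = "\<lambda>\<omega>. LINT x:D|lborel. 2 * indicator (slice E \<omega> 0) x * \<psi> 0 x"
    let ?S = "\<lambda>\<omega> k. \<Sum>i<2 ^ k. Z (dyadic t k (Suc i)) (\<psi> (dyadic t k (Suc i))) \<omega> -
       Z (dyadic t k i) (\<psi> (dyadic t k (Suc i))) \<omega>"
    show "\<exists>X. has_Wiener_integral P' D W' t \<psi> X \<and> (AE \<omega> in P'. ?L \<omega> = ?R \<omega> + X \<omega>)"
    proof (cases "t = 0")
      \<comment> \<open>The support is contained in an empty set, so \<psi> is zero; the dyadic sums
        are constantly zero as well, which forces X = 0 almost surely.\<close>
      case True
      then have \<psi>0: "\<psi> s x = 0" for s x using \<psi> by (auto simp: C1c_def)
      then have \<psi>e: "\<psi> s = (\<lambda>x. 0)" for s by auto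
      obtain X where X: "has_Wiener_integral P' D W' t \<psi> X" "AE \<omega> in P'. ?S \<omega> \<longlonglongrightarrow> X \<omega>"
        by (rule dyadic_Wiener_integral[OF D Qc t, of \<psi> 0]) (auto simp: \<psi>e L2_zero H1_zero[OF Db])
      from X(2) have "AE \<omega> in P'. ?L \<omega> = ?R \<omega> + X \<omega>"
      proof eventually_elim
        fix \<omega> assume "?S \<omega> \<longlonglongrightarrow> X \<omega>"
        then have "X \<omega> = 0" using True by (simp add: dyadic_def LIMSEQ_const_iff)
        then show "?L \<omega> = ?R \<omega> + X \<omega>" by (simp add: True \<psi>0 set_integral_singleton_zero)
      qed
      with X(1) show ?thesis by blast
    next
      case False
      then have t0: "0 < t" "t \<le> T" using t by auto
      obtain G C where
        "\<And>\<tau> x. \<tau> \<in> {0<..<t} \<Longrightarrow> x \<in> D \<Longrightarrow> ((\<lambda>s. \<psi> s x) has_real_derivative fst (G (\<tau>, x))) (at \<tau>)"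
        "\<And>\<tau> x. \<tau> \<in> {0<..<t} \<Longrightarrow> x \<in> D \<Longrightarrow> (\<psi> \<tau> has_derivative (\<lambda>h. snd (G (\<tau>, x)) \<bullet> h)) (at x)"
        "continuous_on ({0<..<t} \<times> D) G"
        and C0: "0 \<le> C" and "\<And>\<tau> x. \<tau> \<in> {0<..<t} \<Longrightarrow> x \<in> D \<Longrightarrow> norm (G (\<tau>, x)) \<le> C"
        and \<psi>t: "\<And>x. \<psi> t x = 0"
        and \<psi>L: "\<And>a. a \<in> {0..t} \<Longrightarrow> \<psi> a \<in> L2 D"
        and C: "\<And>a b x. a \<in> {0..t} \<Longrightarrow> b \<in> {0..t} \<Longrightarrow> x \<in> D \<Longrightarrow> \<bar>\<psi> a x - \<psi> b x\<bar> \<le> C * \<bar>a - b\<bar>"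
        and wg: "\<And>a. a \<in> {0<..<t} \<Longrightarrow> weak_grad D (\<psi> a) (\<lambda>x. snd (G (a, x)))"
        by (rule C1c_properties[OF D \<psi> t0(1)]) blast
      have "\<psi> t = (\<lambda>x. 0)" using \<psi>t by auto
      then have \<psi>H: "\<psi> a \<in> H1 D" if "a \<in> {0<..t}" for a
        using wg[of a] that H1_zero[OF Db] by (cases "a = t") (auto simp: H1_def)
      obtain X where X: "has_Wiener_integral P' D W' t \<psi> X" "AE \<omega> in P'. ?S \<omega> \<longlonglongrightarrow> X \<omega>"
        by (rule dyadic_Wiener_integral[OF D Qc t \<psi>L \<psi>H _ C0 C]) (use False in auto)
      from X(2) chi AE_space have "AE \<omega> in P'. ?L \<omega> = ?R \<omega> + X \<omega>"
      proof eventually_elim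
        fix \<omega> assume S: "?S \<omega> \<longlonglongrightarrow> X \<omega>" and gC: "g \<omega> \<in> C_L1 T D" and \<omega>: "\<omega> \<in> space P'"
        \<comment> \<open>The pathwise limit and the almost sure limit concern the same full
          sequence of sums at the same sample point, so they coincide.\<close>
        have "?S \<omega> \<longlonglongrightarrow> ?L \<omega> - ?R \<omega>"
          using dyadic_sum_tendsto[OF D t0 \<psi> v_lim[OF \<omega>] gm gb gC, of "\<lambda>s \<phi>. Z s \<phi> \<omega>"]
          by (simp add: Z_def g_def)
        from LIMSEQ_unique[OF this S] show "?L \<omega> = ?R \<omega> + X \<omega>" by simp
      qed
      with X(1) show ?thesis by blast
    qed
  qed
qed

end
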